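(* For any sufficiently small $\kappa>0$, almost surely there exists a (random) constant $C>0$ such that for all $v_1,v_2\in\mathcal H^1(\mathbb T^2)$ and all $\varepsilon>0$, setting $u_i=e^Xv_i$ and $u_i^\varepsilon=e^{X_\varepsilon}v_i$ for $i=1,2$, $$\big|\mathfrak a(u_1,u_2)-\mathfrak a_\varepsilon(u_1^\varepsilon,u_2^\varepsilon)\big|\le C\,\|\Xi-\Xi_\varepsilon\|_{\mathcal X^\kappa(\mathbb T^2)}\,\|v_1\|_{\mathcal H^1}\,\|v_2\|_{\mathcal H^1},$$ where $\mathfrak a$ is the two-dimensional Anderson form, $\mathfrak a_\varepsilon$ the renormalized regularized form, and $\Xi,\Xi_\varepsilon$ the enhanced noises, all defined in the context.
   Context: $\mathbb T^2=(\mathbb R/2\pi\mathbb Z)^2$ is the torus with Lebesgue measure $\mathrm dx$ normalized to total mass $1$; functions are real-valued. $\mathcal H^1=\mathcal H^1(\mathbb T^2)$ is the usual Sobolev space. For $\alpha\in\mathbb R$, $\mathcal C^\alpha=\mathcal B^\alpha_{\infty,\infty}$ is the Besov–Hölder space with norm $\sup_{n\ge0}2^{\alpha n}\|\Delta_nu\|_{L^\infty}$, where $(\Delta_n)_{n\ge 0}$ are the Littlewood–Paley projectors. $\langle\cdot,\cdot\rangle$ is the duality bracket extending the $L^2$ inner product. White noise: $\xi=\sum_{k\in\mathbb Z^2}\xi_ke^{ik\cdot x}$, where the $\xi_k$ are centered standard complex Gaussian variables ($\mathbb E|\xi_k|^2=1$, $\xi_0$ real), independent up to the constraint $\xi_{-k}=\overline{\xi_k}$.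 Thus $\xi$ is the centered Gaussian random distribution with $\mathbb E[\langle\xi,\varphi\rangle\langle\xi,\psi\rangle]=\langle\varphi,\psi\rangle_{L^2}$. The random field $X$ is $X(x)=-\sum_{k\ne0}|k|^{-2}\xi_ke^{ik\cdot x}$, so $\Delta X=\xi-\xi_0$; almost surely $X\in\mathcal C^{1-\kappa}$ for every $\kappa>0$. Let $\xi_\varepsilon=\xi*\rho_\varepsilon$, with $\rho_\varepsilon=\varepsilon^{-2}\rho(\cdot/\varepsilon)$ a mollifier ($\rho$ smooth, compactly supported, of integral such that convolution with $\rho_\varepsilon$ preserves constants), and let $X_\varepsilon=X*\rho_\varepsilon$ be the corresponding solution of $\Delta X_\varepsilon=\xi_\varepsilon-\langle\xi_\varepsilon,1\rangle$. Put $c_\varepsilon:=\mathbb E[|\nabla X_\varepsilon|^2]$ (independent of the space point; it diverges logarithmically as $\varepsilon\to0$). The Wick square is the random distribution $$|\nabla X|^{2\diamond}=\lim_{\varepsilon\to0}\big(|\nabla X_\varepsilon|^2-c_\varepsilon\big),$$ the limit being in probability in $\mathcal C^{-2\kappa}(\mathbb T^2)$ for every $\kappa>0$. Enhanced noises: $\Xi=(\xi,|\nabla X|^{2\diamond})$ and $\Xi_\varepsilon=(\xi_\varepsilon,|\nabla X_\varepsilon|^2-c_\varepsilon)$, in $\mathcal X^\kappa(\mathbb T^2)=\mathcal C^{-1-\kappa}(\mathbb T^2)\times\mathcal C^{-2\kappa}(\mathbb T^2)$ with the product norm. The Anderson form, with domain $\mathcal D(\mathfrak a)=e^X\mathcal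 H^1(\mathbb T^2)$, is $$\mathfrak a(u_1,u_2):=\int_{\mathbb T^2}\nabla v_1\cdot\nabla v_2\,e^{2X}\mathrm dx-\big\langle|\nabla X|^{2\diamond},v_1v_2e^{2X}\big\rangle+\xi_0\int_{\mathbb T^2}v_1v_2\,e^{2X}\mathrm dx,\qquad v_i=e^{-X}u_i.$$ The renormalized regularized form, with domain $\mathcal H^1(\mathbb T^2)$, is $$\mathfrak a_\varepsilon(u_1,u_2)=\int_{\mathbb T^2}\nabla u_1\cdot\nabla u_2\,\mathrm dx+\int_{\mathbb T^2}u_1u_2\,(\xi_\varepsilon+c_\varepsilon)\,\mathrm dx.$$ *)

theory Defs
  imports "HOL-Probability.Probability"
begin

section \<open>The torus, Fourier modes and distributions\<close>

text \<open>
  Functions on the torus are \<open>2\<pi>\<close>-periodic functions on the plane.  Integrals over the torus are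
  taken with respect to Lebesgue measure on a fundamental cell, normalized to total mass 1.
\<close>

type_synonym plane = "real \<times> real"

definition torus_measure :: "plane measure" where
  "torus_measure = uniform_measure lborel ({0..<2 * pi} \<times> {0..<2 * pi})"

definition torus_periodic :: "(plane \<Rightarrow> 'b) \<Rightarrow> bool" where
  "torus_periodic f \<longleftrightarrow> (\<forall>x. f (x + (2 * pi, 0)) = f x \<and> f (x + (0, 2 * pi)) = f x)"

definition freq :: "int \<times> int \<Rightarrow> plane" where
  "freq k = (of_int (fst k), of_int (snd k))"

definition fmode :: "int \<times> int \<Rightarrow> plane \<Rightarrow> complex" where
  "fmode k x = cis (freq k \<bullet> x)"

text \<open>
  A distribution on the torus is given by its Fourier coefficients: \<open>f\<close> stands for the series
  \<open>\<Sum>k. f k * fmode k\<close>.  Real distributions are the Hermitian families of polynomial growth.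
\<close>

type_synonym torus_distribution = "int \<times> int \<Rightarrow> complex"

definition real_distribution :: "torus_distribution \<Rightarrow> bool" where
  "real_distribution f \<longleftrightarrow>
     (\<forall>k. f (- k) = cnj (f k)) \<and>
     (\<exists>C. \<exists>N::nat. \<forall>k. cmod (f k) \<le> C * (1 + norm (freq k)) ^ N)"

definition random_distribution :: "'w measure \<Rightarrow> ('w \<Rightarrow> torus_distribution) \<Rightarrow> bool" where
  "random_distribution M f \<longleftrightarrow>
     (\<forall>k. (\<lambda>\<omega>. f \<omega> k) \<in> borel_measurable M) \<and> (\<forall>\<omega>\<in>space M. real_distribution (f \<omega>))"

text \<open>The distribution associated with a function on the torus.\<close>

definition dist_of :: "(plane \<Rightarrow> real) \<Rightarrow> torus_distribution" where
  "dist_of g = (\<lambda>k. \<integral>x. complex_of_real (g x) * cnj (fmode k x) \<partial>torus_measure)"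


section \<open>Gradients, smooth functions and the Sobolev space\<close>

definition gradient :: "(plane \<Rightarrow> real) \<Rightarrow> plane \<Rightarrow> plane" where
  "gradient f x = (THE D. GDERIV f x :> D)"

fun C_class :: "nat \<Rightarrow> (plane \<Rightarrow> real) \<Rightarrow> bool" where
  "C_class 0 f \<longleftrightarrow> continuous_on UNIV f"
| "C_class (Suc n) f \<longleftrightarrow>
     (\<forall>x. f differentiable (at x)) \<and> (\<forall>b\<in>Basis. C_class n (\<lambda>x. gradient f x \<bullet> b))"

definition smooth_function :: "(plane \<Rightarrow> real) \<Rightarrow> bool" where
  "smooth_function f \<longleftrightarrow> (\<forall>n. C_class n f)"

definition torus_L2 :: "(plane \<Rightarrow> 'b::euclidean_space) \<Rightarrow> bool" where
  "torus_L2 f \<longleftrightarrow>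
     torus_periodic f \<and> f \<in> borel_measurable borel \<and> integrable torus_measure (\<lambda>x. (norm (f x))\<^sup>2)"

definition has_weak_gradient :: "(plane \<Rightarrow> real) \<Rightarrow> (plane \<Rightarrow> plane) \<Rightarrow> bool" where
  "has_weak_gradient v g \<longleftrightarrow>
     torus_L2 g \<and>
     (\<forall>\<eta>. smooth_function \<eta> \<and> torus_periodic \<eta> \<longrightarrow>
        (\<integral>x. v x *\<^sub>R gradient \<eta> x \<partial>torus_measure) = - (\<integral>x. \<eta> x *\<^sub>R g x \<partial>torus_measure))"

definition sobolev_H1 :: "(plane \<Rightarrow> real) set" where
  "sobolev_H1 = {v. torus_L2 v \<and> (\<exists>g. has_weak_gradient v g)}"

text \<open>The weak gradient is determined up to null sets; all uses below are under an integral.\<close>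

definition weak_gradient :: "(plane \<Rightarrow> real) \<Rightarrow> plane \<Rightarrow> plane" where
  "weak_gradient v = (SOME g. has_weak_gradient v g)"

definition H1_norm :: "(plane \<Rightarrow> real) \<Rightarrow> real" where
  "H1_norm v = sqrt ((\<integral>x. (v x)\<^sup>2 \<partial>torus_measure) + (\<integral>x. (norm (weak_gradient v x))\<^sup>2 \<partial>torus_measure))"


section \<open>Littlewood-Paley theory\<close>

text \<open>
  The projectors are built from an arbitrary smooth radial dyadic partition of unity: \<open>chi\<close> is
  supported in a ball, \<open>phi\<close> in an annulus.
\<close>

definition dyadic_partition :: "(plane \<Rightarrow> real) \<Rightarrow> (plane \<Rightarrow> real) \<Rightarrow> bool" where
  "dyadic_partition chi phi \<longleftrightarrow>
     smooth_function chi \<and> smooth_function phi \<and>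
     (\<forall>z. chi z \<in> {0..1} \<and> phi z \<in> {0..1}) \<and>
     (\<forall>z w. norm z = norm w \<longrightarrow> chi z = chi w \<and> phi z = phi w) \<and>
     (\<exists>R. \<forall>z. chi z \<noteq> 0 \<longrightarrow> norm z \<le> R) \<and>
     (\<exists>r>0. \<exists>R. \<forall>z. phi z \<noteq> 0 \<longrightarrow> r \<le> norm z \<and> norm z \<le> R) \<and>
     (\<forall>z. (\<lambda>j. phi (z /\<^sub>R 2 ^ j)) sums (1 - chi z)) \<and>
     (\<forall>j\<ge>1. \<forall>z. chi z * phi (z /\<^sub>R 2 ^ j) = 0) \<and>
     (\<forall>i j. i + 2 \<le> j \<longrightarrow> (\<forall>z. phi (z /\<^sub>R 2 ^ i) * phi (z /\<^sub>R 2 ^ j) = 0))"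

text \<open>Blocks are numbered from 0, the block of number 0 being the low-frequency one.\<close>

fun lp_multiplier :: "(plane \<Rightarrow> real) \<Rightarrow> (plane \<Rightarrow> real) \<Rightarrow> nat \<Rightarrow> int \<times> int \<Rightarrow> real" where
  "lp_multiplier chi phi 0 k = chi (freq k)"
| "lp_multiplier chi phi (Suc n) k = phi (freq k /\<^sub>R 2 ^ n)"

text \<open>
  For a dyadic partition the sum is finite, and for a real distribution it is real-valued, so that
  taking the real part only changes the type.
\<close>

definition lp_block ::
  "(plane \<Rightarrow> real) \<Rightarrow> (plane \<Rightarrow> real) \<Rightarrow> nat \<Rightarrow> torus_distribution \<Rightarrow> plane \<Rightarrow> real" where
  "lp_block chi phi n f x =
     Re (\<Sum>k | lp_multiplier chi phi n k \<noteq> 0. of_real (lp_multiplier chi phi n k) * f k * fmode k x)"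

definition besov_norm ::
  "(plane \<Rightarrow> real) \<Rightarrow> (plane \<Rightarrow> real) \<Rightarrow> real \<Rightarrow> torus_distribution \<Rightarrow> ennreal" where
  "besov_norm chi phi \<alpha> f =
     (SUP n. ennreal (2 powr (\<alpha> * real n)) * (SUP x. ennreal \<bar>lp_block chi phi n f x\<bar>))"

text \<open>
  A distribution of positive Besov-Hoelder regularity is identified with the continuous function
  \<open>\<Sum>n. lp_block chi phi n f\<close>; the series then converges uniformly.
\<close>

definition fun_of ::
  "(plane \<Rightarrow> real) \<Rightarrow> (plane \<Rightarrow> real) \<Rightarrow> torus_distribution \<Rightarrow> plane \<Rightarrow> real" where
  "fun_of chi phi f x = (\<Sum>n. lp_block chi phi n f x)"

text \<open>
  The usual Littlewood-Paley form of the duality bracket between a distribution and a function.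
  Each block of \<open>f\<close> is a trigonometric polynomial, so the summands are \<open>L\<^sup>2\<close> inner products; for
  \<open>f\<close> in \<open>L\<^sup>2\<close> the sum is the \<open>L\<^sup>2\<close> inner product of \<open>f\<close> and \<open>g\<close>.
\<close>

definition bracket ::
  "(plane \<Rightarrow> real) \<Rightarrow> (plane \<Rightarrow> real) \<Rightarrow> torus_distribution \<Rightarrow> (plane \<Rightarrow> real) \<Rightarrow> real" where
  "bracket chi phi f g = (\<Sum>n. \<integral>x. lp_block chi phi n f x * g x \<partial>torus_measure)"


section \<open>White noise and mollification\<close>

text \<open>
  Outside the zero mode, the density below is that of the circular complex Gaussian law with
  unit second absolute moment.  The zero mode is real because a real distribution is Hermitian.
  Independence holds for every set of frequencies not containing two opposite nonzero ones.
\<close>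

definition white_noise :: "'w measure \<Rightarrow> ('w \<Rightarrow> torus_distribution) \<Rightarrow> bool" where
  "white_noise M \<xi> \<longleftrightarrow>
     random_distribution M \<xi> \<and>
     distributed M lborel (\<lambda>\<omega>. Re (\<xi> \<omega> 0)) (\<lambda>t. ennreal (std_normal_density t)) \<and>
     (\<forall>k. k \<noteq> 0 \<longrightarrow>
        distributed M lborel (\<lambda>\<omega>. \<xi> \<omega> k) (\<lambda>z. ennreal (exp (- (cmod z)\<^sup>2) / pi))) \<and>
     (\<forall>K. (\<forall>k\<in>K. k \<noteq> 0 \<longrightarrow> - k \<notin> K) \<longrightarrow>
        prob_space.indep_vars M (\<lambda>_. borel) (\<lambda>k \<omega>. \<xi> \<omega> k) K)"

definition mollifier :: "(plane \<Rightarrow> real) \<Rightarrow> bool" where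
  "mollifier \<rho> \<longleftrightarrow> smooth_function \<rho> \<and> bounded {y. \<rho> y \<noteq> 0} \<and> (\<integral>y. \<rho> y \<partial>lborel) = 1"

definition rescale :: "(plane \<Rightarrow> real) \<Rightarrow> real \<Rightarrow> plane \<Rightarrow> real" where
  "rescale \<rho> \<epsilon> y = \<rho> (y /\<^sub>R \<epsilon>) / \<epsilon>\<^sup>2"

text \<open>
  Convolution of a distribution on the torus with a test function on the plane, applied to each
  Fourier mode.  The integral is against Lebesgue measure without normalization, so that constants
  are preserved when the test function has integral 1.  For a real distribution the series
  converges absolutely to a real number.
\<close>

definition convolve :: "torus_distribution \<Rightarrow> (plane \<Rightarrow> real) \<Rightarrow> plane \<Rightarrow> real" where
  "convolve f \<rho> x =
     Re (\<Sum>\<^sub>\<infinity>k\<in>UNIV. f k * (\<integral>y. fmode k (x - y) * complex_of_real (\<rho> y) \<partial>lborel))"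


section \<open>The enhanced noise\<close>

definition noise_X :: "torus_distribution \<Rightarrow> torus_distribution" where
  "noise_X \<xi> k = (if k = 0 then 0 else - \<xi> k / of_real ((norm (freq k))\<^sup>2))"

definition noise_eps :: "(plane \<Rightarrow> real) \<Rightarrow> real \<Rightarrow> torus_distribution \<Rightarrow> plane \<Rightarrow> real" where
  "noise_eps \<rho> \<epsilon> \<xi> = convolve \<xi> (rescale \<rho> \<epsilon>)"

definition X_eps :: "(plane \<Rightarrow> real) \<Rightarrow> real \<Rightarrow> torus_distribution \<Rightarrow> plane \<Rightarrow> real" where
  "X_eps \<rho> \<epsilon> \<xi> = convolve (noise_X \<xi>) (rescale \<rho> \<epsilon>)"

text \<open>By stationarity of white noise the expectation does not depend on the point chosen.\<close>

definition c_eps ::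
  "'w measure \<Rightarrow> (plane \<Rightarrow> real) \<Rightarrow> ('w \<Rightarrow> torus_distribution) \<Rightarrow> real \<Rightarrow> real" where
  "c_eps M \<rho> \<xi> \<epsilon> = (\<integral>\<omega>. (norm (gradient (X_eps \<rho> \<epsilon> (\<xi> \<omega>)) 0))\<^sup>2 \<partial>M)"

definition wick_eps ::
  "(plane \<Rightarrow> real) \<Rightarrow> real \<Rightarrow> real \<Rightarrow> torus_distribution \<Rightarrow> plane \<Rightarrow> real" where
  "wick_eps \<rho> \<epsilon> c \<xi> x = (norm (gradient (X_eps \<rho> \<epsilon> \<xi>) x))\<^sup>2 - c"

text \<open>
  \<open>W\<close> is a version of the Wick square: the limit in probability, in every Besov-Hoelder space of
  negative regularity, of the renormalized squares.  This determines \<open>W\<close> almost surely.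
\<close>

definition wick_square ::
  "(plane \<Rightarrow> real) \<Rightarrow> (plane \<Rightarrow> real) \<Rightarrow> 'w measure \<Rightarrow> (plane \<Rightarrow> real) \<Rightarrow>
     ('w \<Rightarrow> torus_distribution) \<Rightarrow> ('w \<Rightarrow> torus_distribution) \<Rightarrow> bool" where
  "wick_square chi phi M \<rho> \<xi> W \<longleftrightarrow>
     random_distribution M W \<and>
     (\<forall>\<kappa>>0. \<forall>\<delta>>0.
        ((\<lambda>\<epsilon>. measure M {\<omega> \<in> space M.
             besov_norm chi phi (- 2 * \<kappa>) (dist_of (wick_eps \<rho> \<epsilon> (c_eps M \<rho> \<xi> \<epsilon>) (\<xi> \<omega>)) - W \<omega>)
               > ennreal \<delta>}) \<longlongrightarrow> 0) (at_right 0))"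

definition enhanced_noise_eps ::
  "(plane \<Rightarrow> real) \<Rightarrow> real \<Rightarrow> real \<Rightarrow> torus_distribution \<Rightarrow> torus_distribution \<times> torus_distribution"
  where
  "enhanced_noise_eps \<rho> \<epsilon> c \<xi> = (dist_of (noise_eps \<rho> \<epsilon> \<xi>), dist_of (wick_eps \<rho> \<epsilon> c \<xi>))"

definition enhanced_norm ::
  "(plane \<Rightarrow> real) \<Rightarrow> (plane \<Rightarrow> real) \<Rightarrow> real \<Rightarrow> torus_distribution \<times> torus_distribution \<Rightarrow> ennreal"
  where
  "enhanced_norm chi phi \<kappa> \<Xi> =
     besov_norm chi phi (- 1 - \<kappa>) (fst \<Xi>) + besov_norm chi phi (- 2 * \<kappa>) (snd \<Xi>)"


section \<open>The forms\<close>

definition field_X ::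
  "(plane \<Rightarrow> real) \<Rightarrow> (plane \<Rightarrow> real) \<Rightarrow> torus_distribution \<Rightarrow> plane \<Rightarrow> real" where
  "field_X chi phi \<xi> = fun_of chi phi (noise_X \<xi>)"

definition anderson_domain ::
  "(plane \<Rightarrow> real) \<Rightarrow> (plane \<Rightarrow> real) \<Rightarrow> torus_distribution \<Rightarrow> (plane \<Rightarrow> real) set" where
  "anderson_domain chi phi \<xi> = (\<lambda>v x. exp (field_X chi phi \<xi> x) * v x) ` sobolev_H1"

text \<open>
  Meaningful for \<open>u1\<close> and \<open>u2\<close> in \<^const>\<open>anderson_domain\<close>.  The pair consists of the noise and
  the Wick square.
\<close>

definition anderson_form ::
  "(plane \<Rightarrow> real) \<Rightarrow> (plane \<Rightarrow> real) \<Rightarrow> torus_distribution \<times> torus_distribution \<Rightarrow>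
     (plane \<Rightarrow> real) \<Rightarrow> (plane \<Rightarrow> real) \<Rightarrow> real" where
  "anderson_form chi phi \<Xi> u1 u2 =
    (let \<xi> = fst \<Xi>; W = snd \<Xi>;
         X = field_X chi phi \<xi>;
         v1 = (\<lambda>x. exp (- X x) * u1 x);
         v2 = (\<lambda>x. exp (- X x) * u2 x)
     in (\<integral>x. (weak_gradient v1 x \<bullet> weak_gradient v2 x) * exp (2 * X x) \<partial>torus_measure)
        - bracket chi phi W (\<lambda>x. v1 x * v2 x * exp (2 * X x))
        + Re (\<xi> 0) * (\<integral>x. v1 x * v2 x * exp (2 * X x) \<partial>torus_measure))"

definition anderson_form_eps ::
  "(plane \<Rightarrow> real) \<Rightarrow> real \<Rightarrow> real \<Rightarrow> torus_distribution \<Rightarrow>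
     (plane \<Rightarrow> real) \<Rightarrow> (plane \<Rightarrow> real) \<Rightarrow> real" where
  "anderson_form_eps \<rho> \<epsilon> c \<xi> u1 u2 =
     (\<integral>x. weak_gradient u1 x \<bullet> weak_gradient u2 x \<partial>torus_measure)
     + (\<integral>x. u1 x * u2 x * (noise_eps \<rho> \<epsilon> \<xi> x + c) \<partial>torus_measure)"

end

theory Submission
  imports Defs "HOL-Real_Asymp.Real_Asymp"
begin

text \<open>
  The estimate is deterministic: it holds for every realisation of the noises whose Fourier
  coefficients are Hermitian, and for every renormalisation constant.

  Substituting u = e^X' v into the regularised form and integrating by parts, with \<Delta> X' =
  \<xi>' - \<xi>(0) for the mollified noise \<xi>', gives the same expression as the one that
  defines the Anderson form. The difference therefore consists of a gradient term and a mass
  term, controlled by e^(2X) - e^(2X') in sup norm, and of two distributional pairings with v1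
  v2 times an exponential.

  Each Littlewood--Paley block of \<Delta>-inverse gains a factor 2^(-3n/2) in sup norm, because
  the heat semigroup contracts the sup norm and kills high frequencies; so X, X' and X - X' are
  Hoelder continuous with norms linear in the Besov norms of the noises. Products v1 v2 w with
  v1, v2 in H1 and w Hoelder have an integral modulus of continuity of order 1/8, and a block of
  frequency 2^n paired with such a function gains 2^(-n/16), which makes the pairings with
  distributions of small negative regularity converge. If a noise has infinite norm the
  right-hand side is infinite unless v1 or v2 vanishes.
\<close>

section \<open>Integration on the torus\<close>

text \<open>The obstacle is to estimate blocks without kernel bounds for the Littlewood-Paley
  multipliers. Two tools replace them: averages of translations, which contract the sup norm, and
  the crude bound of a trigonometric sum by the number of its frequencies, of order 4^n on block n,
  times its largest coefficient. A rapidly decreasing factor must beat that number, and this costs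
  part of the optimal exponent: 3/2 instead of 2 for the inverse Laplacian, 1/16 instead of 1/8 in
  the pairing. The exponents fit as follows. A block of the noise grows like 2^((1 + \<kappa>) n),
  so a block of X is of order 2^((\<kappa> - 1/2) n) and has a crude Lipschitz constant of order
  2^((3 + \<kappa>) n). Interpolation with weights 7/8 and 1/8 leaves 2^((\<kappa> - 1/16) n) and
  the Hoelder exponent 1/8. In the pairing the gain 2^(-n/16) meets the loss 2^(2 \<kappa> n), which
  is summable with room to spare for \<kappa> < 1/64. C does not depend on \<epsilon> because
  mollification enlarges a Besov norm at most by the L1 norm of \<rho>.\<close>

abbreviation cell :: "plane set" where
  "cell \<equiv> {0..<2 * pi} \<times> {0..<2 * pi}"

lemma cell_measurable [measurable]: "cell \<in> sets borel"
  unfolding borel_prod[symmetric] by measurable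

lemma emeasure_cell: "emeasure lborel cell = ennreal ((2 * pi)\<^sup>2)"
  unfolding lborel_prod[symmetric]
  by (subst lborel.emeasure_pair_measure_Times)
     (auto simp: ennreal_mult'[symmetric] power2_eq_square)

lemma prob_space_torus: "prob_space torus_measure"
  unfolding torus_measure_def
  by (rule prob_space_uniform_measure) (simp_all add: emeasure_cell)

interpretation torus: prob_space torus_measure
  by (rule prob_space_torus)

lemma sets_torus [simp, measurable_cong]: "sets torus_measure = sets borel"
  by (simp add: torus_measure_def)

lemma space_torus [simp]: "space torus_measure = UNIV"
  by (simp add: torus_measure_def)

lemma borel_measurable_torus: "borel_measurable torus_measure = borel_measurable borel"
  by (rule measurable_cong_sets) simp_all

section \<open>Periodic functions and translation invariance of the torus measure\<close>

lemma torus_periodic_int: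
  assumes "torus_periodic f"
  shows "f (x + (2 * pi * of_int i, 2 * pi * of_int j)) = f x"
proof -
  have 1: "f (x + (2 * pi * real n, 0)) = f x" for x n
  proof (induction n)
    case (Suc n)
    have "x + (2 * pi * real (Suc n), 0) = (x + (2 * pi * real n, 0)) + (2 * pi, 0)"
      by (simp add: algebra_simps prod_eq_iff)
    then show ?case
      using assms Suc unfolding torus_periodic_def by metis
  qed (simp flip: zero_prod_def)
  have 2: "f (x + (0, 2 * pi * real n)) = f x" for x n
  proof (induction n)
    case (Suc n)
    have "x + (0, 2 * pi * real (Suc n)) = (x + (0, 2 * pi * real n)) + (0, 2 * pi)"
      by (simp add: algebra_simps prod_eq_iff)
    then show ?case
      using assms Suc unfolding torus_periodic_def by metis
  qed (simp flip: zero_prod_def)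
  have per1: "f (x + (2 * pi * of_int i, 0)) = f x" for x
  proof (cases "i \<ge> 0")
    case True
    then show ?thesis using 1[of x "nat i"] by simp
  next
    case False
    then show ?thesis using 1[of "x + (2 * pi * of_int i, 0)" "nat (- i)"] by (simp add: add.assoc flip: zero_prod_def)
  qed
  have per2: "f (x + (0, 2 * pi * of_int j)) = f x" for x
  proof (cases "j \<ge> 0")
    case True
    then show ?thesis using 2[of x "nat j"] by simp
  next
    case False
    then show ?thesis using 2[of "x + (0, 2 * pi * of_int j)" "nat (- j)"] by (simp add: add.assoc flip: zero_prod_def)
  qed
  have "x + (2 * pi * of_int i, 2 * pi * of_int j)
      = (x + (2 * pi * of_int i, 0)) + (0, 2 * pi * of_int j)"
    by (simp add: add.assoc)
  then show ?thesis
    using per1 per2 by metis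
qed

lemma nn_integral_periodic_translate:
  fixes g :: "real \<Rightarrow> ennreal"
  assumes [measurable]: "g \<in> borel_measurable borel" and per: "\<And>x. g (x + 2 * pi) = g x"
  shows "(\<integral>\<^sup>+x. g (x + a) * indicator {0..<2 * pi} x \<partial>lborel)
       = (\<integral>\<^sup>+x. g x * indicator {0..<2 * pi} x \<partial>lborel)"
proof -
  have pern: "g (x + 2 * pi * real n) = g x" for x n
  proof (induction n)
    case (Suc n)
    then show ?case using per[of "x + 2 * pi * real n"] by (simp add: algebra_simps)
  qed simp
  have peri: "g (x + 2 * pi * of_int i) = g x" for x i
  proof (cases "i \<ge> 0")
    case True
    then show ?thesis using pern[of x "nat i"] by simp
  next
    case False
    then show ?thesis using pern[of "x + 2 * pi * of_int i" "nat (- i)"] by simp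
  qed
  \<comment> \<open>Only the shift modulo the period matters, so it may be taken in [0, 2\<pi>]. The
    shifted window then overhangs the cell on one side, and the overhang is moved back by one
    period.\<close>
  define b where "b = a - 2 * pi * of_int \<lfloor>a / (2 * pi)\<rfloor>"
  have b: "0 \<le> b" "b \<le> 2 * pi"
    using floor_divide_lower[of "2 * pi" a] floor_divide_upper[of "2 * pi" a] unfolding b_def
    by (simp_all add: algebra_simps)
  have ga: "g (x + a) = g (x + b)" for x
    using peri[of "x + b" "\<lfloor>a / (2 * pi)\<rfloor>"] by (simp add: b_def)
  have shift: "(\<integral>\<^sup>+x. g (x + t) * indicator {l..<u} x \<partial>lborel)
        = (\<integral>\<^sup>+x. g x * indicator {l + t..<u + t} x \<partial>lborel)" for t l u
    by (subst (2) nn_integral_real_affine[where c=1 and t=t])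
       (auto simp: add.commute intro!: nn_integral_cong split: split_indicator)
  have split: "(\<integral>\<^sup>+x. g x * indicator {l..<u} x \<partial>lborel)
      = (\<integral>\<^sup>+x. g x * indicator {l..<m} x \<partial>lborel) + (\<integral>\<^sup>+x. g x * indicator {m..<u} x \<partial>lborel)"
    if "l \<le> m" "m \<le> u" for l m u
    using that by (subst nn_integral_add[symmetric])
       (auto intro!: nn_integral_cong split: split_indicator)
  have "(\<integral>\<^sup>+x. g (x + a) * indicator {0..<2 * pi} x \<partial>lborel)
      = (\<integral>\<^sup>+x. g x * indicator {b..<2 * pi + b} x \<partial>lborel)"
    by (simp add: ga shift)
  also have "\<dots> = (\<integral>\<^sup>+x. g x * indicator {b..<2 * pi} x \<partial>lborel)
      + (\<integral>\<^sup>+x. g x * indicator {2 * pi..<2 * pi + b} x \<partial>lborel)"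
    using b by (intro split) auto
  also have "(\<integral>\<^sup>+x. g x * indicator {2 * pi..<2 * pi + b} x \<partial>lborel)
      = (\<integral>\<^sup>+x. g x * indicator {0..<b} x \<partial>lborel)"
    using shift[of "2 * pi" 0 b] by (simp add: per add.commute)
  also have "(\<integral>\<^sup>+x. g x * indicator {b..<2 * pi} x \<partial>lborel)
      + (\<integral>\<^sup>+x. g x * indicator {0..<b} x \<partial>lborel)
      = (\<integral>\<^sup>+x. g x * indicator {0..<2 * pi} x \<partial>lborel)"
    using split[of 0 b "2 * pi"] b by (simp add: add.commute)
  finally show ?thesis .
qed

lemma nn_integral_torus:
  fixes f :: "plane \<Rightarrow> ennreal"
  assumes [measurable]: "f \<in> borel_measurable borel"
  shows "(\<integral>\<^sup>+x. f x \<partial>torus_measure)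
    = (\<integral>\<^sup>+x. f x * indicator cell x \<partial>lborel) / ennreal ((2 * pi)\<^sup>2)"
  unfolding torus_measure_def by (subst nn_integral_uniform_measure) (auto simp: emeasure_cell)

text \<open>Tonelli reduces the claim to the one-dimensional case, applied first in the second
  coordinate and then in the first.\<close>

lemma nn_integral_torus_translate:
  fixes f :: "plane \<Rightarrow> ennreal"
  assumes [measurable]: "f \<in> borel_measurable borel" and per: "torus_periodic f"
  shows "(\<integral>\<^sup>+x. f (x + h) \<partial>torus_measure) = (\<integral>\<^sup>+x. f x \<partial>torus_measure)"
proof -
  let ?J = "{0..<2 * pi} :: real set"
  have [measurable]: "f \<in> borel_measurable (borel \<Otimes>\<^sub>M borel)"
    by (simp add: borel_prod)
  have per': "f (a + 2 * pi, b) = f (a, b)" "f (a, b + 2 * pi) = f (a, b)" for a b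
    using per unfolding torus_periodic_def by (metis add_Pair add.right_neutral)+
  have cellI: "(indicator cell (x, y) :: ennreal) = indicator ?J x * indicator ?J y" for x y
    by (auto split: split_indicator)
  have pull: "(\<integral>\<^sup>+y. F y * (indicator ?J x * indicator ?J y) \<partial>lborel)
      = (\<integral>\<^sup>+y. F y * indicator ?J y \<partial>lborel) * indicator ?J x"
    if [measurable]: "F \<in> borel_measurable borel" for F :: "real \<Rightarrow> ennreal" and x :: real
    by (subst nn_integral_multc[symmetric]) (auto simp: mult_ac)
  have "(\<integral>\<^sup>+x. f (x + h) * indicator cell x \<partial>lborel)
      = (\<integral>\<^sup>+x. \<integral>\<^sup>+y. f (x + fst h, y + snd h) * (indicator ?J x * indicator ?J y) \<partial>lborel \<partial>lborel)"
    unfolding lborel_prod[symmetric]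
    by (subst lborel.nn_integral_fst[symmetric])
       (auto simp: cellI plus_prod_def intro!: nn_integral_cong)
  also have "\<dots> = (\<integral>\<^sup>+x. (\<integral>\<^sup>+y. f (x + fst h, y + snd h) * indicator ?J y \<partial>lborel) * indicator ?J x \<partial>lborel)"
    by (subst pull) auto
  also have "\<dots> = (\<integral>\<^sup>+x. (\<integral>\<^sup>+y. f (x + fst h, y) * indicator ?J y \<partial>lborel) * indicator ?J x \<partial>lborel)"
    by (subst nn_integral_periodic_translate) (auto simp: per')
  also have "\<dots> = (\<integral>\<^sup>+x. (\<integral>\<^sup>+y. f (x, y) * indicator ?J y \<partial>lborel) * indicator ?J x \<partial>lborel)"
    by (subst nn_integral_periodic_translate[where g="\<lambda>x. \<integral>\<^sup>+y. f (x, y) * indicator ?J y \<partial>lborel"])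
       (auto simp: per')
  also have "\<dots> = (\<integral>\<^sup>+x. \<integral>\<^sup>+y. f (x, y) * (indicator ?J x * indicator ?J y) \<partial>lborel \<partial>lborel)"
    by (subst pull) auto
  also have "\<dots> = (\<integral>\<^sup>+x. f x * indicator cell x \<partial>lborel)"
    unfolding lborel_prod[symmetric]
    by (subst lborel.nn_integral_fst[symmetric]) (auto simp: cellI intro!: nn_integral_cong)
  finally show ?thesis
    by (simp add: nn_integral_torus)
qed

text \<open>The representative of \<open>x\<close> in the cell. A periodic function factors through
  it, so invariance can be stated once, for the image measure under
  \<open>torus_red\<close>.\<close>

definition torus_red :: "plane \<Rightarrow> plane" where
  "torus_red x = x + (2 * pi * of_int (- \<lfloor>fst x / (2 * pi)\<rfloor>), 2 * pi * of_int (- \<lfloor>snd x / (2 * pi)\<rfloor>))"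

lemma torus_red_measurable [measurable]: "torus_red \<in> borel_measurable borel"
proof -
  define r :: "real \<Rightarrow> real" where "r t = t + 2 * pi * of_int (- \<lfloor>t / (2 * pi)\<rfloor>)" for t
  have [measurable]: "r \<in> borel_measurable borel"
    unfolding r_def by measurable
  have eq: "torus_red = (\<lambda>x. (r (fst x), r (snd x)))"
    by (auto simp: torus_red_def r_def plus_prod_def)
  show ?thesis
    unfolding eq borel_prod[symmetric] by measurable
qed

lemma torus_periodic_torus_red: "torus_periodic torus_red"
proof -
  have *: "\<lfloor>(a + 2 * pi) / (2 * pi)\<rfloor> = \<lfloor>a / (2 * pi)\<rfloor> + 1" for a
    by (simp add: add_divide_distrib)
  have **: "2 * pi + a + 2 * pi * of_int (- \<lfloor>(a + 2 * pi) / (2 * pi)\<rfloor>) = a + 2 * pi * of_int (- \<lfloor>a / (2 * pi)\<rfloor>)" for a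
    unfolding * by (simp add: algebra_simps)
  show ?thesis
    unfolding torus_periodic_def torus_red_def using ** by (simp add: plus_prod_def add.commute)
qed

lemma periodic_torus_red: "torus_periodic f \<Longrightarrow> f (torus_red x) = f x"
  unfolding torus_red_def by (rule torus_periodic_int)

text \<open>Equality of image measures carries the invariance from nonnegative functions to Bochner
  integrals and to integrability, with values in any Banach space, because both can be read off the
  image measure.\<close>

lemma distr_torus_translate:
  "distr torus_measure borel (\<lambda>x. torus_red (x + h)) = distr torus_measure borel torus_red"
proof (rule measure_eqI)
  fix A :: "plane set" assume "A \<in> sets (distr torus_measure borel (\<lambda>x. torus_red (x + h)))"
  then have [measurable]: "A \<in> sets borel" by simp
  have per: "torus_periodic (\<lambda>x. indicator A (torus_red x) :: ennreal)"
    using torus_periodic_torus_red unfolding torus_periodic_def by simp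
  have "(\<integral>\<^sup>+x. indicator A (torus_red (x + h)) \<partial>torus_measure)
      = (\<integral>\<^sup>+x. indicator A (torus_red x) \<partial>torus_measure)"
    by (rule nn_integral_torus_translate[OF _ per]) measurable
  then show "emeasure (distr torus_measure borel (\<lambda>x. torus_red (x + h))) A
      = emeasure (distr torus_measure borel torus_red) A"
    by (simp add: nn_integral_distr flip: nn_integral_indicator)
qed simp

lemma integral_torus_translate:
  fixes f :: "plane \<Rightarrow> 'b::{banach, second_countable_topology}"
  assumes [measurable]: "f \<in> borel_measurable borel" and per: "torus_periodic f"
  shows "(\<integral>x. f (x + h) \<partial>torus_measure) = (\<integral>x. f x \<partial>torus_measure)"
  using arg_cong[OF distr_torus_translate[of h], of "\<lambda>M. integral\<^sup>L M f"]
  by (simp add: integral_distr periodic_torus_red[OF per])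

lemma integrable_torus_translate:
  fixes f :: "plane \<Rightarrow> 'b::{banach, second_countable_topology}"
  assumes [measurable]: "f \<in> borel_measurable borel" and per: "torus_periodic f"
  shows "integrable torus_measure (\<lambda>x. f (x + h)) \<longleftrightarrow> integrable torus_measure f"
  using arg_cong[OF distr_torus_translate[of h], of "\<lambda>M. integrable M f"]
  by (simp add: integrable_distr_eq periodic_torus_red[OF per])

section \<open>Fourier modes and their integrals\<close>

lemma freq_add: "freq (k + l) = freq k + freq l"
  by (simp add: freq_def prod_eq_iff)

lemma freq_minus: "freq (- k) = - freq k"
  by (simp add: freq_def)

lemma freq_0 [simp]: "freq 0 = 0"
  by (simp add: freq_def zero_prod_def)

lemma freq_eq_0_iff [simp]: "freq k = 0 \<longleftrightarrow> k = 0"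
  by (cases k) (simp add: freq_def zero_prod_def)

lemma fmode_0 [simp]: "fmode 0 x = 1"
  by (simp add: fmode_def)

lemma fmode_add: "fmode (k + l) x = fmode k x * fmode l x"
  by (simp add: fmode_def freq_add inner_add_left cis_mult)

lemma fmode_uminus: "fmode (- k) x = cnj (fmode k x)"
  by (simp add: fmode_def freq_minus cis_cnj)

lemma fmode_diff: "fmode (k - l) x = fmode k x * cnj (fmode l x)"
  using fmode_add[of k "- l" x] by (simp add: fmode_uminus)

lemma fmode_translate: "fmode k (x + y) = fmode k x * fmode k y"
  by (simp add: fmode_def inner_add_right cis_mult)

lemma norm_fmode [simp]: "cmod (fmode k x) = 1"
  by (simp add: fmode_def)

lemma continuous_on_fmode [continuous_intros]: "continuous_on A (fmode k)"
  unfolding fmode_def[abs_def] by (intro continuous_intros)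

lemma fmode_measurable [measurable]: "fmode k \<in> borel_measurable borel"
  by (intro borel_measurable_continuous_onI continuous_intros)

lemma torus_periodic_fmode: "torus_periodic (fmode k)"
proof -
  have "fmode k (2 * pi, 0) = 1" "fmode k (0, 2 * pi) = 1"
    using cis_multiple_2pi[of "of_int (fst k)"] cis_multiple_2pi[of "of_int (snd k)"]
    by (simp_all add: fmode_def freq_def mult_ac)
  then show ?thesis
    by (simp add: torus_periodic_def fmode_translate)
qed

lemma integral_fmode: "(\<integral>x. fmode k x \<partial>torus_measure) = (if k = 0 then 1 else 0)"
proof (cases "k = 0")
  case True
  then show ?thesis by (simp add: torus.prob_space[simplified])
next
  case False
  \<comment> \<open>This shift changes the phase by \<pi>, so translation by it multiplies the mode
    by -1 and the integral equals its own negative.\<close>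
  define h where "h = (pi / (norm (freq k))\<^sup>2) *\<^sub>R freq k"
  have "freq k \<bullet> h = pi"
    using False by (simp add: h_def dot_square_norm)
  then have h: "fmode k h = - 1"
    by (simp add: fmode_def)
  have "(\<integral>x. fmode k (x + h) \<partial>torus_measure) = (\<integral>x. fmode k x \<partial>torus_measure)"
    by (rule integral_torus_translate[OF _ torus_periodic_fmode]) measurable
  then show ?thesis
    using False by (simp add: fmode_translate h)
qed

lemma integrable_torus_bounded:
  fixes f :: "plane \<Rightarrow> 'b::{banach, second_countable_topology}"
  assumes "f \<in> borel_measurable borel" and "\<And>x. norm (f x) \<le> B"
  shows "integrable torus_measure f"
  using assms by (intro torus.integrable_const_bound[of _ B]) (auto simp: borel_measurable_torus)

lemma integrable_fmode [simp, intro]: "integrable torus_measure (fmode k)"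
  by (rule integrable_torus_bounded[of _ 1]) auto

section \<open>Trigonometric polynomials are dense in L2\<close>

definition trig_poly :: "(plane \<Rightarrow> complex) \<Rightarrow> bool" where
  "trig_poly p \<longleftrightarrow> (\<exists>A c. finite A \<and> p = (\<lambda>x. \<Sum>k\<in>A. c k * fmode k x))"

lemma trig_poly_monom: "trig_poly (\<lambda>x. c * fmode k x)"
  unfolding trig_poly_def by (intro exI[of _ "{k}"] exI[of _ "\<lambda>_. c"]) simp

lemma trig_poly_const: "trig_poly (\<lambda>x. c)"
  using trig_poly_monom[of c 0] by simp

lemma trig_poly_add:
  assumes "trig_poly p" "trig_poly q"
  shows "trig_poly (\<lambda>x. p x + q x)"
proof -
  obtain A c B d where "finite A" "finite B" and p: "p = (\<lambda>x. \<Sum>k\<in>A. c k * fmode k x)"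
    and q: "q = (\<lambda>x. \<Sum>k\<in>B. d k * fmode k x)"
    using assms unfolding trig_poly_def by blast
  have "p x + q x = (\<Sum>k\<in>A\<union>B. ((if k \<in> A then c k else 0) + (if k \<in> B then d k else 0)) * fmode k x)" for x
  proof -
    have "p x = (\<Sum>k\<in>A\<union>B. (if k \<in> A then c k else 0) * fmode k x)"
      unfolding p by (rule sum.mono_neutral_cong_left) (use \<open>finite A\<close> \<open>finite B\<close> in auto)
    moreover have "q x = (\<Sum>k\<in>A\<union>B. (if k \<in> B then d k else 0) * fmode k x)"
      unfolding q by (rule sum.mono_neutral_cong_left) (use \<open>finite A\<close> \<open>finite B\<close> in auto)
    ultimately show ?thesis
      by (simp add: ring_distribs sum.distrib)
  qed
  then show ?thesis
    unfolding trig_poly_def using \<open>finite A\<close> \<open>finite B\<close>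
    by (intro exI[of _ "A \<union> B"] exI[of _ "\<lambda>k. (if k \<in> A then c k else 0) + (if k \<in> B then d k else 0)"]) auto
qed

lemma trig_poly_sum:
  assumes "\<And>i. i \<in> I \<Longrightarrow> trig_poly (p i)"
  shows "trig_poly (\<lambda>x. \<Sum>i\<in>I. p i x)"
  using assms
proof (induction I rule: infinite_finite_induct)
  case (insert i I)
  then show ?case using trig_poly_add[of "p i"] by simp
qed (simp_all add: trig_poly_const)

lemma trig_poly_mult:
  assumes "trig_poly p" "trig_poly q"
  shows "trig_poly (\<lambda>x. p x * q x)"
proof -
  obtain A c B d where p: "p = (\<lambda>x. \<Sum>k\<in>A. c k * fmode k x)"
    and q: "q = (\<lambda>x. \<Sum>k\<in>B. d k * fmode k x)"
    using assms unfolding trig_poly_def by blast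
  have "trig_poly (\<lambda>x. \<Sum>k\<in>A. \<Sum>l\<in>B. (c k * d l) * fmode (k + l) x)"
    by (intro trig_poly_sum trig_poly_monom)
  then show ?thesis
    by (simp add: p q sum_product fmode_add mult_ac)
qed

lemma trig_poly_measurable: "trig_poly p \<Longrightarrow> p \<in> borel_measurable borel"
  by (auto simp: trig_poly_def)

lemma trig_poly_bounded:
  assumes "trig_poly p"
  obtains B where "\<And>x. cmod (p x) \<le> B"
proof -
  obtain A c where p: "p = (\<lambda>x. \<Sum>k\<in>A. c k * fmode k x)"
    using assms unfolding trig_poly_def by blast
  have "cmod (p x) \<le> (\<Sum>k\<in>A. cmod (c k))" for x
    unfolding p by (intro order_trans[OF norm_sum] sum_mono) (simp add: norm_mult)
  then show thesis by (rule that)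
qed

text \<open>The bridge from Stone--Weierstrass on the embedded torus to Fourier modes: the real and
  imaginary parts of cis t are combinations of cis t and its conjugate, and trigonometric
  polynomials form an algebra.\<close>

lemma trig_poly_real_polynomial:
  fixes g :: "complex \<times> complex \<Rightarrow> real"
  assumes "real_polynomial_function g"
  shows "trig_poly (\<lambda>x. of_real (g (cis (fst x), cis (snd x))))"
  using assms
proof induction
  case (linear g)
  interpret bounded_linear g by fact
  have g: "g (z, w) = Re z * g (1, 0) + Im z * g (\<i>, 0) + Re w * g (0, 1) + Im w * g (0, \<i>)" for z w
  proof -
    have "(z, w) = Re z *\<^sub>R (1, 0) + Im z *\<^sub>R (\<i>, 0) + Re w *\<^sub>R (0, 1) + Im w *\<^sub>R (0, \<i>)"
      by (simp add: complex_eq_iff)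
    then have "g (z, w) = g (Re z *\<^sub>R (1, 0) + Im z *\<^sub>R (\<i>, 0) + Re w *\<^sub>R (0, 1) + Im w *\<^sub>R (0, \<i>))"
      by (rule arg_cong)
    then show ?thesis unfolding add scaleR by simp
  qed
  have modes: "fmode (1, 0) x = cis (fst x)" "fmode (-1, 0) x = cnj (cis (fst x))"
    "fmode (0, 1) x = cis (snd x)" "fmode (0, -1) x = cnj (cis (snd x))" for x
    by (simp_all add: fmode_def freq_def inner_prod_def cis_cnj)
  have monoms: "trig_poly (\<lambda>x. c * cis (fst x))" "trig_poly (\<lambda>x. c * cnj (cis (fst x)))"
    "trig_poly (\<lambda>x. c * cis (snd x))" "trig_poly (\<lambda>x. c * cnj (cis (snd x)))" for c
    using trig_poly_monom[of c "(1, 0)"] trig_poly_monom[of c "(- 1, 0)"]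
      trig_poly_monom[of c "(0, 1)"] trig_poly_monom[of c "(0, - 1)"]
    unfolding modes by simp_all
  have Re: "complex_of_real (Re (cis t)) = 1/2 * cis t + 1/2 * cnj (cis t)"
    and Im: "complex_of_real (Im (cis t)) = (- \<i> / 2) * cis t + (\<i> / 2) * cnj (cis t)" for t
    by (simp_all add: complex_eq_iff)
  have ReIm: "trig_poly (\<lambda>x. of_real (Re (cis (fst x))))" "trig_poly (\<lambda>x. of_real (Im (cis (fst x))))"
    "trig_poly (\<lambda>x. of_real (Re (cis (snd x))))" "trig_poly (\<lambda>x. of_real (Im (cis (snd x))))"
    unfolding Re Im by (intro trig_poly_add monoms)+
  show ?case
    by (subst g, unfold of_real_add of_real_mult)
      (intro trig_poly_add trig_poly_mult trig_poly_const ReIm)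
next
  case (const c)
  then show ?case by (rule trig_poly_const)
next
  case (add f g)
  then show ?case unfolding of_real_add by (intro trig_poly_add)
next
  case (mult f g)
  then show ?case unfolding of_real_mult by (intro trig_poly_mult)
qed

text \<open>A point of the circle other than 1 has a single preimage in the closed interval of
  length 2\<pi>. This is why the embedding of the torus glues only boundary points of the
  cell.\<close>

lemma cis_eq_interior:
  assumes "cis a = cis b" "0 < a" "a < 2 * pi" "0 \<le> b" "b \<le> 2 * pi"
  shows "a = b"
proof -
  obtain n :: int where n: "a = b + 2 * pi * n"
    using assms(1) sin_cos_eq_iff[of a b] by (auto simp: complex_eq_iff)
  have "\<bar>2 * pi * n\<bar> < 2 * pi * 1"
    using assms n by auto
  then have "\<bar>real_of_int n\<bar> < 1"
    by (simp add: abs_mult)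
  then show ?thesis using n by simp
qed

text \<open>
  Vanishing on the boundary of the cell lets h factor through the embedding of the torus into
  two copies of the complex plane, where Stone--Weierstrass applies.
\<close>

lemma trig_approx_continuous:
  fixes h :: "plane \<Rightarrow> real"
  assumes h: "continuous_on ({0..2 * pi} \<times> {0..2 * pi}) h"
    and bd: "\<And>x. fst x \<in> {0, 2 * pi} \<or> snd x \<in> {0, 2 * pi} \<Longrightarrow> h x = 0"
    and "0 < e"
  obtains p where "trig_poly p" "\<And>x. x \<in> cell \<Longrightarrow> cmod (of_real (h x) - p x) \<le> e"
proof -
  define K :: "plane set" where "K = {0..2 * pi} \<times> {0..2 * pi}"
  define \<pi> :: "plane \<Rightarrow> complex \<times> complex" where "\<pi> x = (cis (fst x), cis (snd x))" for x
  have K: "compact K" unfolding K_def by (intro compact_Times) simp_all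
  have cont: "continuous_on A \<pi>" for A
    unfolding \<pi>_def by (intro continuous_intros)
  \<comment> \<open>Distinct points of \<open>K\<close> with the same image lie on the boundary,
    where \<open>h\<close> vanishes, so \<open>h\<close> takes the same value at both.\<close>
  have eq1: "x = y" if "x \<in> K" "y \<in> K" "\<pi> x = \<pi> y" "h x \<noteq> 0" for x y
  proof -
    have "0 < fst x" "fst x < 2 * pi" "0 < snd x" "snd x < 2 * pi"
      using that bd[of x] by (auto simp: K_def less_le)
    then show ?thesis
      using that cis_eq_interior[of "fst x" "fst y"] cis_eq_interior[of "snd x" "snd y"]
      by (auto simp: K_def \<pi>_def prod_eq_iff)
  qed
  have eq: "h x = h y" if "x \<in> K" "y \<in> K" "\<pi> x = \<pi> y" for x y
    using eq1[of x y] eq1[of y x] that by metis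
  define F where "F z = h (SOME x. x \<in> K \<and> \<pi> x = z)" for z
  have F: "F (\<pi> x) = h x" if "x \<in> K" for x
    unfolding F_def using someI_ex[of "\<lambda>y. y \<in> K \<and> \<pi> y = \<pi> x"] that eq by blast
  have cS: "compact (\<pi> ` K)"
    using K cont by (rule compact_continuous_image[rotated])
  \<comment> \<open>\<open>F\<close> is the descent of \<open>h\<close> along a quotient map of a
    compact space: preimages of closed sets under \<open>F\<close> are images of compact sets, hence
    closed.\<close>
  have "closed (F -` B \<inter> \<pi> ` K)" if "closed B" for B
  proof -
    have "F -` B \<inter> \<pi> ` K = \<pi> ` (h -` B \<inter> K)"
      using F by auto
    moreover have "compact (h -` B \<inter> K)"
      using h K that continuous_closed_preimage[of K h B] compact_Int_closed[OF K, of "K \<inter> h -` B"]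
      by (auto simp: K_def[symmetric] compact_imp_closed Int_ac)
    ultimately show ?thesis
      using compact_continuous_image[OF cont] compact_imp_closed by metis
  qed
  then have "continuous_on (\<pi> ` K) F"
    by (subst continuous_on_closed_vimage) (use cS compact_imp_closed in auto)
  then obtain g where g: "real_polynomial_function g" "\<And>z. z \<in> \<pi> ` K \<Longrightarrow> \<bar>F z - g z\<bar> < e"
    using Stone_Weierstrass_real_polynomial_function[OF cS] \<open>0 < e\<close> by metis
  show thesis
  proof
    show "trig_poly (\<lambda>x. of_real (g (\<pi> x)))"
      unfolding \<pi>_def using trig_poly_real_polynomial[OF g(1)] by simp
    fix x :: plane assume "x \<in> cell"
    then have "x \<in> K" by (auto simp: K_def)
    then show "cmod (of_real (h x) - of_real (g (\<pi> x))) \<le> e"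
      using g(2)[of "\<pi> x"] F[of x] by (simp flip: of_real_diff)
  qed
qed

lemma torus_L2_periodic: "torus_L2 f \<Longrightarrow> torus_periodic f"
  by (simp add: torus_L2_def)

text \<open>The Bochner integral is 0 when the integrand is not integrable, so this condition
  carries information only for square integrable \<open>f\<close>.\<close>

definition trig_dense :: "(plane \<Rightarrow> real) \<Rightarrow> bool" where
  "trig_dense f \<longleftrightarrow> (\<forall>e>0. \<exists>p. trig_poly p \<and> (\<integral>x. (cmod (of_real (f x) - p x))\<^sup>2 \<partial>torus_measure) < e)"

lemma power2_sum_le: "(a + b)\<^sup>2 \<le> 2 * a\<^sup>2 + 2 * b\<^sup>2" for a b :: real
  using zero_le_power2[of "a - b"] unfolding power2_sum power2_diff by linarith

lemma integrable_square_diff: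
  fixes f g :: "plane \<Rightarrow> 'b::euclidean_space"
  assumes [measurable]: "f \<in> borel_measurable borel" "g \<in> borel_measurable borel"
    and "integrable torus_measure (\<lambda>x. (norm (f x))\<^sup>2)" "integrable torus_measure (\<lambda>x. (norm (g x))\<^sup>2)"
  shows "integrable torus_measure (\<lambda>x. (norm (f x - g x))\<^sup>2)"
proof (rule Bochner_Integration.integrable_bound)
  show "integrable torus_measure (\<lambda>x. 2 * (norm (f x))\<^sup>2 + 2 * (norm (g x))\<^sup>2)"
    using assms by simp
  have "(norm (f x - g x))\<^sup>2 \<le> 2 * (norm (f x))\<^sup>2 + 2 * (norm (g x))\<^sup>2" for x
  proof -
    have "(norm (f x - g x))\<^sup>2 \<le> (norm (f x) + norm (g x))\<^sup>2"
      by (intro power_mono norm_triangle_ineq4) simp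
    also have "\<dots> \<le> 2 * (norm (f x))\<^sup>2 + 2 * (norm (g x))\<^sup>2"
      by (rule power2_sum_le)
    finally show ?thesis .
  qed
  then show "AE x in torus_measure. norm ((norm (f x - g x))\<^sup>2) \<le> norm (2 * (norm (f x))\<^sup>2 + 2 * (norm (g x))\<^sup>2)"
    by simp
qed (use assms in \<open>simp add: borel_measurable_torus\<close>)

text \<open>Approximable functions are closed under dominated limits. This allows the passage from
  continuous functions to bounded ones and from there to square integrable ones.\<close>

lemma trig_dense_limit:
  fixes f :: "plane \<Rightarrow> real"
  assumes [measurable]: "f \<in> borel_measurable borel" "\<And>n. F n \<in> borel_measurable borel"
    and int: "integrable torus_measure (\<lambda>x. (g x)\<^sup>2)"
    and lim: "AE x in torus_measure. (\<lambda>n. F n x) \<longlonglongrightarrow> f x"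
    and bnd: "\<And>n x. \<bar>F n x\<bar> \<le> g x"
    and dense: "\<And>n. trig_dense (F n)"
  shows "trig_dense f"
  unfolding trig_dense_def
proof (intro allI impI)
  fix e :: real assume "0 < e"
  have [measurable]: "(\<lambda>x. (g x)\<^sup>2) \<in> borel_measurable borel"
    using int borel_measurable_torus by blast
  have bndf: "AE x in torus_measure. \<bar>f x\<bar> \<le> g x"
    using lim
  proof eventually_elim
    case (elim x)
    then have "(\<lambda>n. \<bar>F n x\<bar>) \<longlonglongrightarrow> \<bar>f x\<bar>" by (rule tendsto_rabs)
    then show ?case by (rule LIMSEQ_le_const2) (intro exI allI impI, rule bnd)
  qed
  have sq: "(a - b)\<^sup>2 \<le> 4 * c\<^sup>2" if "\<bar>a\<bar> \<le> c" "\<bar>b\<bar> \<le> c" for a b c :: real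
  proof -
    have "\<bar>a - b\<bar>\<^sup>2 \<le> (2 * c)\<^sup>2" using that by (intro power_mono) auto
    then show ?thesis by (simp add: power_mult_distrib)
  qed
  have "(\<lambda>n. \<integral>x. (f x - F n x)\<^sup>2 \<partial>torus_measure) \<longlonglongrightarrow> (\<integral>x. 0 \<partial>torus_measure)"
  proof (rule integral_dominated_convergence[where w="\<lambda>x. 4 * (g x)\<^sup>2"])
    show "AE x in torus_measure. (\<lambda>n. (f x - F n x)\<^sup>2) \<longlonglongrightarrow> 0"
      using lim
    proof eventually_elim
      case (elim x)
      have "(\<lambda>n. (f x - F n x)\<^sup>2) \<longlonglongrightarrow> (f x - f x)\<^sup>2"
        by (intro tendsto_intros elim)
      then show ?case by simp
    qed
    show "AE x in torus_measure. norm ((f x - F n x)\<^sup>2) \<le> 4 * (g x)\<^sup>2" for n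
      using bndf by eventually_elim (use sq bnd in simp)
  qed (use int in \<open>simp_all add: borel_measurable_torus\<close>)
  \<comment> \<open>A quarter of \<open>e\<close> for each of the two errors, since the square of a
    sum is at most twice the sum of the squares.\<close>
  then have "\<forall>\<^sub>F n in sequentially. (\<integral>x. (f x - F n x)\<^sup>2 \<partial>torus_measure) < e / 4"
    using \<open>0 < e\<close> by (intro order_tendstoD(2)[of _ "\<integral>x. 0 \<partial>torus_measure"]) simp_all
  then obtain n where n: "(\<integral>x. (f x - F n x)\<^sup>2 \<partial>torus_measure) < e / 4"
    using eventually_happens'[OF sequentially_bot] by blast
  obtain p where p: "trig_poly p" "(\<integral>x. (cmod (of_real (F n x) - p x))\<^sup>2 \<partial>torus_measure) < e / 4"
    using dense[of n] \<open>0 < e\<close> unfolding trig_dense_def by (metis divide_pos_pos zero_less_numeral)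
  have [measurable]: "p \<in> borel_measurable borel" using p(1) by (rule trig_poly_measurable)
  have intg: "integrable torus_measure (\<lambda>x. 4 * (g x)\<^sup>2)" using int by simp
  have i1: "integrable torus_measure (\<lambda>x. (f x - F n x)\<^sup>2)"
  proof (rule Bochner_Integration.integrable_bound[OF intg])
    show "AE x in torus_measure. norm ((f x - F n x)\<^sup>2) \<le> norm (4 * (g x)\<^sup>2)"
      using bndf by eventually_elim (use sq bnd in simp)
  qed (simp add: borel_measurable_torus)
  have i2: "integrable torus_measure (\<lambda>x. (cmod (of_real (F n x) - p x))\<^sup>2)"
  proof (rule integrable_square_diff)
    show "integrable torus_measure (\<lambda>x. (cmod (complex_of_real (F n x)))\<^sup>2)"
    proof (rule Bochner_Integration.integrable_bound[OF int])
      have "(F n x)\<^sup>2 \<le> (g x)\<^sup>2" for x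
        using bnd[of n x] by (metis abs_ge_zero abs_of_nonneg order_trans abs_le_square_iff)
      then show "AE x in torus_measure. norm ((cmod (complex_of_real (F n x)))\<^sup>2) \<le> norm ((g x)\<^sup>2)"
        by simp
    qed (simp add: borel_measurable_torus)
    obtain B where "\<And>x. cmod (p x) \<le> B" using trig_poly_bounded[OF p(1)] by blast
    then show "integrable torus_measure (\<lambda>x. (cmod (p x))\<^sup>2)"
      by (intro integrable_torus_bounded[of _ "B\<^sup>2"]) (auto intro!: power_mono)
  qed simp_all
  have "(\<integral>x. (cmod (of_real (f x) - p x))\<^sup>2 \<partial>torus_measure)
     \<le> (\<integral>x. 2 * (f x - F n x)\<^sup>2 + 2 * (cmod (of_real (F n x) - p x))\<^sup>2 \<partial>torus_measure)"
  proof (rule integral_mono')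
    show "integrable torus_measure (\<lambda>x. 2 * (f x - F n x)\<^sup>2 + 2 * (cmod (of_real (F n x) - p x))\<^sup>2)"
      using i1 i2 by simp
    fix x
    have "cmod (of_real (f x) - p x) \<le> \<bar>f x - F n x\<bar> + cmod (of_real (F n x) - p x)"
      using norm_triangle_ineq[of "of_real (f x - F n x)" "of_real (F n x) - p x"]
      by (simp only: norm_of_real) simp
    then have "(cmod (of_real (f x) - p x))\<^sup>2 \<le> (\<bar>f x - F n x\<bar> + cmod (of_real (F n x) - p x))\<^sup>2"
      by (intro power_mono) simp_all
    also have "\<dots> \<le> 2 * (f x - F n x)\<^sup>2 + 2 * (cmod (of_real (F n x) - p x))\<^sup>2"
      using power2_sum_le[of "\<bar>f x - F n x\<bar>"] by simp
    finally show "(cmod (of_real (f x) - p x))\<^sup>2 \<le> 2 * (f x - F n x)\<^sup>2 + 2 * (cmod (of_real (F n x) - p x))\<^sup>2" .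
  qed simp
  also have "\<dots> < e"
    using i1 i2 n p(2) by simp
  finally show "\<exists>p. trig_poly p \<and> (\<integral>x. (cmod (of_real (f x) - p x))\<^sup>2 \<partial>torus_measure) < e"
    using p(1) by blast
qed

lemma AE_torus_cell: "AE x in torus_measure. x \<in> cell"
  unfolding torus_measure_def by (rule AE_uniform_measureI) auto

lemma AE_torus_lborel: "AE x in lborel. P x \<Longrightarrow> AE x in torus_measure. P x"
  unfolding torus_measure_def by (rule AE_uniform_measureI) auto

lemma trig_dense_continuous:
  fixes h :: "plane \<Rightarrow> real"
  assumes h: "continuous_on UNIV h"
    and bd: "\<And>x. fst x \<in> {0, 2 * pi} \<or> snd x \<in> {0, 2 * pi} \<Longrightarrow> h x = 0"
  shows "trig_dense h"
  unfolding trig_dense_def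
proof (intro allI impI)
  fix e :: real assume "0 < e"
  \<comment> \<open>Makes \<open>d\<^sup>2\<close> at most e / 2, whether \<open>e\<close> is small
    or large.\<close>
  define d where "d = min 1 (e / 2)"
  have d: "0 < d" "d\<^sup>2 < e" using \<open>0 < e\<close>
  proof -
    show "0 < d" using \<open>0 < e\<close> by (simp add: d_def)
    have "d * d \<le> 1 * (e / 2)" unfolding d_def using \<open>0 < e\<close> by (intro mult_mono) auto
    then show "d\<^sup>2 < e" using \<open>0 < e\<close> by (simp add: power2_eq_square)
  qed
  obtain p where p: "trig_poly p" "\<And>x. x \<in> cell \<Longrightarrow> cmod (of_real (h x) - p x) \<le> d"
    using trig_approx_continuous[of h d] h bd d(1) continuous_on_subset[OF h] by (metis top_greatest)
  have [measurable]: "p \<in> borel_measurable borel" "h \<in> borel_measurable borel"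
    using p(1) h by (simp_all add: trig_poly_measurable borel_measurable_continuous_onI)
  have "(\<integral>x. (cmod (of_real (h x) - p x))\<^sup>2 \<partial>torus_measure) \<le> (\<integral>x. d\<^sup>2 \<partial>torus_measure)"
    using AE_torus_cell
  proof (intro integral_mono_AE')
    show "AE x in torus_measure. (cmod (of_real (h x) - p x))\<^sup>2 \<le> d\<^sup>2"
      using AE_torus_cell by eventually_elim (use p(2) in \<open>auto intro!: power_mono\<close>)
  qed simp_all
  also have "\<dots> < e" using d(2) by (simp add: torus.prob_space[simplified])
  finally show "\<exists>p. trig_poly p \<and> (\<integral>x. (cmod (of_real (h x) - p x))\<^sup>2 \<partial>torus_measure) < e"
    using p(1) by blast
qed

definition clip :: "real \<Rightarrow> real \<Rightarrow> real" where
  "clip M t = max (- M) (min M t)"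

lemma continuous_on_clip [continuous_intros]: "continuous_on A f \<Longrightarrow> continuous_on A (\<lambda>x. clip M (f x))"
  unfolding clip_def by (intro continuous_intros)

lemma clip_measurable [measurable]: "clip M \<in> borel_measurable borel"
  unfolding clip_def[abs_def] by measurable

lemma AE_torus_interior: "AE x in torus_measure. 0 < fst x \<and> fst x < 2 * pi \<and> 0 < snd x \<and> snd x < 2 * pi"
proof -
  have "AE x in lborel. fst (x::plane) \<noteq> 0 \<and> snd x \<noteq> 0"
  proof -
    have 1: "{x::plane. x \<bullet> (1, 0) = 0} \<in> null_sets lebesgue" "{x::plane. x \<bullet> (0, 1) = 0} \<in> null_sets lebesgue"
      by (simp_all flip: negligible_iff_null_sets)
        (auto intro!: negligible_standard_hyperplane simp: Basis_prod_def)
    have "AE x in lebesgue. fst (x::plane) \<noteq> 0 \<and> snd x \<noteq> 0"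
      using AE_not_in[OF 1(1)] AE_not_in[OF 1(2)]
      by eventually_elim (auto simp: inner_prod_def)
    then show ?thesis by (simp add: AE_completion_iff)
  qed
  from AE_torus_lborel[OF this] AE_torus_cell show ?thesis
    by eventually_elim (auto simp: less_le)
qed

lemma trig_dense_bounded:
  fixes f :: "plane \<Rightarrow> real"
  assumes f [measurable]: "f \<in> borel_measurable borel" and M: "\<And>x. \<bar>f x\<bar> \<le> M"
  shows "trig_dense f"
proof -
  have "f \<in> borel_measurable lebesgue"
    using f by (simp add: measurable_completion)
  then have "f measurable_on UNIV"
    by (intro lebesgue_measurable_imp_measurable_on) simp_all
  \<comment> \<open>Measurability gives continuous functions that converge almost everywhere. They
    may be unbounded or nonzero on the boundary of the cell; clipping repairs the former and a
    cutoff the latter.\<close>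
  then obtain N g where N: "negligible N" and cont: "\<And>n. continuous_on UNIV (g n)"
    and limN: "\<And>x. x \<notin> N \<Longrightarrow> (\<lambda>n. g n x) \<longlonglongrightarrow> f x"
    unfolding measurable_on_def by auto
  \<comment> \<open>\<open>\<phi>\<close> vanishes on the four lines bounding the cell and is
    positive inside, so \<open>min 1 (real n * \<phi> x)\<close> is a continuous cutoff that tends
    to 1 at every interior point.\<close>
  define \<phi> :: "plane \<Rightarrow> real" where "\<phi> x = \<bar>fst x * (2 * pi - fst x) * snd x * (2 * pi - snd x)\<bar>" for x
  define F where "F n x = min 1 (real n * \<phi> x) * clip M (g n x)" for n x
  have "M \<ge> 0" using M[of 0] by simp
  have contF: "continuous_on UNIV (F n)" for n
    unfolding F_def \<phi>_def using cont by (intro continuous_intros) auto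
  have "AE x in lebesgue. x \<notin> N"
    using N by (intro AE_not_in) (simp add: negligible_iff_null_sets)
  then have "AE x in lborel. x \<notin> N"
    by (simp add: AE_completion_iff)
  from AE_torus_lborel[OF this] AE_torus_interior
  have lim: "AE x in torus_measure. (\<lambda>n. F n x) \<longlonglongrightarrow> f x"
  proof eventually_elim
    case (elim x)
    have "0 < \<phi> x" using elim by (simp add: \<phi>_def)
    have "\<forall>\<^sub>F n in sequentially. real n * \<phi> x \<ge> 1"
    proof -
      have "filterlim (\<lambda>n. real n * \<phi> x) at_top sequentially"
        by (rule filterlim_at_top_mult_tendsto_pos[where f="\<lambda>_. \<phi> x" and c="\<phi> x"])
          (use \<open>0 < \<phi> x\<close> filterlim_real_sequentially in simp_all)
      then show ?thesis by (simp add: filterlim_at_top)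
    qed
    then have ev: "\<forall>\<^sub>F n in sequentially. clip M (g n x) = F n x"
      by eventually_elim (simp add: F_def)
    have tend: "(\<lambda>n. clip M (g n x)) \<longlonglongrightarrow> clip M (f x)"
      unfolding clip_def by (intro tendsto_intros limN) (use elim in simp)
    have "clip M (f x) = f x" using M[of x] by (auto simp: clip_def)
    with Lim_transform_eventually[OF tend ev] show ?case by (simp only:)
  qed
  show ?thesis
  proof (rule trig_dense_limit[where F=F and g="\<lambda>_. M"])
    show "\<bar>F n x\<bar> \<le> M" for n x
    proof -
      have "0 \<le> real n * \<phi> x" by (simp add: \<phi>_def)
      then have "\<bar>min 1 (real n * \<phi> x)\<bar> \<le> 1" by (cases "real n * \<phi> x \<le> 1") simp_all
      moreover have "\<bar>clip M (g n x)\<bar> \<le> M" using \<open>M \<ge> 0\<close> by (auto simp: clip_def)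
      ultimately have "\<bar>min 1 (real n * \<phi> x)\<bar> * \<bar>clip M (g n x)\<bar> \<le> 1 * M"
        by (intro mult_mono) auto
      then show ?thesis by (simp add: F_def abs_mult)
    qed
    show "trig_dense (F n)" for n
      by (rule trig_dense_continuous[OF contF]) (auto simp: F_def \<phi>_def)
    show "F n \<in> borel_measurable borel" for n
      using contF by (rule borel_measurable_continuous_onI)
  qed (rule f lim torus.integrable_const)+
qed

lemma trig_dense_L2:
  fixes f :: "plane \<Rightarrow> real"
  assumes "f \<in> borel_measurable borel" "integrable torus_measure (\<lambda>x. (f x)\<^sup>2)"
  shows "trig_dense f"
proof (rule trig_dense_limit[where F="\<lambda>n x. clip (real n) (f x)" and g="\<lambda>x. \<bar>f x\<bar>"])
  show "AE x in torus_measure. (\<lambda>n. clip (real n) (f x)) \<longlonglongrightarrow> f x"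
  proof (rule AE_I2)
    fix x
    have "\<forall>\<^sub>F n in sequentially. real n \<ge> \<bar>f x\<bar>"
      using filterlim_real_sequentially by (simp add: filterlim_at_top)
    then have "\<forall>\<^sub>F n in sequentially. f x = clip (real n) (f x)"
      by eventually_elim (auto simp: clip_def)
    then show "(\<lambda>n. clip (real n) (f x)) \<longlonglongrightarrow> f x"
      by (rule Lim_transform_eventually[OF tendsto_const])
  qed
  show "trig_dense (\<lambda>x. clip (real n) (f x))" for n
    using assms(1) by (intro trig_dense_bounded[where M="real n"]) (auto simp: clip_def)
qed (use assms in \<open>auto simp: clip_def\<close>)

section \<open>Fourier coefficients and convergence in mean square\<close>

lemma dist_of_uminus: "dist_of f (- k) = cnj (dist_of f k)"
  unfolding dist_of_def by (subst Bochner_Integration.integral_cnj[symmetric]) (simp add: fmode_uminus)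

lemma torus_square_integrable_imp_integrable:
  fixes f :: "plane \<Rightarrow> real"
  assumes "f \<in> borel_measurable borel" "integrable torus_measure (\<lambda>x. (f x)\<^sup>2)"
  shows "integrable torus_measure f"
  by (rule torus.square_integrable_imp_integrable) (use assms in \<open>simp_all add: borel_measurable_torus\<close>)

lemma integrable_mult_bounded:
  fixes f :: "plane \<Rightarrow> 'b::{real_normed_field, banach, second_countable_topology}"
  assumes f: "integrable torus_measure f" and w: "w \<in> borel_measurable borel" "\<And>x. norm (w x) \<le> B"
  shows "integrable torus_measure (\<lambda>x. f x * w x)"
proof (rule Bochner_Integration.integrable_bound)
  show "integrable torus_measure (\<lambda>x. B * norm (f x))" using f by simp
  have "norm (f x * w x) \<le> norm (B * norm (f x))" for x
  proof -
    have "norm (f x) * norm (w x) \<le> norm (f x) * B" by (intro mult_left_mono w) simp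
    moreover have "0 \<le> B" using order_trans[OF norm_ge_zero w(2)] .
    ultimately show ?thesis by (simp add: norm_mult abs_mult mult.commute)
  qed
  then show "AE x in torus_measure. norm (f x * w x) \<le> norm (B * norm (f x))" by simp
  show "(\<lambda>x. f x * w x) \<in> borel_measurable torus_measure"
    using f w(1) by (auto simp: borel_measurable_torus)
qed

text \<open>Completing the square in each coefficient. The first two terms on the right do not
  depend on \<open>c\<close>, so the Fourier coefficients give the best approximation with
  frequencies in \<open>A\<close>; taking them as \<open>c\<close> gives the exact error.\<close>

lemma pythagoras_trig:
  fixes f :: "plane \<Rightarrow> real"
  assumes f [measurable]: "f \<in> borel_measurable borel" and f2: "integrable torus_measure (\<lambda>x. (f x)\<^sup>2)"
    and A: "finite A"
  shows "(\<integral>x. (cmod (of_real (f x) - (\<Sum>k\<in>A. c k * fmode k x)))\<^sup>2 \<partial>torus_measure)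
    = (\<integral>x. (f x)\<^sup>2 \<partial>torus_measure) - (\<Sum>k\<in>A. (cmod (dist_of f k))\<^sup>2) + (\<Sum>k\<in>A. (cmod (c k - dist_of f k))\<^sup>2)"
proof -
  define p where "p x = (\<Sum>k\<in>A. c k * fmode k x)" for x
  have fi: "integrable torus_measure f"
    using f f2 by (rule torus_square_integrable_imp_integrable)
  then have fci: "integrable torus_measure (\<lambda>x. complex_of_real (f x))" by simp
  have im: "integrable torus_measure (\<lambda>x. complex_of_real (f x) * cnj (fmode k x))" for k
    by (rule integrable_mult_bounded[OF fci, where B=1]) (simp_all flip: fmode_uminus)
  have e1: "of_real (f x) * cnj (p x) = (\<Sum>k\<in>A. cnj (c k) * (of_real (f x) * cnj (fmode k x)))" for x
    by (simp add: p_def sum_distrib_left mult_ac)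
  have i1: "integrable torus_measure (\<lambda>x. of_real (f x) * cnj (p x))"
    unfolding e1 using im by simp
  have v1: "(\<integral>x. of_real (f x) * cnj (p x) \<partial>torus_measure) = (\<Sum>k\<in>A. cnj (c k) * dist_of f k)"
    unfolding e1 dist_of_def using im by (simp add: Bochner_Integration.integral_sum)
  have e2: "p x * cnj (p x) = (\<Sum>k\<in>A. \<Sum>l\<in>A. (c k * cnj (c l)) * fmode (k - l) x)" for x
    by (simp add: p_def sum_product fmode_diff mult_ac)
  have i2: "integrable torus_measure (\<lambda>x. p x * cnj (p x))"
    unfolding e2 by simp
  have "(\<integral>x. p x * cnj (p x) \<partial>torus_measure) = (\<Sum>k\<in>A. \<Sum>l\<in>A. (c k * cnj (c l)) * (if k = l then 1 else 0))"
    unfolding e2 by (simp add: Bochner_Integration.integral_sum integral_fmode)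
  then have v2: "(\<integral>x. p x * cnj (p x) \<partial>torus_measure) = (\<Sum>k\<in>A. c k * cnj (c k))"
    using A by (simp add: if_distrib cong: if_cong)
  have "of_real (\<integral>x. (cmod (of_real (f x) - p x))\<^sup>2 \<partial>torus_measure)
      = (\<integral>x. of_real ((f x)\<^sup>2) - of_real (f x) * cnj (p x) - cnj (of_real (f x) * cnj (p x)) + p x * cnj (p x) \<partial>torus_measure)"
    unfolding integral_complex_of_real[symmetric]
    by (rule Bochner_Integration.integral_cong, simp, unfold complex_norm_square)
      (simp add: algebra_simps power2_eq_square)
  also have "\<dots> = of_real (\<integral>x. (f x)\<^sup>2 \<partial>torus_measure) - (\<Sum>k\<in>A. cnj (c k) * dist_of f k)
      - cnj (\<Sum>k\<in>A. cnj (c k) * dist_of f k) + (\<Sum>k\<in>A. c k * cnj (c k))"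
  proof -
    have "integrable torus_measure (\<lambda>x. complex_of_real ((f x)\<^sup>2))" using f2 by (simp only: integrable_of_real)
    moreover have "integrable torus_measure (\<lambda>x. cnj (of_real (f x) * cnj (p x)))"
      using i1 by (simp only: integrable_cnj)
    ultimately show ?thesis
      using i1 i2 by (simp only: Bochner_Integration.integral_add Bochner_Integration.integral_diff
          Bochner_Integration.integrable_add Bochner_Integration.integrable_diff v1 v2
          Bochner_Integration.integral_cnj integral_complex_of_real)
  qed
  also have "\<dots> = of_real ((\<integral>x. (f x)\<^sup>2 \<partial>torus_measure) - (\<Sum>k\<in>A. (cmod (dist_of f k))\<^sup>2)
      + (\<Sum>k\<in>A. (cmod (c k - dist_of f k))\<^sup>2))"
    unfolding of_real_add of_real_diff of_real_sum complex_norm_square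
    by (simp add: sum_subtractf sum.distrib algebra_simps)
  finally show ?thesis
    unfolding p_def of_real_eq_iff .
qed

text \<open>Boxes are symmetric under negation, which keeps partial sums with Hermitian coefficients
  real, and they exhaust all frequencies.\<close>

definition freq_box :: "nat \<Rightarrow> (int \<times> int) set" where
  "freq_box m = {- int m..int m} \<times> {- int m..int m}"

definition fourier_partial :: "nat \<Rightarrow> torus_distribution \<Rightarrow> plane \<Rightarrow> real" where
  "fourier_partial m a x = Re (\<Sum>k\<in>freq_box m. a k * fmode k x)"

lemma finite_freq_box [simp]: "finite (freq_box m)"
  by (simp add: freq_box_def)

lemma uminus_image_freq_box: "uminus ` freq_box m = freq_box m"
proof -
  have neg: "- k \<in> freq_box m" if "k \<in> freq_box m" for k
    using that by (cases k) (auto simp: freq_box_def)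
  show ?thesis
  proof
    show "uminus ` freq_box m \<subseteq> freq_box m" using neg by blast
    show "freq_box m \<subseteq> uminus ` freq_box m" using neg by (metis image_eqI minus_minus subsetI)
  qed
qed

lemma hermitian_sum_real:
  assumes "\<And>k. a (- k) = cnj (a k)" "uminus ` A = A"
  shows "of_real (Re (\<Sum>k\<in>A. a k * fmode k x)) = (\<Sum>k\<in>A. a k * fmode k x)"
proof -
  have "(\<Sum>k\<in>A. a k * fmode k x) = (\<Sum>k\<in>uminus ` A. a k * fmode k x)"
    by (simp add: assms(2))
  also have "\<dots> = cnj (\<Sum>k\<in>A. a k * fmode k x)"
    by (subst sum.reindex) (auto simp: assms(1) fmode_uminus)
  finally show ?thesis
    by (metis Reals_cnj_iff of_real_Re)
qed

theorem fourier_L2: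
  fixes f :: "plane \<Rightarrow> real"
  assumes f: "f \<in> borel_measurable borel" and f2: "integrable torus_measure (\<lambda>x. (f x)\<^sup>2)"
  shows "(\<lambda>m. \<integral>x. (f x - fourier_partial m (dist_of f) x)\<^sup>2 \<partial>torus_measure) \<longlonglongrightarrow> 0"
proof (rule LIMSEQ_I)
  fix e :: real assume "0 < e"
  then obtain p where p: "trig_poly p" "(\<integral>x. (cmod (of_real (f x) - p x))\<^sup>2 \<partial>torus_measure) < e"
    using trig_dense_L2[OF f f2] unfolding trig_dense_def by blast
  then obtain A c where A: "finite A" and p_eq: "p = (\<lambda>x. \<Sum>k\<in>A. c k * fmode k x)"
    unfolding trig_poly_def by blast
  obtain m0 where m0: "A \<subseteq> freq_box m0"
  proof -
    have "\<forall>k\<in>A. \<bar>fst k\<bar> \<le> (\<Sum>k\<in>A. \<bar>fst k\<bar> + \<bar>snd k\<bar>) \<and> \<bar>snd k\<bar> \<le> (\<Sum>k\<in>A. \<bar>fst k\<bar> + \<bar>snd k\<bar>)"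
      using member_le_sum[of _ A "\<lambda>k. \<bar>fst k\<bar> + \<bar>snd k\<bar>"] A by fastforce
    then have "A \<subseteq> freq_box (nat (\<Sum>k\<in>A. \<bar>fst k\<bar> + \<bar>snd k\<bar>))"
      by (force simp: freq_box_def)
    then show thesis by (rule that)
  qed
  have "norm ((\<integral>x. (f x - fourier_partial m (dist_of f) x)\<^sup>2 \<partial>torus_measure) - 0) < e" if "m \<ge> m0" for m
  proof -
    have sub: "A \<subseteq> freq_box m" using m0 that by (auto simp: freq_box_def)
    have "(f x - fourier_partial m (dist_of f) x)\<^sup>2 = (cmod (of_real (f x) - (\<Sum>k\<in>freq_box m. dist_of f k * fmode k x)))\<^sup>2" for x
    proof -
      have "of_real (fourier_partial m (dist_of f) x) = (\<Sum>k\<in>freq_box m. dist_of f k * fmode k x)"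
        unfolding fourier_partial_def by (rule hermitian_sum_real) (simp_all add: dist_of_uminus uminus_image_freq_box)
      then have "of_real (f x) - (\<Sum>k\<in>freq_box m. dist_of f k * fmode k x) = of_real (f x - fourier_partial m (dist_of f) x)"
        by simp
      then show ?thesis by (simp only: norm_of_real power2_abs)
    qed
    then have "(\<integral>x. (f x - fourier_partial m (dist_of f) x)\<^sup>2 \<partial>torus_measure)
        = (\<integral>x. (f x)\<^sup>2 \<partial>torus_measure) - (\<Sum>k\<in>freq_box m. (cmod (dist_of f k))\<^sup>2)"
      using pythagoras_trig[OF f f2 finite_freq_box, where c="dist_of f"] by simp
    \<comment> \<open>Comparison with the approximating polynomial \<open>p\<close>, whose
      coefficients are extended by 0 to the whole box.\<close>
    also have "\<dots> \<le> (\<integral>x. (f x)\<^sup>2 \<partial>torus_measure) - (\<Sum>k\<in>freq_box m. (cmod (dist_of f k))\<^sup>2)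
        + (\<Sum>k\<in>freq_box m. (cmod ((if k \<in> A then c k else 0) - dist_of f k))\<^sup>2)"
      by (simp add: sum_nonneg)
    also have "\<dots> = (\<integral>x. (cmod (of_real (f x) - (\<Sum>k\<in>freq_box m. (if k \<in> A then c k else 0) * fmode k x)))\<^sup>2 \<partial>torus_measure)"
      using pythagoras_trig[OF f f2 finite_freq_box, where c="\<lambda>k. if k \<in> A then c k else 0"] by simp
    also have "\<dots> = (\<integral>x. (cmod (of_real (f x) - p x))\<^sup>2 \<partial>torus_measure)"
    proof -
      have "(\<Sum>k\<in>freq_box m. (if k \<in> A then c k else 0) * fmode k x) = p x" for x
        unfolding p_eq by (rule sum.mono_neutral_cong_right) (use sub in auto)
      then show ?thesis by simp
    qed
    finally have "(\<integral>x. (f x - fourier_partial m (dist_of f) x)\<^sup>2 \<partial>torus_measure) < e"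
      using p(2) by simp
    then show ?thesis by simp
  qed
  then show "\<exists>no. \<forall>m\<ge>no. norm ((\<integral>x. (f x - fourier_partial m (dist_of f) x)\<^sup>2 \<partial>torus_measure) - 0) < e"
    by blast
qed

section \<open>Square-integrable functions and weak gradients\<close>

text \<open>Square integrability over the cell for real functions, kept apart from the periodicity
  that \<open>torus_L2\<close> includes.\<close>

definition sqint :: "(plane \<Rightarrow> real) \<Rightarrow> bool" where
  "sqint f \<longleftrightarrow> f \<in> borel_measurable borel \<and> integrable torus_measure (\<lambda>x. (f x)\<^sup>2)"

definition L2norm :: "(plane \<Rightarrow> real) \<Rightarrow> real" where
  "L2norm f = sqrt (\<integral>x. (f x)\<^sup>2 \<partial>torus_measure)"

lemma sqint_measurable [measurable_dest]: "sqint f \<Longrightarrow> f \<in> borel_measurable borel"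
  by (simp add: sqint_def)

lemma sqint_integrable_square: "sqint f \<Longrightarrow> integrable torus_measure (\<lambda>x. (f x)\<^sup>2)"
  by (simp add: sqint_def)

lemma sqint_integrable: "sqint f \<Longrightarrow> integrable torus_measure f"
  unfolding sqint_def by (elim conjE) (rule torus_square_integrable_imp_integrable)

lemma L2norm_nonneg [simp]: "0 \<le> L2norm f"
  by (simp add: L2norm_def)

lemma L2norm_square: "(L2norm f)\<^sup>2 = (\<integral>x. (f x)\<^sup>2 \<partial>torus_measure)"
  by (simp add: L2norm_def)

lemma sqint_bounded:
  assumes "f \<in> borel_measurable borel" "\<And>x. \<bar>f x\<bar> \<le> B"
  shows "sqint f"
proof -
  have "(f x)\<^sup>2 \<le> B\<^sup>2" for x
    using power_mono[OF assms(2)[of x], of 2] by simp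
  then show ?thesis
    unfolding sqint_def using assms(1) by (auto intro!: integrable_torus_bounded[of _ "B\<^sup>2"])
qed

lemma integrable_prod_sqint:
  assumes "sqint f" "sqint g"
  shows "integrable torus_measure (\<lambda>x. f x * g x)"
proof (rule Bochner_Integration.integrable_bound)
  show "integrable torus_measure (\<lambda>x. (f x)\<^sup>2 + (g x)\<^sup>2)"
    using assms by (simp add: sqint_def)
  have "\<bar>f x * g x\<bar> \<le> (f x)\<^sup>2 + (g x)\<^sup>2" for x
    using zero_le_power2[of "\<bar>f x\<bar> - \<bar>g x\<bar>"] zero_le_power2[of "f x"] zero_le_power2[of "g x"]
    unfolding power2_diff power2_abs abs_mult by (simp add: mult.assoc) (smt (verit) zero_le_mult_iff abs_ge_zero)
  then show "AE x in torus_measure. norm (f x * g x) \<le> norm ((f x)\<^sup>2 + (g x)\<^sup>2)"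
    by simp
qed (use assms in \<open>auto simp: sqint_def borel_measurable_torus\<close>)

lemma sqint_add:
  assumes "sqint f" "sqint g"
  shows "sqint (\<lambda>x. f x + g x)"
  using assms integrable_prod_sqint[OF assms] unfolding sqint_def power2_sum
  by (auto simp: mult.assoc)

lemma sqint_mult_bounded:
  assumes "sqint f" and w [measurable]: "w \<in> borel_measurable borel" and "\<And>x. \<bar>w x\<bar> \<le> B"
  shows "sqint (\<lambda>x. f x * w x)"
proof -
  have "\<bar>(w x)\<^sup>2\<bar> \<le> B\<^sup>2" for x
    using power_mono[OF assms(3)[of x], of 2] by simp
  then show ?thesis
    using assms integrable_mult_bounded[of "\<lambda>x. (f x)\<^sup>2" "\<lambda>x. (w x)\<^sup>2" "B\<^sup>2"]
    unfolding sqint_def by (auto simp: power_mult_distrib)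
qed

lemma sqint_cmult: "sqint f \<Longrightarrow> sqint (\<lambda>x. c * f x)"
  using sqint_mult_bounded[of f "\<lambda>_. c" "\<bar>c\<bar>"] by (simp add: mult.commute)

lemma sqint_diff:
  assumes "sqint f" "sqint g"
  shows "sqint (\<lambda>x. f x - g x)"
  using sqint_add[OF assms(1) sqint_cmult[OF assms(2), of "-1"]] by simp

lemma Cauchy_Schwarz_torus:
  assumes f: "sqint f" and g: "sqint g"
  shows "(\<integral>x. \<bar>f x * g x\<bar> \<partial>torus_measure) \<le> L2norm f * L2norm g"
proof -
  let ?a = "L2norm f" and ?b = "L2norm g"
  have bound: "(\<integral>x. \<bar>f x * g x\<bar> \<partial>torus_measure) \<le> (?a + e) * (?b + e)" if "e > 0" for e
  proof -
    \<comment> \<open>Weighted Young inequality with weights formed from \<open>q / p\<close> and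
      \<open>p / q\<close>. Enlarging both norms by \<open>e\<close> keeps the quotients meaningful
      when a norm vanishes; \<open>e\<close> is sent to 0 at the end.\<close>
    define p q where "p = ?a + e" and "q = ?b + e"
    have pq: "p > 0" "q > 0" using that unfolding p_def q_def by (auto intro: add_nonneg_pos)
    have "(\<integral>x. \<bar>f x * g x\<bar> \<partial>torus_measure)
      \<le> (\<integral>x. (q / (2 * p)) * (f x)\<^sup>2 + (p / (2 * q)) * (g x)\<^sup>2 \<partial>torus_measure)"
    proof (rule integral_mono)
      show "integrable torus_measure (\<lambda>x. \<bar>f x * g x\<bar>)"
        using integrable_prod_sqint[OF f g] by simp
      show "integrable torus_measure (\<lambda>x. (q / (2 * p)) * (f x)\<^sup>2 + (p / (2 * q)) * (g x)\<^sup>2)"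
        using f g by (simp add: sqint_def)
      fix x
      have "0 \<le> (q * \<bar>f x\<bar> - p * \<bar>g x\<bar>)\<^sup>2" by simp
      then have "2 * p * q * \<bar>f x * g x\<bar> \<le> q\<^sup>2 * (f x)\<^sup>2 + p\<^sup>2 * (g x)\<^sup>2"
        unfolding power2_diff power_mult_distrib power2_abs by (simp add: abs_mult mult_ac)
      then show "\<bar>f x * g x\<bar> \<le> (q / (2 * p)) * (f x)\<^sup>2 + (p / (2 * q)) * (g x)\<^sup>2"
        using pq by (simp add: field_simps power2_eq_square)
    qed
    also have "\<dots> = (q / (2 * p)) * ?a\<^sup>2 + (p / (2 * q)) * ?b\<^sup>2"
      using f g by (simp add: L2norm_square sqint_def)
    also have "\<dots> \<le> (q / (2 * p)) * p\<^sup>2 + (p / (2 * q)) * q\<^sup>2"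
      using pq that by (intro add_mono mult_left_mono power_mono) (auto simp: p_def q_def)
    also have "\<dots> = p * q"
      using pq by (simp add: field_simps power2_eq_square)
    finally show ?thesis by (simp add: p_def q_def)
  qed
  have lim: "((\<lambda>e. (?a + e) * (?b + e)) \<longlongrightarrow> (?a + 0) * (?b + 0)) (at_right 0)"
    by (intro tendsto_intros)
  have ev: "\<forall>\<^sub>F e in at_right 0. (\<integral>x. \<bar>f x * g x\<bar> \<partial>torus_measure) \<le> (?a + e) * (?b + e)"
    using bound by (auto simp: eventually_at_right_less intro: eventually_mono[OF eventually_at_right_less])
  show ?thesis
    using tendsto_lowerbound[OF lim ev] by simp
qed

lemma abs_integral_prod_le:
  assumes f: "sqint f" and g: "sqint g" and w: "w \<in> borel_measurable borel" "\<And>x. \<bar>w x\<bar> \<le> B"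
  shows "\<bar>\<integral>x. f x * g x * w x \<partial>torus_measure\<bar> \<le> B * (L2norm f * L2norm g)"
proof -
  have "B \<ge> 0" using w(2)[of 0] by linarith
  have "\<bar>\<integral>x. f x * g x * w x \<partial>torus_measure\<bar> \<le> (\<integral>x. \<bar>f x * g x * w x\<bar> \<partial>torus_measure)"
    by (rule integral_abs_bound)
  also have "\<dots> \<le> (\<integral>x. B * \<bar>f x * g x\<bar> \<partial>torus_measure)"
  proof (rule integral_mono')
    show "\<bar>f x * g x * w x\<bar> \<le> B * \<bar>f x * g x\<bar>" for x
      using mult_left_mono[OF w(2)[of x], of "\<bar>f x * g x\<bar>"] by (simp add: abs_mult mult_ac)
  qed (use integrable_prod_sqint[OF f g] \<open>B \<ge> 0\<close> in simp_all)
  also have "\<dots> \<le> B * (L2norm f * L2norm g)"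
    using Cauchy_Schwarz_torus[OF f g] \<open>B \<ge> 0\<close> by (simp add: mult_left_mono)
  finally show ?thesis .
qed

definition L2lim :: "(nat \<Rightarrow> plane \<Rightarrow> real) \<Rightarrow> (plane \<Rightarrow> real) \<Rightarrow> bool" where
  "L2lim F f \<longleftrightarrow> sqint f \<and> (\<forall>m. sqint (F m)) \<and> (\<lambda>m. L2norm (\<lambda>x. F m x - f x)) \<longlonglongrightarrow> 0"

text \<open>The difference of the products splits into a term with both errors and two terms with
  one error each. With this device identities for trigonometric polynomials are carried over to
  H1.\<close>

lemma L2lim_bilinear:
  assumes F: "L2lim F f" and G: "L2lim G g" and w: "w \<in> borel_measurable borel" "\<And>x. \<bar>w x\<bar> \<le> B"
  shows "(\<lambda>m. \<integral>x. F m x * G m x * w x \<partial>torus_measure) \<longlonglongrightarrow> (\<integral>x. f x * g x * w x \<partial>torus_measure)"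
proof (rule LIM_zero_cancel, rule Lim_null_comparison)
  have s: "sqint f" "sqint g" "\<And>m. sqint (F m)" "\<And>m. sqint (G m)"
    using F G by (auto simp: L2lim_def)
  have tri: "integrable torus_measure (\<lambda>x. a x * b x * w x)" if "sqint a" "sqint b" for a b
    by (rule integrable_mult_bounded[OF integrable_prod_sqint[OF that] w(1), of B]) (simp add: w)
  have "\<bar>(\<integral>x. F m x * G m x * w x \<partial>torus_measure) - (\<integral>x. f x * g x * w x \<partial>torus_measure)\<bar>
     \<le> B * (L2norm (\<lambda>x. F m x - f x) * L2norm (\<lambda>x. G m x - g x))
       + B * (L2norm (\<lambda>x. F m x - f x) * L2norm g) + B * (L2norm f * L2norm (\<lambda>x. G m x - g x))" for m
  proof -
    note d = sqint_diff[OF s(3) s(1), of m] sqint_diff[OF s(4) s(2), of m]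
    have "(\<integral>x. F m x * G m x * w x \<partial>torus_measure) - (\<integral>x. f x * g x * w x \<partial>torus_measure)
       = (\<integral>x. ((F m x - f x) * (G m x - g x) * w x + (F m x - f x) * g x * w x) + f x * (G m x - g x) * w x \<partial>torus_measure)"
      using tri[OF s(3) s(4)] tri[OF s(1) s(2)]
      by (subst Bochner_Integration.integral_diff[symmetric])
         (auto intro!: Bochner_Integration.integral_cong simp: algebra_simps)
    also have "\<dots> = (\<integral>x. (F m x - f x) * (G m x - g x) * w x \<partial>torus_measure)
        + (\<integral>x. (F m x - f x) * g x * w x \<partial>torus_measure) + (\<integral>x. f x * (G m x - g x) * w x \<partial>torus_measure)"
      by (subst Bochner_Integration.integral_add Bochner_Integration.integral_add,
          auto intro!: tri d s Bochner_Integration.integrable_add)+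
    finally show ?thesis
      using abs_integral_prod_le[OF d w] abs_integral_prod_le[OF d(1) s(2) w] abs_integral_prod_le[OF s(1) d(2) w]
      by linarith
  qed
  then show "\<forall>\<^sub>F m in sequentially. norm ((\<integral>x. F m x * G m x * w x \<partial>torus_measure) - (\<integral>x. f x * g x * w x \<partial>torus_measure))
     \<le> B * (L2norm (\<lambda>x. F m x - f x) * L2norm (\<lambda>x. G m x - g x))
       + B * (L2norm (\<lambda>x. F m x - f x) * L2norm g) + B * (L2norm f * L2norm (\<lambda>x. G m x - g x))"
    by simp
  have "(\<lambda>m. B * (L2norm (\<lambda>x. F m x - f x) * L2norm (\<lambda>x. G m x - g x))
       + B * (L2norm (\<lambda>x. F m x - f x) * L2norm g) + B * (L2norm f * L2norm (\<lambda>x. G m x - g x)))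
     \<longlonglongrightarrow> B * (0 * 0) + B * (0 * L2norm g) + B * (L2norm f * 0)"
    using F G unfolding L2lim_def by (intro tendsto_intros) auto
  then show "(\<lambda>m. B * (L2norm (\<lambda>x. F m x - f x) * L2norm (\<lambda>x. G m x - g x))
       + B * (L2norm (\<lambda>x. F m x - f x) * L2norm g) + B * (L2norm f * L2norm (\<lambda>x. G m x - g x)))
     \<longlonglongrightarrow> 0" by simp
qed

lemma continuous_on_fourier_partial [continuous_intros]: "continuous_on A (fourier_partial m a)"
  unfolding fourier_partial_def by (intro continuous_intros)

lemma fourier_partial_measurable [measurable]: "fourier_partial m a \<in> borel_measurable borel"
  by (intro borel_measurable_continuous_onI continuous_intros)

lemma torus_periodic_fourier_partial: "torus_periodic (fourier_partial m a)"
  using torus_periodic_fmode unfolding torus_periodic_def fourier_partial_def by simp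

lemma sqint_fourier_partial: "sqint (fourier_partial m a)"
proof (rule sqint_bounded)
  show "\<bar>fourier_partial m a x\<bar> \<le> (\<Sum>k\<in>freq_box m. cmod (a k))" for x
    unfolding fourier_partial_def
    by (rule order_trans[OF abs_Re_le_cmod order_trans[OF norm_sum]]) (simp add: norm_mult)
qed measurable

lemma L2lim_fourier_partial:
  assumes "sqint f"
  shows "L2lim (\<lambda>m. fourier_partial m (dist_of f)) f"
proof -
  have "(\<lambda>m. sqrt (\<integral>x. (f x - fourier_partial m (dist_of f) x)\<^sup>2 \<partial>torus_measure)) \<longlonglongrightarrow> sqrt 0"
    using assms by (intro tendsto_real_sqrt fourier_L2) (auto simp: sqint_def)
  then show ?thesis
    using assms unfolding L2lim_def L2norm_def by (simp add: sqint_fourier_partial power2_commute)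
qed

text \<open>By the Pythagorean identity the defect in this limit is the mean-square error of the
  partial sums, which tends to 0.\<close>

theorem parseval:
  assumes "sqint f"
  shows "(\<lambda>m. \<Sum>k\<in>freq_box m. (cmod (dist_of f k))\<^sup>2) \<longlonglongrightarrow> (\<integral>x. (f x)\<^sup>2 \<partial>torus_measure)"
proof -
  have f: "f \<in> borel_measurable borel" "integrable torus_measure (\<lambda>x. (f x)\<^sup>2)"
    using assms by (auto simp: sqint_def)
  have "(f x - fourier_partial m (dist_of f) x)\<^sup>2 = (cmod (of_real (f x) - (\<Sum>k\<in>freq_box m. dist_of f k * fmode k x)))\<^sup>2" for x m
  proof -
    have "of_real (fourier_partial m (dist_of f) x) = (\<Sum>k\<in>freq_box m. dist_of f k * fmode k x)"
      unfolding fourier_partial_def by (rule hermitian_sum_real) (simp_all add: dist_of_uminus uminus_image_freq_box)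
    then have "of_real (f x) - (\<Sum>k\<in>freq_box m. dist_of f k * fmode k x) = of_real (f x - fourier_partial m (dist_of f) x)"
      by simp
    then show ?thesis by (simp only: norm_of_real power2_abs)
  qed
  then have "(\<integral>x. (f x - fourier_partial m (dist_of f) x)\<^sup>2 \<partial>torus_measure)
      = (\<integral>x. (f x)\<^sup>2 \<partial>torus_measure) - (\<Sum>k\<in>freq_box m. (cmod (dist_of f k))\<^sup>2)" for m
    using pythagoras_trig[OF f finite_freq_box, where c="dist_of f"] by simp
  then have "(\<lambda>m. (\<integral>x. (f x)\<^sup>2 \<partial>torus_measure) - (\<Sum>k\<in>freq_box m. (cmod (dist_of f k))\<^sup>2)) \<longlonglongrightarrow> 0"
    using fourier_L2[OF f] by simp
  then have "(\<lambda>m. (\<integral>x. (f x)\<^sup>2 \<partial>torus_measure) - ((\<integral>x. (f x)\<^sup>2 \<partial>torus_measure) - (\<Sum>k\<in>freq_box m. (cmod (dist_of f k))\<^sup>2)))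
     \<longlonglongrightarrow> (\<integral>x. (f x)\<^sup>2 \<partial>torus_measure) - 0"
    by (intro tendsto_intros)
  then show ?thesis by simp
qed

lemma sqint_eq_0_AE:
  assumes "sqint f" "(\<integral>x. (f x)\<^sup>2 \<partial>torus_measure) = 0"
  shows "AE x in torus_measure. f x = 0"
  using assms integral_nonneg_eq_0_iff_AE[of torus_measure "\<lambda>x. (f x)\<^sup>2"]
  by (simp add: sqint_def)

lemma dist_of_zero_AE:
  assumes "sqint f" "\<And>k. dist_of f k = 0"
  shows "AE x in torus_measure. f x = 0"
proof (rule sqint_eq_0_AE[OF assms(1)])
  show "(\<integral>x. (f x)\<^sup>2 \<partial>torus_measure) = 0"
    using parseval[OF assms(1)] unfolding assms(2) by (simp add: LIMSEQ_const_iff)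
qed

section \<open>Weak gradients in terms of Fourier coefficients\<close>

lemma gradient_eqI:
  assumes "GDERIV f x :> D"
  shows "gradient f x = D"
  unfolding gradient_def
proof (rule the_equality)
  show "GDERIV f x :> D" by (rule assms)
  fix E assume "GDERIV f x :> E"
  then have "(\<lambda>h. h \<bullet> E) = (\<lambda>h. h \<bullet> D)"
    using assms unfolding gderiv_def by (rule has_derivative_unique)
  then show "E = D"
    by (metis inner_commute vector_eq_rdot)
qed

lemma GDERIV_cos_freq: "GDERIV (\<lambda>x. a * cos (freq k \<bullet> x) + b * sin (freq k \<bullet> x)) x
    :> (b * cos (freq k \<bullet> x) - a * sin (freq k \<bullet> x)) *\<^sub>R freq k"
  unfolding gderiv_def
  by (rule derivative_eq_intros refl)+ (auto simp: algebra_simps inner_commute)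

lemma smooth_cos_freq: "smooth_function (\<lambda>x. a * cos (freq k \<bullet> x) + b * sin (freq k \<bullet> x))"
proof -
  have "C_class n (\<lambda>x. a * cos (freq k \<bullet> x) + b * sin (freq k \<bullet> x))" for n
  proof (induction n arbitrary: a b)
    case 0
    show ?case by (simp, intro continuous_intros)
  next
    case (Suc n)
    \<comment> \<open>The family is closed under partial derivatives, with new amplitudes; this is
      why the induction leaves \<open>a\<close> and \<open>b\<close> arbitrary.\<close>
    have "(\<lambda>x. gradient (\<lambda>x. a * cos (freq k \<bullet> x) + b * sin (freq k \<bullet> x)) x \<bullet> e)
       = (\<lambda>x. (b * (freq k \<bullet> e)) * cos (freq k \<bullet> x) + (- a * (freq k \<bullet> e)) * sin (freq k \<bullet> x))" for e
      by (auto simp: gradient_eqI[OF GDERIV_cos_freq] algebra_simps)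
    moreover have "(\<lambda>x. a * cos (freq k \<bullet> x) + b * sin (freq k \<bullet> x)) differentiable (at x)" for x
      using GDERIV_cos_freq[of a k b x] unfolding gderiv_def differentiable_def by blast
    ultimately show ?case
      using Suc by (simp only: C_class.simps) blast
  qed
  then show ?thesis by (simp add: smooth_function_def)
qed

definition dx1 :: "torus_distribution \<Rightarrow> torus_distribution" where
  "dx1 a k = \<i> * of_int (fst k) * a k"

definition dx2 :: "torus_distribution \<Rightarrow> torus_distribution" where
  "dx2 a k = \<i> * of_int (snd k) * a k"

lemma torus_L2_sqint:
  fixes g :: "plane \<Rightarrow> plane"
  assumes "torus_L2 g"
  shows "sqint (\<lambda>x. fst (g x))" "sqint (\<lambda>x. snd (g x))"
proof -
  have [measurable]: "g \<in> borel_measurable borel" using assms by (simp add: torus_L2_def)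
  then have m: "(\<lambda>x. fst (g x)) \<in> borel_measurable borel" "(\<lambda>x. snd (g x)) \<in> borel_measurable borel"
    by (auto intro!: borel_measurable_continuous_on[where f=fst] borel_measurable_continuous_on[where f=snd] continuous_intros)
  have i: "integrable torus_measure (\<lambda>x. (norm (g x))\<^sup>2)" using assms by (simp add: torus_L2_def)
  have le: "(fst (g x))\<^sup>2 \<le> (norm (g x))\<^sup>2" "(snd (g x))\<^sup>2 \<le> (norm (g x))\<^sup>2" for x
    by (simp_all add: norm_prod_def)
  show "sqint (\<lambda>x. fst (g x))" "sqint (\<lambda>x. snd (g x))"
    unfolding sqint_def using m le
    by (auto intro!: Bochner_Integration.integrable_bound[OF i] simp: borel_measurable_torus)
qed

lemma torus_L2_real_sqint: "torus_L2 (v :: plane \<Rightarrow> real) \<Longrightarrow> sqint v"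
  by (simp add: torus_L2_def sqint_def)

lemma Re_Im_dist_of:
  assumes "sqint f"
  shows "Re (dist_of f k) = (\<integral>x. f x * cos (freq k \<bullet> x) \<partial>torus_measure)"
    and "Im (dist_of f k) = - (\<integral>x. f x * sin (freq k \<bullet> x) \<partial>torus_measure)"
proof -
  have "integrable torus_measure (\<lambda>x. complex_of_real (f x))" using sqint_integrable[OF assms] by simp
  then have i: "integrable torus_measure (\<lambda>x. complex_of_real (f x) * cnj (fmode k x))"
    by (rule integrable_mult_bounded[where B=1]) (simp_all flip: fmode_uminus)
  show "Re (dist_of f k) = (\<integral>x. f x * cos (freq k \<bullet> x) \<partial>torus_measure)"
    unfolding dist_of_def integral_Re[OF i, symmetric] by (simp add: fmode_def)
  have "Im (dist_of f k) = (\<integral>x. - (f x * sin (freq k \<bullet> x)) \<partial>torus_measure)"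
    unfolding dist_of_def integral_Im[OF i, symmetric] by (simp add: fmode_def)
  then show "Im (dist_of f k) = - (\<integral>x. f x * sin (freq k \<bullet> x) \<partial>torus_measure)"
    by simp
qed

text \<open>Cosines and sines are admissible test functions, so the defining identity of a weak
  gradient fixes all its Fourier coefficients. From here on the gradient of \<open>v\<close> is
  accessible through the coefficients of \<open>v\<close>, whichever version of it was
  chosen.\<close>

lemma dist_of_weak_gradient:
  assumes v: "sqint v" and g: "has_weak_gradient v g"
  shows "dist_of (\<lambda>x. fst (g x)) = dx1 (dist_of v)" "dist_of (\<lambda>x. snd (g x)) = dx2 (dist_of v)"
proof -
  have gL: "torus_L2 g" using g by (simp add: has_weak_gradient_def)
  note gs = torus_L2_sqint[OF gL]
  have "integrable torus_measure (\<lambda>x. (fst (g x), 0::real))" "integrable torus_measure (\<lambda>x. (0::real, snd (g x)))"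
    using integrable_bounded_linear[OF bounded_linear_Pair[OF bounded_linear_ident bounded_linear_zero] sqint_integrable[OF gs(1)]]
      integrable_bounded_linear[OF bounded_linear_Pair[OF bounded_linear_zero bounded_linear_ident] sqint_integrable[OF gs(2)]]
    by simp_all
  then have ig: "integrable torus_measure g"
    using Bochner_Integration.integrable_add[of torus_measure "\<lambda>x. (fst (g x), 0)" "\<lambda>x. (0, snd (g x))"] by simp
  have bl: "(\<integral>x. w x *\<^sub>R g x \<partial>torus_measure) = ((\<integral>x. fst (g x) * w x \<partial>torus_measure), (\<integral>x. snd (g x) * w x \<partial>torus_measure))"
    if [measurable]: "w \<in> borel_measurable borel" and "\<And>x. \<bar>w x\<bar> \<le> 1" for w :: "plane \<Rightarrow> real"
  proof -
    have i: "integrable torus_measure (\<lambda>x. w x *\<^sub>R g x)"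
    proof (rule Bochner_Integration.integrable_bound[OF ig])
      show "AE x in torus_measure. norm (w x *\<^sub>R g x) \<le> norm (g x)"
        using that(2) by (simp add: mult_left_le_one_le)
      show "(\<lambda>x. w x *\<^sub>R g x) \<in> borel_measurable torus_measure"
        using gL by (auto simp: borel_measurable_torus torus_L2_def)
    qed
    show ?thesis
      using integral_bounded_linear[OF bounded_linear_fst i] integral_bounded_linear[OF bounded_linear_snd i]
      by (simp add: prod_eq_iff mult.commute)
  qed
  have per: "torus_periodic (\<lambda>x. a * cos (freq k \<bullet> x) + b * sin (freq k \<bullet> x))" for a b k
    using torus_periodic_fmode[of k] by (simp add: torus_periodic_def fmode_def complex_eq_iff)
  have weak: "(\<integral>x. v x *\<^sub>R ((b * cos (freq k \<bullet> x) - a * sin (freq k \<bullet> x)) *\<^sub>R freq k) \<partial>torus_measure)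
      = - (\<integral>x. (a * cos (freq k \<bullet> x) + b * sin (freq k \<bullet> x)) *\<^sub>R g x \<partial>torus_measure)" for a b k
  proof -
    let ?\<eta> = "\<lambda>x. a * cos (freq k \<bullet> x) + b * sin (freq k \<bullet> x)"
    have "(\<integral>x. v x *\<^sub>R gradient ?\<eta> x \<partial>torus_measure) = - (\<integral>x. ?\<eta> x *\<^sub>R g x \<partial>torus_measure)"
      using g smooth_cos_freq[of a k b] per[of a k b] unfolding has_weak_gradient_def by blast
    then show ?thesis
      unfolding gradient_eqI[OF GDERIV_cos_freq] .
  qed
  have sc [measurable]: "(\<lambda>x. cos (freq k \<bullet> x)) \<in> borel_measurable borel" "(\<lambda>x. sin (freq k \<bullet> x)) \<in> borel_measurable borel" for k
    by (intro borel_measurable_continuous_onI continuous_intros)+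
  have scale: "(\<integral>x. (v x * w x) *\<^sub>R freq k \<partial>torus_measure) = (\<integral>x. v x * w x \<partial>torus_measure) *\<^sub>R freq k"
    if "w \<in> borel_measurable borel" and "\<And>x. \<bar>w x\<bar> \<le> 1" for w :: "plane \<Rightarrow> real" and k
    by (rule integral_scaleR_left, rule integrable_mult_bounded[OF sqint_integrable[OF v] that(1), of 1]) (simp add: that(2))
  have c: "(\<integral>x. fst (g x) * cos (freq k \<bullet> x) \<partial>torus_measure) = fst (freq k) * (\<integral>x. v x * sin (freq k \<bullet> x) \<partial>torus_measure)"
    "(\<integral>x. snd (g x) * cos (freq k \<bullet> x) \<partial>torus_measure) = snd (freq k) * (\<integral>x. v x * sin (freq k \<bullet> x) \<partial>torus_measure)" for k
    using weak[where a=1 and b=0 and k=k] bl[of "\<lambda>x. cos (freq k \<bullet> x)"]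
      scale[of "\<lambda>x. sin (freq k \<bullet> x)" k]
    by (simp_all add: prod_eq_iff mult.commute)
  have s: "(\<integral>x. fst (g x) * sin (freq k \<bullet> x) \<partial>torus_measure) = - fst (freq k) * (\<integral>x. v x * cos (freq k \<bullet> x) \<partial>torus_measure)"
    "(\<integral>x. snd (g x) * sin (freq k \<bullet> x) \<partial>torus_measure) = - snd (freq k) * (\<integral>x. v x * cos (freq k \<bullet> x) \<partial>torus_measure)" for k
    using weak[where a=0 and b=1 and k=k] bl[of "\<lambda>x. sin (freq k \<bullet> x)"]
      scale[of "\<lambda>x. cos (freq k \<bullet> x)" k]
    by (simp_all add: prod_eq_iff mult.commute)
  have fst_snd_freq: "fst (freq k) = of_int (fst k)" "snd (freq k) = of_int (snd k)" for k
    by (simp_all add: freq_def)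
  show "dist_of (\<lambda>x. fst (g x)) = dx1 (dist_of v)"
  proof
    fix k show "dist_of (\<lambda>x. fst (g x)) k = dx1 (dist_of v) k"
      by (simp add: complex_eq_iff dx1_def Re_Im_dist_of[OF gs(1)] Re_Im_dist_of[OF v] c s fst_snd_freq)
  qed
  show "dist_of (\<lambda>x. snd (g x)) = dx2 (dist_of v)"
  proof
    fix k show "dist_of (\<lambda>x. snd (g x)) k = dx2 (dist_of v) k"
      by (simp add: complex_eq_iff dx2_def Re_Im_dist_of[OF gs(2)] Re_Im_dist_of[OF v] c s fst_snd_freq)
  qed
qed

text \<open>Together with \<open>dist_of_weak_gradient\<close> this says that the partial sums of an
  H1 function have as classical gradient the partial sums of its weak gradient, so the function and
  its gradient are approximated in mean square at once.\<close>

lemma GDERIV_fourier_partial: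
  "GDERIV (fourier_partial m a) x :> (fourier_partial m (dx1 a) x, fourier_partial m (dx2 a) x)"
proof -
  have eq: "fourier_partial m a = (\<lambda>x. \<Sum>k\<in>freq_box m. Re (a k) * cos (freq k \<bullet> x) + (- Im (a k)) * sin (freq k \<bullet> x))"
    by (auto simp: fourier_partial_def fmode_def)
  have "GDERIV (\<lambda>x. \<Sum>k\<in>A. Re (a k) * cos (freq k \<bullet> x) + (- Im (a k)) * sin (freq k \<bullet> x)) x :>
      (\<Sum>k\<in>A. (- Im (a k) * cos (freq k \<bullet> x) - Re (a k) * sin (freq k \<bullet> x)) *\<^sub>R freq k)" if "finite A" for A
    using that
  proof (induction A)
    case (insert k A)
    show ?case
      unfolding sum.insert[OF insert.hyps]
      by (rule GDERIV_add[OF GDERIV_cos_freq insert.IH])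
  qed (simp add: GDERIV_const)
  from this[OF finite_freq_box[of m]]
  have "GDERIV (fourier_partial m a) x :> (\<Sum>k\<in>freq_box m. (- Im (a k) * cos (freq k \<bullet> x) - Re (a k) * sin (freq k \<bullet> x)) *\<^sub>R freq k)"
    unfolding eq .
  moreover have "(\<Sum>k\<in>freq_box m. (- Im (a k) * cos (freq k \<bullet> x) - Re (a k) * sin (freq k \<bullet> x)) *\<^sub>R freq k)
      = (fourier_partial m (dx1 a) x, fourier_partial m (dx2 a) x)"
    by (simp add: prod_eq_iff fst_sum snd_sum fourier_partial_def freq_def dx1_def dx2_def fmode_def algebra_simps)
  ultimately show ?thesis by simp
qed

lemma weak_gradient_props:
  assumes "v \<in> sobolev_H1"
  shows "has_weak_gradient v (weak_gradient v)" "sqint v" "torus_L2 (weak_gradient v)"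
    "sqint (\<lambda>x. fst (weak_gradient v x))" "sqint (\<lambda>x. snd (weak_gradient v x))" "torus_periodic v"
proof -
  show w: "has_weak_gradient v (weak_gradient v)"
    using someI_ex[of "has_weak_gradient v"] assms by (simp add: sobolev_H1_def weak_gradient_def)
  show "sqint v" "torus_periodic v" using assms by (simp_all add: sobolev_H1_def torus_L2_real_sqint torus_L2_periodic)
  show L: "torus_L2 (weak_gradient v)" using w by (simp add: has_weak_gradient_def)
  from torus_L2_sqint[OF this] show "sqint (\<lambda>x. fst (weak_gradient v x))" "sqint (\<lambda>x. snd (weak_gradient v x))" by auto
qed

text \<open>Equal Fourier coefficients force equality almost everywhere. Under an integral the
  chosen \<open>weak_gradient\<close> may therefore be replaced by any explicit one.\<close>

lemma weak_gradient_unique: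
  assumes v: "sqint v" and g: "has_weak_gradient v g" and h: "has_weak_gradient v h"
  shows "AE x in torus_measure. g x = h x"
proof -
  note gs = torus_L2_sqint[of g] and hs = torus_L2_sqint[of h]
  have L: "torus_L2 g" "torus_L2 h" using g h by (simp_all add: has_weak_gradient_def)
  have z: "AE x in torus_measure. a x - b x = 0" if "sqint a" "sqint b" "dist_of a = dist_of b" for a b
  proof (rule dist_of_zero_AE[OF sqint_diff[OF that(1,2)]])
    fix k
    have i: "integrable torus_measure (\<lambda>x. complex_of_real (f x) * cnj (fmode k x))" if "sqint f" for f
    proof -
      have "integrable torus_measure (\<lambda>x. complex_of_real (f x))" using sqint_integrable[OF that] by simp
      then show ?thesis
        by (rule integrable_mult_bounded[where B=1]) (simp_all flip: fmode_uminus)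
    qed
    show "dist_of (\<lambda>x. a x - b x) k = 0"
      using fun_cong[OF that(3), of k] i[OF that(1)] i[OF that(2)] unfolding dist_of_def
      by (simp add: algebra_simps)
  qed
  have "AE x in torus_measure. fst (g x) - fst (h x) = 0" "AE x in torus_measure. snd (g x) - snd (h x) = 0"
    using z[OF gs(1)[OF L(1)] hs(1)[OF L(2)]] z[OF gs(2)[OF L(1)] hs(2)[OF L(2)]]
    by (simp_all only: dist_of_weak_gradient[OF v g] dist_of_weak_gradient[OF v h] simp_thms)
  then show ?thesis
    by eventually_elim (simp add: prod_eq_iff)
qed

lemma H1_norm_square:
  assumes "v \<in> sobolev_H1"
  shows "(H1_norm v)\<^sup>2 = (L2norm v)\<^sup>2 + (L2norm (\<lambda>x. fst (weak_gradient v x)))\<^sup>2 + (L2norm (\<lambda>x. snd (weak_gradient v x)))\<^sup>2"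
proof -
  note p = weak_gradient_props[OF assms]
  have "(\<integral>x. (norm (weak_gradient v x))\<^sup>2 \<partial>torus_measure)
     = (\<integral>x. (fst (weak_gradient v x))\<^sup>2 + (snd (weak_gradient v x))\<^sup>2 \<partial>torus_measure)"
    by (simp add: norm_prod_def)
  also have "\<dots> = (L2norm (\<lambda>x. fst (weak_gradient v x)))\<^sup>2 + (L2norm (\<lambda>x. snd (weak_gradient v x)))\<^sup>2"
    using p by (simp add: L2norm_square sqint_def)
  finally show ?thesis
    unfolding H1_norm_def by (simp add: L2norm_square[of v])
qed

lemma H1_norm_nonneg [simp]: "0 \<le> H1_norm v"
  by (simp add: H1_norm_def)

lemma H1_norm_ge:
  assumes "v \<in> sobolev_H1"
  shows "L2norm v \<le> H1_norm v" "L2norm (\<lambda>x. fst (weak_gradient v x)) \<le> H1_norm v"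
    "L2norm (\<lambda>x. snd (weak_gradient v x)) \<le> H1_norm v"
  by (rule power2_le_imp_le, simp_all add: H1_norm_square[OF assms])+

section \<open>Translations and integrals of derivatives\<close>

lemma sqint_translate:
  assumes "sqint f" "torus_periodic f"
  shows "sqint (\<lambda>x. f (x + h))" "L2norm (\<lambda>x. f (x + h)) = L2norm f"
proof -
  have [measurable]: "f \<in> borel_measurable borel" using assms(1) by (rule sqint_measurable)
  have p: "torus_periodic (\<lambda>x. (f x)\<^sup>2)" using assms(2) by (simp add: torus_periodic_def)
  show "sqint (\<lambda>x. f (x + h))"
    using integrable_torus_translate[OF _ p, of h] assms(1) by (simp add: sqint_def)
  show "L2norm (\<lambda>x. f (x + h)) = L2norm f"
    unfolding L2norm_def using integral_torus_translate[OF _ p, of h] by simp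
qed

lemma cmod_cis_diff_1: "cmod (cis t - 1) \<le> \<bar>t\<bar>"
proof -
  have "cmod (cis t - 1) = 2 * \<bar>sin (t / 2)\<bar>"
  proof (rule power2_eq_imp_eq)
    have "(cmod (cis t - 1))\<^sup>2 = 2 - 2 * cos t"
      using sin_cos_squared_add[of t] unfolding cmod_power2 by (simp add: power2_eq_square algebra_simps)
    also have "\<dots> = (2 * \<bar>sin (t / 2)\<bar>)\<^sup>2"
      using cos_double_sin[of "t / 2"] by (simp add: power_mult_distrib)
    finally show "(cmod (cis t - 1))\<^sup>2 = (2 * \<bar>sin (t / 2)\<bar>)\<^sup>2" .
  qed simp_all
  then show ?thesis using abs_sin_x_le_abs_x[of "t / 2"] by simp
qed

text \<open>On coefficients the translation multiplies by e^(i k.h), which differs from 1 by at most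
  |k| |h|, and |k| times the coefficient of \<open>v\<close> has the size of the coefficient of its
  gradient. Parseval adds this up.\<close>

lemma L2norm_translate_diff:
  assumes "v \<in> sobolev_H1"
  shows "L2norm (\<lambda>x. v (x + h) - v x) \<le> norm h * H1_norm v"
proof -
  note p = weak_gradient_props[OF assms]
  let ?g1 = "\<lambda>x. fst (weak_gradient v x)" and ?g2 = "\<lambda>x. snd (weak_gradient v x)"
  have [measurable]: "v \<in> borel_measurable borel" using p by (simp add: sqint_def)
  note vt = sqint_translate[OF p(2) p(6), of h]
  have s: "sqint (\<lambda>x. v (x + h) - v x)" by (rule sqint_diff[OF vt(1) p(2)])
  have coeff: "dist_of (\<lambda>x. v (x + h) - v x) k = (fmode k h - 1) * dist_of v k" for k
  proof -
    have i: "integrable torus_measure (\<lambda>x. complex_of_real (f x) * cnj (fmode k x))" if "sqint f" for f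
    proof -
      have "integrable torus_measure (\<lambda>x. complex_of_real (f x))" using sqint_integrable[OF that] by simp
      then show ?thesis
        by (rule integrable_mult_bounded[where B=1]) (simp_all flip: fmode_uminus)
    qed
    have per: "torus_periodic (\<lambda>x. complex_of_real (v x) * cnj (fmode k x))"
      using p(6) torus_periodic_fmode[of k] by (simp add: torus_periodic_def)
    have "(\<integral>x. complex_of_real (v (x + h)) * cnj (fmode k x) \<partial>torus_measure)
       = (\<integral>x. fmode k h * (complex_of_real (v (x + h)) * cnj (fmode k (x + h))) \<partial>torus_measure)"
    proof (rule Bochner_Integration.integral_cong)
      fix x
      have "fmode k h * cnj (fmode k h) = 1" using complex_norm_square[of "fmode k h"] by simp
      then show "complex_of_real (v (x + h)) * cnj (fmode k x) = fmode k h * (complex_of_real (v (x + h)) * cnj (fmode k (x + h)))"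
        by (simp add: fmode_translate mult_ac)
    qed simp
    also have "\<dots> = fmode k h * dist_of v k"
      unfolding dist_of_def integral_mult_right_zero
      using integral_torus_translate[OF _ per, of h] by (simp flip: fmode_uminus)
    finally have "dist_of (\<lambda>x. v (x + h)) k = fmode k h * dist_of v k" unfolding dist_of_def .
    moreover have "dist_of (\<lambda>x. v (x + h) - v x) k = dist_of (\<lambda>x. v (x + h)) k - dist_of v k"
      using i[OF vt(1)] i[OF p(2)] unfolding dist_of_def by (simp add: algebra_simps)
    ultimately show ?thesis by (simp add: algebra_simps)
  qed
  have le: "(cmod (dist_of (\<lambda>x. v (x + h) - v x) k))\<^sup>2
     \<le> (norm h)\<^sup>2 * ((cmod (dist_of ?g1 k))\<^sup>2 + (cmod (dist_of ?g2 k))\<^sup>2)" for k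
  proof -
    have "cmod (fmode k h - 1) \<le> norm (freq k) * norm h"
      unfolding fmode_def using cmod_cis_diff_1 Cauchy_Schwarz_ineq2 order_trans by blast
    then have "(cmod (fmode k h - 1) * cmod (dist_of v k))\<^sup>2 \<le> (norm (freq k) * norm h * cmod (dist_of v k))\<^sup>2"
      by (intro power_mono mult_right_mono) auto
    then have le: "(cmod (fmode k h - 1))\<^sup>2 * (cmod (dist_of v k))\<^sup>2
        \<le> (norm h)\<^sup>2 * ((norm (freq k))\<^sup>2 * (cmod (dist_of v k))\<^sup>2)"
      unfolding power_mult_distrib by (simp only: mult_ac)
    have n: "(norm (freq k))\<^sup>2 = (of_int (fst k))\<^sup>2 + (of_int (snd k))\<^sup>2"
      by (simp add: norm_prod_def freq_def)
    have "(cmod (dist_of ?g1 k))\<^sup>2 + (cmod (dist_of ?g2 k))\<^sup>2 = (norm (freq k))\<^sup>2 * (cmod (dist_of v k))\<^sup>2"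
      unfolding dist_of_weak_gradient[OF p(2) p(1)] n
      by (simp add: dx1_def dx2_def norm_mult power_mult_distrib distrib_right)
    then show ?thesis
      unfolding coeff norm_mult power_mult_distrib using le by simp
  qed
  have "(\<integral>x. (v (x + h) - v x)\<^sup>2 \<partial>torus_measure) \<le> (norm h)\<^sup>2 * ((\<integral>x. (?g1 x)\<^sup>2 \<partial>torus_measure) + (\<integral>x. (?g2 x)\<^sup>2 \<partial>torus_measure))"
  proof (rule LIMSEQ_le[OF parseval[OF s]])
    show "(\<lambda>m. (norm h)\<^sup>2 * ((\<Sum>k\<in>freq_box m. (cmod (dist_of ?g1 k))\<^sup>2) + (\<Sum>k\<in>freq_box m. (cmod (dist_of ?g2 k))\<^sup>2)))
      \<longlonglongrightarrow> (norm h)\<^sup>2 * ((\<integral>x. (?g1 x)\<^sup>2 \<partial>torus_measure) + (\<integral>x. (?g2 x)\<^sup>2 \<partial>torus_measure))"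
      by (intro tendsto_intros parseval p)
    have "(\<Sum>k\<in>freq_box m. (cmod (dist_of (\<lambda>x. v (x + h) - v x) k))\<^sup>2)
       \<le> (\<Sum>k\<in>freq_box m. (norm h)\<^sup>2 * ((cmod (dist_of ?g1 k))\<^sup>2 + (cmod (dist_of ?g2 k))\<^sup>2))" for m
      by (intro sum_mono le)
    then show "\<exists>N. \<forall>n\<ge>N. (\<Sum>k\<in>freq_box n. (cmod (dist_of (\<lambda>x. v (x + h) - v x) k))\<^sup>2)
       \<le> (norm h)\<^sup>2 * ((\<Sum>k\<in>freq_box n. (cmod (dist_of ?g1 k))\<^sup>2) + (\<Sum>k\<in>freq_box n. (cmod (dist_of ?g2 k))\<^sup>2))"
      by (simp add: sum.distrib sum_distrib_left distrib_left)
  qed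
  also have "\<dots> \<le> (norm h)\<^sup>2 * (H1_norm v)\<^sup>2"
    by (intro mult_left_mono) (simp_all add: H1_norm_square[OF assms] L2norm_square)
  finally show ?thesis
    unfolding L2norm_square[symmetric] power_mult_distrib[symmetric]
    by (rule power2_le_imp_le) simp
qed

lemma continuous_periodic_bounded:
  fixes f :: "plane \<Rightarrow> 'b::real_normed_vector"
  assumes "continuous_on UNIV f" "torus_periodic f"
  obtains B where "\<And>x. norm (f x) \<le> B" "B > 0"
proof -
  have "compact (f ` ({0..2 * pi} \<times> {0..2 * pi}))"
    by (intro compact_continuous_image compact_Times continuous_on_subset[OF assms(1)]) auto
  then obtain B where B: "\<And>x. x \<in> {0..2 * pi} \<times> {0..2 * pi} \<Longrightarrow> norm (f x) \<le> B"
    unfolding bounded_iff[of "f ` _"] using compact_imp_bounded[of "f ` ({0..2 * pi} \<times> {0..2 * pi})"]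
    by (auto simp: bounded_iff)
  have "torus_red x \<in> {0..2 * pi} \<times> {0..2 * pi}" for x
  proof -
    have "0 \<le> t + 2 * pi * of_int (- \<lfloor>t / (2 * pi)\<rfloor>)" "t + 2 * pi * of_int (- \<lfloor>t / (2 * pi)\<rfloor>) \<le> 2 * pi" for t
      using floor_divide_lower[of "2 * pi" t] floor_divide_upper[of "2 * pi" t] by (simp_all add: algebra_simps)
    then show ?thesis by (simp add: torus_red_def plus_prod_def)
  qed
  then have "norm (f x) \<le> max B 1" for x
    using B[of "torus_red x"] periodic_torus_red[OF assms(2), of x] by simp
  then show thesis by (rule that) simp
qed

text \<open>By translation invariance every difference quotient of \<open>f\<close> integrates to 0.
  The bound on the gradient makes \<open>f\<close> Lipschitz, which dominates the quotients in the
  limit.\<close>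

lemma integral_partial_derivative:
  fixes f :: "plane \<Rightarrow> real"
  assumes f: "\<And>x. GDERIV f x :> G x" and per: "torus_periodic f"
    and G: "G \<in> borel_measurable borel" "\<And>x. norm (G x) \<le> B"
  shows "(\<integral>x. G x \<bullet> e \<partial>torus_measure) = 0"
proof -
  have der: "(f has_derivative (\<lambda>h. h \<bullet> G x)) (at x)" for x
    using f by (simp add: gderiv_def)
  then have "continuous_on UNIV f"
    by (meson continuous_at_imp_continuous_on has_derivative_continuous)
  then have [measurable]: "f \<in> borel_measurable borel"
    by (rule borel_measurable_continuous_onI)
  obtain Bf where Bf: "\<And>x. norm (f x) \<le> Bf"
    using continuous_periodic_bounded[OF \<open>continuous_on UNIV f\<close> per] by blast
  have lip: "\<bar>f y - f x\<bar> \<le> B * norm (y - x)" for x y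
  proof -
    have "norm (f y - f x) \<le> B * norm (y - x)"
    proof (rule differentiable_bound[of UNIV f "\<lambda>x h. h \<bullet> G x"])
      show "onorm (\<lambda>h. h \<bullet> G x) \<le> B" for x
      proof (rule onorm_le)
        show "norm (h \<bullet> G x) \<le> B * norm h" for h
          using Cauchy_Schwarz_ineq2[of h "G x"] mult_right_mono[OF G(2)[of x], of "norm h"]
          by (simp add: mult.commute)
      qed
    qed (use der in auto)
    then show ?thesis by simp
  qed
  define s where "s n x = real (Suc n) * (f (x + (1 / real (Suc n)) *\<^sub>R e) - f x)" for n x
  have "(\<lambda>n. \<integral>x. s n x \<partial>torus_measure) \<longlonglongrightarrow> (\<integral>x. G x \<bullet> e \<partial>torus_measure)"
  proof (rule integral_dominated_convergence[where w="\<lambda>_. B * norm e"])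
    show "AE x in torus_measure. (\<lambda>n. s n x) \<longlonglongrightarrow> G x \<bullet> e"
    proof (rule AE_I2)
      fix x
      have "((\<lambda>t. f (x + t *\<^sub>R e)) has_derivative (\<lambda>t. (t *\<^sub>R e) \<bullet> G (x + 0 *\<^sub>R e))) (at 0)"
        by (rule has_derivative_compose[where f="\<lambda>t. x + t *\<^sub>R e", OF _ der]) (auto intro!: derivative_eq_intros)
      then have "((\<lambda>t. f (x + t *\<^sub>R e)) has_field_derivative (G x \<bullet> e)) (at 0)"
        unfolding has_field_derivative_def by (simp add: inner_commute mult.commute[of _ "e \<bullet> G x"])
      then have "(\<lambda>t. (f (x + t *\<^sub>R e) - f x) / t) \<midarrow>0\<rightarrow> G x \<bullet> e"
        unfolding DERIV_def by simp
      moreover have "filterlim (\<lambda>n. 1 / real (Suc n)) (at 0) sequentially"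
        using LIMSEQ_inverse_real_of_nat by (auto simp: filterlim_at inverse_eq_divide)
      ultimately have "(\<lambda>n. (f (x + (1 / real (Suc n)) *\<^sub>R e) - f x) / (1 / real (Suc n))) \<longlonglongrightarrow> G x \<bullet> e"
        by (rule filterlim_compose)
      then show "(\<lambda>n. s n x) \<longlonglongrightarrow> G x \<bullet> e"
        by (simp add: s_def mult.commute)
    qed
    show "AE x in torus_measure. norm (s n x) \<le> B * norm e" for n
    proof (rule AE_I2)
      fix x
      have "norm (s n x) = real (Suc n) * \<bar>f (x + (1 / real (Suc n)) *\<^sub>R e) - f x\<bar>"
        by (simp add: s_def abs_mult)
      also have "\<dots> \<le> real (Suc n) * (B * norm ((1 / real (Suc n)) *\<^sub>R e))"
        using lip[of "x + (1 / real (Suc n)) *\<^sub>R e" x] by (intro mult_left_mono) auto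
      also have "\<dots> = B * norm e" by simp
      finally show "norm (s n x) \<le> B * norm e" .
    qed
  qed (use G in \<open>auto simp: borel_measurable_torus s_def\<close>)
  moreover have "(\<integral>x. s n x \<partial>torus_measure) = 0" for n
  proof -
    have i: "integrable torus_measure f" by (rule integrable_torus_bounded[OF _ Bf]) measurable
    then have "integrable torus_measure (\<lambda>x. f (x + (1 / real (Suc n)) *\<^sub>R e))"
      using integrable_torus_translate[OF _ per] by simp
    then show ?thesis
      unfolding s_def using i integral_torus_translate[OF _ per, of "(1 / real (Suc n)) *\<^sub>R e"] by simp
  qed
  ultimately show ?thesis by (simp add: LIMSEQ_const_iff)
qed

section \<open>Absolutely convergent Fourier series\<close>

text \<open>
  This infix is declared for sums over sets twice in the library; the one of Infinite-Sum is
  kept.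
\<close>

no_notation Infinite_Set_Sum.abs_summable_on (infix "abs'_summable'_on" 50)

definition fourier :: "torus_distribution \<Rightarrow> plane \<Rightarrow> complex" where
  "fourier a x = (\<Sum>\<^sub>\<infinity>k. a k * fmode k x)"

text \<open>An enumeration turns sums over frequencies into series, so that termwise integration and
  differentiation and the theorem of Tannery apply.\<close>

definition freq_enum :: "nat \<Rightarrow> int \<times> int" where
  "freq_enum = from_nat_into UNIV"

lemma bij_freq_enum: "bij freq_enum"
proof -
  have "infinite (UNIV :: (int \<times> int) set)"
    by (simp add: finite_prod infinite_UNIV_int)
  then show ?thesis
    unfolding freq_enum_def using bij_betw_from_nat_into[of "UNIV :: (int \<times> int) set"] by simp
qed

lemma fourier_abs_summable: "a abs_summable_on UNIV \<Longrightarrow> (\<lambda>k. a k * fmode k x) abs_summable_on UNIV"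
  by (simp add: norm_mult)

lemma summable_freq_enum:
  fixes f :: "int \<times> int \<Rightarrow> real"
  assumes "f summable_on UNIV"
  shows "summable (\<lambda>n. f (freq_enum n))"
proof -
  have "(\<lambda>n. f (freq_enum n)) summable_on UNIV"
    using assms summable_on_reindex_bij_betw[OF bij_freq_enum] by blast
  then show ?thesis
    using has_sum_imp_sums sums_summable unfolding summable_on_def by blast
qed

lemma fourier_sums:
  assumes "a abs_summable_on UNIV"
  shows "(\<lambda>n. a (freq_enum n) * fmode (freq_enum n) x) sums fourier a x"
proof -
  have "((\<lambda>k. a k * fmode k x) has_sum fourier a x) UNIV"
    unfolding fourier_def using abs_summable_summable[OF fourier_abs_summable[OF assms]] by (rule has_sum_infsum)
  then have "((\<lambda>n. a (freq_enum n) * fmode (freq_enum n) x) has_sum fourier a x) UNIV"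
    by (rule has_sum_reindex_bij_betw[OF bij_freq_enum, THEN iffD2])
  then show ?thesis by (rule has_sum_imp_sums)
qed

definition coeff_l1 :: "torus_distribution \<Rightarrow> real" where
  "coeff_l1 a = (\<Sum>\<^sub>\<infinity>k. cmod (a k))"

lemma norm_fourier_le: "a abs_summable_on UNIV \<Longrightarrow> cmod (fourier a x) \<le> coeff_l1 a"
  unfolding fourier_def coeff_l1_def
  using norm_infsum_bound[OF fourier_abs_summable] by (simp add: norm_mult)

lemma continuous_on_fourier:
  assumes "a abs_summable_on UNIV"
  shows "continuous_on A (fourier a)"
proof -
  have "uniform_limit UNIV (\<lambda>X y. \<Sum>k\<in>X. a k * fmode k y) (\<lambda>y. \<Sum>\<^sub>\<infinity>k\<in>UNIV. a k * fmode k y) (finite_subsets_at_top UNIV)"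
    by (rule Weierstrass_m_test_general[where M="\<lambda>k. cmod (a k)"]) (use assms in \<open>simp_all add: norm_mult\<close>)
  then have "continuous_on UNIV (\<lambda>y. \<Sum>\<^sub>\<infinity>k\<in>UNIV. a k * fmode k y)"
    by (rule uniform_limit_theorem[rotated]) (auto intro!: always_eventually continuous_intros)
  then show ?thesis
    unfolding fourier_def[abs_def] by (rule continuous_on_subset) simp
qed

lemma fourier_measurable:
  "a abs_summable_on UNIV \<Longrightarrow> fourier a \<in> borel_measurable borel"
  by (intro borel_measurable_continuous_onI continuous_on_fourier)

lemma torus_periodic_fourier: "torus_periodic (fourier a)"
  using torus_periodic_fmode unfolding torus_periodic_def fourier_def by simp

lemma fourier_real:
  assumes "\<And>k. a (- k) = cnj (a k)"
  shows "of_real (Re (fourier a x)) = fourier a x"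
proof -
  have "bij (uminus :: int \<times> int \<Rightarrow> int \<times> int)" by (rule bij_uminus)
  then have "fourier a x = (\<Sum>\<^sub>\<infinity>k. a (- k) * fmode (- k) x)"
    unfolding fourier_def by (rule infsum_reindex_bij_betw[symmetric])
  also have "\<dots> = cnj (fourier a x)"
    unfolding fourier_def infsum_cnj[symmetric] by (simp add: assms fmode_uminus)
  finally show ?thesis by (metis Reals_cnj_iff of_real_Re)
qed

lemma integral_fourier:
  assumes a: "a abs_summable_on UNIV" and g: "integrable torus_measure g"
  shows "(\<lambda>n. a (freq_enum n) * (\<integral>x. fmode (freq_enum n) x * g x \<partial>torus_measure)) sums (\<integral>x. fourier a x * g x \<partial>torus_measure)"
proof -
  have gm: "g \<in> borel_measurable borel" using borel_measurable_integrable[OF g] by (simp add: borel_measurable_torus)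
  have s: "summable (\<lambda>n. cmod (a (freq_enum n)))" by (rule summable_freq_enum[OF a])
  have i: "integrable torus_measure (\<lambda>x. (a k * fmode k x) * g x)" for k
    using integrable_mult_bounded[OF g, of "\<lambda>x. a k * fmode k x" "cmod (a k)"] by (simp add: norm_mult mult.commute)
  have n: "(\<integral>x. norm (a k * fmode k x * g x) \<partial>torus_measure) = cmod (a k) * (\<integral>x. norm (g x) \<partial>torus_measure)" for k
    by (simp add: norm_mult)
  have sn: "summable (\<lambda>n. cmod (a (freq_enum n)) * c)" for c using s by (rule summable_mult2)
  have 1: "(\<Sum>n. a (freq_enum n) * fmode (freq_enum n) x * g x) = fourier a x * g x" for x
    using sums_mult2[OF fourier_sums[OF a, of x], of "g x"] by (simp add: sums_iff)
  have "(\<lambda>n. \<integral>x. a (freq_enum n) * fmode (freq_enum n) x * g x \<partial>torus_measure) sums (\<integral>x. (\<Sum>n. a (freq_enum n) * fmode (freq_enum n) x * g x) \<partial>torus_measure)"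
    by (rule sums_integral) (use i sn n in \<open>auto simp: norm_mult\<close>)
  then show ?thesis unfolding 1 by (simp add: mult.assoc)
qed

lemma coeff_fourier:
  assumes a: "a abs_summable_on UNIV"
  shows "(\<integral>x. fourier a x * cnj (fmode k x) \<partial>torus_measure) = a k"
proof -
  have "integrable torus_measure (\<lambda>x. cnj (fmode k x))"
    by (simp flip: fmode_uminus)
  from integral_fourier[OF a this]
  have *: "(\<lambda>n. a (freq_enum n) * (if freq_enum n = k then 1 else 0)) sums (\<integral>x. fourier a x * cnj (fmode k x) \<partial>torus_measure)"
    by (simp flip: fmode_diff add: integral_fmode)
  obtain m where m: "freq_enum m = k" "\<And>n. freq_enum n = k \<longleftrightarrow> n = m"
    using bij_freq_enum by (metis bij_pointE)
  have "(\<lambda>n. a (freq_enum n) * (if freq_enum n = k then 1 else 0)) = (\<lambda>n. if n = m then a k else 0)"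
    using m by (auto simp: fun_eq_iff simp flip: m(1))
  moreover have "(\<lambda>n. if n = m then a k else 0) sums a k" by (rule sums_single)
  ultimately show ?thesis using * sums_unique2 by metis
qed

lemma dist_of_fourier:
  assumes "a abs_summable_on UNIV" "\<And>k. a (- k) = cnj (a k)"
  shows "dist_of (\<lambda>x. Re (fourier a x)) = a"
  unfolding dist_of_def fourier_real[of a, OF assms(2)] coeff_fourier[OF assms(1)] ..

text \<open>Absolutely convergent Fourier series form an algebra, with convolution of the
  coefficients. It is used to see that the squared gradient of the mollified field is again such a
  series.\<close>

lemma fourier_mult_exists:
  assumes a: "a abs_summable_on UNIV" and b: "b abs_summable_on UNIV"
  obtains c where "c abs_summable_on UNIV" "\<And>x. fourier c x = fourier a x * fourier b x"
proof -
  define h where "h = (\<lambda>(j, l). a j * b l)"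
  have h: "h abs_summable_on (UNIV \<times> UNIV)"
  proof (rule Infinite_Sum.abs_summable_on_Sigma_iff[THEN iffD2], intro conjI ballI)
    show "(\<lambda>l. h (j, l)) abs_summable_on UNIV" for j
      using b by (simp add: h_def norm_mult summable_on_cmult_right)
    show "(\<lambda>j. \<Sum>\<^sub>\<infinity>l. norm (h (j, l))) abs_summable_on UNIV"
      using a by (simp add: h_def norm_mult infsum_cmult_right' abs_mult summable_on_cmult_left)
  qed
  \<comment> \<open>Reindexes the pairs (j, l) by the total frequency k = j + l together with j,
    after which the sum over a row is the convolution.\<close>
  define s where "s = (\<lambda>(k :: int \<times> int, j :: int \<times> int). (j, k - j))"
  have s: "bij_betw s (UNIV \<times> UNIV) (UNIV \<times> UNIV)"
    by (rule bij_betw_byWitness[where f'="\<lambda>(j, l). (j + l, j)"]) (auto simp: s_def)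
  have hs: "(\<lambda>p. h (s p)) abs_summable_on (UNIV \<times> UNIV)"
    using h by (subst summable_on_reindex_bij_betw[OF s, of "\<lambda>p. norm (h p)"])
  define c where "c k = (\<Sum>\<^sub>\<infinity>j. h (s (k, j)))" for k
  have row: "(\<lambda>j. h (s (k, j))) abs_summable_on UNIV" for k
    using Infinite_Sum.abs_summable_on_Sigma_iff[THEN iffD1, OF hs, THEN conjunct1] by blast
  have tot: "(\<lambda>k. \<Sum>\<^sub>\<infinity>j. norm (h (s (k, j)))) abs_summable_on UNIV"
    using Infinite_Sum.abs_summable_on_Sigma_iff[THEN iffD1, OF hs] by auto
  have c: "c abs_summable_on UNIV"
  proof (rule Infinite_Sum.abs_summable_on_comparison_test[OF tot])
    fix k
    have "norm (c k) \<le> (\<Sum>\<^sub>\<infinity>j. norm (h (s (k, j))))"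
      unfolding c_def by (rule norm_infsum_bound[OF row])
    then show "norm (c k) \<le> norm (\<Sum>\<^sub>\<infinity>j. norm (h (s (k, j))))" by simp
  qed
  have "fourier c x = fourier a x * fourier b x" for x
  proof -
    define u where "u = (\<lambda>p. h p * fmode (fst p + snd p) x)"
    have u: "u summable_on (UNIV \<times> UNIV)"
      by (rule abs_summable_summable) (use h in \<open>simp add: u_def norm_mult\<close>)
    have us: "(\<lambda>p. u (s p)) summable_on (UNIV \<times> UNIV)"
      using u by (subst summable_on_reindex_bij_betw[OF s])
    have u_prod: "u (j, l) = (a j * fmode j x) * (b l * fmode l x)" for j l
      by (simp add: u_def h_def fmode_add)
    have "fourier a x * fourier b x = (\<Sum>\<^sub>\<infinity>j. \<Sum>\<^sub>\<infinity>l. u (j, l))"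
      unfolding u_prod infsum_cmult_right' infsum_cmult_left' fourier_def ..
    also have "\<dots> = infsum u (UNIV \<times> UNIV)"
      by (rule infsum_Sigma_banach[OF u])
    also have "\<dots> = infsum (\<lambda>p. u (s p)) (UNIV \<times> UNIV)"
      by (rule infsum_reindex_bij_betw[OF s, symmetric])
    also have "\<dots> = (\<Sum>\<^sub>\<infinity>k. \<Sum>\<^sub>\<infinity>j. u (s (k, j)))"
      by (rule infsum_Sigma_banach[OF us, symmetric])
    also have "\<dots> = fourier c x"
      unfolding fourier_def c_def by (simp add: u_def s_def infsum_cmult_left')
    finally show ?thesis ..
  qed
  with c show thesis by (rule that)
qed

lemma fourier_add:
  assumes "a abs_summable_on UNIV" "b abs_summable_on UNIV"
  shows "fourier (\<lambda>k. a k + b k) x = fourier a x + fourier b x"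
  unfolding fourier_def distrib_right
  by (rule infsum_add) (rule abs_summable_summable[OF fourier_abs_summable[OF assms(1)]]
      abs_summable_summable[OF fourier_abs_summable[OF assms(2)]])+

lemma abs_summable_add_complex:
  fixes a b :: torus_distribution
  assumes "a abs_summable_on UNIV" "b abs_summable_on UNIV"
  shows "(\<lambda>k. a k + b k) abs_summable_on UNIV"
proof (rule Infinite_Sum.abs_summable_on_comparison_test)
  show "(\<lambda>k. cmod (a k) + cmod (b k)) abs_summable_on UNIV"
    using summable_on_add[OF assms] by simp
qed (simp add: norm_triangle_ineq)

lemma fourier_finite_support:
  assumes "finite A" "\<And>k. k \<notin> A \<Longrightarrow> a k = 0"
  shows "fourier a x = (\<Sum>k\<in>A. a k * fmode k x)" "a abs_summable_on UNIV"
proof -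
  have "fourier a x = infsum (\<lambda>k. a k * fmode k x) A"
    unfolding fourier_def by (rule infsum_cong_neutral) (use assms in auto)
  then show "fourier a x = (\<Sum>k\<in>A. a k * fmode k x)" using assms by simp
  have "(\<lambda>k. cmod (a k)) summable_on A" using assms by simp
  then show "a abs_summable_on UNIV"
    by (rule summable_on_cong_neutral[THEN iffD1, rotated -1]) (use assms in auto)
qed

text \<open>The weight \<open>1 + norm (freq k)\<close> bounds the norms of the termwise gradients
  summably and uniformly in \<open>x\<close>, so the series may be differentiated term by
  term.\<close>

lemma GDERIV_fourier:
  assumes a: "(\<lambda>k. of_real (1 + norm (freq k)) * a k) abs_summable_on UNIV"
  shows "GDERIV (\<lambda>x. Re (fourier a x)) x :> (Re (fourier (dx1 a) x), Re (fourier (dx2 a) x))"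
    and "a abs_summable_on UNIV" "dx1 a abs_summable_on UNIV" "dx2 a abs_summable_on UNIV"
proof -
  have nrm: "norm (of_real (1 + norm (freq k)) * a k) = cmod (a k) + norm (freq k) * cmod (a k)" for k
  proof -
    have "norm (complex_of_real (1 + norm (freq k))) = 1 + norm (freq k)"
      unfolding norm_of_real by simp
    then show ?thesis unfolding norm_mult by (simp add: distrib_right)
  qed
  have fs: "\<bar>of_int (fst k)\<bar> \<le> norm (freq k)" "\<bar>of_int (snd k)\<bar> \<le> norm (freq k)" for k
    using norm_fst_le[of "of_int (fst k) :: real" "of_int (snd k) :: real"]
      norm_snd_le[of "of_int (snd k) :: real" "of_int (fst k) :: real"] by (simp_all add: freq_def)
  show a0: "a abs_summable_on UNIV"
    by (rule Infinite_Sum.abs_summable_on_comparison_test[OF a]) (simp only: nrm, simp)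
  show p1: "dx1 a abs_summable_on UNIV"
    by (rule Infinite_Sum.abs_summable_on_comparison_test[OF a], simp only: nrm)
      (use fs in \<open>auto simp: dx1_def norm_mult intro!: add_increasing mult_right_mono\<close>)
  show p2: "dx2 a abs_summable_on UNIV"
    by (rule Infinite_Sum.abs_summable_on_comparison_test[OF a], simp only: nrm)
      (use fs in \<open>auto simp: dx2_def norm_mult intro!: add_increasing mult_right_mono\<close>)
  have f1: "(\<lambda>k. norm (freq k) * cmod (a k)) summable_on UNIV"
  proof -
    have "(\<lambda>k. norm (freq k) * cmod (a k)) abs_summable_on UNIV"
      by (rule Infinite_Sum.abs_summable_on_comparison_test[OF a], simp only: nrm) simp
    then show ?thesis by simp
  qed
  define b where "b n = norm (freq (freq_enum n)) * cmod (a (freq_enum n))" for n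
  have b: "summable b" unfolding b_def using f1 by (rule summable_freq_enum)
  define f where "f n x = Re (a (freq_enum n)) * cos (freq (freq_enum n) \<bullet> x) + (- Im (a (freq_enum n))) * sin (freq (freq_enum n) \<bullet> x)" for n x
  define f' where "f' n x h = h \<bullet> ((- Im (a (freq_enum n)) * cos (freq (freq_enum n) \<bullet> x) - Re (a (freq_enum n)) * sin (freq (freq_enum n) \<bullet> x)) *\<^sub>R freq (freq_enum n))" for n and x h :: plane
  define g' where "g' x h = h \<bullet> (Re (fourier (dx1 a) x), Re (fourier (dx2 a) x))" for x h :: plane
  have f_eq: "f n x = Re (a (freq_enum n) * fmode (freq_enum n) x)" for n x
    by (simp add: f_def fmode_def)
  have f'_eq: "f' n x h = fst h * Re (dx1 a (freq_enum n) * fmode (freq_enum n) x) + snd h * Re (dx2 a (freq_enum n) * fmode (freq_enum n) x)" for n x h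
    by (cases h) (simp add: f'_def dx1_def dx2_def fmode_def freq_def algebra_simps)
  have g'_sums: "(\<lambda>n. f' n x h) sums g' x h" for x h
    unfolding f'_eq g'_def inner_prod_def fst_conv snd_conv inner_real_def
    by (intro sums_add sums_mult sums_Re fourier_sums p1 p2)
  have f'_le: "norm (f' n x h) \<le> b n * norm h" for n x h
  proof -
    have "\<bar>- Im (a k) * cos t - Re (a k) * sin t\<bar> \<le> cmod (a k)" for k t
    proof -
      have "- Im (a k) * cos t - Re (a k) * sin t = Re (\<i> * a k * cis t)" by simp
      then show ?thesis using abs_Re_le_cmod[of "\<i> * a k * cis t"] by (simp add: norm_mult)
    qed
    then have "norm (f' n x h) \<le> norm h * (cmod (a (freq_enum n)) * norm (freq (freq_enum n)))"
      unfolding f'_def real_norm_def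
      by (intro order_trans[OF Cauchy_Schwarz_ineq2] mult_left_mono, unfold norm_scaleR)
        (rule mult_right_mono, simp_all only: real_norm_def norm_ge_zero)
    then show ?thesis by (simp add: b_def mult_ac)
  qed
  have "\<exists>g. \<forall>x\<in>UNIV. (\<lambda>n. f n x) sums (g x) \<and> (g has_derivative g' x) (at x within UNIV)"
  proof (rule has_derivative_series[where f'=f'])
    show "(f n has_derivative f' n x) (at x within UNIV)" for n x
      using GDERIV_cos_freq[of "Re (a (freq_enum n))" "freq_enum n" "- Im (a (freq_enum n))" x]
      unfolding gderiv_def f_def[abs_def] f'_def[abs_def] by simp
    show "(\<lambda>n. f n 0) sums Re (fourier a 0)"
      unfolding f_eq by (intro sums_Re fourier_sums a0)
    fix e :: real assume "e > 0"
    have "(\<lambda>n. suminf b - sum b {..<n}) \<longlonglongrightarrow> suminf b - suminf b"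
      by (intro tendsto_intros summable_LIMSEQ b)
    then have "\<forall>\<^sub>F n in sequentially. suminf b - sum b {..<n} < e"
      using \<open>e > 0\<close> by (intro order_tendstoD(2)) auto
    then show "\<forall>\<^sub>F n in sequentially. \<forall>x\<in>UNIV. \<forall>h. norm (sum (\<lambda>i. f' i x h) {..<n} - g' x h) \<le> e * norm h"
    proof eventually_elim
      case (elim n)
      show ?case
      proof (intro ballI allI)
        fix x h :: plane
        have bs: "summable (\<lambda>i. b (i + n) * norm h)"
          using summable_ignore_initial_segment[OF b] by (rule summable_mult2)
        have ns: "summable (\<lambda>i. norm (f' (i + n) x h))"
          by (rule summable_comparison_test'[OF bs, of 0]) (use f'_le in auto)
        have "g' x h - sum (\<lambda>i. f' i x h) {..<n} = (\<Sum>i. f' (i + n) x h)"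
          using suminf_split_initial_segment[OF sums_summable[OF g'_sums[of x h]], of n]
            sums_unique[OF g'_sums[of x h]] by simp
        then have "norm (sum (\<lambda>i. f' i x h) {..<n} - g' x h) = norm (\<Sum>i. f' (i + n) x h)"
          by (simp add: norm_minus_commute)
        also have "\<dots> \<le> (\<Sum>i. norm (f' (i + n) x h))" by (rule summable_norm[OF ns])
        also have "\<dots> \<le> (\<Sum>i. b (i + n) * norm h)"
          by (rule suminf_le[OF f'_le ns bs])
        also have "\<dots> = (suminf b - sum b {..<n}) * norm h"
          using suminf_mult2[OF summable_ignore_initial_segment[OF b], of n "norm h"]
            suminf_split_initial_segment[OF b, of n] by simp
        also have "\<dots> \<le> e * norm h" using elim by (intro mult_right_mono) auto
        finally show "norm (sum (\<lambda>i. f' i x h) {..<n} - g' x h) \<le> e * norm h" .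
      qed
    qed
  qed simp_all
  then obtain g where g: "\<And>x. (\<lambda>n. f n x) sums g x" "\<And>x. (g has_derivative g' x) (at x)"
    by auto
  have "g = (\<lambda>x. Re (fourier a x))"
  proof
    fix x
    have "(\<lambda>n. f n x) sums Re (fourier a x)" unfolding f_eq by (intro sums_Re fourier_sums a0)
    then show "g x = Re (fourier a x)" using g(1) sums_unique2 by blast
  qed
  with g(2) show "GDERIV (\<lambda>x. Re (fourier a x)) x :> (Re (fourier (dx1 a) x), Re (fourier (dx2 a) x))"
    unfolding gderiv_def g'_def[abs_def] by simp
qed

section \<open>Littlewood--Paley blocks\<close>

lemma lp_multiplier_bounds:
  assumes "dyadic_partition chi phi"
  shows "0 \<le> lp_multiplier chi phi n k" "lp_multiplier chi phi n k \<le> 1"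
proof -
  have "\<forall>z. chi z \<in> {0..1} \<and> phi z \<in> {0..1}"
    using assms unfolding dyadic_partition_def by (elim conjE)
  then have *: "0 \<le> chi z" "chi z \<le> 1" "0 \<le> phi z" "phi z \<le> 1" for z
    by (simp_all only: atLeastAtMost_iff simp_thms)
  show "0 \<le> lp_multiplier chi phi n k" "lp_multiplier chi phi n k \<le> 1"
    by (cases n; simp only: lp_multiplier.simps *)+
qed

lemma lp_multiplier_uminus:
  assumes "dyadic_partition chi phi"
  shows "lp_multiplier chi phi n (- k) = lp_multiplier chi phi n k"
proof -
  have *: "\<forall>z w. norm z = norm w \<longrightarrow> chi z = chi w \<and> phi z = phi w"
    using assms unfolding dyadic_partition_def by (elim conjE)
  have "chi (- z) = chi z" "phi (- z) = phi z" for z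
    using *[rule_format, of "- z" z] by simp_all
  then show ?thesis
    by (cases n) (simp_all only: lp_multiplier.simps freq_minus scaleR_minus_right)
qed

lemma lp_multiplier_sums:
  assumes "dyadic_partition chi phi"
  shows "(\<lambda>n. lp_multiplier chi phi n k) sums 1"
proof -
  have "\<forall>z. (\<lambda>j. phi (z /\<^sub>R 2 ^ j)) sums (1 - chi z)"
    using assms unfolding dyadic_partition_def by (elim conjE)
  then have "(\<lambda>j. phi (freq k /\<^sub>R 2 ^ j)) sums (1 - chi (freq k))" ..
  then have "(\<lambda>n. lp_multiplier chi phi (Suc n) k) sums (1 - chi (freq k))" by simp
  from sums_Suc[OF this] show ?thesis by simp
qed

lemma lp_multiplier_support:
  assumes "dyadic_partition chi phi"
  obtains r R where "0 < r" "1 \<le> R"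
    "\<And>n k. lp_multiplier chi phi n k \<noteq> 0 \<Longrightarrow> norm (freq k) \<le> R * 2 ^ n"
    "\<And>n k. n > 0 \<Longrightarrow> lp_multiplier chi phi n k \<noteq> 0 \<Longrightarrow> r * 2 ^ n \<le> norm (freq k)"
proof -
  have "\<exists>R. \<forall>z. chi z \<noteq> 0 \<longrightarrow> norm z \<le> R"
    using assms unfolding dyadic_partition_def by (elim conjE)
  moreover have "\<exists>r>0. \<exists>R. \<forall>z. phi z \<noteq> 0 \<longrightarrow> r \<le> norm z \<and> norm z \<le> R"
    using assms unfolding dyadic_partition_def by (elim conjE)
  ultimately obtain R1 r R2 where R1: "\<And>z. chi z \<noteq> 0 \<Longrightarrow> norm z \<le> R1"
    and r: "r > 0" "\<And>z. phi z \<noteq> 0 \<Longrightarrow> r \<le> norm z" and R2: "\<And>z. phi z \<noteq> 0 \<Longrightarrow> norm z \<le> R2"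
    by blast
  define R where "R = max 1 (max R1 R2)"
  show thesis
  \<comment> \<open>Block \<open>Suc m\<close> is \<open>phi\<close> at scale 2^m; expressed through
    2^n with n = Suc m, the inner radius is halved.\<close>
  proof (rule that[of "r / 2" R])
    show "0 < r / 2" "1 \<le> R" using r by (auto simp: R_def)
    have sc: "norm (z /\<^sub>R 2 ^ m) = norm z / 2 ^ m" for z :: plane and m :: nat
      by (simp add: divide_inverse power_inverse mult.commute)
    fix n k assume nz: "lp_multiplier chi phi n k \<noteq> 0"
    show "norm (freq k) \<le> R * 2 ^ n"
    proof (cases n)
      case 0
      then show ?thesis using nz R1[of "freq k"] by (auto simp: R_def)
    next
      case (Suc m)
      then have "norm (freq k) / 2 ^ m \<le> R" using nz R2[of "freq k /\<^sub>R 2 ^ m"] unfolding sc by (simp add: R_def)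
      then have "norm (freq k) \<le> R * 2 ^ m" by (simp add: field_simps)
      also have "\<dots> \<le> R * 2 ^ n" unfolding Suc by (simp add: R_def)
      finally show ?thesis .
    qed
  next
    fix n :: nat and k assume "n > 0" and nz: "lp_multiplier chi phi n k \<noteq> 0"
    then obtain m where m: "n = Suc m" by (cases n) auto
    have sc: "norm (z /\<^sub>R 2 ^ m) = norm z / 2 ^ m" for z :: plane
      by (simp add: divide_inverse power_inverse mult.commute)
    have "r \<le> norm (freq k) / 2 ^ m" using nz r(2)[of "freq k /\<^sub>R 2 ^ m"] unfolding sc m by simp
    then show "r / 2 * 2 ^ n \<le> norm (freq k)" by (simp add: m field_simps)
  qed
qed

section \<open>Counting frequencies in a ball\<close>

definition freq_bound :: "real \<Rightarrow> nat" where
  "freq_bound R = nat \<lceil>R\<rceil>"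

lemma freq_ball_subset: "{k. norm (freq k) \<le> R} \<subseteq> freq_box (freq_bound R)"
proof
  fix k assume "k \<in> {k. norm (freq k) \<le> R}"
  then have "\<bar>real_of_int (fst k)\<bar> \<le> R" "\<bar>real_of_int (snd k)\<bar> \<le> R"
    using norm_fst_le[of "of_int (fst k) :: real" "of_int (snd k) :: real"]
      norm_snd_le[of "of_int (snd k) :: real" "of_int (fst k) :: real"] by (auto simp: freq_def)
  moreover have "0 \<le> R" using \<open>k \<in> _\<close> norm_ge_zero order_trans by blast
  ultimately have "0 \<le> \<lceil>R\<rceil>" "\<bar>fst k\<bar> \<le> \<lceil>R\<rceil>" "\<bar>snd k\<bar> \<le> \<lceil>R\<rceil>" by linarith+
  then show "k \<in> freq_box (freq_bound R)"
    by (cases k) (auto simp: freq_box_def freq_bound_def)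
qed

lemma finite_freq_ball: "finite {k. norm (freq k) \<le> R}"
  by (rule finite_subset[OF freq_ball_subset]) simp

lemma card_freq_ball:
  assumes "1 \<le> R"
  shows "real (card {k. norm (freq k) \<le> R}) \<le> 25 * R\<^sup>2"
proof -
  have "card {k. norm (freq k) \<le> R} \<le> card (freq_box (freq_bound R))"
    by (intro card_mono freq_ball_subset) simp
  also have "\<dots> = (2 * freq_bound R + 1)\<^sup>2"
    by (simp add: freq_box_def card_cartesian_product power2_eq_square nat_add_distrib nat_mult_distrib)
  finally have "real (card {k. norm (freq k) \<le> R}) \<le> real ((2 * freq_bound R + 1)\<^sup>2)"
    by (simp only: of_nat_le_iff)
  also have "\<dots> = (2 * real (freq_bound R) + 1)\<^sup>2" by simp
  \<comment> \<open>The side of the box has at most 2 (R + 1) + 1 points, hence at most 5 R for R at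
    least 1.\<close>
  also have "\<dots> \<le> (5 * R)\<^sup>2"
  proof (rule power_mono)
    have "real (freq_bound R) \<le> R + 1" unfolding freq_bound_def using assms by linarith
    then show "2 * real (freq_bound R) + 1 \<le> 5 * R" using assms by linarith
  qed simp
  finally show ?thesis by (simp add: power_mult_distrib)
qed

lemma finite_lp_support:
  assumes "dyadic_partition chi phi"
  shows "finite {k. lp_multiplier chi phi n k \<noteq> 0}"
proof -
  obtain r R where R: "\<And>n k. lp_multiplier chi phi n k \<noteq> 0 \<Longrightarrow> norm (freq k) \<le> R * 2 ^ n"
    using lp_multiplier_support[OF assms] by metis
  show ?thesis
    by (rule finite_subset[OF _ finite_freq_ball[of "R * 2 ^ n"]]) (use R in auto)
qed

section \<open>Blocks of absolutely convergent Fourier series\<close>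

lemma lp_block_fourier:
  assumes "dyadic_partition chi phi"
  shows "lp_block chi phi n a x = Re (fourier (\<lambda>k. of_real (lp_multiplier chi phi n k) * a k) x)"
    and "(\<lambda>k. of_real (lp_multiplier chi phi n k) * a k) abs_summable_on UNIV"
  using fourier_finite_support[OF finite_lp_support[OF assms, of n], of "\<lambda>k. of_real (lp_multiplier chi phi n k) * a k"]
  by (auto simp: lp_block_def)

lemma lp_partial_multiplier:
  assumes "dyadic_partition chi phi"
  shows "0 \<le> (\<Sum>n<N. lp_multiplier chi phi n k)" "(\<Sum>n<N. lp_multiplier chi phi n k) \<le> 1"
proof -
  show "0 \<le> (\<Sum>n<N. lp_multiplier chi phi n k)"
    by (intro sum_nonneg lp_multiplier_bounds[OF assms])
  show "(\<Sum>n<N. lp_multiplier chi phi n k) \<le> 1"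
    using sum_le_suminf[of "\<lambda>n. lp_multiplier chi phi n k" "{..<N}"] lp_multiplier_sums[OF assms, of k]
      lp_multiplier_bounds[OF assms] by (auto simp: sums_iff)
qed

text \<open>Partial sums of the multipliers lie between 0 and 1, so all partial Littlewood-Paley
  sums share the bound \<open>coeff_l1 a\<close>. It is the dominating constant when these sums are
  integrated.\<close>

lemma lp_partial_fourier:
  assumes d: "dyadic_partition chi phi" and a: "a abs_summable_on UNIV"
  shows "(\<Sum>n<N. lp_block chi phi n a x) = Re (fourier (\<lambda>k. of_real (\<Sum>n<N. lp_multiplier chi phi n k) * a k) x)"
    and "(\<lambda>k. of_real (\<Sum>n<N. lp_multiplier chi phi n k) * a k) abs_summable_on UNIV"
    and "\<bar>\<Sum>n<N. lp_block chi phi n a x\<bar> \<le> coeff_l1 a"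
proof -
  have le: "norm (of_real (\<Sum>n<N. lp_multiplier chi phi n k) * a k) \<le> norm (a k)" for k N
    using lp_partial_multiplier[OF d, of k N] unfolding norm_mult norm_of_real
    by (intro mult_left_le_one_le) auto
  show abs: "(\<lambda>k. of_real (\<Sum>n<N. lp_multiplier chi phi n k) * a k) abs_summable_on UNIV" for N
    by (rule Infinite_Sum.abs_summable_on_comparison_test[OF a le])
  show eq: "(\<Sum>n<N. lp_block chi phi n a x) = Re (fourier (\<lambda>k. of_real (\<Sum>n<N. lp_multiplier chi phi n k) * a k) x)" for N
  proof (induction N)
    case (Suc N)
    then show ?case
      using fourier_add[OF abs[of N] lp_block_fourier(2)[OF d, of N a], of x] lp_block_fourier(1)[OF d, of N a x]
      by (simp add: distrib_right)
  qed (simp add: fourier_def)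
  have "\<bar>\<Sum>n<N. lp_block chi phi n a x\<bar> \<le> coeff_l1 (\<lambda>k. of_real (\<Sum>n<N. lp_multiplier chi phi n k) * a k)"
    unfolding eq using abs_Re_le_cmod norm_fourier_le[OF abs] order_trans by blast
  also have "\<dots> \<le> coeff_l1 a"
    unfolding coeff_l1_def by (rule infsum_mono[OF abs a le])
  finally show "\<bar>\<Sum>n<N. lp_block chi phi n a x\<bar> \<le> coeff_l1 a" .
qed

text \<open>At each frequency the partial multipliers tend to 1, and absolute summability lets the
  limit pass inside the sum over frequencies.\<close>

lemma lp_block_sums:
  assumes d: "dyadic_partition chi phi" and a: "a abs_summable_on UNIV"
  shows "(\<lambda>n. lp_block chi phi n a x) sums Re (fourier a x)"
proof -
  define m where "m N k = complex_of_real (\<Sum>n<N. lp_multiplier chi phi n k)" for N k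
  have "(\<forall>\<^sub>F N in sequentially. summable (\<lambda>i. norm (m N (freq_enum i) * a (freq_enum i) * fmode (freq_enum i) x)))
    \<and> summable (\<lambda>i. norm (a (freq_enum i) * fmode (freq_enum i) x))
    \<and> (\<lambda>N. \<Sum>i. m N (freq_enum i) * a (freq_enum i) * fmode (freq_enum i) x) \<longlonglongrightarrow> (\<Sum>i. a (freq_enum i) * fmode (freq_enum i) x)"
  proof (rule tannerys_theorem[where M="\<lambda>i. cmod (a (freq_enum i))"])
    show "(\<lambda>N. m N (freq_enum i) * a (freq_enum i) * fmode (freq_enum i) x) \<longlonglongrightarrow> a (freq_enum i) * fmode (freq_enum i) x" for i
    proof -
      have "(\<lambda>N. \<Sum>n<N. lp_multiplier chi phi n (freq_enum i)) \<longlonglongrightarrow> 1"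
        using lp_multiplier_sums[OF d] by (simp add: sums_def)
      then have "(\<lambda>N. m N (freq_enum i) * a (freq_enum i) * fmode (freq_enum i) x) \<longlonglongrightarrow> of_real 1 * a (freq_enum i) * fmode (freq_enum i) x"
        unfolding m_def by (intro tendsto_intros)
      then show ?thesis by simp
    qed
    have "norm (m N (freq_enum i) * a (freq_enum i) * fmode (freq_enum i) x) \<le> cmod (a (freq_enum i))" for i N
      using lp_partial_multiplier[OF d, of "freq_enum i" N] unfolding m_def norm_mult norm_of_real norm_fmode mult_1_right
      by (intro mult_left_le_one_le) auto
    then show "\<forall>\<^sub>F (i, N) in sequentially \<times>\<^sub>F sequentially. norm (m N (freq_enum i) * a (freq_enum i) * fmode (freq_enum i) x) \<le> cmod (a (freq_enum i))"
      by (auto intro!: always_eventually)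
    show "summable (\<lambda>i. cmod (a (freq_enum i)))" by (rule summable_freq_enum[OF a])
  qed simp
  moreover have "(\<Sum>i. m N (freq_enum i) * a (freq_enum i) * fmode (freq_enum i) x) = fourier (\<lambda>k. m N k * a k) x" for N
    using fourier_sums[OF lp_partial_fourier(2)[OF d a, of N]] unfolding m_def by (simp add: sums_iff)
  moreover have "(\<Sum>i. a (freq_enum i) * fmode (freq_enum i) x) = fourier a x"
    using fourier_sums[OF a] by (simp add: sums_iff)
  ultimately have "(\<lambda>N. fourier (\<lambda>k. m N k * a k) x) \<longlonglongrightarrow> fourier a x" by simp
  then have "(\<lambda>N. Re (fourier (\<lambda>k. m N k * a k) x)) \<longlonglongrightarrow> Re (fourier a x)" by (rule tendsto_Re)
  then show ?thesis
    unfolding sums_def lp_partial_fourier(1)[OF d a] m_def .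
qed

lemma fun_of_fourier:
  assumes "dyadic_partition chi phi" "a abs_summable_on UNIV"
  shows "fun_of chi phi a x = Re (fourier a x)"
  unfolding fun_of_def using lp_block_sums[OF assms] by (simp add: sums_iff)

lemma continuous_on_lp_block:
  assumes "dyadic_partition chi phi"
  shows "continuous_on A (lp_block chi phi n a)"
  unfolding lp_block_def[abs_def] by (intro continuous_intros)

lemma lp_block_measurable:
  assumes "dyadic_partition chi phi"
  shows "lp_block chi phi n a \<in> borel_measurable borel"
  by (intro borel_measurable_continuous_onI continuous_on_lp_block assms)

lemma torus_periodic_lp_block: "torus_periodic (lp_block chi phi n a)"
  using torus_periodic_fmode unfolding torus_periodic_def lp_block_def by simp

text \<open>Dominated convergence, with bound \<open>coeff_l1 a\<close> times the modulus of
  \<open>g\<close>, identifies the Littlewood-Paley bracket with an ordinary integral. It is applied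
  to the regularised Wick square.\<close>

lemma bracket_fourier:
  assumes d: "dyadic_partition chi phi" and a: "a abs_summable_on UNIV" and g: "integrable torus_measure g"
  shows "(\<lambda>n. \<integral>x. lp_block chi phi n a x * g x \<partial>torus_measure) sums (\<integral>x. Re (fourier a x) * g x \<partial>torus_measure)"
proof -
  have gm [measurable]: "g \<in> borel_measurable borel" using borel_measurable_integrable[OF g] by (simp add: borel_measurable_torus)
  have [measurable]: "(\<lambda>x. Re (fourier a x)) \<in> borel_measurable borel"
    using fourier_measurable[OF a] by measurable
  have [measurable]: "lp_block chi phi n a \<in> borel_measurable borel" for n
    by (rule lp_block_measurable[OF d])
  have "(\<lambda>N. \<integral>x. (\<Sum>n<N. lp_block chi phi n a x) * g x \<partial>torus_measure) \<longlonglongrightarrow> (\<integral>x. Re (fourier a x) * g x \<partial>torus_measure)"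
  proof (rule integral_dominated_convergence[where w="\<lambda>x. coeff_l1 a * \<bar>g x\<bar>"])
    show "AE x in torus_measure. (\<lambda>N. (\<Sum>n<N. lp_block chi phi n a x) * g x) \<longlonglongrightarrow> Re (fourier a x) * g x"
      using lp_block_sums[OF d a] unfolding sums_def by (intro AE_I2 tendsto_intros) auto
    show "AE x in torus_measure. norm ((\<Sum>n<N. lp_block chi phi n a x) * g x) \<le> coeff_l1 a * \<bar>g x\<bar>" for N
      using lp_partial_fourier(3)[OF d a] by (intro AE_I2) (auto simp: abs_mult intro!: mult_right_mono)
  qed (use g in \<open>simp_all add: borel_measurable_torus\<close>)
  moreover have "(\<integral>x. (\<Sum>n<N. lp_block chi phi n a x) * g x \<partial>torus_measure) = (\<Sum>n<N. \<integral>x. lp_block chi phi n a x * g x \<partial>torus_measure)" for N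
  proof -
    have "integrable torus_measure (\<lambda>x. lp_block chi phi n a x * g x)" for n
    proof -
      obtain B where "\<And>x. norm (lp_block chi phi n a x) \<le> B"
        using continuous_periodic_bounded[OF continuous_on_lp_block[OF d] torus_periodic_lp_block] by metis
      then show ?thesis
        by (subst mult.commute) (rule integrable_mult_bounded[OF g lp_block_measurable[OF d]])
    qed
    then show ?thesis by (simp add: sum_distrib_right)
  qed
  ultimately show ?thesis by (simp add: sums_def)
qed

text \<open>For a nonpositive exponent the weight is at most 1, and each block is bounded by the sum
  of all coefficients. Hence mollified quantities have finite norm, which is needed when the noise
  itself has infinite norm.\<close>

lemma besov_norm_finite_fourier:
  assumes d: "dyadic_partition chi phi" and a: "a abs_summable_on UNIV" and "\<alpha> \<le> 0"
  shows "besov_norm chi phi \<alpha> a \<le> ennreal (coeff_l1 a)"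
  unfolding besov_norm_def
proof (rule SUP_least)
  fix n
  have "\<bar>lp_block chi phi n a x\<bar> \<le> coeff_l1 a" for x
  proof -
    have "\<bar>lp_block chi phi n a x\<bar> \<le> coeff_l1 (\<lambda>k. of_real (lp_multiplier chi phi n k) * a k)"
      unfolding lp_block_fourier(1)[OF d] using abs_Re_le_cmod norm_fourier_le[OF lp_block_fourier(2)[OF d]] order_trans by blast
    also have "\<dots> \<le> coeff_l1 a"
      unfolding coeff_l1_def
    proof (rule infsum_mono[OF lp_block_fourier(2)[OF d] a])
      fix k show "norm (of_real (lp_multiplier chi phi n k) * a k) \<le> norm (a k)"
        using lp_multiplier_bounds[OF d, of n k] unfolding norm_mult norm_of_real
        by (intro mult_left_le_one_le) auto
    qed
    finally show ?thesis .
  qed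
  then have "(SUP x. ennreal \<bar>lp_block chi phi n a x\<bar>) \<le> ennreal (coeff_l1 a)"
    by (intro SUP_least ennreal_leI)
  moreover have "ennreal (2 powr (\<alpha> * real n)) \<le> 1"
  proof -
    have "\<alpha> * real n \<le> 0" using assms(3) by (simp add: mult_nonpos_nonneg)
    then have "2 powr (\<alpha> * real n) \<le> 2 powr 0" by (intro powr_mono) auto
    then show ?thesis by (simp add: ennreal_le_1)
  qed
  ultimately have "ennreal (2 powr (\<alpha> * real n)) * (SUP x. ennreal \<bar>lp_block chi phi n a x\<bar>) \<le> 1 * ennreal (coeff_l1 a)"
    by (intro mult_mono) auto
  then show "ennreal (2 powr (\<alpha> * real n)) * (SUP x. ennreal \<bar>lp_block chi phi n a x\<bar>) \<le> ennreal (coeff_l1 a)"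
    by simp
qed

section \<open>Mollified noise\<close>

lemma integral_lborel_scale:
  fixes G :: "plane \<Rightarrow> 'b::{banach, second_countable_topology}"
  assumes [measurable]: "G \<in> borel_measurable borel" and "e > 0"
  shows "(\<integral>y. G y \<partial>lborel) = e\<^sup>2 *\<^sub>R (\<integral>y. G (e *\<^sub>R y) \<partial>lborel)"
proof -
  have "(\<integral>y. G y \<partial>lborel) = (\<integral>y. G y \<partial>(density (distr lborel borel (\<lambda>x::plane. 0 + e *\<^sub>R x)) (\<lambda>_. ennreal (\<bar>e\<bar> ^ DIM(plane)))))"
    using lborel_affine[of e "0::plane"] assms by simp
  also have "\<dots> = e\<^sup>2 *\<^sub>R (\<integral>y. G (e *\<^sub>R y) \<partial>lborel)"
    by (subst integral_density) (use \<open>e > 0\<close> in \<open>simp_all add: integral_distr power2_eq_square\<close>)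
  finally show ?thesis .
qed

lemma integral_lborel_translate:
  fixes G :: "plane \<Rightarrow> 'b::{banach, second_countable_topology}"
  assumes [measurable]: "G \<in> borel_measurable borel"
  shows "(\<integral>y. G (y + h) \<partial>lborel) = (\<integral>y. G y \<partial>lborel)"
proof -
  have "(\<integral>y. G y \<partial>lborel) = (\<integral>y. G y \<partial>(distr lborel borel ((+) h)))"
    by (simp add: lborel_distr_plus)
  also have "\<dots> = (\<integral>y. G (y + h) \<partial>lborel)"
    by (subst integral_distr) (simp_all add: add.commute)
  finally show ?thesis ..
qed

lemma integrable_compact_support:
  fixes f :: "plane \<Rightarrow> 'b::{banach, second_countable_topology}"
  assumes "continuous_on UNIV f" "\<And>y. r < norm y \<Longrightarrow> f y = 0"
  shows "integrable lborel f"
proof -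
  have "integrable lborel (\<lambda>y. indicator (cball 0 r) y *\<^sub>R f y)"
    by (rule borel_integrable_compact[OF compact_cball continuous_on_subset[OF assms(1)]]) simp
  moreover have "(\<lambda>y. indicator (cball 0 r) y *\<^sub>R f y) = f"
    using assms(2) by (auto simp: fun_eq_iff indicator_def not_le)
  ultimately show ?thesis by simp
qed

text \<open>Difference quotients integrate to 0 as on the torus, with compact support in place of
  periodicity to provide bounds and integrability.\<close>

lemma integral_plane_derivative:
  fixes f :: "plane \<Rightarrow> real"
  assumes f: "\<And>x. GDERIV f x :> G x" and G: "continuous_on UNIV G"
    and supp: "\<And>y. r < norm y \<Longrightarrow> f y = 0"
  shows "(\<integral>x. G x \<bullet> e \<partial>lborel) = 0"
proof -
  have der: "(f has_derivative (\<lambda>h. h \<bullet> G x)) (at x)" for x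
    using f by (simp add: gderiv_def)
  then have contf: "continuous_on UNIV f"
    by (meson continuous_at_imp_continuous_on has_derivative_continuous)
  then have fm [measurable]: "f \<in> borel_measurable borel"
    by (rule borel_measurable_continuous_onI)
  have Gm [measurable]: "G \<in> borel_measurable borel"
    using G by (rule borel_measurable_continuous_onI)
  have G0: "G x = 0" if "r < norm x" for x
  proof -
    have o: "open {y::plane. r < norm y}"
      by (intro open_Collect_less continuous_intros)
    have "((\<lambda>_. 0) has_derivative (\<lambda>h. h \<bullet> G x)) (at x)"
      by (rule has_derivative_transform_within_open[OF der o]) (use that supp in blast)+
    then have "(\<lambda>h. h \<bullet> G x) = (\<lambda>_. 0)"
      by (rule has_derivative_unique) (rule has_derivative_const)
    then have "G x \<bullet> G x = 0" by meson
    then show ?thesis by simp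
  qed
  obtain B where B: "\<And>x. norm (G x) \<le> B"
  proof -
    have "compact (G ` cball 0 r)"
      by (intro compact_continuous_image continuous_on_subset[OF G]) auto
    then have "bounded (G ` cball 0 r)" by (rule compact_imp_bounded)
    then obtain B where "\<forall>y\<in>G ` cball 0 r. norm y \<le> B" unfolding bounded_iff by blast
    then have "norm (G x) \<le> B" if "norm x \<le> r" for x using that by simp
    then have "norm (G x) \<le> max B 0" for x
      using G0[of x] by (cases "norm x \<le> r") (auto simp: not_le le_max_iff_disj)
    then show thesis by (rule that)
  qed
  then have B0: "B \<ge> 0" using order_trans[OF norm_ge_zero] by blast
  have lip: "\<bar>f y - f x\<bar> \<le> B * norm (y - x)" for x y
  proof -
    have "norm (f y - f x) \<le> B * norm (y - x)"
    proof (rule differentiable_bound[of UNIV f "\<lambda>x h. h \<bullet> G x"])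
      show "onorm (\<lambda>h. h \<bullet> G x) \<le> B" for x
      proof (rule onorm_le)
        show "norm (h \<bullet> G x) \<le> B * norm h" for h
          using Cauchy_Schwarz_ineq2[of h "G x"] mult_right_mono[OF B[of x], of "norm h"]
          by (simp add: mult.commute)
      qed
    qed (use der in auto)
    then show ?thesis by simp
  qed
  define s where "s n x = real (Suc n) * (f (x + (1 / real (Suc n)) *\<^sub>R e) - f x)" for n x
  have "(\<lambda>n. \<integral>x. s n x \<partial>lborel) \<longlonglongrightarrow> (\<integral>x. G x \<bullet> e \<partial>lborel)"
  \<comment> \<open>All difference quotients use steps of length at most \<open>norm e\<close>, so
    they vanish outside the ball enlarged by that amount.\<close>
  proof (rule integral_dominated_convergence[where w="\<lambda>x. indicator (cball 0 (r + norm e)) x *\<^sub>R (B * norm e)"])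
    show "AE x in lborel. (\<lambda>n. s n x) \<longlonglongrightarrow> G x \<bullet> e"
    proof (rule AE_I2)
      fix x
      have "((\<lambda>t. f (x + t *\<^sub>R e)) has_derivative (\<lambda>t. (t *\<^sub>R e) \<bullet> G (x + 0 *\<^sub>R e))) (at 0)"
        by (rule has_derivative_compose[where f="\<lambda>t. x + t *\<^sub>R e", OF _ der]) (auto intro!: derivative_eq_intros)
      then have "((\<lambda>t. f (x + t *\<^sub>R e)) has_field_derivative (G x \<bullet> e)) (at 0)"
        unfolding has_field_derivative_def by (simp add: inner_commute mult.commute[of _ "e \<bullet> G x"])
      then have "(\<lambda>t. (f (x + t *\<^sub>R e) - f x) / t) \<midarrow>0\<rightarrow> G x \<bullet> e"
        unfolding DERIV_def by simp
      moreover have "filterlim (\<lambda>n. 1 / real (Suc n)) (at 0) sequentially"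
        using LIMSEQ_inverse_real_of_nat by (auto simp: filterlim_at inverse_eq_divide)
      ultimately have "(\<lambda>n. (f (x + (1 / real (Suc n)) *\<^sub>R e) - f x) / (1 / real (Suc n))) \<longlonglongrightarrow> G x \<bullet> e"
        by (rule filterlim_compose)
      then show "(\<lambda>n. s n x) \<longlonglongrightarrow> G x \<bullet> e"
        by (simp add: s_def mult.commute)
    qed
    show "AE x in lborel. norm (s n x) \<le> indicator (cball 0 (r + norm e)) x *\<^sub>R (B * norm e)" for n
    proof (rule AE_I2)
      fix x
      show "norm (s n x) \<le> indicator (cball 0 (r + norm e)) x *\<^sub>R (B * norm e)"
      proof (cases "norm x \<le> r + norm e")
        case True
        have "norm (s n x) = real (Suc n) * \<bar>f (x + (1 / real (Suc n)) *\<^sub>R e) - f x\<bar>"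
          by (simp add: s_def abs_mult)
        also have "\<dots> \<le> real (Suc n) * (B * norm ((1 / real (Suc n)) *\<^sub>R e))"
          using lip[of "x + (1 / real (Suc n)) *\<^sub>R e" x] by (intro mult_left_mono) auto
        also have "\<dots> = B * norm e" by simp
        finally show ?thesis using True by simp
      next
        case False
        have "norm ((1 / real (Suc n)) *\<^sub>R e) \<le> norm e"
          by (simp add: divide_le_eq mult_le_cancel_left1)
        then have "r < norm (x + (1 / real (Suc n)) *\<^sub>R e)"
          using False norm_diff_ineq[of x "(1 / real (Suc n)) *\<^sub>R e"] by linarith
        moreover have "r < norm x" using False norm_ge_zero[of e] by linarith
        ultimately show ?thesis using supp B0 by (simp add: s_def)
      qed
    qed
    show "integrable lborel (\<lambda>x. indicator (cball 0 (r + norm e)) x *\<^sub>R (B * norm e))"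
      by (rule borel_integrable_compact) auto
  qed (simp_all add: s_def)
  moreover have "(\<integral>x. s n x \<partial>lborel) = 0" for n
  proof -
    have i: "integrable lborel f" by (rule integrable_compact_support[OF contf supp])
    have "integrable lborel (\<lambda>x. f (x + h))" for h
    proof (rule integrable_compact_support[where r="r + norm h"])
      show "continuous_on UNIV (\<lambda>x. f (x + h))"
        by (intro continuous_on_compose2[OF contf] continuous_intros) auto
      show "f (y + h) = 0" if "r + norm h < norm y" for y
        using that norm_diff_ineq[of y h] by (intro supp) linarith
    qed
    then show ?thesis
      unfolding s_def using i integral_lborel_translate[OF fm, of "(1 / real (Suc n)) *\<^sub>R e"] by simp
  qed
  ultimately show ?thesis by (simp add: LIMSEQ_const_iff)
qed

text \<open>The derivative is represented by the vector of its values on the basis, so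
  \<open>gradient\<close> is the genuine gradient and not an unspecified value of
  \<open>THE\<close>.\<close>

lemma C_class_Suc_D:
  assumes "C_class (Suc n) f"
  shows "GDERIV f x :> gradient f x" "continuous_on UNIV f"
proof -
  have d: "f differentiable (at x)" for x using assms unfolding C_class.simps by blast
  have G: "GDERIV f x :> gradient f x" for x
  proof -
    obtain D where D: "(f has_derivative D) (at x)" using d[of x] by (auto simp: differentiable_def)
    then interpret bounded_linear D by (rule has_derivative_bounded_linear)
    have "D h = h \<bullet> (\<Sum>b\<in>Basis. D b *\<^sub>R b)" for h
    proof -
      have "D h = D (\<Sum>b\<in>Basis. (h \<bullet> b) *\<^sub>R b)" by (simp add: euclidean_representation)
      then show ?thesis by (simp add: sum scaleR inner_sum_right mult.commute)
    qed
    then have "GDERIV f x :> (\<Sum>b\<in>Basis. D b *\<^sub>R b)"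
      unfolding gderiv_def by (intro has_derivative_eq_rhs[OF D] ext)
    then show ?thesis using gradient_eqI by metis
  qed
  show "GDERIV f x :> gradient f x" by (rule G)
  show "continuous_on UNIV f"
    using G unfolding gderiv_def by (meson continuous_at_imp_continuous_on has_derivative_continuous)
qed

lemma C_class_continuous: "C_class n f \<Longrightarrow> continuous_on UNIV f"
  by (cases n) (use C_class_Suc_D(2) in auto)

lemma C_class_gradient_continuous:
  assumes "C_class (Suc n) f"
  shows "continuous_on UNIV (gradient f)"
proof -
  have "continuous_on UNIV (\<lambda>x. gradient f x \<bullet> b)" if "b \<in> Basis" for b
    using assms that C_class_continuous[of n "\<lambda>x. gradient f x \<bullet> b"] by simp
  then show ?thesis by (subst continuous_on_componentwise) blast
qed

lemma gradient_support:
  assumes "C_class (Suc n) f" "\<And>y. r < norm y \<Longrightarrow> f y = 0" "r < norm x"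
  shows "gradient f x = 0"
proof (rule gradient_eqI)
  have o: "open {y::plane. r < norm y}"
    by (intro open_Collect_less continuous_intros)
  have "GDERIV (\<lambda>_. 0) x :> 0" by (rule GDERIV_const)
  then show "GDERIV f x :> 0"
    unfolding gderiv_def
    by (rule has_derivative_transform_within_open[OF _ o]) (use assms(2,3) in \<open>simp_all only: mem_Collect_eq\<close>)
qed

text \<open>The Fourier transform of \<open>f\<close> at \<open>e *\<^sub>R freq k\<close>. For a
  mollifier \<open>f\<close> and positive \<open>e\<close> it is the factor by which convolution
  with \<open>rescale f e\<close> multiplies mode \<open>k\<close>.\<close>

definition plane_coeff :: "real \<Rightarrow> (plane \<Rightarrow> real) \<Rightarrow> int \<times> int \<Rightarrow> complex" where
  "plane_coeff e f k = (\<integral>y. cnj (fmode k (e *\<^sub>R y)) * of_real (f y) \<partial>lborel)"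

lemma integrable_plane_coeff:
  assumes "continuous_on UNIV f" "\<And>y. r < norm y \<Longrightarrow> f y = 0"
  shows "integrable lborel (\<lambda>y. cnj (fmode k (e *\<^sub>R y)) * of_real (f y))"
proof (rule integrable_compact_support[where r=r])
  show "continuous_on UNIV (\<lambda>y. cnj (fmode k (e *\<^sub>R y)) * complex_of_real (f y))"
    by (intro continuous_intros assms(1) continuous_on_compose2[OF continuous_on_fmode[of UNIV]]) auto
qed (simp add: assms(2))

lemma norm_plane_coeff_le:
  assumes "continuous_on UNIV f" "\<And>y. r < norm y \<Longrightarrow> f y = 0"
  shows "cmod (plane_coeff e f k) \<le> (\<integral>y. \<bar>f y\<bar> \<partial>lborel)"
  unfolding plane_coeff_def
  using integral_norm_bound[of lborel "\<lambda>y. cnj (fmode k (e *\<^sub>R y)) * complex_of_real (f y)"] by (simp add: norm_mult)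

text \<open>Integration by parts against cosine and sine; compact support leaves no boundary
  term.\<close>

lemma plane_coeff_derivative:
  assumes f: "C_class (Suc n) f" and supp: "\<And>y. r < norm y \<Longrightarrow> f y = 0"
  shows "plane_coeff e (\<lambda>x. gradient f x \<bullet> b) k = \<i> * of_real (e * (freq k \<bullet> b)) * plane_coeff e f k"
proof -
  note D = C_class_Suc_D[OF f]
  have cG: "continuous_on UNIV (gradient f)" by (rule C_class_gradient_continuous[OF f])
  have main: "(\<integral>y. (gradient f y \<bullet> b) * (p * cos (e * (freq k \<bullet> y)) + q * sin (e * (freq k \<bullet> y)))
      + f y * (e * (freq k \<bullet> b)) * (q * cos (e * (freq k \<bullet> y)) - p * sin (e * (freq k \<bullet> y))) \<partial>lborel) = 0" for p q
  proof -
    define t where "t y = p * cos (e * (freq k \<bullet> y)) + q * sin (e * (freq k \<bullet> y))" for y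
    define t' where "t' y = (e * (q * cos (e * (freq k \<bullet> y)) - p * sin (e * (freq k \<bullet> y)))) *\<^sub>R freq k" for y
    have t: "GDERIV t y :> t' y" for y
      unfolding gderiv_def t_def[abs_def] t'_def
      by (rule derivative_eq_intros refl)+ (auto simp: algebra_simps inner_commute)
    have "(\<integral>y. (f y *\<^sub>R t' y + t y *\<^sub>R gradient f y) \<bullet> b \<partial>lborel) = 0"
    proof (rule integral_plane_derivative[where f="\<lambda>y. f y * t y" and r=r])
      show "GDERIV (\<lambda>y. f y * t y) y :> f y *\<^sub>R t' y + t y *\<^sub>R gradient f y" for y
        by (rule GDERIV_mult[OF D(1) t])
      show "continuous_on UNIV (\<lambda>y. f y *\<^sub>R t' y + t y *\<^sub>R gradient f y)"
        unfolding t_def t'_def by (intro continuous_intros D(2) cG)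
    qed (simp add: supp)
    then show ?thesis
      by (simp add: t_def t'_def inner_add_left algebra_simps)
  qed
  have fm: "fmode k (e *\<^sub>R y) = cis (e * (freq k \<bullet> y))" for y
    by (simp add: fmode_def)
  have gs: "gradient f y \<bullet> b = 0" if "r < norm y" for y
    using gradient_support[OF f supp that] by simp
  have cgb: "continuous_on UNIV (\<lambda>y. gradient f y \<bullet> b)"
    by (intro continuous_intros cG)
  note i1 = integrable_plane_coeff[OF D(2) supp, of r k e]
  note i2 = integrable_plane_coeff[OF cgb gs, of r k e]
  have re: "integrable lborel (\<lambda>y. f y * cos (e * (freq k \<bullet> y)))" "integrable lborel (\<lambda>y. f y * sin (e * (freq k \<bullet> y)))"
    "integrable lborel (\<lambda>y. (gradient f y \<bullet> b) * cos (e * (freq k \<bullet> y)))" "integrable lborel (\<lambda>y. (gradient f y \<bullet> b) * sin (e * (freq k \<bullet> y)))"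
    by (rule integrable_compact_support[where r=r]; (intro continuous_intros D(2) cG | simp add: supp gs))+
  have P: "Re (plane_coeff e u k) = (\<integral>y. u y * cos (e * (freq k \<bullet> y)) \<partial>lborel)"
     "Im (plane_coeff e u k) = - (\<integral>y. u y * sin (e * (freq k \<bullet> y)) \<partial>lborel)"
    if i: "integrable lborel (\<lambda>y. cnj (fmode k (e *\<^sub>R y)) * complex_of_real (u y))" for u
  proof -
    show "Re (plane_coeff e u k) = (\<integral>y. u y * cos (e * (freq k \<bullet> y)) \<partial>lborel)"
      unfolding plane_coeff_def integral_Re[OF i, symmetric] by (simp add: fm mult.commute)
    have "Im (plane_coeff e u k) = (\<integral>y. - (u y * sin (e * (freq k \<bullet> y))) \<partial>lborel)"
      unfolding plane_coeff_def integral_Im[OF i, symmetric] by (simp add: fm mult.commute)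
    then show "Im (plane_coeff e u k) = - (\<integral>y. u y * sin (e * (freq k \<bullet> y)) \<partial>lborel)" by simp
  qed
  have c: "(\<integral>y. (gradient f y \<bullet> b) * cos (e * (freq k \<bullet> y)) \<partial>lborel) = (e * (freq k \<bullet> b)) * (\<integral>y. f y * sin (e * (freq k \<bullet> y)) \<partial>lborel)"
  proof -
    have "(\<integral>y. (gradient f y \<bullet> b) * cos (e * (freq k \<bullet> y)) - (e * (freq k \<bullet> b)) * (f y * sin (e * (freq k \<bullet> y))) \<partial>lborel) = 0"
      using main[of 1 0] by (simp add: mult_ac)
    then show ?thesis
      using re by simp
  qed
  have s: "(\<integral>y. (gradient f y \<bullet> b) * sin (e * (freq k \<bullet> y)) \<partial>lborel) = - ((e * (freq k \<bullet> b)) * (\<integral>y. f y * cos (e * (freq k \<bullet> y)) \<partial>lborel))"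
  proof -
    have "(\<integral>y. (gradient f y \<bullet> b) * sin (e * (freq k \<bullet> y)) + (e * (freq k \<bullet> b)) * (f y * cos (e * (freq k \<bullet> y))) \<partial>lborel) = 0"
      using main[of 0 1] by (simp add: mult_ac)
    then show ?thesis
      using re by simp
  qed
  show ?thesis
    unfolding complex_eq_iff using c s by (simp add: P[OF i1] P[OF i2])
qed

text \<open>Each derivative is traded for a factor \<open>e\<close> times the frequency component,
  and the coefficients of the last derivative are bounded by its L1 norm. The constant may depend on
  \<open>e\<close>: this decay serves only to make series converge.\<close>

lemma plane_coeff_decay_component:
  assumes "C_class n f" "\<And>y. r < norm y \<Longrightarrow> f y = 0" "e > 0" "b \<in> Basis"
  shows "\<exists>C. \<forall>k. \<bar>freq k \<bullet> b\<bar> ^ n * cmod (plane_coeff e f k) \<le> C"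
  using assms(1,2)
proof (induction n arbitrary: f)
  case 0
  then show ?case
    by (intro exI allI, simp only: power_0 mult_1_left)
      (rule norm_plane_coeff_le[OF C_class_continuous[OF 0(1)]], rule 0(2))
next
  case (Suc n)
  have "\<exists>C. \<forall>k. \<bar>freq k \<bullet> b\<bar> ^ n * cmod (plane_coeff e (\<lambda>x. gradient f x \<bullet> b) k) \<le> C"
    by (rule Suc.IH) (use Suc.prems assms(4) gradient_support[OF Suc.prems] in auto)
  then obtain C where C: "\<bar>freq k \<bullet> b\<bar> ^ n * cmod (plane_coeff e (\<lambda>x. gradient f x \<bullet> b) k) \<le> C" for k
    by blast
  have "\<bar>freq k \<bullet> b\<bar> ^ Suc n * cmod (plane_coeff e f k) \<le> C / e" for k
  proof -
    have eq: "plane_coeff e (\<lambda>x. gradient f x \<bullet> b) k = \<i> * of_real (e * (freq k \<bullet> b)) * plane_coeff e f k"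
      by (rule plane_coeff_derivative[OF Suc.prems(1)], rule Suc.prems(2))
    have "e * (\<bar>freq k \<bullet> b\<bar> ^ Suc n * cmod (plane_coeff e f k)) \<le> C"
      using C[of k] \<open>e > 0\<close> unfolding eq by (simp add: norm_mult abs_mult mult_ac)
    then show ?thesis using \<open>e > 0\<close> by (simp add: field_simps)
  qed
  then show ?case by blast
qed

lemma norm_freq_power_le: "norm (freq k) ^ n \<le> 2 ^ n * (\<bar>freq k \<bullet> (1, 0)\<bar> ^ n + \<bar>freq k \<bullet> (0, 1)\<bar> ^ n)"
proof -
  let ?a = "\<bar>freq k \<bullet> (1, 0)\<bar>" and ?b = "\<bar>freq k \<bullet> (0, 1)\<bar>"
  have "norm (freq k) \<le> ?a + ?b"
    using norm_Pair_le[of "fst (freq k)" "snd (freq k)"] by (simp add: inner_prod_def)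
  also have "\<dots> \<le> 2 * max ?a ?b" by simp
  finally have "norm (freq k) ^ n \<le> (2 * max ?a ?b) ^ n" by (intro power_mono) auto
  also have "\<dots> = 2 ^ n * max ?a ?b ^ n" by (rule power_mult_distrib)
  also have "max ?a ?b ^ n \<le> ?a ^ n + ?b ^ n" by (simp add: max_def)
  finally show ?thesis by simp
qed

lemma one_plus_power_le: "0 \<le> t \<Longrightarrow> (1 + t) ^ n \<le> 2 ^ n * (1 + t ^ n)" for t :: real
proof -
  assume "0 \<le> t"
  then have "(1 + t) ^ n \<le> (2 * max 1 t) ^ n" by (intro power_mono) auto
  also have "\<dots> = 2 ^ n * max 1 t ^ n" by (rule power_mult_distrib)
  also have "max 1 t ^ n \<le> 1 + t ^ n" using \<open>0 \<le> t\<close> by (simp add: max_def)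
  finally show ?thesis by simp
qed

lemma plane_coeff_decay:
  assumes f: "smooth_function f" "\<And>y. r < norm y \<Longrightarrow> f y = 0" and "e > 0"
  obtains C where "\<And>k. (1 + norm (freq k)) ^ n * cmod (plane_coeff e f k) \<le> C"
proof -
  have Cc: "C_class m f" for m using f(1) by (simp add: smooth_function_def)
  have B: "(1, 0) \<in> (Basis :: plane set)" "(0, 1) \<in> (Basis :: plane set)"
    by (auto simp: Basis_prod_def)
  obtain C0 where C0: "cmod (plane_coeff e f k) \<le> C0" for k
    using norm_plane_coeff_le[OF C_class_continuous[OF Cc[of 0]], of r] f(2) by blast
  obtain C1 where C1: "\<bar>freq k \<bullet> (1, 0)\<bar> ^ n * cmod (plane_coeff e f k) \<le> C1" for k
    using plane_coeff_decay_component[OF Cc f(2) \<open>e > 0\<close> B(1)] by blast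
  obtain C2 where C2: "\<bar>freq k \<bullet> (0, 1)\<bar> ^ n * cmod (plane_coeff e f k) \<le> C2" for k
    using plane_coeff_decay_component[OF Cc f(2) \<open>e > 0\<close> B(2)] by blast
  have "(1 + norm (freq k)) ^ n * cmod (plane_coeff e f k) \<le> 2 ^ n * (C0 + 2 ^ n * (C1 + C2))" for k
  proof -
    have "(1 + norm (freq k)) ^ n * cmod (plane_coeff e f k)
       \<le> (2 ^ n * (1 + 2 ^ n * (\<bar>freq k \<bullet> (1, 0)\<bar> ^ n + \<bar>freq k \<bullet> (0, 1)\<bar> ^ n))) * cmod (plane_coeff e f k)"
      using one_plus_power_le[of "norm (freq k)" n] norm_freq_power_le[of k n]
      by (intro mult_right_mono) (auto intro: order_trans)
    also have "\<dots> = 2 ^ n * (cmod (plane_coeff e f k) + 2 ^ n * (\<bar>freq k \<bullet> (1, 0)\<bar> ^ n * cmod (plane_coeff e f k)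
        + \<bar>freq k \<bullet> (0, 1)\<bar> ^ n * cmod (plane_coeff e f k)))"
      by (simp add: algebra_simps)
    also have "\<dots> \<le> 2 ^ n * (C0 + 2 ^ n * (C1 + C2))"
      using C0[of k] C1[of k] C2[of k] by (intro mult_left_mono add_mono) auto
    finally show ?thesis .
  qed
  then show thesis by (rule that)
qed

lemma summable_int_inverse_square: "(\<lambda>i::int. 1 / (1 + \<bar>real_of_int i\<bar>)\<^sup>2) summable_on UNIV"
proof -
  have s: "summable (\<lambda>n. 1 / (1 + real n)\<^sup>2)"
    using summable_Suc_iff[of "\<lambda>n. inverse (real n ^ 2)"] inverse_power_summable[of 2, where 'a=real]
    by (simp add: inverse_eq_divide add.commute)
  then have n: "(\<lambda>n. 1 / (1 + real n)\<^sup>2) summable_on UNIV"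
    by (intro norm_summable_imp_summable_on) simp
  have "(\<lambda>i::int. 1 / (1 + \<bar>real_of_int i\<bar>)\<^sup>2) summable_on (range int)"
    by (subst summable_on_reindex) (use n in \<open>simp_all add: o_def\<close>)
  moreover have "(\<lambda>i::int. 1 / (1 + \<bar>real_of_int i\<bar>)\<^sup>2) summable_on (range (\<lambda>n. - int n))"
    by (subst summable_on_reindex) (use n in \<open>simp_all add: o_def inj_on_def\<close>)
  ultimately have "(\<lambda>i::int. 1 / (1 + \<bar>real_of_int i\<bar>)\<^sup>2) summable_on (range int \<union> range (\<lambda>n. - int n))"
    by (rule summable_on_union)
  moreover have "range int \<union> range (\<lambda>n. - int n) = UNIV"
  proof -
    have "i \<in> range int \<union> range (\<lambda>n. - int n)" for i
      by (cases i rule: int_cases2) auto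
    then show ?thesis by blast
  qed
  ultimately show ?thesis by simp
qed

text \<open>The fourth power splits into a square for each coordinate, which puts the weight below a
  product of two summable one-dimensional weights.\<close>

lemma summable_freq_weight: "(\<lambda>k. 1 / (1 + norm (freq k)) ^ 4) summable_on UNIV"
proof -
  let ?w = "\<lambda>i::int. 1 / (1 + \<bar>real_of_int i\<bar>)\<^sup>2"
  have w: "(\<lambda>(i, j). ?w i * ?w j) abs_summable_on (UNIV \<times> UNIV)"
  proof (rule Infinite_Sum.abs_summable_on_Sigma_iff[THEN iffD2], intro conjI ballI)
    show "(\<lambda>j. case (i, j) of (i, j) \<Rightarrow> ?w i * ?w j) abs_summable_on UNIV" for i
      using summable_on_cmult_right[OF summable_int_inverse_square, of "?w i"] by simp
    have "norm (case (i, j) of (i, j) \<Rightarrow> ?w i * ?w j) = ?w i * ?w j" for i j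
      by (simp add: abs_mult)
    then have eq: "(\<Sum>\<^sub>\<infinity>j. norm (case (i, j) of (i, j) \<Rightarrow> ?w i * ?w j)) = ?w i * (\<Sum>\<^sub>\<infinity>j. ?w j)" for i
      by (simp only: infsum_cmult_right')
    have "(\<lambda>i. ?w i * (\<Sum>\<^sub>\<infinity>j. ?w j)) summable_on UNIV"
      by (intro summable_on_cmult_left summable_int_inverse_square)
    then show "(\<lambda>i. \<Sum>\<^sub>\<infinity>j. norm (case (i, j) of (i, j) \<Rightarrow> ?w i * ?w j)) abs_summable_on UNIV"
      unfolding eq by (rule summable_on_iff_abs_summable_on_real[THEN iffD1])
  qed
  have "(\<lambda>k. 1 / (1 + norm (freq k)) ^ 4) abs_summable_on UNIV"
  proof (rule Infinite_Sum.abs_summable_on_comparison_test[OF w[unfolded UNIV_Times_UNIV]])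
    fix k :: "int \<times> int"
    have fs: "\<bar>real_of_int (fst k)\<bar> \<le> norm (freq k)" "\<bar>real_of_int (snd k)\<bar> \<le> norm (freq k)"
      using norm_fst_le[of "of_int (fst k) :: real" "of_int (snd k) :: real"]
        norm_snd_le[of "of_int (snd k) :: real" "of_int (fst k) :: real"] by (simp_all add: freq_def)
    have "(1 + \<bar>real_of_int (fst k)\<bar>)\<^sup>2 * (1 + \<bar>real_of_int (snd k)\<bar>)\<^sup>2 \<le> (1 + norm (freq k))\<^sup>2 * (1 + norm (freq k))\<^sup>2"
      using fs by (intro mult_mono power_mono) auto
    also have "\<dots> = (1 + norm (freq k)) ^ 4" by (simp flip: power_add)
    finally have le: "(1 + \<bar>real_of_int (fst k)\<bar>)\<^sup>2 * (1 + \<bar>real_of_int (snd k)\<bar>)\<^sup>2 \<le> (1 + norm (freq k)) ^ 4" .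
    have "1 / (1 + norm (freq k)) ^ 4 \<le> 1 / ((1 + \<bar>real_of_int (fst k)\<bar>)\<^sup>2 * (1 + \<bar>real_of_int (snd k)\<bar>)\<^sup>2)"
      by (rule divide_left_mono[OF le]) (auto intro!: mult_pos_pos zero_less_power add_pos_nonneg)
    then show "norm (1 / (1 + norm (freq k)) ^ 4) \<le> norm (case k of (i, j) \<Rightarrow> ?w i * ?w j)"
      by (simp add: case_prod_beta abs_mult)
  qed
  then show ?thesis by simp
qed

section \<open>The mollified noise and field as Fourier series\<close>

abbreviation moll_coeff :: "(plane \<Rightarrow> real) \<Rightarrow> real \<Rightarrow> int \<times> int \<Rightarrow> complex" where
  "moll_coeff \<rho> e \<equiv> plane_coeff e \<rho>"

lemma mollifier_support:
  assumes "mollifier \<rho>"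
  obtains r where "\<And>y. r < norm y \<Longrightarrow> \<rho> y = 0"
proof -
  obtain r where "\<And>y. y \<in> {y. \<rho> y \<noteq> 0} \<Longrightarrow> norm y \<le> r"
    using assms unfolding mollifier_def bounded_iff by blast
  then show thesis using that by (metis (mono_tags, lifting) mem_Collect_eq not_le)
qed

lemma mollifier_continuous: "mollifier \<rho> \<Longrightarrow> continuous_on UNIV \<rho>"
  using C_class_continuous[of 0 \<rho>] by (simp add: mollifier_def smooth_function_def)

text \<open>The weight of degree 2 allows two termwise differentiations, as the Laplacian of the
  mollified field requires.\<close>

lemma abs_summable_mollified:
  assumes f: "real_distribution f" and \<rho>: "mollifier \<rho>" and "e > 0"
  shows "(\<lambda>k. of_real ((1 + norm (freq k)) ^ 2) * (f k * moll_coeff \<rho> e k)) abs_summable_on UNIV"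
proof -
  obtain C N where C: "\<And>k. cmod (f k) \<le> C * (1 + norm (freq k)) ^ N"
    using f unfolding real_distribution_def by blast
  have C0: "0 \<le> C" using order_trans[OF norm_ge_zero C[of 0]] by simp
  obtain r where r: "\<And>y. r < norm y \<Longrightarrow> \<rho> y = 0" using mollifier_support[OF \<rho>] by blast
  \<comment> \<open>N powers absorb the growth of \<open>f\<close>, two the weight in the claim, and
    four make the sum over all frequencies converge.\<close>
  obtain D where D: "\<And>k. (1 + norm (freq k)) ^ (N + 6) * cmod (moll_coeff \<rho> e k) \<le> D"
    using plane_coeff_decay[of \<rho> r e "N + 6"] r \<rho> \<open>e > 0\<close> unfolding mollifier_def by blast
  have D0: "0 \<le> D"
    by (rule order_trans[OF _ D[of 0]]) simp
  show ?thesis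
  proof (rule Infinite_Sum.abs_summable_on_comparison_test)
    show "(\<lambda>k. (C * D) * (1 / (1 + norm (freq k)) ^ 4)) abs_summable_on UNIV"
      using summable_on_cmult_right[OF summable_freq_weight, of "C * D"] C0 D0 by simp
    fix k
    let ?t = "1 + norm (freq k)"
    have t: "?t > 0" by (simp add: add_pos_nonneg)
    have "norm (of_real (?t ^ 2) * (f k * moll_coeff \<rho> e k)) = ?t ^ 2 * (cmod (f k) * cmod (moll_coeff \<rho> e k))"
      unfolding norm_mult norm_of_real using t by simp
    also have "\<dots> \<le> ?t ^ 2 * ((C * ?t ^ N) * cmod (moll_coeff \<rho> e k))"
      by (intro mult_left_mono mult_right_mono C) auto
    also have "\<dots> = C * (?t ^ (N + 6) * cmod (moll_coeff \<rho> e k)) / ?t ^ 4"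
    proof -
      have "N + 6 = 2 + N + 4" by simp
      then have "?t ^ (N + 6) = ?t ^ 2 * ?t ^ N * ?t ^ 4" by (simp only: power_add)
      then show ?thesis using t by simp
    qed
    also have "\<dots> \<le> C * D / ?t ^ 4"
      using t by (intro divide_right_mono mult_left_mono D C0) auto
    finally show "norm (of_real (?t ^ 2) * (f k * moll_coeff \<rho> e k)) \<le> norm ((C * D) * (1 / ?t ^ 4))"
      using C0 D0 t by simp
  qed
qed

text \<open>The normalisation in \<open>rescale\<close> cancels the Jacobian of the dilation, which
  leaves the Fourier transform of the unscaled mollifier at a scaled frequency.\<close>

lemma convolve_rescale:
  assumes \<rho>: "mollifier \<rho>" and "e > 0"
  shows "convolve f (rescale \<rho> e) x = Re (fourier (\<lambda>k. f k * moll_coeff \<rho> e k) x)"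
proof -
  have c: "continuous_on UNIV \<rho>" by (rule mollifier_continuous[OF \<rho>])
  have [measurable]: "\<rho> \<in> borel_measurable borel" using c by (rule borel_measurable_continuous_onI)
  have "(\<integral>y. fmode k (x - y) * complex_of_real (rescale \<rho> e y) \<partial>lborel) = fmode k x * moll_coeff \<rho> e k" for k
  proof -
    have *: "(\<lambda>y. fmode k (x - y)) = (\<lambda>y. fmode k x * cnj (fmode k y))"
      using fmode_translate[of k x "- y" for y] by (auto simp: fmode_def cis_cnj)
    have m: "(\<lambda>y. fmode k (x - y) * complex_of_real (rescale \<rho> e y)) \<in> borel_measurable borel"
      unfolding * rescale_def fmode_uminus[symmetric] by measurable
    have "(\<integral>y. fmode k (x - y) * complex_of_real (rescale \<rho> e y) \<partial>lborel)
       = e\<^sup>2 *\<^sub>R (\<integral>y. fmode k (x - e *\<^sub>R y) * complex_of_real (rescale \<rho> e (e *\<^sub>R y)) \<partial>lborel)"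
      by (rule integral_lborel_scale[OF m \<open>e > 0\<close>])
    also have "(\<lambda>y. fmode k (x - e *\<^sub>R y) * complex_of_real (rescale \<rho> e (e *\<^sub>R y)))
        = (\<lambda>y. (fmode k x / of_real (e\<^sup>2)) * (cnj (fmode k (e *\<^sub>R y)) * of_real (\<rho> y)))"
      using \<open>e > 0\<close> fun_cong[OF *, of "e *\<^sub>R y" for y] by (auto simp: rescale_def)
    also have "e\<^sup>2 *\<^sub>R (\<integral>y. (fmode k x / of_real (e\<^sup>2)) * (cnj (fmode k (e *\<^sub>R y)) * of_real (\<rho> y)) \<partial>lborel)
        = fmode k x * moll_coeff \<rho> e k"
      unfolding integral_mult_right_zero plane_coeff_def using \<open>e > 0\<close> by (simp add: scaleR_conv_of_real)
    finally show ?thesis .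
  qed
  then show ?thesis by (simp add: convolve_def fourier_def mult_ac)
qed

lemma moll_coeff_uminus: "moll_coeff \<rho> e (- k) = cnj (moll_coeff \<rho> e k)"
  unfolding plane_coeff_def Bochner_Integration.integral_cnj[symmetric]
  by (simp add: fmode_uminus)

lemma moll_coeff_0: "mollifier \<rho> \<Longrightarrow> moll_coeff \<rho> e 0 = 1"
  unfolding plane_coeff_def mollifier_def by simp

lemma real_distribution_uminus: "real_distribution f \<Longrightarrow> f (- k) = cnj (f k)"
  unfolding real_distribution_def by blast

lemma real_distribution_noise_X:
  assumes "real_distribution f"
  shows "real_distribution (noise_X f)"
proof -
  obtain C N where C: "\<And>k. cmod (f k) \<le> C * (1 + norm (freq k)) ^ N"
    using assms unfolding real_distribution_def by blast
  have "cmod (noise_X f k) \<le> cmod (f k)" for k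
  proof (cases "k = 0")
    case False
    have "1 \<le> (of_int (fst k))\<^sup>2 + (of_int (snd k) :: real)\<^sup>2"
    proof -
      have "fst k \<noteq> 0 \<or> snd k \<noteq> 0" using False by (auto simp: prod_eq_iff)
      then have "1 \<le> (fst k)\<^sup>2 + (snd k)\<^sup>2"
        by (smt (verit) zero_less_power2 zero_le_power2)
      then have "real_of_int 1 \<le> real_of_int ((fst k)\<^sup>2 + (snd k)\<^sup>2)" by (simp only: of_int_le_iff)
      then show ?thesis by simp
    qed
    then have "1 \<le> (norm (freq k))\<^sup>2" by (simp add: norm_prod_def freq_def)
    then show ?thesis using False mult_left_mono[of 1 "(norm (freq k))\<^sup>2" "cmod (f k)"]
      by (simp add: noise_X_def norm_divide norm_power divide_le_eq)
  qed (simp add: noise_X_def)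
  then have "cmod (noise_X f k) \<le> C * (1 + norm (freq k)) ^ N" for k
    using C order_trans by blast
  moreover have "noise_X f (- k) = cnj (noise_X f k)" for k
    using real_distribution_uminus[OF assms] by (simp add: noise_X_def freq_minus)
  ultimately show ?thesis unfolding real_distribution_def by blast
qed

text \<open>One differentiation spends one of the two powers; what is left is the weight of degree 1
  that \<open>GDERIV_fourier\<close> asks for.\<close>

lemma weight_dx:
  assumes a: "(\<lambda>k. of_real ((1 + norm (freq k)) ^ 2) * a k) abs_summable_on UNIV"
  shows "(\<lambda>k. of_real (1 + norm (freq k)) * a k) abs_summable_on UNIV"
    and "(\<lambda>k. of_real (1 + norm (freq k)) * dx1 a k) abs_summable_on UNIV"
    and "(\<lambda>k. of_real (1 + norm (freq k)) * dx2 a k) abs_summable_on UNIV"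
proof -
  have fs: "\<bar>of_int (fst k)\<bar> \<le> 1 + norm (freq k)" "\<bar>of_int (snd k)\<bar> \<le> 1 + norm (freq k)" for k
    using norm_fst_le[of "of_int (fst k) :: real" "of_int (snd k) :: real"]
      norm_snd_le[of "of_int (snd k) :: real" "of_int (fst k) :: real"] by (simp_all add: freq_def)
  have n2: "norm (complex_of_real ((1 + norm (freq k)) ^ 2) * a k) = (1 + norm (freq k)) * ((1 + norm (freq k)) * cmod (a k))" for k
    unfolding norm_mult norm_of_real by (simp add: power2_eq_square abs_mult)
  have n1: "norm (complex_of_real (1 + norm (freq k)) * b) = (1 + norm (freq k)) * cmod b" for k b
    unfolding norm_mult norm_of_real by simp
  have t: "1 \<le> 1 + norm (freq k)" "0 \<le> 1 + norm (freq k)" for k by simp_all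
  show "(\<lambda>k. of_real (1 + norm (freq k)) * a k) abs_summable_on UNIV"
    by (rule Infinite_Sum.abs_summable_on_comparison_test[OF a], unfold n1 n2)
      (rule mult_left_mono[OF _ t(2)], use t in \<open>simp add: distrib_right\<close>)
  show "(\<lambda>k. of_real (1 + norm (freq k)) * dx1 a k) abs_summable_on UNIV"
    by (rule Infinite_Sum.abs_summable_on_comparison_test[OF a], unfold n1 n2)
      (rule mult_left_mono[OF _ t(2)], use mult_right_mono[OF fs(1)] in \<open>simp add: dx1_def norm_mult\<close>)
  show "(\<lambda>k. of_real (1 + norm (freq k)) * dx2 a k) abs_summable_on UNIV"
    by (rule Infinite_Sum.abs_summable_on_comparison_test[OF a], unfold n1 n2)
      (rule mult_left_mono[OF _ t(2)], use mult_right_mono[OF fs(2)] in \<open>simp add: dx2_def norm_mult\<close>)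
qed

lemma dx_uminus:
  assumes "\<And>k. a (- k) = cnj (a k)"
  shows "dx1 a (- k) = cnj (dx1 a k)" "dx2 a (- k) = cnj (dx2 a k)"
  by (simp_all add: dx1_def dx2_def assms)

definition X_coeff :: "(plane \<Rightarrow> real) \<Rightarrow> real \<Rightarrow> torus_distribution \<Rightarrow> torus_distribution" where
  "X_coeff \<rho> e \<xi> k = noise_X \<xi> k * moll_coeff \<rho> e k"

definition noise_coeff :: "(plane \<Rightarrow> real) \<Rightarrow> real \<Rightarrow> torus_distribution \<Rightarrow> torus_distribution" where
  "noise_coeff \<rho> e \<xi> k = \<xi> k * moll_coeff \<rho> e k"

lemma coeff_uminus:
  assumes "real_distribution \<xi>"
  shows "X_coeff \<rho> e \<xi> (- k) = cnj (X_coeff \<rho> e \<xi> k)" "noise_coeff \<rho> e \<xi> (- k) = cnj (noise_coeff \<rho> e \<xi> k)"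
  using real_distribution_uminus[OF assms] real_distribution_uminus[OF real_distribution_noise_X[OF assms]]
  by (simp_all add: X_coeff_def noise_coeff_def moll_coeff_uminus)

lemma coeff_weights:
  assumes "real_distribution \<xi>" "mollifier \<rho>" "e > 0"
  shows "(\<lambda>k. of_real ((1 + norm (freq k)) ^ 2) * X_coeff \<rho> e \<xi> k) abs_summable_on UNIV"
    and "(\<lambda>k. of_real ((1 + norm (freq k)) ^ 2) * noise_coeff \<rho> e \<xi> k) abs_summable_on UNIV"
  unfolding X_coeff_def noise_coeff_def
  using abs_summable_mollified[OF real_distribution_noise_X[OF assms(1)] assms(2,3)]
    abs_summable_mollified[OF assms] by simp_all

lemma X_eps_eq:
  assumes "mollifier \<rho>" "e > 0"
  shows "X_eps \<rho> e \<xi> = (\<lambda>x. Re (fourier (X_coeff \<rho> e \<xi>) x))" "noise_eps \<rho> e \<xi> = (\<lambda>x. Re (fourier (noise_coeff \<rho> e \<xi>) x))"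
  unfolding X_eps_def noise_eps_def X_coeff_def[abs_def] noise_coeff_def[abs_def] convolve_rescale[OF assms]
  by (rule refl)+

lemma coeff_summable:
  assumes "real_distribution \<xi>" "mollifier \<rho>" "e > 0"
  shows "X_coeff \<rho> e \<xi> abs_summable_on UNIV" "noise_coeff \<rho> e \<xi> abs_summable_on UNIV"
    "dx1 (X_coeff \<rho> e \<xi>) abs_summable_on UNIV" "dx2 (X_coeff \<rho> e \<xi>) abs_summable_on UNIV"
    "dx1 (dx1 (X_coeff \<rho> e \<xi>)) abs_summable_on UNIV" "dx2 (dx1 (X_coeff \<rho> e \<xi>)) abs_summable_on UNIV"
    "dx1 (dx2 (X_coeff \<rho> e \<xi>)) abs_summable_on UNIV" "dx2 (dx2 (X_coeff \<rho> e \<xi>)) abs_summable_on UNIV"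
  using GDERIV_fourier(2-4)[OF weight_dx(1)[OF coeff_weights(1)[OF assms]]]
    GDERIV_fourier(2)[OF weight_dx(1)[OF coeff_weights(2)[OF assms]]]
    GDERIV_fourier(3,4)[OF weight_dx(2)[OF coeff_weights(1)[OF assms]]]
    GDERIV_fourier(3,4)[OF weight_dx(3)[OF coeff_weights(1)[OF assms]]]
  by simp_all

lemma dist_of_noise_eps:
  assumes "real_distribution \<xi>" "mollifier \<rho>" "e > 0"
  shows "dist_of (noise_eps \<rho> e \<xi>) = noise_coeff \<rho> e \<xi>"
  unfolding X_eps_eq[OF assms(2,3)]
  by (rule dist_of_fourier[OF coeff_summable(2)[OF assms] coeff_uminus(2)[OF assms(1)]])

text \<open>Inverse Laplacian and mollification are both Fourier multipliers and commute. Hence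
  \<open>X_eps\<close> is the field of the mollified noise, and bounds of a field by its noise apply
  to it.\<close>

lemma noise_X_noise_coeff: "noise_X (noise_coeff \<rho> e \<xi>) = X_coeff \<rho> e \<xi>"
  by (auto simp: noise_X_def noise_coeff_def X_coeff_def)

lemma GDERIV_X_eps:
  assumes "real_distribution \<xi>" "mollifier \<rho>" "e > 0"
  defines "X1 \<equiv> dx1 (X_coeff \<rho> e \<xi>)" and "X2 \<equiv> dx2 (X_coeff \<rho> e \<xi>)"
  shows "GDERIV (X_eps \<rho> e \<xi>) x :> (Re (fourier X1 x), Re (fourier X2 x))"
    "GDERIV (\<lambda>x. Re (fourier X1 x)) x :> (Re (fourier (dx1 X1) x), Re (fourier (dx2 X1) x))"
    "GDERIV (\<lambda>x. Re (fourier X2 x)) x :> (Re (fourier (dx1 X2) x), Re (fourier (dx2 X2) x))"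
  unfolding X1_def X2_def X_eps_eq[OF assms(2,3)]
  using GDERIV_fourier(1)[OF weight_dx(1)[OF coeff_weights(1)[OF assms(1-3)]]]
    GDERIV_fourier(1)[OF weight_dx(2)[OF coeff_weights(1)[OF assms(1-3)]]]
    GDERIV_fourier(1)[OF weight_dx(3)[OF coeff_weights(1)[OF assms(1-3)]]] by simp_all

text \<open>Away from frequency 0 the Laplacian undoes \<open>noise_X\<close>. At frequency 0 the
  field has no mode and the mollifier has coefficient 1, so exactly \<open>\<xi> 0\<close> has to be
  added.\<close>

lemma noise_eps_laplacian:
  assumes "real_distribution \<xi>" "mollifier \<rho>" "e > 0"
  shows "noise_eps \<rho> e \<xi> x = Re (\<xi> 0) + Re (fourier (dx1 (dx1 (X_coeff \<rho> e \<xi>))) x) + Re (fourier (dx2 (dx2 (X_coeff \<rho> e \<xi>))) x)"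
proof -
  let ?a = "X_coeff \<rho> e \<xi>"
  define d where "d k = (if k = 0 then \<xi> 0 else 0)" for k :: "int \<times> int"
  have d: "fourier d x = \<xi> 0" "d abs_summable_on UNIV"
    using fourier_finite_support[of "{0}" d] by (auto simp: d_def)
  have lap: "noise_coeff \<rho> e \<xi> k = (dx1 (dx1 ?a) k + dx2 (dx2 ?a) k) + d k" for k
  proof (cases "k = 0")
    case True
    then show ?thesis by (simp add: noise_coeff_def d_def dx1_def dx2_def moll_coeff_0[OF assms(2)])
  next
    case False
    define N where "N = (complex_of_real (norm (freq k)))\<^sup>2"
    have N: "N = (of_int (fst k))\<^sup>2 + (of_int (snd k))\<^sup>2"
      unfolding N_def of_real_power[symmetric] by (simp add: norm_prod_def freq_def)
    have "N \<noteq> 0" using False by (simp add: N_def)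
    have "dx1 (dx1 ?a) k + dx2 (dx2 ?a) k = - (N * ?a k)"
      unfolding N dx1_def dx2_def by (simp add: power2_eq_square algebra_simps)
    also have "\<dots> = noise_coeff \<rho> e \<xi> k"
      using False \<open>N \<noteq> 0\<close> by (simp add: X_coeff_def noise_X_def noise_coeff_def flip: N_def)
    finally show ?thesis using False by (simp add: d_def)
  qed
  note s = coeff_summable[OF assms]
  have "fourier (noise_coeff \<rho> e \<xi>) x = fourier (dx1 (dx1 ?a)) x + fourier (dx2 (dx2 ?a)) x + fourier d x"
    unfolding lap[abs_def]
    by (subst fourier_add[OF abs_summable_add_complex[OF s(5) s(8)] d(2)], subst fourier_add[OF s(5) s(8)]) simp
  then show ?thesis
    unfolding X_eps_eq[OF assms(2,3)] by (simp add: d(1))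
qed

text \<open>Since absolutely convergent series form an algebra, the regularised Wick square is one
  of them. This gives both its bracket as an integral and the finiteness of its norm.\<close>

lemma wick_eps_fourier:
  assumes "real_distribution \<xi>" "mollifier \<rho>" "e > 0"
  obtains w where "w abs_summable_on UNIV" "wick_eps \<rho> e c \<xi> = (\<lambda>x. Re (fourier w x))" "dist_of (wick_eps \<rho> e c \<xi>) = w"
proof -
  let ?a = "X_coeff \<rho> e \<xi>"
  note s = coeff_summable[OF assms]
  obtain p where p: "p abs_summable_on UNIV" "\<And>x. fourier p x = fourier (dx1 ?a) x * fourier (dx1 ?a) x"
    using fourier_mult_exists[OF s(3) s(3)] by blast
  obtain q where q: "q abs_summable_on UNIV" "\<And>x. fourier q x = fourier (dx2 ?a) x * fourier (dx2 ?a) x"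
    using fourier_mult_exists[OF s(4) s(4)] by blast
  define d where "d k = (if k = 0 then - complex_of_real c else 0)" for k :: "int \<times> int"
  have d: "fourier d x = - complex_of_real c" "d abs_summable_on UNIV" for x
    using fourier_finite_support[of "{0}" d] by (auto simp: d_def)
  define w where "w k = p k + q k + d k" for k
  have w: "w abs_summable_on UNIV"
    unfolding w_def by (intro abs_summable_add_complex p q d)
  have FSw: "fourier w x = fourier p x + fourier q x + fourier d x" for x
    unfolding w_def
    by (subst fourier_add[OF abs_summable_add_complex[OF p(1) q(1)] d(2)], subst fourier_add[OF p(1) q(1)]) simp
  have real: "fourier (dx1 ?a) x = of_real (Re (fourier (dx1 ?a) x))" "fourier (dx2 ?a) x = of_real (Re (fourier (dx2 ?a) x))" for x
  proof -
    have h: "dx1 ?a (- k) = cnj (dx1 ?a k)" "dx2 ?a (- k) = cnj (dx2 ?a k)" for k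
      by (rule dx_uminus, rule coeff_uminus(1)[OF assms(1)])+
    show "fourier (dx1 ?a) x = of_real (Re (fourier (dx1 ?a) x))" "fourier (dx2 ?a) x = of_real (Re (fourier (dx2 ?a) x))"
      using fourier_real[of "dx1 ?a" x, OF h(1)] fourier_real[of "dx2 ?a" x, OF h(2)] by simp_all
  qed
  have wick: "complex_of_real (wick_eps \<rho> e c \<xi> x) = fourier w x" for x
  proof -
    have "wick_eps \<rho> e c \<xi> x = (Re (fourier (dx1 ?a) x))\<^sup>2 + (Re (fourier (dx2 ?a) x))\<^sup>2 - c"
      unfolding wick_eps_def gradient_eqI[OF GDERIV_X_eps(1)[OF assms]] by (simp add: norm_prod_def)
    then show ?thesis
      unfolding FSw p(2) q(2) d by (subst (1 2) real, subst (1 2) real) (simp add: power2_eq_square)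
  qed
  have "wick_eps \<rho> e c \<xi> = (\<lambda>x. Re (fourier w x))"
    using wick by (metis Re_complex_of_real)
  moreover have "dist_of (wick_eps \<rho> e c \<xi>) = w"
    unfolding dist_of_def wick coeff_fourier[OF w] ..
  ultimately show thesis using w that by blast
qed

text \<open>Blocks commute with convolution: the block of the mollified noise is the integral of
  translates of the block of the noise against the mollifier. The resulting factor is the same for
  every \<open>e\<close>.\<close>

lemma lp_block_mollified:
  assumes d: "dyadic_partition chi phi" and \<rho>: "mollifier \<rho>" and B: "\<And>x. \<bar>lp_block chi phi n \<xi> x\<bar> \<le> B"
  shows "\<bar>lp_block chi phi n (noise_coeff \<rho> e \<xi>) x\<bar> \<le> B * (\<integral>y. \<bar>\<rho> y\<bar> \<partial>lborel)"
proof -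
  let ?m = "lp_multiplier chi phi n"
  let ?A = "{k. ?m k \<noteq> 0}"
  have c: "continuous_on UNIV \<rho>" by (rule mollifier_continuous[OF \<rho>])
  obtain r where r: "\<And>y. r < norm y \<Longrightarrow> \<rho> y = 0" using mollifier_support[OF \<rho>] by blast
  have i: "integrable lborel (\<lambda>y. cnj (fmode k (e *\<^sub>R y)) * complex_of_real (\<rho> y))" for k
    by (rule integrable_plane_coeff[OF c r])
  have i\<rho>: "integrable lborel \<rho>" by (rule integrable_compact_support[OF c r])
  have cont: "continuous_on UNIV (\<lambda>y. lp_block chi phi n \<xi> (x - e *\<^sub>R y))"
    by (intro continuous_on_compose2[OF continuous_on_lp_block[OF d, of UNIV]] continuous_intros) auto
  have ib: "integrable lborel (\<lambda>y. lp_block chi phi n \<xi> (x - e *\<^sub>R y) * \<rho> y)"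
    by (rule integrable_compact_support[where r=r]) (intro continuous_intros cont c | simp add: r)+
  have shift: "fmode k (x - e *\<^sub>R y) = fmode k x * cnj (fmode k (e *\<^sub>R y))" for k y
    using fmode_translate[of k x "- (e *\<^sub>R y)"] by (simp add: fmode_def cis_cnj)
  define S where "S y = (\<Sum>k\<in>?A. (of_real (?m k) * \<xi> k * fmode k x) * (cnj (fmode k (e *\<^sub>R y)) * of_real (\<rho> y)))" for y
  have S: "Re (S y) = lp_block chi phi n \<xi> (x - e *\<^sub>R y) * \<rho> y" for y
  proof -
    have "S y = (\<Sum>k\<in>?A. of_real (?m k) * \<xi> k * fmode k (x - e *\<^sub>R y)) * of_real (\<rho> y)"
      unfolding S_def shift sum_distrib_right by (simp add: mult_ac)
    then show ?thesis by (simp add: lp_block_def)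
  qed
  have iS: "integrable lborel S"
    unfolding S_def by (intro Bochner_Integration.integrable_sum integrable_mult_right i)
  have "(\<Sum>k\<in>?A. of_real (?m k) * noise_coeff \<rho> e \<xi> k * fmode k x) = (\<integral>y. S y \<partial>lborel)"
  proof -
    have "(\<integral>y. S y \<partial>lborel) = (\<Sum>k\<in>?A. (of_real (?m k) * \<xi> k * fmode k x) * plane_coeff e \<rho> k)"
      unfolding S_def plane_coeff_def
      by (subst Bochner_Integration.integral_sum) (intro integrable_mult_right i, simp only: integral_mult_right_zero)
    then show ?thesis by (simp add: noise_coeff_def mult_ac)
  qed
  then have "lp_block chi phi n (noise_coeff \<rho> e \<xi>) x = Re (\<integral>y. S y \<partial>lborel)"
    by (simp add: lp_block_def)
  also have "\<dots> = (\<integral>y. lp_block chi phi n \<xi> (x - e *\<^sub>R y) * \<rho> y \<partial>lborel)"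
    using integral_Re[OF iS] by (simp add: S)
  finally have "\<bar>lp_block chi phi n (noise_coeff \<rho> e \<xi>) x\<bar> \<le> (\<integral>y. \<bar>lp_block chi phi n \<xi> (x - e *\<^sub>R y) * \<rho> y\<bar> \<partial>lborel)"
    by (simp only: integral_abs_bound)
  also have "\<dots> \<le> (\<integral>y. B * \<bar>\<rho> y\<bar> \<partial>lborel)"
  proof (rule integral_mono)
    show "\<bar>lp_block chi phi n \<xi> (x - e *\<^sub>R y) * \<rho> y\<bar> \<le> B * \<bar>\<rho> y\<bar>" for y
      unfolding abs_mult by (rule mult_right_mono[OF B]) simp
  qed (use ib i\<rho> in simp_all)
  finally show ?thesis by simp
qed

section \<open>Conjugation of the regularised form\<close>

lemma integral_torus_partial:
  assumes "\<And>x. GDERIV f x :> (D1 x, D2 x)" "torus_periodic f"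
    "continuous_on UNIV D1" "continuous_on UNIV D2" "torus_periodic D1" "torus_periodic D2"
  shows "(\<integral>x. D1 x \<partial>torus_measure) = 0" "(\<integral>x. D2 x \<partial>torus_measure) = 0"
proof -
  have c: "continuous_on UNIV (\<lambda>x. (D1 x, D2 x))" using assms by (intro continuous_intros)
  have p: "torus_periodic (\<lambda>x. (D1 x, D2 x))" using assms(5,6) by (simp add: torus_periodic_def)
  obtain B where B: "\<And>x. norm (D1 x, D2 x) \<le> B" using continuous_periodic_bounded[OF c p] by blast
  have m: "(\<lambda>x. (D1 x, D2 x)) \<in> borel_measurable borel" using c by (rule borel_measurable_continuous_onI)
  show "(\<integral>x. D1 x \<partial>torus_measure) = 0" "(\<integral>x. D2 x \<partial>torus_measure) = 0"
    using integral_partial_derivative[OF assms(1,2) m B, of "(1, 0)"]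
      integral_partial_derivative[OF assms(1,2) m B, of "(0, 1)"] by simp_all
qed

lemma integral_plane_components:
  fixes f :: "'a \<Rightarrow> plane"
  assumes "integrable M (\<lambda>x. fst (f x))" "integrable M (\<lambda>x. snd (f x))"
  shows "integrable M f" "integral\<^sup>L M f = ((\<integral>x. fst (f x) \<partial>M), (\<integral>x. snd (f x) \<partial>M))"
proof -
  have "integrable M (\<lambda>x. (fst (f x), 0::real))" "integrable M (\<lambda>x. (0::real, snd (f x)))"
    using integrable_bounded_linear[OF bounded_linear_Pair[OF bounded_linear_ident bounded_linear_zero] assms(1)]
      integrable_bounded_linear[OF bounded_linear_Pair[OF bounded_linear_zero bounded_linear_ident] assms(2)]
    by simp_all
  then show i: "integrable M f"
    using Bochner_Integration.integrable_add[of M "\<lambda>x. (fst (f x), 0)" "\<lambda>x. (0, snd (f x))"] by simp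
  show "integral\<^sup>L M f = ((\<integral>x. fst (f x) \<partial>M), (\<integral>x. snd (f x) \<partial>M))"
    using integral_bounded_linear[OF bounded_linear_fst i] integral_bounded_linear[OF bounded_linear_snd i]
    by (simp add: prod_eq_iff)
qed

lemma L2lim_weak_gradient:
  assumes "v \<in> sobolev_H1"
  shows "L2lim (\<lambda>m. fourier_partial m (dx1 (dist_of v))) (\<lambda>x. fst (weak_gradient v x))"
    "L2lim (\<lambda>m. fourier_partial m (dx2 (dist_of v))) (\<lambda>x. snd (weak_gradient v x))"
    "L2lim (\<lambda>m. fourier_partial m (dist_of v)) v"
proof -
  note p = weak_gradient_props[OF assms]
  show "L2lim (\<lambda>m. fourier_partial m (dx1 (dist_of v))) (\<lambda>x. fst (weak_gradient v x))"
    using L2lim_fourier_partial[OF p(4)] unfolding dist_of_weak_gradient(1)[OF p(2) p(1)] .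
  show "L2lim (\<lambda>m. fourier_partial m (dx2 (dist_of v))) (\<lambda>x. snd (weak_gradient v x))"
    using L2lim_fourier_partial[OF p(5)] unfolding dist_of_weak_gradient(2)[OF p(2) p(1)] .
  show "L2lim (\<lambda>m. fourier_partial m (dist_of v)) v"
    by (rule L2lim_fourier_partial[OF p(2)])
qed

section \<open>Continuous periodic weights and integration by parts in H1\<close>

definition cont_periodic :: "(plane \<Rightarrow> real) \<Rightarrow> bool" where
  "cont_periodic f \<longleftrightarrow> continuous_on UNIV f \<and> torus_periodic f"

lemma cont_periodic_arith:
  assumes "cont_periodic f" "cont_periodic g"
  shows "cont_periodic (\<lambda>x. f x + g x)" "cont_periodic (\<lambda>x. f x - g x)" "cont_periodic (\<lambda>x. f x * g x)"
  using assms by (auto simp: cont_periodic_def torus_periodic_def intro!: continuous_intros)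

lemma cont_periodic_const: "cont_periodic (\<lambda>x. c)"
  by (simp add: cont_periodic_def torus_periodic_def)

lemma cont_periodic_exp: "cont_periodic f \<Longrightarrow> cont_periodic (\<lambda>x. exp (f x))"
  by (auto simp: cont_periodic_def torus_periodic_def intro!: continuous_intros)

lemma cont_periodic_fourier_partial: "cont_periodic (fourier_partial m a)"
  by (simp add: cont_periodic_def continuous_on_fourier_partial torus_periodic_fourier_partial)

lemma cont_periodic_bounded:
  assumes "cont_periodic f"
  obtains B where "\<And>x. \<bar>f x\<bar> \<le> B" "B > 0"
  using continuous_periodic_bounded[of f] assms unfolding cont_periodic_def by auto

lemma cont_periodic_measurable: "cont_periodic f \<Longrightarrow> f \<in> borel_measurable borel"
  unfolding cont_periodic_def by (blast intro: borel_measurable_continuous_onI)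

lemma sqint_cont_periodic: "cont_periodic f \<Longrightarrow> sqint f"
  using cont_periodic_bounded[of f] cont_periodic_measurable[of f] sqint_bounded by metis

lemma sqint_mult_cont_periodic: "sqint f \<Longrightarrow> cont_periodic w \<Longrightarrow> sqint (\<lambda>x. f x * w x)"
  using cont_periodic_bounded[of w] cont_periodic_measurable[of w] sqint_mult_bounded[of f w] by metis

lemma integrable_mult3:
  assumes "sqint f" "sqint g" "cont_periodic w"
  shows "integrable torus_measure (\<lambda>x. f x * g x * w x)"
proof -
  obtain B where B: "\<And>x. \<bar>w x\<bar> \<le> B" using cont_periodic_bounded[OF assms(3)] by blast
  show ?thesis
    by (rule integrable_mult_bounded[OF integrable_prod_sqint[OF assms(1,2)] cont_periodic_measurable[OF assms(3)], of B])
      (simp add: B)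
qed

lemma L2lim_bilinear_cont_periodic:
  assumes "L2lim F f" "L2lim G g" "cont_periodic w"
  shows "(\<lambda>m. \<integral>x. F m x * G m x * w x \<partial>torus_measure) \<longlonglongrightarrow> (\<integral>x. f x * g x * w x \<partial>torus_measure)"
proof -
  obtain B where "\<And>x. \<bar>w x\<bar> \<le> B" using cont_periodic_bounded[OF assms(3)] by blast
  then show ?thesis by (rule L2lim_bilinear[OF assms(1,2) cont_periodic_measurable[OF assms(3)]])
qed

text \<open>For partial Fourier sums the product of the two functions and the weight is
  differentiable and periodic, so its partial derivatives integrate to 0. Each term is bilinear in
  quantities that converge in mean square, hence the identity survives the limit.\<close>

lemma integral_by_parts_H1:
  assumes v: "v \<in> sobolev_H1" and u: "u \<in> sobolev_H1"
    and D: "\<And>x. GDERIV w x :> (D1 x, D2 x)" and c: "cont_periodic w" "cont_periodic D1" "cont_periodic D2"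
  shows "(\<integral>x. fst (weak_gradient v x) * u x * w x \<partial>torus_measure)
      + (\<integral>x. v x * fst (weak_gradient u x) * w x \<partial>torus_measure) + (\<integral>x. v x * u x * D1 x \<partial>torus_measure) = 0" (is ?A)
    and "(\<integral>x. snd (weak_gradient v x) * u x * w x \<partial>torus_measure)
      + (\<integral>x. v x * snd (weak_gradient u x) * w x \<partial>torus_measure) + (\<integral>x. v x * u x * D2 x \<partial>torus_measure) = 0" (is ?B)
proof -
  let ?v = "\<lambda>m. fourier_partial m (dist_of v)" and ?u = "\<lambda>m. fourier_partial m (dist_of u)"
  let ?v1 = "\<lambda>m. fourier_partial m (dx1 (dist_of v))" and ?u1 = "\<lambda>m. fourier_partial m (dx1 (dist_of u))"
  let ?v2 = "\<lambda>m. fourier_partial m (dx2 (dist_of v))" and ?u2 = "\<lambda>m. fourier_partial m (dx2 (dist_of u))"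
  note Lv = L2lim_weak_gradient[OF v] and Lu = L2lim_weak_gradient[OF u]
  have G: "GDERIV (\<lambda>x. ?v m x * ?u m x * w x) x :>
      (?v1 m x * ?u m x * w x + ?v m x * ?u1 m x * w x + ?v m x * ?u m x * D1 x,
       ?v2 m x * ?u m x * w x + ?v m x * ?u2 m x * w x + ?v m x * ?u m x * D2 x)" for m x
    by (rule GDERIV_subst[OF GDERIV_mult[OF GDERIV_mult[OF GDERIV_fourier_partial GDERIV_fourier_partial] D]])
      (simp add: algebra_simps)
  have z: "(\<integral>x. ?v1 m x * ?u m x * w x + ?v m x * ?u1 m x * w x + ?v m x * ?u m x * D1 x \<partial>torus_measure) = 0"
     "(\<integral>x. ?v2 m x * ?u m x * w x + ?v m x * ?u2 m x * w x + ?v m x * ?u m x * D2 x \<partial>torus_measure) = 0" for m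
  proof -
    have cp: "cont_periodic (\<lambda>x. ?v m x * ?u m x * w x)"
      "cont_periodic (\<lambda>x. ?v1 m x * ?u m x * w x + ?v m x * ?u1 m x * w x + ?v m x * ?u m x * D1 x)"
      "cont_periodic (\<lambda>x. ?v2 m x * ?u m x * w x + ?v m x * ?u2 m x * w x + ?v m x * ?u m x * D2 x)"
      by (intro cont_periodic_arith cont_periodic_fourier_partial c)+
    show "(\<integral>x. ?v1 m x * ?u m x * w x + ?v m x * ?u1 m x * w x + ?v m x * ?u m x * D1 x \<partial>torus_measure) = 0"
     "(\<integral>x. ?v2 m x * ?u m x * w x + ?v m x * ?u2 m x * w x + ?v m x * ?u m x * D2 x \<partial>torus_measure) = 0"
      using integral_torus_partial[OF G] cp by (simp_all add: cont_periodic_def)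
  qed
  note ii = integrable_mult3[OF sqint_fourier_partial sqint_fourier_partial]
  have s: "(\<integral>x. ?v1 m x * ?u m x * w x \<partial>torus_measure) + (\<integral>x. ?v m x * ?u1 m x * w x \<partial>torus_measure)
      + (\<integral>x. ?v m x * ?u m x * D1 x \<partial>torus_measure) = 0"
    "(\<integral>x. ?v2 m x * ?u m x * w x \<partial>torus_measure) + (\<integral>x. ?v m x * ?u2 m x * w x \<partial>torus_measure)
      + (\<integral>x. ?v m x * ?u m x * D2 x \<partial>torus_measure) = 0" for m
    using z[of m] ii[OF c(1)] ii[OF c(2)] ii[OF c(3)]
    by (simp_all add: Bochner_Integration.integral_add)
  have "(\<lambda>m. (\<integral>x. ?v1 m x * ?u m x * w x \<partial>torus_measure) + (\<integral>x. ?v m x * ?u1 m x * w x \<partial>torus_measure)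
      + (\<integral>x. ?v m x * ?u m x * D1 x \<partial>torus_measure)) \<longlonglongrightarrow>
     (\<integral>x. fst (weak_gradient v x) * u x * w x \<partial>torus_measure)
      + (\<integral>x. v x * fst (weak_gradient u x) * w x \<partial>torus_measure) + (\<integral>x. v x * u x * D1 x \<partial>torus_measure)"
    by (intro tendsto_add L2lim_bilinear_cont_periodic Lv Lu c)
  then show ?A unfolding s by (simp add: LIMSEQ_const_iff)
  have "(\<lambda>m. (\<integral>x. ?v2 m x * ?u m x * w x \<partial>torus_measure) + (\<integral>x. ?v m x * ?u2 m x * w x \<partial>torus_measure)
      + (\<integral>x. ?v m x * ?u m x * D2 x \<partial>torus_measure)) \<longlonglongrightarrow>
     (\<integral>x. snd (weak_gradient v x) * u x * w x \<partial>torus_measure)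
      + (\<integral>x. v x * snd (weak_gradient u x) * w x \<partial>torus_measure) + (\<integral>x. v x * u x * D2 x \<partial>torus_measure)"
    by (intro tendsto_add L2lim_bilinear_cont_periodic Lv Lu c)
  then show ?B unfolding s by (simp add: LIMSEQ_const_iff)
qed

lemma torus_L2_Pair:
  assumes "sqint f" "sqint g" "torus_periodic f" "torus_periodic g"
  shows "torus_L2 (\<lambda>x. (f x, g x))"
proof -
  have "integrable torus_measure (\<lambda>x. (f x)\<^sup>2 + (g x)\<^sup>2)"
    using sqint_integrable_square[OF assms(1)] sqint_integrable_square[OF assms(2)] by simp
  moreover have "(norm (f x, g x))\<^sup>2 = (f x)\<^sup>2 + (g x)\<^sup>2" for x by (simp add: norm_prod_def)
  ultimately show ?thesis
    using assms sqint_measurable[OF assms(1)] sqint_measurable[OF assms(2)]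
    unfolding torus_L2_def by (auto simp: torus_periodic_def borel_prod[symmetric])
qed

lemma smooth_periodic_cont_periodic:
  assumes \<eta>: "smooth_function \<eta>" "torus_periodic \<eta>"
  shows "cont_periodic \<eta>" "cont_periodic (\<lambda>x. fst (gradient \<eta> x))" "cont_periodic (\<lambda>x. snd (gradient \<eta> x))"
    "GDERIV \<eta> x :> (fst (gradient \<eta> x), snd (gradient \<eta> x))"
proof -
  have C: "C_class (Suc 0) \<eta>" using \<eta>(1) unfolding smooth_function_def by blast
  note G = C_class_Suc_D(1)[OF C]
  show "GDERIV \<eta> x :> (fst (gradient \<eta> x), snd (gradient \<eta> x))" using G by simp
  have cG: "continuous_on UNIV (gradient \<eta>)" by (rule C_class_gradient_continuous[OF C])
  have "gradient \<eta> (x + h) = gradient \<eta> x" if h: "\<And>x. \<eta> (x + h) = \<eta> x" for x h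
  proof (rule gradient_eqI[symmetric, THEN sym])
    have "((\<lambda>y. \<eta> (y - h)) has_derivative (\<lambda>d. d \<bullet> gradient \<eta> (x + h - h))) (at (x + h))"
      using G[of "x + h - h"] unfolding gderiv_def
      by (rule has_derivative_compose[where f="\<lambda>y. y - h", rotated]) (auto intro!: derivative_eq_intros)
    moreover have "(\<lambda>y. \<eta> (y - h)) = \<eta>"
    proof
      fix y show "\<eta> (y - h) = \<eta> y" using h[of "y - h"] by simp
    qed
    ultimately show "GDERIV \<eta> (x + h) :> gradient \<eta> x" unfolding gderiv_def by simp
  qed
  then have pG: "torus_periodic (gradient \<eta>)" using \<eta>(2) unfolding torus_periodic_def by blast
  show "cont_periodic \<eta>" using C_class_Suc_D(2)[OF C] \<eta>(2) by (simp add: cont_periodic_def)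
  show "cont_periodic (\<lambda>x. fst (gradient \<eta> x))" "cont_periodic (\<lambda>x. snd (gradient \<eta> x))"
    using cG pG unfolding cont_periodic_def by (auto simp: torus_periodic_def intro!: continuous_intros)
qed

text \<open>Admits test functions as members of H1 in \<open>integral_by_parts_H1\<close>, with
  their classical gradient.\<close>

lemma has_weak_gradient_smooth:
  assumes D: "\<And>x. GDERIV w x :> (D1 x, D2 x)" and c: "cont_periodic w" "cont_periodic D1" "cont_periodic D2"
  shows "w \<in> sobolev_H1" "has_weak_gradient w (\<lambda>x. (D1 x, D2 x))"
proof -
  have L: "torus_L2 (\<lambda>x. (D1 x, D2 x))"
    using torus_L2_Pair[OF sqint_cont_periodic[OF c(2)] sqint_cont_periodic[OF c(3)]] c by (simp add: cont_periodic_def)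
  have "(\<integral>x. w x *\<^sub>R gradient \<eta> x \<partial>torus_measure) = - (\<integral>x. \<eta> x *\<^sub>R (D1 x, D2 x) \<partial>torus_measure)"
    if \<eta>: "smooth_function \<eta>" "torus_periodic \<eta>" for \<eta>
  proof -
    define E1 E2 where "E1 x = fst (gradient \<eta> x)" and "E2 x = snd (gradient \<eta> x)" for x
    note cp = smooth_periodic_cont_periodic[OF \<eta>]
    have cE: "cont_periodic \<eta>" "cont_periodic E1" "cont_periodic E2" and G': "GDERIV \<eta> x :> (E1 x, E2 x)" for x
      using cp unfolding E1_def[abs_def] E2_def[abs_def] by simp_all
    have i: "integrable torus_measure f" if "cont_periodic f" for f
      using sqint_integrable[OF sqint_cont_periodic[OF that]] .
    have z: "(\<integral>x. w x * E1 x + \<eta> x * D1 x \<partial>torus_measure) = 0" "(\<integral>x. w x * E2 x + \<eta> x * D2 x \<partial>torus_measure) = 0"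
    proof -
      have GG: "GDERIV (\<lambda>x. w x * \<eta> x) x :> (w x * E1 x + \<eta> x * D1 x, w x * E2 x + \<eta> x * D2 x)" for x
        by (rule GDERIV_subst[OF GDERIV_mult[OF D G']]) simp
      have "cont_periodic (\<lambda>x. w x * \<eta> x)" "cont_periodic (\<lambda>x. w x * E1 x + \<eta> x * D1 x)" "cont_periodic (\<lambda>x. w x * E2 x + \<eta> x * D2 x)"
        by (intro cont_periodic_arith c cE)+
      then show "(\<integral>x. w x * E1 x + \<eta> x * D1 x \<partial>torus_measure) = 0" "(\<integral>x. w x * E2 x + \<eta> x * D2 x \<partial>torus_measure) = 0"
        using integral_torus_partial[OF GG] by (simp_all add: cont_periodic_def)
    qed
    note im = i[OF cont_periodic_arith(3)[OF c(1) cE(2)]] i[OF cont_periodic_arith(3)[OF c(1) cE(3)]]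
      i[OF cont_periodic_arith(3)[OF cE(1) c(2)]] i[OF cont_periodic_arith(3)[OF cE(1) c(3)]]
    show ?thesis
      using z im integral_plane_components(2)[of torus_measure "\<lambda>x. w x *\<^sub>R gradient \<eta> x"]
        integral_plane_components(2)[of torus_measure "\<lambda>x. \<eta> x *\<^sub>R (D1 x, D2 x)"]
      by (simp add: E1_def E2_def Bochner_Integration.integral_add)
  qed
  with L show "has_weak_gradient w (\<lambda>x. (D1 x, D2 x))" unfolding has_weak_gradient_def by blast
  moreover have "torus_L2 w"
    using c(1) sqint_cont_periodic[OF c(1)] unfolding torus_L2_def by (auto simp: cont_periodic_def sqint_def)
  ultimately show "w \<in> sobolev_H1" unfolding sobolev_H1_def by blast
qed

text \<open>Integration by parts for \<open>v\<close> and a test function, with weight e^X, is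
  exactly the defining identity of the weak gradient of e^X v.\<close>

lemma weak_gradient_exp_mult:
  assumes v: "v \<in> sobolev_H1" and D: "\<And>x. GDERIV X x :> (G1 x, G2 x)" and c: "cont_periodic X" "cont_periodic G1" "cont_periodic G2"
  defines "u \<equiv> \<lambda>x. exp (X x) * v x"
    and "g \<equiv> \<lambda>x. ((fst (weak_gradient v x) + v x * G1 x) * exp (X x), (snd (weak_gradient v x) + v x * G2 x) * exp (X x))"
  shows "u \<in> sobolev_H1" "has_weak_gradient u g"
proof -
  note p = weak_gradient_props[OF v]
  have cE: "cont_periodic (\<lambda>x. exp (X x))" by (rule cont_periodic_exp[OF c(1)])
  have DE: "GDERIV (\<lambda>x. exp (X x)) x :> (exp (X x) * G1 x, exp (X x) * G2 x)" for x
    by (rule GDERIV_subst[OF GDERIV_DERIV_compose[OF D DERIV_exp]]) simp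
  have s: "sqint (\<lambda>x. (fst (weak_gradient v x) + v x * G1 x) * exp (X x))"
     "sqint (\<lambda>x. (snd (weak_gradient v x) + v x * G2 x) * exp (X x))"
    by (intro sqint_mult_cont_periodic sqint_add p cE c)+
  have pg: "torus_periodic (weak_gradient v)" using p(3) by (rule torus_L2_periodic)
  have per: "torus_periodic (\<lambda>x. (fst (weak_gradient v x) + v x * G1 x) * exp (X x))"
     "torus_periodic (\<lambda>x. (snd (weak_gradient v x) + v x * G2 x) * exp (X x))"
    using pg p(6) c unfolding cont_periodic_def torus_periodic_def by simp_all
  have L: "torus_L2 g" unfolding g_def by (rule torus_L2_Pair[OF s per])
  have "(\<integral>x. u x *\<^sub>R gradient \<eta> x \<partial>torus_measure) = - (\<integral>x. \<eta> x *\<^sub>R g x \<partial>torus_measure)"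
    if \<eta>: "smooth_function \<eta>" "torus_periodic \<eta>" for \<eta>
  proof -
    note cp = smooth_periodic_cont_periodic[OF \<eta>]
    note H = has_weak_gradient_smooth[OF cp(4,1,2,3)]
    \<comment> \<open>The gradient of \<open>\<eta>\<close> that occurs in the integration by parts
      is an arbitrary choice; up to a null set it is the classical one.\<close>
    have AE: "AE x in torus_measure. weak_gradient \<eta> x = gradient \<eta> x"
      using weak_gradient_unique[OF sqint_cont_periodic[OF cp(1)] weak_gradient_props(1)[OF H(1)] H(2)] by simp
    have cE12: "cont_periodic (\<lambda>x. exp (X x) * G1 x)" "cont_periodic (\<lambda>x. exp (X x) * G2 x)" by (intro cont_periodic_arith cE c)+
    note q = weak_gradient_props[OF H(1)]
    have e: "(\<integral>x. v x * fst (weak_gradient \<eta> x) * exp (X x) \<partial>torus_measure) = (\<integral>x. v x * fst (gradient \<eta> x) * exp (X x) \<partial>torus_measure)"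
      "(\<integral>x. v x * snd (weak_gradient \<eta> x) * exp (X x) \<partial>torus_measure) = (\<integral>x. v x * snd (gradient \<eta> x) * exp (X x) \<partial>torus_measure)"
    proof -
      have *: "AE x in torus_measure. v x * fst (weak_gradient \<eta> x) * exp (X x) = v x * fst (gradient \<eta> x) * exp (X x)"
        using AE by (rule eventually_mono) simp
      have **: "AE x in torus_measure. v x * snd (weak_gradient \<eta> x) * exp (X x) = v x * snd (gradient \<eta> x) * exp (X x)"
        using AE by (rule eventually_mono) simp
      from integral_cong_AE[OF _ _ *] integral_cong_AE[OF _ _ **]
      show "(\<integral>x. v x * fst (weak_gradient \<eta> x) * exp (X x) \<partial>torus_measure) = (\<integral>x. v x * fst (gradient \<eta> x) * exp (X x) \<partial>torus_measure)"
        "(\<integral>x. v x * snd (weak_gradient \<eta> x) * exp (X x) \<partial>torus_measure) = (\<integral>x. v x * snd (gradient \<eta> x) * exp (X x) \<partial>torus_measure)"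
        using borel_measurable_integrable[OF integrable_mult3[OF p(2) q(4) cE]]
          borel_measurable_integrable[OF integrable_mult3[OF p(2) sqint_cont_periodic[OF cp(2)] cE]]
          borel_measurable_integrable[OF integrable_mult3[OF p(2) q(5) cE]]
          borel_measurable_integrable[OF integrable_mult3[OF p(2) sqint_cont_periodic[OF cp(3)] cE]] by blast+
    qed
    note ibp = integral_by_parts_H1[OF v H(1) DE cE cE12, unfolded e]
    note s\<eta> = sqint_cont_periodic[OF cp(1)] and s1 = sqint_cont_periodic[OF cp(2)] and s2 = sqint_cont_periodic[OF cp(3)]
    note i1 = integrable_mult3[OF p(2) s1 cE] integrable_mult3[OF p(2) s2 cE]
    note i2 = integrable_mult3[OF p(4) s\<eta> cE] integrable_mult3[OF p(2) s\<eta> cE12(1)]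
    note i3 = integrable_mult3[OF p(5) s\<eta> cE] integrable_mult3[OF p(2) s\<eta> cE12(2)]
    have l: "(\<lambda>x. fst (u x *\<^sub>R gradient \<eta> x)) = (\<lambda>x. v x * fst (gradient \<eta> x) * exp (X x))"
      "(\<lambda>x. snd (u x *\<^sub>R gradient \<eta> x)) = (\<lambda>x. v x * snd (gradient \<eta> x) * exp (X x))"
      by (auto simp: u_def)
    have r: "(\<lambda>x. fst (\<eta> x *\<^sub>R g x)) = (\<lambda>x. fst (weak_gradient v x) * \<eta> x * exp (X x) + v x * \<eta> x * (exp (X x) * G1 x))"
      "(\<lambda>x. snd (\<eta> x *\<^sub>R g x)) = (\<lambda>x. snd (weak_gradient v x) * \<eta> x * exp (X x) + v x * \<eta> x * (exp (X x) * G2 x))"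
      by (auto simp: g_def algebra_simps)
    have L1: "(\<integral>x. u x *\<^sub>R gradient \<eta> x \<partial>torus_measure)
        = ((\<integral>x. v x * fst (gradient \<eta> x) * exp (X x) \<partial>torus_measure), (\<integral>x. v x * snd (gradient \<eta> x) * exp (X x) \<partial>torus_measure))"
      using integral_plane_components(2)[of torus_measure "\<lambda>x. u x *\<^sub>R gradient \<eta> x"] i1 unfolding l by simp
    have R1: "(\<integral>x. \<eta> x *\<^sub>R g x \<partial>torus_measure)
       = ((\<integral>x. fst (weak_gradient v x) * \<eta> x * exp (X x) \<partial>torus_measure) + (\<integral>x. v x * \<eta> x * (exp (X x) * G1 x) \<partial>torus_measure),
          (\<integral>x. snd (weak_gradient v x) * \<eta> x * exp (X x) \<partial>torus_measure) + (\<integral>x. v x * \<eta> x * (exp (X x) * G2 x) \<partial>torus_measure))"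
      using integral_plane_components(2)[of torus_measure "\<lambda>x. \<eta> x *\<^sub>R g x"] i2 i3 unfolding r
      by (simp add: Bochner_Integration.integral_add Bochner_Integration.integrable_add)
    show ?thesis
      unfolding L1 R1 using ibp by (simp add: prod_eq_iff)
  qed
  with L show w: "has_weak_gradient u g" unfolding has_weak_gradient_def by blast
  have "sqint u" unfolding u_def mult.commute[of "exp _"] by (rule sqint_mult_cont_periodic[OF p(2) cE])
  moreover have "torus_periodic u" using p(6) c(1) unfolding u_def cont_periodic_def torus_periodic_def by simp
  ultimately have "torus_L2 u" unfolding torus_L2_def sqint_def by simp
  then show "u \<in> sobolev_H1" using w unfolding sobolev_H1_def by blast
qed

text \<open>The product rule turns the gradient term into e^(2X) (grad v1 . grad v2 + grad X . grad
  (v1 v2) + |grad X|^2 v1 v2). Integrating the middle term by parts against e^(2X) grad X produces -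
  (2 |grad X|^2 + \<Delta>X) e^(2X) v1 v2. The Laplacian cancels the one contained in
  \<open>N\<close>, and |grad X|^2 is left with the opposite sign.\<close>

theorem conjugated_form:
  assumes v1: "v1 \<in> sobolev_H1" and v2: "v2 \<in> sobolev_H1"
    and D: "\<And>x. GDERIV X x :> (G1 x, G2 x)"
    and D1: "\<And>x. GDERIV G1 x :> (H11 x, H12 x)" and D2: "\<And>x. GDERIV G2 x :> (H21 x, H22 x)"
    and c: "cont_periodic X" "cont_periodic G1" "cont_periodic G2" and h: "cont_periodic H11" "cont_periodic H12" "cont_periodic H21" "cont_periodic H22"
    and N: "\<And>x. N x = n0 + H11 x + H22 x"
  defines "u1 \<equiv> \<lambda>x. exp (X x) * v1 x" and "u2 \<equiv> \<lambda>x. exp (X x) * v2 x"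
  shows "(\<integral>x. weak_gradient u1 x \<bullet> weak_gradient u2 x \<partial>torus_measure) + (\<integral>x. u1 x * u2 x * (N x + d) \<partial>torus_measure)
    = (\<integral>x. (weak_gradient v1 x \<bullet> weak_gradient v2 x) * exp (2 * X x) \<partial>torus_measure)
      - (\<integral>x. ((G1 x)\<^sup>2 + (G2 x)\<^sup>2 - d) * (v1 x * v2 x * exp (2 * X x)) \<partial>torus_measure)
      + n0 * (\<integral>x. v1 x * v2 x * exp (2 * X x) \<partial>torus_measure)"
proof -
  let ?E = "\<lambda>x. exp (2 * X x)"
  let ?a1 = "\<lambda>x. fst (weak_gradient v1 x)" and ?a2 = "\<lambda>x. snd (weak_gradient v1 x)"
  let ?b1 = "\<lambda>x. fst (weak_gradient v2 x)" and ?b2 = "\<lambda>x. snd (weak_gradient v2 x)"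
  note p = weak_gradient_props[OF v1] and q = weak_gradient_props[OF v2]
  have cE: "cont_periodic ?E" by (intro cont_periodic_exp cont_periodic_arith cont_periodic_const c)
  have DE: "GDERIV ?E x :> (2 * G1 x * ?E x, 2 * G2 x * ?E x)" for x
  proof -
    have "GDERIV (\<lambda>x. X x + X x) x :> (G1 x, G2 x) + (G1 x, G2 x)" by (rule GDERIV_add[OF D D])
    then have "GDERIV (\<lambda>x. 2 * X x) x :> (2 * G1 x, 2 * G2 x)" by simp
    then show ?thesis
      by (rule GDERIV_subst[OF GDERIV_DERIV_compose[OF _ DERIV_exp]]) simp
  qed
  have DEG1: "GDERIV (\<lambda>x. ?E x * G1 x) x :> ((2 * (G1 x)\<^sup>2 + H11 x) * ?E x, (2 * G1 x * G2 x + H12 x) * ?E x)" for x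
    by (rule GDERIV_subst[OF GDERIV_mult[OF DE D1]]) (simp add: algebra_simps power2_eq_square)
  have DEG2: "GDERIV (\<lambda>x. ?E x * G2 x) x :> ((2 * G1 x * G2 x + H21 x) * ?E x, (2 * (G2 x)\<^sup>2 + H22 x) * ?E x)" for x
    by (rule GDERIV_subst[OF GDERIV_mult[OF DE D2]]) (simp add: algebra_simps power2_eq_square)
  have sq: "(G1 x)\<^sup>2 = G1 x * G1 x" "(G2 x)\<^sup>2 = G2 x * G2 x" for x by (simp_all add: power2_eq_square)
  have cp: "cont_periodic (\<lambda>x. ?E x * G1 x)" "cont_periodic (\<lambda>x. ?E x * G2 x)"
    "cont_periodic (\<lambda>x. (2 * (G1 x)\<^sup>2 + H11 x) * ?E x)" "cont_periodic (\<lambda>x. (2 * G1 x * G2 x + H12 x) * ?E x)"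
    "cont_periodic (\<lambda>x. (2 * G1 x * G2 x + H21 x) * ?E x)" "cont_periodic (\<lambda>x. (2 * (G2 x)\<^sup>2 + H22 x) * ?E x)"
    "cont_periodic (\<lambda>x. ((G1 x)\<^sup>2 + (G2 x)\<^sup>2 - d) * ?E x)" "cont_periodic N" "cont_periodic (\<lambda>x. (N x + d) * ?E x)"
    unfolding sq N[abs_def] by (intro cont_periodic_arith cont_periodic_const c h cE)+
  note I1 = integral_by_parts_H1(1)[OF v1 v2 DEG1 cp(1,3,4)]
  note I2 = integral_by_parts_H1(2)[OF v1 v2 DEG2 cp(2,5,6)]
  note W1 = weak_gradient_exp_mult[OF v1 D c, folded u1_def] and W2 = weak_gradient_exp_mult[OF v2 D c, folded u2_def]
  have su: "sqint u1" "sqint u2"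
    using weak_gradient_props(2)[OF W1(1)] weak_gradient_props(2)[OF W2(1)] .
  have E: "exp (X x) * exp (X x) = ?E x" for x by (simp add: mult_exp_exp)
  define F where "F x = (?a1 x + v1 x * G1 x) * (?b1 x + v2 x * G1 x) * ?E x + (?a2 x + v1 x * G2 x) * (?b2 x + v2 x * G2 x) * ?E x" for x
  have s: "sqint (\<lambda>x. ?a1 x + v1 x * G1 x)" "sqint (\<lambda>x. ?a2 x + v1 x * G2 x)" "sqint (\<lambda>x. ?b1 x + v2 x * G1 x)" "sqint (\<lambda>x. ?b2 x + v2 x * G2 x)"
    by (intro sqint_add sqint_mult_cont_periodic p q c)+
  have iF: "integrable torus_measure F"
    unfolding F_def by (intro Bochner_Integration.integrable_add integrable_mult3 s cE)
  have "AE x in torus_measure. weak_gradient u1 x \<bullet> weak_gradient u2 x = F x"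
    using weak_gradient_unique[OF su(1) weak_gradient_props(1)[OF W1(1)] W1(2)]
      weak_gradient_unique[OF su(2) weak_gradient_props(1)[OF W2(1)] W2(2)]
  proof eventually_elim
    case (elim x)
    show ?case unfolding elim F_def E[symmetric] by (simp add: algebra_simps)
  qed
  then have "(\<integral>x. weak_gradient u1 x \<bullet> weak_gradient u2 x \<partial>torus_measure) = (\<integral>x. F x \<partial>torus_measure)"
  proof (rule integral_cong_AE[rotated 2])
    have "torus_L2 (weak_gradient u1)" "torus_L2 (weak_gradient u2)"
      using weak_gradient_props(3)[OF W1(1)] weak_gradient_props(3)[OF W2(1)] .
    then show "(\<lambda>x. weak_gradient u1 x \<bullet> weak_gradient u2 x) \<in> borel_measurable torus_measure"
      unfolding torus_L2_def borel_measurable_torus by (intro borel_measurable_inner) auto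
  qed (use iF in auto)
  moreover have "(\<integral>x. u1 x * u2 x * (N x + d) \<partial>torus_measure) = (\<integral>x. v1 x * v2 x * ((N x + d) * ?E x) \<partial>torus_measure)"
    by (rule Bochner_Integration.integral_cong[OF refl], unfold u1_def u2_def E[symmetric]) (simp only: mult_ac)
  moreover have "(\<integral>x. F x \<partial>torus_measure) + (\<integral>x. v1 x * v2 x * ((N x + d) * ?E x) \<partial>torus_measure)
     = (\<integral>x. (weak_gradient v1 x \<bullet> weak_gradient v2 x) * ?E x \<partial>torus_measure)
      - (\<integral>x. v1 x * v2 x * (((G1 x)\<^sup>2 + (G2 x)\<^sup>2 - d) * ?E x) \<partial>torus_measure)
      + n0 * (\<integral>x. v1 x * v2 x * ?E x \<partial>torus_measure)"
  proof -
    note j = integrable_mult3[OF p(2) q(2) cp(9)] integrable_mult3[OF p(2) q(2) cp(7)] integrable_mult3[OF p(2) q(2) cE]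
      integrable_mult3[OF p(4) q(4) cE] integrable_mult3[OF p(5) q(5) cE]
    note j1 = integrable_mult3[OF p(4) q(2) cp(1)] integrable_mult3[OF p(2) q(4) cp(1)] integrable_mult3[OF p(2) q(2) cp(3)]
    note j2 = integrable_mult3[OF p(5) q(2) cp(2)] integrable_mult3[OF p(2) q(5) cp(2)] integrable_mult3[OF p(2) q(2) cp(6)]
    have g: "(\<lambda>x. (weak_gradient v1 x \<bullet> weak_gradient v2 x) * ?E x) = (\<lambda>x. ?a1 x * ?b1 x * ?E x + ?a2 x * ?b2 x * ?E x)"
      by (auto simp: inner_prod_def algebra_simps)
    have ig: "integrable torus_measure (\<lambda>x. (weak_gradient v1 x \<bullet> weak_gradient v2 x) * ?E x)"
      unfolding g using j by simp
    have "(\<integral>x. F x \<partial>torus_measure) + (\<integral>x. v1 x * v2 x * ((N x + d) * ?E x) \<partial>torus_measure)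
      = (\<integral>x. F x + v1 x * v2 x * ((N x + d) * ?E x) \<partial>torus_measure)"
      using iF j(1) by simp
    \<comment> \<open>The integrand is written as that of the claim plus two groups which integrate
      to 0 by \<open>I1\<close> and \<open>I2\<close>.\<close>
    also have "(\<lambda>x. F x + v1 x * v2 x * ((N x + d) * ?E x))
      = (\<lambda>x. (((weak_gradient v1 x \<bullet> weak_gradient v2 x) * ?E x - v1 x * v2 x * (((G1 x)\<^sup>2 + (G2 x)\<^sup>2 - d) * ?E x)) + n0 * (v1 x * v2 x * ?E x))
        + ((?a1 x * v2 x * (?E x * G1 x) + v1 x * ?b1 x * (?E x * G1 x)) + v1 x * v2 x * ((2 * (G1 x)\<^sup>2 + H11 x) * ?E x))
        + ((?a2 x * v2 x * (?E x * G2 x) + v1 x * ?b2 x * (?E x * G2 x)) + v1 x * v2 x * ((2 * (G2 x)\<^sup>2 + H22 x) * ?E x)))"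
      by (auto simp: F_def inner_prod_def N power2_eq_square algebra_simps)
    also have "(\<integral>x. (((weak_gradient v1 x \<bullet> weak_gradient v2 x) * ?E x - v1 x * v2 x * (((G1 x)\<^sup>2 + (G2 x)\<^sup>2 - d) * ?E x)) + n0 * (v1 x * v2 x * ?E x))
        + ((?a1 x * v2 x * (?E x * G1 x) + v1 x * ?b1 x * (?E x * G1 x)) + v1 x * v2 x * ((2 * (G1 x)\<^sup>2 + H11 x) * ?E x))
        + ((?a2 x * v2 x * (?E x * G2 x) + v1 x * ?b2 x * (?E x * G2 x)) + v1 x * v2 x * ((2 * (G2 x)\<^sup>2 + H22 x) * ?E x)) \<partial>torus_measure)
      = ((\<integral>x. (weak_gradient v1 x \<bullet> weak_gradient v2 x) * ?E x \<partial>torus_measure)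
      - (\<integral>x. v1 x * v2 x * (((G1 x)\<^sup>2 + (G2 x)\<^sup>2 - d) * ?E x) \<partial>torus_measure)
      + n0 * (\<integral>x. v1 x * v2 x * ?E x \<partial>torus_measure))
      + ((\<integral>x. ?a1 x * v2 x * (?E x * G1 x) \<partial>torus_measure) + (\<integral>x. v1 x * ?b1 x * (?E x * G1 x) \<partial>torus_measure)
        + (\<integral>x. v1 x * v2 x * ((2 * (G1 x)\<^sup>2 + H11 x) * ?E x) \<partial>torus_measure))
      + ((\<integral>x. ?a2 x * v2 x * (?E x * G2 x) \<partial>torus_measure) + (\<integral>x. v1 x * ?b2 x * (?E x * G2 x) \<partial>torus_measure)
        + (\<integral>x. v1 x * v2 x * ((2 * (G2 x)\<^sup>2 + H22 x) * ?E x) \<partial>torus_measure))"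
      using ig j j1 j2
      by (simp only: Bochner_Integration.integral_add Bochner_Integration.integral_diff integral_mult_right_zero
          Bochner_Integration.integrable_add Bochner_Integration.integrable_diff integrable_mult_right simp_thms)
    finally show ?thesis using I1 I2 by simp
  qed
  ultimately show ?thesis by (simp add: mult_ac)
qed

section \<open>Heat semigroup and inverse Laplacian\<close>

definition trig_sum :: "(int \<times> int) set \<Rightarrow> torus_distribution \<Rightarrow> plane \<Rightarrow> real" where
  "trig_sum A c x = Re (\<Sum>k\<in>A. c k * fmode k x)"

definition hermitian :: "(int \<times> int) set \<Rightarrow> torus_distribution \<Rightarrow> bool" where
  "hermitian A c \<longleftrightarrow> finite A \<and> uminus ` A = A \<and> (\<forall>k. c (- k) = cnj (c k))"

lemma trig_sum_complex: "hermitian A c \<Longrightarrow> of_real (trig_sum A c x) = (\<Sum>k\<in>A. c k * fmode k x)"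
  unfolding trig_sum_def hermitian_def by (intro hermitian_sum_real) auto

text \<open>Integration against one mode extracts its coefficient, and the torus has mass 1.\<close>

lemma trig_sum_coeff_bound:
  assumes h: "hermitian A c" and M: "\<And>x. \<bar>trig_sum A c x\<bar> \<le> M" and k: "k \<in> A"
  shows "cmod (c k) \<le> M"
proof -
  have fin: "finite A" using h by (simp add: hermitian_def)
  have "(\<integral>x. (\<Sum>l\<in>A. c l * fmode l x) * cnj (fmode k x) \<partial>torus_measure) = (\<integral>x. (\<Sum>l\<in>A. c l * fmode (l - k) x) \<partial>torus_measure)"
    by (simp add: sum_distrib_right fmode_diff mult.assoc)
  also have "\<dots> = (\<Sum>l\<in>A. c l * (if l = k then 1 else 0))"
    by (simp add: Bochner_Integration.integral_sum integral_fmode)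
  also have "\<dots> = c k" using fin k by (simp add: if_distrib cong: if_cong)
  finally have "cmod (c k) = cmod (\<integral>x. of_real (trig_sum A c x) * cnj (fmode k x) \<partial>torus_measure)"
    by (simp add: trig_sum_complex[OF h])
  also have "\<dots> \<le> (\<integral>x. cmod (of_real (trig_sum A c x) * cnj (fmode k x)) \<partial>torus_measure)"
    by (rule integral_norm_bound)
  also have "\<dots> \<le> (\<integral>x. M \<partial>torus_measure)"
    by (rule integral_mono') (use M order_trans[OF abs_ge_zero M] in \<open>auto simp: norm_mult\<close>)
  also have "\<dots> = M" by (simp add: torus.prob_space[simplified])
  finally show ?thesis .
qed

lemma cont_periodic_trig_sum: "cont_periodic (trig_sum A c)"
  using torus_periodic_fmode unfolding cont_periodic_def trig_sum_def[abs_def] torus_periodic_def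
  by (auto intro!: continuous_intros)

lemma trig_sum_norm_le: "\<bar>trig_sum A c x\<bar> \<le> (\<Sum>k\<in>A. cmod (c k))"
  unfolding trig_sum_def by (rule order_trans[OF abs_Re_le_cmod order_trans[OF norm_sum]]) (simp add: norm_mult)

text \<open>The Fourier multiplier of \<open>shift_avg\<close>: averaging over the four signs
  factorises into one cosine for each coordinate.\<close>

definition shift_mult :: "real \<Rightarrow> int \<times> int \<Rightarrow> real" where
  "shift_mult h k = cos (of_int (fst k) * h) * cos (of_int (snd k) * h)"

definition shift_avg :: "real \<Rightarrow> (plane \<Rightarrow> real) \<Rightarrow> plane \<Rightarrow> real" where
  "shift_avg h f x = (f (x + (h, h)) + f (x + (h, - h)) + f (x + (- h, h)) + f (x + (- h, - h))) / 4"

lemma trig_sum_shift_avg: "trig_sum A (\<lambda>k. of_real (shift_mult h k) * c k) = shift_avg h (trig_sum A c)"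
proof
  fix x
  have four: "fmode k (h, h) + fmode k (h, - h) + fmode k (- h, h) + fmode k (- h, - h) = 4 * of_real (shift_mult h k)" for k
    by (simp add: complex_eq_iff fmode_def freq_def shift_mult_def cos_add sin_add cos_diff sin_diff)
  have "4 * (\<Sum>k\<in>A. of_real (shift_mult h k) * c k * fmode k x)
     = (\<Sum>k\<in>A. c k * fmode k x * (4 * of_real (shift_mult h k)))"
    by (simp add: sum_distrib_left mult_ac)
  also have "\<dots> = (\<Sum>k\<in>A. c k * fmode k (x + (h, h))) + (\<Sum>k\<in>A. c k * fmode k (x + (h, - h)))
     + (\<Sum>k\<in>A. c k * fmode k (x + (- h, h))) + (\<Sum>k\<in>A. c k * fmode k (x + (- h, - h)))"
    unfolding four[symmetric] fmode_translate by (simp add: algebra_simps sum.distrib)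
  finally have "Re (4 * (\<Sum>k\<in>A. of_real (shift_mult h k) * c k * fmode k x))
     = trig_sum A c (x + (h, h)) + trig_sum A c (x + (h, - h)) + trig_sum A c (x + (- h, h)) + trig_sum A c (x + (- h, - h))"
    unfolding trig_sum_def plus_complex.sel(1)[symmetric] by (rule arg_cong)
  then have "4 * trig_sum A (\<lambda>k. of_real (shift_mult h k) * c k) x
     = trig_sum A c (x + (h, h)) + trig_sum A c (x + (h, - h)) + trig_sum A c (x + (- h, h)) + trig_sum A c (x + (- h, - h))"
    unfolding trig_sum_def by (simp only: times_complex.sel complex_Re_numeral complex_Im_numeral mult_zero_left diff_0_right)
  then show "trig_sum A (\<lambda>k. of_real (shift_mult h k) * c k) x = shift_avg h (trig_sum A c) x"
    by (simp add: shift_avg_def)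
qed

lemma shift_avg_bound:
  assumes "\<And>x. \<bar>f x\<bar> \<le> M"
  shows "\<bar>shift_avg h f x\<bar> \<le> M"
  using assms[of "x + (h, h)"] assms[of "x + (h, - h)"] assms[of "x + (- h, h)"] assms[of "x + (- h, - h)"]
  unfolding shift_avg_def abs_le_iff by (auto simp: field_simps)

lemma trig_sum_shift_power:
  "trig_sum A (\<lambda>k. of_real (shift_mult h k ^ Suc j) * c k) = shift_avg h (trig_sum A (\<lambda>k. of_real (shift_mult h k ^ j) * c k))"
proof -
  have "(\<lambda>k. of_real (shift_mult h k ^ Suc j) * c k) = (\<lambda>k. of_real (shift_mult h k) * (of_real (shift_mult h k ^ j) * c k))"
    by (simp add: mult.assoc)
  then show ?thesis by (simp only: trig_sum_shift_avg)
qed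

lemma trig_sum_shift_power_bound:
  assumes M: "\<And>x. \<bar>trig_sum A c x\<bar> \<le> M"
  shows "\<bar>trig_sum A (\<lambda>k. of_real (shift_mult h k ^ j) * c k) x\<bar> \<le> M"
proof (induction j arbitrary: x)
  case 0
  then show ?case using M by simp
next
  case (Suc j)
  show ?case unfolding trig_sum_shift_power by (rule shift_avg_bound[OF Suc])
qed

text \<open>The central limit theorem for coin tossing, in terms of characteristic functions: m
  independent steps of variance 2 t / m.\<close>

lemma cos_power_limit: "(\<lambda>m. cos (a * sqrt (2 * t / real m)) ^ m) \<longlonglongrightarrow> exp (- t * a\<^sup>2)" if "t > 0" for a t :: real
proof (cases "a = 0")
  case True
  then show ?thesis by simp
next
  case False
  define b where "b = a * sqrt (2 * t)"
  have b: "b \<noteq> 0" "b\<^sup>2 = 2 * t * a\<^sup>2" using that False by (simp_all add: b_def power_mult_distrib)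
  \<comment> \<open>The limit is first taken along a real variable with \<open>powr\<close>; the
    return to natural powers uses that the cosine is eventually positive.\<close>
  have "((\<lambda>y. cos (b / sqrt y) powr y) \<longlongrightarrow> exp (- (b * b / 2))) at_top"
    using b(1) by real_asymp
  then have "((\<lambda>y. cos (a * sqrt (2 * t / y)) powr y) \<longlongrightarrow> exp (- t * a\<^sup>2)) at_top"
  proof -
    have "cos (b / sqrt y) = cos (a * sqrt (2 * t / y))" for y
      by (simp add: b_def real_sqrt_divide)
    moreover have "- (b * b / 2) = - t * a\<^sup>2" using b(2) by (simp add: power2_eq_square)
    ultimately show ?thesis
      using \<open>((\<lambda>y. cos (b / sqrt y) powr y) \<longlongrightarrow> exp (- (b * b / 2))) at_top\<close> by (simp only:)
  qed
  then have "(\<lambda>m. cos (a * sqrt (2 * t / real m)) powr real m) \<longlonglongrightarrow> exp (- t * a\<^sup>2)"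
    by (rule filterlim_compose[OF _ filterlim_real_sequentially])
  moreover have "\<forall>\<^sub>F m in sequentially. cos (a * sqrt (2 * t / real m)) powr real m = cos (a * sqrt (2 * t / real m)) ^ m"
  proof -
    have "(\<lambda>m. cos (a * sqrt (2 * t / real m))) \<longlonglongrightarrow> 1"
      using that by real_asymp
    then have "\<forall>\<^sub>F m in sequentially. 0 < cos (a * sqrt (2 * t / real m))"
      by (rule order_tendstoD(1)) simp
    then show ?thesis by eventually_elim (simp add: powr_realpow)
  qed
  ultimately show ?thesis by (rule Lim_transform_eventually)
qed

text \<open>
  The heat semigroup contracts the sup norm because it is a limit of averages of translations.
\<close>

lemma trig_sum_heat_bound:
  assumes h: "finite A" and M: "\<And>x. \<bar>trig_sum A c x\<bar> \<le> M" and "t \<ge> 0"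
  shows "\<bar>trig_sum A (\<lambda>k. of_real (exp (- t * (norm (freq k))\<^sup>2)) * c k) x\<bar> \<le> M"
proof (cases "t = 0")
  case True
  then show ?thesis using M by simp
next
  case False
  then have t: "t > 0" using assms(3) by simp
  \<comment> \<open>Diffusive scaling: m averages over shifts of size sqrt (2 t / m) in each
    coordinate.\<close>
  have lim: "(\<lambda>m. shift_mult (sqrt (2 * t / real m)) k ^ m) \<longlonglongrightarrow> exp (- t * (norm (freq k))\<^sup>2)" for k
  proof -
    have "(\<lambda>m. cos (of_int (fst k) * sqrt (2 * t / real m)) ^ m * cos (of_int (snd k) * sqrt (2 * t / real m)) ^ m)
       \<longlonglongrightarrow> exp (- t * (of_int (fst k))\<^sup>2) * exp (- t * (of_int (snd k))\<^sup>2)"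
      by (intro tendsto_mult cos_power_limit t)
    moreover have "exp (- t * (of_int (fst k))\<^sup>2) * exp (- t * (of_int (snd k))\<^sup>2) = exp (- t * (norm (freq k))\<^sup>2)"
      by (simp add: mult_exp_exp norm_prod_def freq_def algebra_simps)
    ultimately show ?thesis unfolding shift_mult_def power_mult_distrib by simp
  qed
  have "(\<lambda>m. trig_sum A (\<lambda>k. of_real (shift_mult (sqrt (2 * t / real m)) k ^ m) * c k) x)
      \<longlonglongrightarrow> trig_sum A (\<lambda>k. of_real (exp (- t * (norm (freq k))\<^sup>2)) * c k) x"
    unfolding trig_sum_def by (intro tendsto_intros lim)
  then have "(\<lambda>m. \<bar>trig_sum A (\<lambda>k. of_real (shift_mult (sqrt (2 * t / real m)) k ^ m) * c k) x\<bar>)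
      \<longlonglongrightarrow> \<bar>trig_sum A (\<lambda>k. of_real (exp (- t * (norm (freq k))\<^sup>2)) * c k) x\<bar>"
    by (rule tendsto_rabs)
  then show ?thesis
    by (rule LIMSEQ_le_const2) (intro exI allI impI trig_sum_shift_power_bound M)
qed

text \<open>
  With u(t) the heat flow of the inverse Laplacian, u(0) - u(T) is the time integral of the heat
  flow of the original function.
\<close>

lemma trig_sum_inverse_laplacian:
  assumes h: "hermitian A c" and M: "\<And>x. \<bar>trig_sum A c x\<bar> \<le> M" and nz: "\<And>k. k \<in> A \<Longrightarrow> k \<noteq> 0" and "T \<ge> 0"
  shows "\<bar>trig_sum A (\<lambda>k. - c k / of_real ((norm (freq k))\<^sup>2)) x\<bar>
    \<le> T * M + (\<Sum>k\<in>A. M / (norm (freq k))\<^sup>2 * exp (- T * (norm (freq k))\<^sup>2))"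
proof -
  have fin: "finite A" using h by (simp add: hermitian_def)
  have M0: "0 \<le> M" using order_trans[OF abs_ge_zero M] .
  define g where "g k = - c k / of_real ((norm (freq k))\<^sup>2)" for k
  define u where "u t = trig_sum A (\<lambda>k. of_real (exp (- t * (norm (freq k))\<^sup>2)) * g k) x" for t
  have ReR: "Re (of_real r * z) = r * Re z" for r z by simp
  have ueq: "u t = (\<Sum>k\<in>A. exp (- t * (norm (freq k))\<^sup>2) * Re (g k * fmode k x))" for t
    unfolding u_def trig_sum_def Re_sum mult.assoc ReR by simp
  have "(u has_real_derivative trig_sum A (\<lambda>k. of_real (exp (- t * (norm (freq k))\<^sup>2)) * c k) x) (at t)" for t
  proof -
    have "(u has_real_derivative (\<Sum>k\<in>A. - (norm (freq k))\<^sup>2 * exp (- t * (norm (freq k))\<^sup>2) * Re (g k * fmode k x))) (at t)"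
      unfolding ueq[abs_def] by (auto intro!: derivative_eq_intros sum.cong simp: mult.commute)
    moreover have "(\<Sum>k\<in>A. - (norm (freq k))\<^sup>2 * exp (- t * (norm (freq k))\<^sup>2) * Re (g k * fmode k x))
       = trig_sum A (\<lambda>k. of_real (exp (- t * (norm (freq k))\<^sup>2)) * c k) x"
      unfolding trig_sum_def Re_sum
    proof (rule sum.cong[OF refl])
      fix k assume "k \<in> A"
      then have "(norm (freq k))\<^sup>2 \<noteq> 0" using nz by simp
      then have "c k = of_real (- (norm (freq k))\<^sup>2) * g k" by (simp add: g_def del: of_real_power)
      then have "Re (of_real (exp (- t * (norm (freq k))\<^sup>2)) * c k * fmode k x)
         = Re (of_real (exp (- t * (norm (freq k))\<^sup>2) * (- (norm (freq k))\<^sup>2)) * (g k * fmode k x))"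
        by (simp only: of_real_mult mult_ac)
      then show "- (norm (freq k))\<^sup>2 * exp (- t * (norm (freq k))\<^sup>2) * Re (g k * fmode k x)
          = Re (of_real (exp (- t * (norm (freq k))\<^sup>2)) * c k * fmode k x)"
        unfolding ReR by (simp only: mult_ac ReR)
    qed
    ultimately show ?thesis by simp
  qed
  note der = this
  \<comment> \<open>Mean value inequality on [0, T]: the derivative of \<open>u\<close> is the heat
    flow of the original sum, which stays below \<open>M\<close>.\<close>
  have "norm (u 0 - u T) \<le> M * norm (0 - T)"
    by (rule field_differentiable_bound[of "{0..T}" u "\<lambda>t. trig_sum A (\<lambda>k. of_real (exp (- t * (norm (freq k))\<^sup>2)) * c k) x"])
      (use \<open>T \<ge> 0\<close> has_field_derivative_at_within[OF der] trig_sum_heat_bound[OF fin M] in auto)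
  then have "\<bar>u 0 - u T\<bar> \<le> T * M" using \<open>T \<ge> 0\<close> by (simp add: mult.commute)
  \<comment> \<open>The remainder at time T is summed frequency by frequency, with each coefficient
    at most \<open>M\<close>; the exponential makes this affordable.\<close>
  moreover have "\<bar>u T\<bar> \<le> (\<Sum>k\<in>A. M / (norm (freq k))\<^sup>2 * exp (- T * (norm (freq k))\<^sup>2))"
  proof -
    have "\<bar>u T\<bar> \<le> (\<Sum>k\<in>A. cmod (of_real (exp (- T * (norm (freq k))\<^sup>2)) * g k))"
      unfolding u_def by (rule trig_sum_norm_le)
    also have "\<dots> \<le> (\<Sum>k\<in>A. M / (norm (freq k))\<^sup>2 * exp (- T * (norm (freq k))\<^sup>2))"
    proof (rule sum_mono)
      fix k assume "k \<in> A"
      then have "cmod (c k) \<le> M" by (rule trig_sum_coeff_bound[OF h M])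
      then have "cmod (g k) \<le> M / (norm (freq k))\<^sup>2"
        unfolding g_def by (simp add: norm_divide norm_power divide_right_mono)
      then have "cmod (g k) * exp (- T * (norm (freq k))\<^sup>2) \<le> M / (norm (freq k))\<^sup>2 * exp (- T * (norm (freq k))\<^sup>2)"
        by (rule mult_right_mono) simp
      then show "cmod (of_real (exp (- T * (norm (freq k))\<^sup>2)) * g k) \<le> M / (norm (freq k))\<^sup>2 * exp (- T * (norm (freq k))\<^sup>2)"
        unfolding norm_mult norm_of_real abs_exp_cancel by (simp only: mult.commute)
    qed
    finally show ?thesis .
  qed
  moreover have "trig_sum A g x = u 0" by (simp add: u_def)
  ultimately show ?thesis unfolding g_def[abs_def] by linarith
qed

section \<open>The inverse Laplacian on a block\<close>

definition lp_freqs :: "(plane \<Rightarrow> real) \<Rightarrow> (plane \<Rightarrow> real) \<Rightarrow> nat \<Rightarrow> (int \<times> int) set" where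
  "lp_freqs chi phi n = {k. lp_multiplier chi phi n k \<noteq> 0}"

definition lp_coeff :: "(plane \<Rightarrow> real) \<Rightarrow> (plane \<Rightarrow> real) \<Rightarrow> nat \<Rightarrow> torus_distribution \<Rightarrow> torus_distribution" where
  "lp_coeff chi phi n a k = of_real (lp_multiplier chi phi n k) * a k"

lemma lp_block_trig_sum: "lp_block chi phi n a = trig_sum (lp_freqs chi phi n) (lp_coeff chi phi n a)"
  by (auto simp: lp_block_def trig_sum_def lp_freqs_def lp_coeff_def)

lemma hermitian_lp:
  assumes d: "dyadic_partition chi phi" and a: "\<And>k. a (- k) = cnj (a k)"
  shows "hermitian (lp_freqs chi phi n) (lp_coeff chi phi n a)"
proof -
  have neg: "- k \<in> lp_freqs chi phi n" if "k \<in> lp_freqs chi phi n" for k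
    using that by (simp add: lp_freqs_def lp_multiplier_uminus[OF d])
  have "uminus ` lp_freqs chi phi n = lp_freqs chi phi n"
  proof
    show "uminus ` lp_freqs chi phi n \<subseteq> lp_freqs chi phi n" using neg by blast
    show "lp_freqs chi phi n \<subseteq> uminus ` lp_freqs chi phi n" using neg by (metis image_eqI minus_minus subsetI)
  qed
  then show ?thesis
    using finite_lp_support[OF d] by (simp add: hermitian_def lp_freqs_def lp_coeff_def a lp_multiplier_uminus[OF d])
qed

lemma card_lp_freqs:
  assumes "1 \<le> R" "\<And>k. k \<in> lp_freqs chi phi n \<Longrightarrow> norm (freq k) \<le> R * 2 ^ n"
  shows "real (card (lp_freqs chi phi n)) \<le> 25 * R\<^sup>2 * 4 ^ n"
proof -
  have R: "1 \<le> R * 2 ^ n" using mult_mono[OF assms(1) one_le_power[of "2::real" n]] assms(1) by simp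
  have "card (lp_freqs chi phi n) \<le> card {k. norm (freq k) \<le> R * 2 ^ n}"
    using assms(2) by (intro card_mono finite_freq_ball) auto
  then have "real (card (lp_freqs chi phi n)) \<le> 25 * (R * 2 ^ n)\<^sup>2"
    using card_freq_ball[OF R] by linarith
  also have "\<dots> = 25 * R\<^sup>2 * 4 ^ n"
    by (simp add: power_mult_distrib power_mult[symmetric] mult.commute[of n 2] power_mult)
  finally show ?thesis .
qed

lemma norm_freq_ge_1: "k \<noteq> 0 \<Longrightarrow> 1 \<le> norm (freq k)"
proof -
  assume "k \<noteq> 0"
  then have "fst k \<noteq> 0 \<or> snd k \<noteq> 0" by (auto simp: prod_eq_iff)
  then have "1 \<le> \<bar>real_of_int (fst k)\<bar> \<or> 1 \<le> \<bar>real_of_int (snd k)\<bar>" by linarith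
  then show "1 \<le> norm (freq k)"
    using norm_fst_le[of "of_int (fst k) :: real" "of_int (snd k) :: real"]
      norm_snd_le[of "of_int (snd k) :: real" "of_int (fst k) :: real"] by (auto simp: freq_def)
qed

text \<open>Only the cubic term of the exponential series is kept: the third power turns y of order
  2^(n/2) into the decay 2^(-3n/2).\<close>

lemma exp_minus_le_cube: "exp (- y) \<le> 6 / y ^ 3" if "y > 0" for y :: real
proof -
  have "(\<Sum>i\<in>{3}. y ^ i /\<^sub>R fact i) \<le> (\<Sum>i. y ^ i /\<^sub>R fact i)"
    using that by (intro sum_le_suminf summable_exp_generic) auto
  then have "y ^ 3 / 6 \<le> exp y" unfolding exp_def by (simp add: fact_numeral)
  then have "1 / exp y \<le> 1 / (y ^ 3 / 6)" using that by (intro divide_left_mono) auto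
  then show ?thesis by (simp add: exp_minus inverse_eq_divide)
qed

lemma lp_inverse_laplacian:
  assumes d: "dyadic_partition chi phi"
  obtains C where "C > 0" "\<And>n a M x. (\<And>k. a (- k) = cnj (a k)) \<Longrightarrow> (\<And>x. \<bar>lp_block chi phi n a x\<bar> \<le> M) \<Longrightarrow>
      \<bar>lp_block chi phi n (noise_X a) x\<bar> \<le> C * 2 powr (- 3 / 2 * real n) * M"
proof -
  obtain r R where r: "0 < r" and R: "1 \<le> R"
    and sR: "\<And>n k. lp_multiplier chi phi n k \<noteq> 0 \<Longrightarrow> norm (freq k) \<le> R * 2 ^ n"
    and sr: "\<And>n k. n > 0 \<Longrightarrow> lp_multiplier chi phi n k \<noteq> 0 \<Longrightarrow> r * 2 ^ n \<le> norm (freq k)"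
    using lp_multiplier_support[OF d] by metis
  \<comment> \<open>The summands account for the short-time part, for block 0 and for the long-time
    part, where 150 is 25 times 6.\<close>
  define C where "C = 1 + 25 * R\<^sup>2 + 150 * R\<^sup>2 / r ^ 8"
  have C: "C > 0" using R r unfolding C_def by (intro add_pos_nonneg) auto
  show thesis
  proof (rule that[OF C])
    fix n a M x
    assume h: "\<And>k. a (- k) = cnj (a k)" and M: "\<And>x. \<bar>lp_block chi phi n a x\<bar> \<le> M"
    let ?A = "lp_freqs chi phi n" and ?c = "lp_coeff chi phi n a"
    have H: "hermitian ?A ?c" by (rule hermitian_lp[OF d], rule h)
    have fin: "finite ?A" using H by (simp add: hermitian_def)
    have Mt: "\<And>x. \<bar>trig_sum ?A ?c x\<bar> \<le> M" using M unfolding lp_block_trig_sum .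
    have M0: "0 \<le> M" using order_trans[OF abs_ge_zero M] .
    have card: "real (card ?A) \<le> 25 * R\<^sup>2 * 4 ^ n"
      by (rule card_lp_freqs[OF R]) (auto simp: lp_freqs_def intro: sR)
    show "\<bar>lp_block chi phi n (noise_X a) x\<bar> \<le> C * 2 powr (- 3 / 2 * real n) * M"
    \<comment> \<open>Block 0 may contain frequency 0, which \<open>noise_X\<close> deletes; it has
      a bounded number of frequencies and is estimated coefficient by coefficient.\<close>
    proof (cases "n = 0")
      case True
      have "\<bar>lp_block chi phi n (noise_X a) x\<bar> \<le> (\<Sum>k\<in>?A. cmod (lp_coeff chi phi n (noise_X a) k))"
        unfolding lp_block_trig_sum by (rule trig_sum_norm_le)
      also have "\<dots> \<le> (\<Sum>k\<in>?A. M)"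
      proof (rule sum_mono)
        fix k assume k: "k \<in> ?A"
        show "cmod (lp_coeff chi phi n (noise_X a) k) \<le> M"
        proof (cases "k = 0")
          case False
          have "1 \<le> (norm (freq k))\<^sup>2" using norm_freq_ge_1[OF False] by (simp add: one_le_power)
          then have "cmod (?c k) / (norm (freq k))\<^sup>2 \<le> cmod (?c k)"
            using mult_left_mono[of 1 "(norm (freq k))\<^sup>2" "cmod (?c k)"] by (simp add: divide_le_eq)
          moreover have "cmod (lp_coeff chi phi n (noise_X a) k) = cmod (?c k) / (norm (freq k))\<^sup>2"
            using False by (simp add: lp_coeff_def noise_X_def norm_mult norm_divide norm_power)
          ultimately show ?thesis using trig_sum_coeff_bound[OF H Mt k] by simp
        qed (simp add: lp_coeff_def noise_X_def M0)
      qed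
      also have "\<dots> \<le> (25 * R\<^sup>2) * M" using mult_right_mono[OF card M0] True by simp
      also have "\<dots> \<le> C * M" using M0 r R unfolding C_def by (intro mult_right_mono) auto
      finally show ?thesis using True by simp
    next
      case False
      have nz: "k \<noteq> 0" if "k \<in> ?A" for k
      proof
        assume "k = 0"
        then have "r * 2 ^ n \<le> 0" using sr[of n k] that False by (auto simp: lp_freqs_def)
        moreover have "0 < r * 2 ^ n" using r by simp
        ultimately show False by linarith
      qed
      \<comment> \<open>The short-time part is then T M. On the block T |k|^2 is at least of order
        2^(n/2), so the exponential is at most a multiple of T, while the factor 1 / |k|^2 offsets
        the number of frequencies, of order 4^n.\<close>
      define T where "T = 2 powr (- 3 / 2 * real n)"
      have T0: "T > 0" by (simp add: T_def)
      have p4: "(4::real) ^ n = 2 powr (2 * real n)"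
        by (simp add: powr_mult_base powr_powr[symmetric] powr_realpow)
      have le: "M / (norm (freq k))\<^sup>2 * exp (- T * (norm (freq k))\<^sup>2) \<le> M * (6 / r ^ 8 * (T / 4 ^ n))" if k: "k \<in> ?A" for k
      proof -
        have "r * 2 ^ n \<le> norm (freq k)" using sr[of n k] k False by (simp add: lp_freqs_def)
        then have "(r * 2 ^ n)\<^sup>2 \<le> (norm (freq k))\<^sup>2" using r by (intro power_mono) auto
        moreover have "(r * 2 ^ n)\<^sup>2 = r\<^sup>2 * 4 ^ n"
          by (simp add: power_mult_distrib power_mult[symmetric] mult.commute[of n 2] power_mult)
        ultimately have q: "r\<^sup>2 * 4 ^ n \<le> (norm (freq k))\<^sup>2" by simp
        have q0: "0 < r\<^sup>2 * 4 ^ n" using r by simp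
        define y where "y = T * (r\<^sup>2 * 4 ^ n)"
        have y0: "y > 0" using T0 q0 by (simp add: y_def)
        have y: "y = r\<^sup>2 * 2 powr (real n / 2)"
          unfolding y_def T_def p4 by (simp add: powr_add[symmetric] mult_ac)
        have "exp (- T * (norm (freq k))\<^sup>2) \<le> exp (- y)"
          using q T0 by (simp add: y_def)
        also have "\<dots> \<le> 6 / y ^ 3" by (rule exp_minus_le_cube[OF y0])
        also have "y ^ 3 = r ^ 6 * 2 powr (3 / 2 * real n)"
          unfolding y power_mult_distrib by (simp add: power_mult[symmetric] powr_powr[symmetric] powr_realpow[symmetric] powr_powr mult.commute)
        finally have e: "exp (- T * (norm (freq k))\<^sup>2) \<le> 6 / r ^ 6 * T"
          by (simp add: T_def powr_minus field_simps)
        have "M / (norm (freq k))\<^sup>2 \<le> M / (r\<^sup>2 * 4 ^ n)"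
          using q q0 M0 by (intro divide_left_mono mult_pos_pos) auto
        then have "M / (norm (freq k))\<^sup>2 * exp (- T * (norm (freq k))\<^sup>2) \<le> M / (r\<^sup>2 * 4 ^ n) * (6 / r ^ 6 * T)"
          using M0 q0 by (intro mult_mono e) auto
        also have "\<dots> = M * (6 / r ^ 8 * (T / 4 ^ n))"
        proof -
          have "r ^ 8 = r\<^sup>2 * r ^ 6" by (simp flip: power_add)
          then show ?thesis by (simp add: field_simps)
        qed
        finally show ?thesis .
      qed
      have "lp_block chi phi n (noise_X a) x = trig_sum ?A (\<lambda>k. - ?c k / of_real ((norm (freq k))\<^sup>2)) x"
        unfolding lp_block_trig_sum trig_sum_def
        by (intro arg_cong[where f=Re] sum.cong) (use nz in \<open>auto simp: lp_coeff_def noise_X_def\<close>)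
      then have "\<bar>lp_block chi phi n (noise_X a) x\<bar>
          \<le> T * M + (\<Sum>k\<in>?A. M / (norm (freq k))\<^sup>2 * exp (- T * (norm (freq k))\<^sup>2))"
        using trig_sum_inverse_laplacian[OF H Mt nz, of T x] T0 by simp
      also have "(\<Sum>k\<in>?A. M / (norm (freq k))\<^sup>2 * exp (- T * (norm (freq k))\<^sup>2)) \<le> (\<Sum>k\<in>?A. M * (6 / r ^ 8 * (T / 4 ^ n)))"
        by (rule sum_mono[OF le])
      also have "\<dots> = real (card ?A) * (M * (6 / r ^ 8 * (T / 4 ^ n)))" by simp
      also have "\<dots> \<le> (25 * R\<^sup>2 * 4 ^ n) * (M * (6 / r ^ 8 * (T / 4 ^ n)))"
        using M0 T0 r by (intro mult_right_mono card) auto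
      also have "\<dots> = (150 * R\<^sup>2 / r ^ 8) * T * M" by simp
      finally have "\<bar>lp_block chi phi n (noise_X a) x\<bar> \<le> (1 + 150 * R\<^sup>2 / r ^ 8) * T * M"
        by (simp add: algebra_simps)
      also have "\<dots> \<le> C * T * M"
        using M0 T0 unfolding C_def by (intro mult_right_mono) auto
      finally show ?thesis by (simp add: T_def)
    qed
  qed
qed

text \<open>Deliberately crude: each of about 4^n frequencies contributes at most M |h|, since 1 /
  |k|^2 outweighs the factor |k| of the increment. The bound enters an interpolation with weight 1/8
  only, which makes its growth tolerable.\<close>

lemma lp_lipschitz:
  assumes d: "dyadic_partition chi phi"
  obtains C where "C > 0" "\<And>n a M x h. (\<And>k. a (- k) = cnj (a k)) \<Longrightarrow> (\<And>x. \<bar>lp_block chi phi n a x\<bar> \<le> M) \<Longrightarrow>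
      \<bar>lp_block chi phi n (noise_X a) (x + h) - lp_block chi phi n (noise_X a) x\<bar> \<le> C * 4 ^ n * M * norm h"
proof -
  obtain r R where R: "1 \<le> R" and sR: "\<And>n k. lp_multiplier chi phi n k \<noteq> 0 \<Longrightarrow> norm (freq k) \<le> R * 2 ^ n"
    using lp_multiplier_support[OF d] by metis
  show thesis
  proof (rule that[of "25 * R\<^sup>2"])
    show "0 < 25 * R\<^sup>2" using R by simp
    fix n a M x h
    assume hh: "\<And>k. a (- k) = cnj (a k)" and M: "\<And>x. \<bar>lp_block chi phi n a x\<bar> \<le> M"
    let ?A = "lp_freqs chi phi n" and ?c = "lp_coeff chi phi n a"
    have H: "hermitian ?A ?c" by (rule hermitian_lp[OF d], rule hh)
    have Mt: "\<And>x. \<bar>trig_sum ?A ?c x\<bar> \<le> M" using M unfolding lp_block_trig_sum .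
    have M0: "0 \<le> M" using order_trans[OF abs_ge_zero M] .
    have card: "real (card ?A) \<le> 25 * R\<^sup>2 * 4 ^ n"
      by (rule card_lp_freqs[OF R]) (auto simp: lp_freqs_def intro: sR)
    have "lp_block chi phi n (noise_X a) (x + h) - lp_block chi phi n (noise_X a) x
       = trig_sum ?A (\<lambda>k. lp_coeff chi phi n (noise_X a) k * (fmode k h - 1)) x"
      unfolding lp_block_trig_sum trig_sum_def by (simp add: fmode_translate algebra_simps sum_subtractf)
    also have "\<bar>\<dots>\<bar> \<le> (\<Sum>k\<in>?A. cmod (lp_coeff chi phi n (noise_X a) k * (fmode k h - 1)))"
      by (rule trig_sum_norm_le)
    also have "\<dots> \<le> (\<Sum>k\<in>?A. M * norm h)"
    proof (rule sum_mono)
      fix k assume k: "k \<in> ?A"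
      show "cmod (lp_coeff chi phi n (noise_X a) k * (fmode k h - 1)) \<le> M * norm h"
      proof (cases "k = 0")
        case False
        have k1: "1 \<le> norm (freq k)" by (rule norm_freq_ge_1[OF False])
        have "cmod (fmode k h - 1) \<le> norm (freq k) * norm h"
          unfolding fmode_def using cmod_cis_diff_1 Cauchy_Schwarz_ineq2 order_trans by blast
        then have "cmod (lp_coeff chi phi n (noise_X a) k * (fmode k h - 1)) \<le> cmod (?c k) / (norm (freq k))\<^sup>2 * (norm (freq k) * norm h)"
          using False by (simp add: lp_coeff_def noise_X_def norm_mult norm_divide norm_power mult_left_mono divide_right_mono)
        also have "\<dots> = cmod (?c k) * norm h / norm (freq k)"
          using k1 by (simp add: power2_eq_square field_simps)
        also have "\<dots> \<le> cmod (?c k) * norm h / 1"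
          using k1 by (intro divide_left_mono) auto
        also have "\<dots> \<le> M * norm h" using trig_sum_coeff_bound[OF H Mt k] by (simp add: mult_right_mono)
        finally show ?thesis .
      qed (simp add: lp_coeff_def noise_X_def M0)
    qed
    also have "\<dots> = real (card ?A) * (M * norm h)" by simp
    also have "\<dots> \<le> (25 * R\<^sup>2 * 4 ^ n) * (M * norm h)"
      using M0 by (intro mult_right_mono card) auto
    finally show "\<bar>lp_block chi phi n (noise_X a) (x + h) - lp_block chi phi n (noise_X a) x\<bar> \<le> 25 * R\<^sup>2 * 4 ^ n * M * norm h"
      by (simp add: mult_ac)
  qed
qed

section \<open>Regularity of the field\<close>

lemma besov_block_bound:
  assumes "besov_norm chi phi \<alpha> f \<le> ennreal B" "0 \<le> B"
  shows "\<bar>lp_block chi phi n f x\<bar> \<le> B * 2 powr (- \<alpha> * real n)"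
proof -
  have "ennreal (2 powr (\<alpha> * real n) * \<bar>lp_block chi phi n f x\<bar>)
      = ennreal (2 powr (\<alpha> * real n)) * ennreal \<bar>lp_block chi phi n f x\<bar>"
    by (rule ennreal_mult) simp_all
  also have "\<dots> \<le> ennreal (2 powr (\<alpha> * real n)) * (SUP x. ennreal \<bar>lp_block chi phi n f x\<bar>)"
    by (intro mult_left_mono SUP_upper) simp_all
  also have "\<dots> \<le> besov_norm chi phi \<alpha> f"
    unfolding besov_norm_def by (rule SUP_upper) simp
  also note assms(1)
  finally have "2 powr (\<alpha> * real n) * \<bar>lp_block chi phi n f x\<bar> \<le> B"
    using assms(2) by (simp only: ennreal_le_iff)
  then show ?thesis
    by (simp add: powr_minus field_simps)
qed

lemma besov_norm_leI:
  assumes "\<And>n x. \<bar>lp_block chi phi n f x\<bar> \<le> B * 2 powr (- \<alpha> * real n)"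
  shows "besov_norm chi phi \<alpha> f \<le> ennreal B"
  unfolding besov_norm_def
proof (rule SUP_least)
  fix n
  have B: "0 \<le> B"
  proof -
    have "0 \<le> B * 2 powr (- \<alpha> * real n)" using order_trans[OF abs_ge_zero assms] .
    then show ?thesis by (simp add: zero_le_mult_iff)
  qed
  have "(SUP x. ennreal \<bar>lp_block chi phi n f x\<bar>) \<le> ennreal (B * 2 powr (- \<alpha> * real n))"
    by (intro SUP_least ennreal_leI assms)
  then have "ennreal (2 powr (\<alpha> * real n)) * (SUP x. ennreal \<bar>lp_block chi phi n f x\<bar>)
      \<le> ennreal (2 powr (\<alpha> * real n)) * ennreal (B * 2 powr (- \<alpha> * real n))"
    by (intro mult_left_mono) simp_all
  also have "\<dots> = ennreal (2 powr (\<alpha> * real n) * (B * 2 powr (- \<alpha> * real n)))"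
    by (rule ennreal_mult[symmetric]) (use B in simp_all)
  also have "2 powr (\<alpha> * real n) * (B * 2 powr (- \<alpha> * real n)) = B"
    by (simp add: powr_minus field_simps)
  finally show "ennreal (2 powr (\<alpha> * real n)) * (SUP x. ennreal \<bar>lp_block chi phi n f x\<bar>) \<le> ennreal B" .
qed

lemma lp_block_diff:
  "lp_block chi phi n (a - b) x = lp_block chi phi n a x - lp_block chi phi n b x"
  unfolding lp_block_def by (simp add: algebra_simps sum_subtractf)

text \<open>Used in the negative: regularised quantities have finite norm, so a noise of infinite
  norm is at infinite distance from them.\<close>

lemma besov_norm_triangle:
  "besov_norm chi phi \<alpha> a \<le> besov_norm chi phi \<alpha> (a - b) + besov_norm chi phi \<alpha> b"
proof -
  have "ennreal (2 powr (\<alpha> * real n)) * ennreal \<bar>lp_block chi phi n a x\<bar>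
     \<le> besov_norm chi phi \<alpha> (a - b) + besov_norm chi phi \<alpha> b" for n x
  proof -
    have "\<bar>lp_block chi phi n a x\<bar> \<le> \<bar>lp_block chi phi n (a - b) x\<bar> + \<bar>lp_block chi phi n b x\<bar>"
      unfolding lp_block_diff by linarith
    then have "ennreal \<bar>lp_block chi phi n a x\<bar> \<le> ennreal \<bar>lp_block chi phi n (a - b) x\<bar> + ennreal \<bar>lp_block chi phi n b x\<bar>"
      by (simp add: ennreal_leI flip: ennreal_plus)
    then have "ennreal (2 powr (\<alpha> * real n)) * ennreal \<bar>lp_block chi phi n a x\<bar>
      \<le> ennreal (2 powr (\<alpha> * real n)) * (ennreal \<bar>lp_block chi phi n (a - b) x\<bar> + ennreal \<bar>lp_block chi phi n b x\<bar>)"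
      by (rule mult_left_mono) simp
    also have "\<dots> = ennreal (2 powr (\<alpha> * real n)) * ennreal \<bar>lp_block chi phi n (a - b) x\<bar>
        + ennreal (2 powr (\<alpha> * real n)) * ennreal \<bar>lp_block chi phi n b x\<bar>"
      by (rule distrib_left)
    also have "\<dots> \<le> besov_norm chi phi \<alpha> (a - b) + besov_norm chi phi \<alpha> b"
      unfolding besov_norm_def
      by (intro add_mono SUP_upper2[of n UNIV] mult_left_mono SUP_upper) simp_all
    finally show ?thesis .
  qed
  then show ?thesis
    unfolding besov_norm_def[of _ _ _ a] by (simp add: SUP_mult_left_ennreal SUP_le_iff)
qed

lemma noise_X_diff: "noise_X (a - b) = noise_X a - noise_X b"
  by (auto simp: noise_X_def diff_divide_distrib)

text \<open>A weighted geometric mean of two bounds of the same quantity. With these weights the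
  field is Hoelder of order 1/8 and its block bounds remain summable.\<close>

lemma powr_interpolate:
  fixes d a b :: real
  assumes "0 \<le> d" "d \<le> a" "d \<le> b"
  shows "d \<le> a powr (7 / 8) * b powr (1 / 8)"
proof -
  have "d = d powr (7 / 8) * d powr (1 / 8)"
    using assms(1) by (simp add: powr_add[symmetric] powr_one_gt_zero_iff)
  also have "\<dots> \<le> a powr (7 / 8) * b powr (1 / 8)"
    using assms by (intro mult_mono powr_mono2) auto
  finally show ?thesis .
qed

text \<open>One rate for all series: it bounds 2^((\<kappa> - 1/16) n) for \<kappa> at most 1/32,
  and 2^((2 \<kappa> - 1/16) n) for \<kappa> at most 1/64.\<close>

definition decay_ratio :: real where
  "decay_ratio = 2 powr (- 1 / 32)"

lemma decay_ratio_bounds: "0 < decay_ratio" "decay_ratio < 1"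
  unfolding decay_ratio_def using powr_less_mono[of "- 1 / 32" 0 "2::real"] by simp_all

lemma decay_ratio_power: "2 powr (- real n / 32) = decay_ratio ^ n"
  unfolding decay_ratio_def by (simp add: powr_powr flip: powr_realpow)

lemma decay_ratio_sums: "(\<lambda>n. c * decay_ratio ^ n) sums (c * (1 / (1 - decay_ratio)))"
  by (intro sums_mult geometric_sums) (use decay_ratio_bounds in simp)

text \<open>The constant precedes \<open>a\<close> and the bound is linear in \<open>B\<close>, so
  that one statement serves the noise, the mollified noise and their difference. Summability is part
  of the conclusion because the infinite sums behind \<open>fun_of\<close> are later subtracted
  termwise.\<close>

lemma field_X_bounds:
  assumes d: "dyadic_partition chi phi"
  obtains C where "C > 0"
    "\<And>a B \<kappa> x h. (\<And>k. a (- k) = cnj (a k)) \<Longrightarrow> 0 \<le> B \<Longrightarrow> \<kappa> \<le> 1 / 32 \<Longrightarrow> besov_norm chi phi (- 1 - \<kappa>) a \<le> ennreal B \<Longrightarrow>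
      summable (\<lambda>n. lp_block chi phi n (noise_X a) x) \<and> \<bar>fun_of chi phi (noise_X a) x\<bar> \<le> C * B \<and>
      \<bar>fun_of chi phi (noise_X a) (x + h) - fun_of chi phi (noise_X a) x\<bar> \<le> C * B * norm h powr (1 / 8)"
proof -
  obtain C1 where C1: "C1 > 0" "\<And>n a M x. (\<And>k. a (- k) = cnj (a k)) \<Longrightarrow> (\<And>x. \<bar>lp_block chi phi n a x\<bar> \<le> M) \<Longrightarrow>
      \<bar>lp_block chi phi n (noise_X a) x\<bar> \<le> C1 * 2 powr (- 3 / 2 * real n) * M"
    using lp_inverse_laplacian[OF d] by blast
  obtain C2 where C2: "C2 > 0" "\<And>n a M x h. (\<And>k. a (- k) = cnj (a k)) \<Longrightarrow> (\<And>x. \<bar>lp_block chi phi n a x\<bar> \<le> M) \<Longrightarrow>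
      \<bar>lp_block chi phi n (noise_X a) (x + h) - lp_block chi phi n (noise_X a) x\<bar> \<le> C2 * 4 ^ n * M * norm h"
    using lp_lipschitz[OF d] by blast
  \<comment> \<open>Twice \<open>C1\<close> for an increment bounded by two values, and
    \<open>C2\<close> for the Lipschitz bound.\<close>
  define K where "K = 2 * C1 + C2"
  have K: "K > 0" using C1(1) C2(1) by (simp add: K_def)
  show thesis
  proof (rule that[of "K * (1 / (1 - decay_ratio))"])
    show "0 < K * (1 / (1 - decay_ratio))" using K decay_ratio_bounds by simp
    fix a B \<kappa> and x h :: plane
    assume herm: "\<And>k. a (- k) = cnj (a k)" and B: "0 \<le> B" and \<kappa>: "\<kappa> \<le> 1 / 32"
      and bes: "besov_norm chi phi (- 1 - \<kappa>) a \<le> ennreal B"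
    let ?Y = "\<lambda>n. lp_block chi phi n (noise_X a)"
    have M: "\<bar>lp_block chi phi n a x\<bar> \<le> B * 2 powr ((1 + \<kappa>) * real n)" for n x
      using besov_block_bound[OF bes B, of n x] by (simp add: add.commute)
    have Y1: "\<bar>?Y n x\<bar> \<le> C1 * B * 2 powr ((\<kappa> - 1 / 2) * real n)" for n x
    proof -
      have "\<bar>?Y n x\<bar> \<le> C1 * 2 powr (- 3 / 2 * real n) * (B * 2 powr ((1 + \<kappa>) * real n))"
        by (rule C1(2), rule herm, rule M)
      also have "\<dots> = C1 * B * 2 powr (- 3 / 2 * real n + (1 + \<kappa>) * real n)"
        by (simp only: powr_add mult_ac)
      also have "- 3 / 2 * real n + (1 + \<kappa>) * real n = (\<kappa> - 1 / 2) * real n" by (simp add: algebra_simps)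
      finally show ?thesis .
    qed
    have Y2: "\<bar>?Y n (x + h) - ?Y n x\<bar> \<le> C2 * B * 2 powr ((3 + \<kappa>) * real n) * norm h" for n x
    proof -
      have "\<bar>?Y n (x + h) - ?Y n x\<bar> \<le> C2 * 4 ^ n * (B * 2 powr ((1 + \<kappa>) * real n)) * norm h"
        by (rule C2(2), rule herm, rule M)
      also have "(4::real) ^ n = 2 powr (2 * real n)"
        by (simp add: powr_powr[symmetric] powr_realpow)
      also have "C2 * 2 powr (2 * real n) * (B * 2 powr ((1 + \<kappa>) * real n)) * norm h
          = C2 * B * 2 powr (2 * real n + (1 + \<kappa>) * real n) * norm h"
        by (simp only: powr_add mult_ac)
      also have "2 * real n + (1 + \<kappa>) * real n = (3 + \<kappa>) * real n" by (simp add: algebra_simps)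
      finally show ?thesis .
    qed
    have P: "\<bar>?Y n x\<bar> \<le> K * B * decay_ratio ^ n" for n x
    proof -
      have "(\<kappa> - 1 / 2) * real n \<le> (- 1 / 32) * real n" using \<kappa> by (intro mult_right_mono) auto
      then have a1: "2 powr ((\<kappa> - 1 / 2) * real n) \<le> decay_ratio ^ n"
        unfolding decay_ratio_power[symmetric] by (intro powr_mono) auto
      have a2: "C1 * B \<le> K * B" using B C1(1) C2(1) unfolding K_def by (intro mult_right_mono) auto
      have "C1 * B * 2 powr ((\<kappa> - 1 / 2) * real n) \<le> K * B * decay_ratio ^ n"
        by (rule mult_mono[OF a2 a1]) (use K B in simp_all)
      then show ?thesis using Y1[of n x] by linarith
    qed
    have Q: "\<bar>?Y n (x + h) - ?Y n x\<bar> \<le> K * B * norm h powr (1 / 8) * decay_ratio ^ n" for n x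
    proof -
      let ?d = "\<bar>?Y n (x + h) - ?Y n x\<bar>"
      have KB: "0 \<le> K * B" using K B by simp
      have "2 * (C1 * B * 2 powr ((\<kappa> - 1 / 2) * real n)) \<le> K * B * 2 powr ((\<kappa> - 1 / 2) * real n)"
        using B C2(1) unfolding K_def by (simp add: algebra_simps)
      then have d1: "?d \<le> K * B * 2 powr ((\<kappa> - 1 / 2) * real n)"
        using Y1[of n "x + h"] Y1[of n x] by linarith
      have "C2 * B * 2 powr ((3 + \<kappa>) * real n) * norm h \<le> K * B * 2 powr ((3 + \<kappa>) * real n) * norm h"
        using B C1(1) unfolding K_def by (intro mult_right_mono) auto
      then have d2: "?d \<le> K * B * 2 powr ((3 + \<kappa>) * real n) * norm h"
        using Y2[of n x] by linarith
      \<comment> \<open>The exponent becomes 7/8 (\<kappa> - 1/2) + 1/8 (3 + \<kappa>) = \<kappa> -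
        1/16.\<close>
      have "?d \<le> (K * B * 2 powr ((\<kappa> - 1 / 2) * real n)) powr (7 / 8) * (K * B * 2 powr ((3 + \<kappa>) * real n) * norm h) powr (1 / 8)"
        by (rule powr_interpolate[OF abs_ge_zero d1 d2])
      also have "\<dots> = ((K * B) powr (7 / 8) * (K * B) powr (1 / 8)) * (2 powr ((\<kappa> - 1 / 2) * real n * (7 / 8)) * 2 powr ((3 + \<kappa>) * real n * (1 / 8))) * norm h powr (1 / 8)"
        using KB by (simp add: powr_mult powr_powr del: times_divide_eq_right)
      also have "(K * B) powr (7 / 8) * (K * B) powr (1 / 8) = K * B"
        using KB by (simp add: powr_add[symmetric] powr_one_gt_zero_iff)
      also have "2 powr ((\<kappa> - 1 / 2) * real n * (7 / 8)) * 2 powr ((3 + \<kappa>) * real n * (1 / 8)) = 2 powr ((\<kappa> - 1 / 16) * real n)"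
        unfolding powr_add[symmetric] by (rule arg_cong[where f="\<lambda>t. 2 powr t"]) (simp add: field_simps)
      also have "K * B * 2 powr ((\<kappa> - 1 / 16) * real n) * norm h powr (1 / 8) \<le> K * B * decay_ratio ^ n * norm h powr (1 / 8)"
      proof -
        have "(\<kappa> - 1 / 16) * real n \<le> (- 1 / 32) * real n" using \<kappa> by (intro mult_right_mono) auto
        then have "2 powr ((\<kappa> - 1 / 16) * real n) \<le> decay_ratio ^ n"
          unfolding decay_ratio_power[symmetric] by (intro powr_mono) auto
        then show ?thesis using KB by (intro mult_right_mono mult_left_mono) auto
      qed
      finally show ?thesis by (simp add: mult_ac)
    qed
    have sumP: "summable (\<lambda>n. \<bar>?Y n x\<bar>)" for x
      by (rule summable_comparison_test'[OF sums_summable[OF decay_ratio_sums[of "K * B"]], of 0]) (use P in auto)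
    then have sumY: "summable (\<lambda>n. ?Y n x)" for x by (rule summable_rabs_cancel)
    have "\<bar>fun_of chi phi (noise_X a) x\<bar> \<le> (\<Sum>n. \<bar>?Y n x\<bar>)"
      unfolding fun_of_def by (rule summable_rabs[OF sumP])
    also have "\<dots> \<le> (\<Sum>n. K * B * decay_ratio ^ n)"
      by (rule suminf_le[OF P sumP sums_summable[OF decay_ratio_sums]])
    also have "\<dots> = K * (1 / (1 - decay_ratio)) * B"
      using sums_unique[OF decay_ratio_sums[of "K * B"]] by (simp add: mult_ac)
    finally have F1: "\<bar>fun_of chi phi (noise_X a) x\<bar> \<le> K * (1 / (1 - decay_ratio)) * B" .
    have sumQ: "summable (\<lambda>n. \<bar>?Y n (x + h) - ?Y n x\<bar>)"
      by (rule summable_comparison_test'[OF sums_summable[OF decay_ratio_sums[of "K * B * norm h powr (1 / 8)"]], of 0]) (use Q in auto)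
    have "fun_of chi phi (noise_X a) (x + h) - fun_of chi phi (noise_X a) x = (\<Sum>n. ?Y n (x + h) - ?Y n x)"
      unfolding fun_of_def by (rule suminf_diff[OF sumY sumY])
    then have "\<bar>fun_of chi phi (noise_X a) (x + h) - fun_of chi phi (noise_X a) x\<bar> \<le> (\<Sum>n. \<bar>?Y n (x + h) - ?Y n x\<bar>)"
      using summable_rabs[OF sumQ] by simp
    also have "\<dots> \<le> (\<Sum>n. K * B * norm h powr (1 / 8) * decay_ratio ^ n)"
      by (rule suminf_le[OF Q sumQ sums_summable[OF decay_ratio_sums]])
    also have "\<dots> = K * (1 / (1 - decay_ratio)) * B * norm h powr (1 / 8)"
      using sums_unique[OF decay_ratio_sums[of "K * B * norm h powr (1 / 8)"]] by (simp add: mult_ac)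
    finally show "summable (\<lambda>n. ?Y n x) \<and> \<bar>fun_of chi phi (noise_X a) x\<bar> \<le> K * (1 / (1 - decay_ratio)) * B \<and>
      \<bar>fun_of chi phi (noise_X a) (x + h) - fun_of chi phi (noise_X a) x\<bar> \<le> K * (1 / (1 - decay_ratio)) * B * norm h powr (1 / 8)"
      using sumY F1 by blast
  qed
qed

section \<open>Pairing a distribution with a Hoelder function\<close>

lemma torus_periodic_translate:
  assumes "torus_periodic f"
  shows "torus_periodic (\<lambda>x. f (x + s))"
  unfolding torus_periodic_def
proof (intro allI conjI)
  fix x :: plane
  have e: "x + t + s = (x + s) + t" for t by (simp add: add_ac)
  show "f (x + (2 * pi, 0) + s) = f (x + s)" "f (x + (0, 2 * pi) + s) = f (x + s)"
    unfolding e using assms unfolding torus_periodic_def by blast+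
qed

text \<open>Translation invariance moves each shift from \<open>f\<close> to \<open>g\<close>, so
  that only the sup norm of \<open>f\<close> and the L1 modulus of continuity of \<open>g\<close>
  matter. The diagonal shifts have length at most 2 h.\<close>

lemma shift_avg_integral:
  assumes f: "cont_periodic f" and M: "\<And>x. \<bar>f x\<bar> \<le> M"
    and g: "integrable torus_measure g" "g \<in> borel_measurable borel" "torus_periodic g"
    and L: "\<And>s. norm s \<le> 2 * h \<Longrightarrow> (\<integral>x. \<bar>g (x + s) - g x\<bar> \<partial>torus_measure) \<le> L" and h: "0 \<le> h"
  shows "\<bar>\<integral>x. (f x - shift_avg h f x) * g x \<partial>torus_measure\<bar> \<le> M * L"
proof -
  have M0: "0 \<le> M" using order_trans[OF abs_ge_zero M] .
  have fm [measurable]: "f \<in> borel_measurable borel" by (rule cont_periodic_measurable[OF f])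
  have ifg: "integrable torus_measure (\<lambda>x. f (x + s) * g (x + t))" for s t
  proof -
    have "integrable torus_measure (\<lambda>x. g (x + t))" using integrable_torus_translate[OF g(2,3)] g(1) by simp
    from integrable_mult_bounded[OF this, of "\<lambda>x. f (x + s)" M] show ?thesis using M by (simp add: mult.commute)
  qed
  have one: "\<bar>\<integral>x. (f x - f (x + s)) * g x \<partial>torus_measure\<bar> \<le> M * L" if s: "norm s \<le> 2 * h" for s
  proof -
    have per: "torus_periodic (\<lambda>x. f (x + s) * g x)"
      using torus_periodic_translate[of f s] f g(3) unfolding cont_periodic_def torus_periodic_def by simp
    have "(\<integral>x. f (x + s) * g x \<partial>torus_measure) = (\<integral>x. f (x - s + s) * g (x - s) \<partial>torus_measure)"
      using integral_torus_translate[OF _ per, of "- s"] g(2) by simp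
    also have "\<dots> = (\<integral>x. f x * g (x - s) \<partial>torus_measure)" by simp
    finally have eq: "(\<integral>x. f (x + s) * g x \<partial>torus_measure) = (\<integral>x. f x * g (x - s) \<partial>torus_measure)" .
    have "(\<integral>x. (f x - f (x + s)) * g x \<partial>torus_measure) = (\<integral>x. f x * g x \<partial>torus_measure) - (\<integral>x. f x * g (x - s) \<partial>torus_measure)"
      using ifg[of 0 0] ifg[of s 0] eq by (simp add: left_diff_distrib)
    also have "\<dots> = (\<integral>x. f x * (g x - g (x - s)) \<partial>torus_measure)"
      using ifg[of 0 0] ifg[of 0 "- s"] by (simp add: right_diff_distrib)
    also have "\<bar>\<dots>\<bar> \<le> (\<integral>x. \<bar>f x * (g x - g (x - s))\<bar> \<partial>torus_measure)" by (rule integral_abs_bound)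
    also have "\<dots> \<le> (\<integral>x. M * \<bar>g (x + - s) - g x\<bar> \<partial>torus_measure)"
    proof (rule integral_mono')
      show "integrable torus_measure (\<lambda>x. M * \<bar>g (x + - s) - g x\<bar>)"
        using integrable_torus_translate[OF g(2,3), of "- s"] g(1) by simp
      show "\<bar>f x * (g x - g (x - s))\<bar> \<le> M * \<bar>g (x + - s) - g x\<bar>" for x
        using mult_right_mono[OF M[of x], of "\<bar>g (x - s) - g x\<bar>"] by (simp add: abs_mult abs_minus_commute)
    qed (use M0 in simp)
    also have "\<dots> \<le> M * L" using L[of "- s"] s M0 by (simp add: mult_left_mono)
    finally show ?thesis .
  qed
  have n: "norm (a, b) \<le> 2 * h" if "\<bar>a\<bar> = h" "\<bar>b\<bar> = h" for a b :: real
    using norm_Pair_le[of a b] that by simp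
  have i: "integrable torus_measure (\<lambda>x. (f x - f (x + s)) * g x)" for s
    using ifg[of 0 0] ifg[of s 0] by (simp add: left_diff_distrib)
  have "(\<integral>x. (f x - shift_avg h f x) * g x \<partial>torus_measure)
    = (\<integral>x. (((f x - f (x + (h, h))) * g x + (f x - f (x + (h, - h))) * g x) + ((f x - f (x + (- h, h))) * g x + (f x - f (x + (- h, - h))) * g x)) / 4 \<partial>torus_measure)"
    by (rule Bochner_Integration.integral_cong) (simp_all add: shift_avg_def field_simps)
  also have "\<dots> = (((\<integral>x. (f x - f (x + (h, h))) * g x \<partial>torus_measure) + (\<integral>x. (f x - f (x + (h, - h))) * g x \<partial>torus_measure))
     + ((\<integral>x. (f x - f (x + (- h, h))) * g x \<partial>torus_measure) + (\<integral>x. (f x - f (x + (- h, - h))) * g x \<partial>torus_measure))) / 4"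
    using i by (simp only: integral_divide_zero Bochner_Integration.integral_add Bochner_Integration.integrable_add simp_thms)
  finally show ?thesis
    using one[OF n[of h h]] one[OF n[of h "- h"]] one[OF n[of "- h" h]] one[OF n[of "- h" "- h"]] h by simp
qed

text \<open>Averaging does not increase the sup norm, so each further average costs the same amount
  M L.\<close>

lemma shift_telescope:
  assumes M: "\<And>x. \<bar>trig_sum A c x\<bar> \<le> M"
    and g: "integrable torus_measure g" "g \<in> borel_measurable borel" "torus_periodic g"
    and L: "\<And>s. norm s \<le> 2 * h \<Longrightarrow> (\<integral>x. \<bar>g (x + s) - g x\<bar> \<partial>torus_measure) \<le> L" and h: "0 \<le> h"
  shows "\<bar>\<integral>x. (trig_sum A c x - trig_sum A (\<lambda>k. of_real (shift_mult h k ^ m) * c k) x) * g x \<partial>torus_measure\<bar> \<le> real m * (M * L)"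
proof (induction m)
  case 0
  then show ?case by simp
next
  case (Suc m)
  let ?t = "\<lambda>m. trig_sum A (\<lambda>k. of_real (shift_mult h k ^ m) * c k)"
  have i: "integrable torus_measure (\<lambda>x. (?t j x - ?t l x) * g x)" for j l
  proof -
    have "cont_periodic (\<lambda>x. ?t j x - ?t l x)" by (intro cont_periodic_arith cont_periodic_trig_sum)
    moreover then obtain B where "\<And>x. \<bar>?t j x - ?t l x\<bar> \<le> B" using cont_periodic_bounded by blast
    ultimately show ?thesis
      using integrable_mult_bounded[OF g(1), of "\<lambda>x. ?t j x - ?t l x" B] cont_periodic_measurable by (simp add: mult.commute)
  qed
  have "(\<integral>x. (trig_sum A c x - ?t (Suc m) x) * g x \<partial>torus_measure)
     = (\<integral>x. (?t 0 x - ?t m x) * g x + (?t m x - ?t (Suc m) x) * g x \<partial>torus_measure)"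
    by (rule Bochner_Integration.integral_cong) (simp_all add: algebra_simps)
  also have "\<dots> = (\<integral>x. (?t 0 x - ?t m x) * g x \<partial>torus_measure) + (\<integral>x. (?t m x - shift_avg h (?t m) x) * g x \<partial>torus_measure)"
    using i[of 0 m] i[of m "Suc m"] unfolding trig_sum_shift_power by (rule Bochner_Integration.integral_add)
  finally have "(\<integral>x. (trig_sum A c x - ?t (Suc m) x) * g x \<partial>torus_measure)
     = (\<integral>x. (trig_sum A c x - ?t m x) * g x \<partial>torus_measure) + (\<integral>x. (?t m x - shift_avg h (?t m) x) * g x \<partial>torus_measure)"
    by simp
  moreover have "\<bar>\<integral>x. (?t m x - shift_avg h (?t m) x) * g x \<partial>torus_measure\<bar> \<le> M * L"
    by (rule shift_avg_integral[OF cont_periodic_trig_sum trig_sum_shift_power_bound[OF M] g L h])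
  ultimately show ?case
    using Suc by (simp add: distrib_right)
qed

lemma polynomial_times_geometric_bounded:
  assumes "0 \<le> q" "q < 1"
  obtains C :: real where "C > 0" "\<And>m. real m ^ p * q ^ m \<le> C"
proof -
  have "(\<lambda>m. real m ^ p * q ^ m) \<longlonglongrightarrow> 0"
    using assms by (cases "q = 0") real_asymp+
  then have "Bseq (\<lambda>m. real m ^ p * q ^ m)" by (intro convergent_imp_Bseq convergentI)
  then obtain K where "K > 0" "\<And>m. norm (real m ^ p * q ^ m) \<le> K" unfolding Bseq_def by blast
  then show thesis using that[of K] by (metis abs_le_D1 real_norm_def)
qed

text \<open>An L1 Besov condition of order 1/8, with one constant for the L1 norm and for the
  modulus of continuity. Shifts of length at most 2 suffice, since those applied to \<open>g\<close>
  have length at most 2 h with h at most 1.\<close>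

definition hoelder_L1 :: "real \<Rightarrow> (plane \<Rightarrow> real) \<Rightarrow> bool" where
  "hoelder_L1 L g \<longleftrightarrow> integrable torus_measure g \<and> g \<in> borel_measurable borel \<and> torus_periodic g \<and>
    (\<integral>x. \<bar>g x\<bar> \<partial>torus_measure) \<le> L \<and>
    (\<forall>s. norm s \<le> 2 \<longrightarrow> (\<integral>x. \<bar>g (x + s) - g x\<bar> \<partial>torus_measure) \<le> L * norm s powr (1 / 8))"

lemma hoelder_L1_nonneg:
  assumes "hoelder_L1 L g"
  shows "0 \<le> L"
proof -
  have "0 \<le> (\<integral>x. \<bar>g x\<bar> \<partial>torus_measure)" by (rule Bochner_Integration.integral_nonneg) simp
  then show ?thesis using assms unfolding hoelder_L1_def by linarith
qed

lemma integral_prod_sup_le: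
  fixes f g :: "plane \<Rightarrow> real"
  assumes "integrable torus_measure g" "f \<in> borel_measurable borel" "\<And>x. \<bar>f x\<bar> \<le> M" "(\<integral>x. \<bar>g x\<bar> \<partial>torus_measure) \<le> L"
  shows "\<bar>\<integral>x. f x * g x \<partial>torus_measure\<bar> \<le> M * L"
proof -
  have M0: "0 \<le> M" using order_trans[OF abs_ge_zero assms(3)] .
  have "\<bar>\<integral>x. f x * g x \<partial>torus_measure\<bar> \<le> (\<integral>x. \<bar>f x * g x\<bar> \<partial>torus_measure)" by (rule integral_abs_bound)
  also have "\<dots> \<le> (\<integral>x. M * \<bar>g x\<bar> \<partial>torus_measure)"
  proof (rule integral_mono')
    show "\<bar>f x * g x\<bar> \<le> M * \<bar>g x\<bar>" for x
      unfolding abs_mult by (intro mult_right_mono assms) simp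
  qed (use assms M0 in simp_all)
  also have "\<dots> \<le> M * L" using assms(4) M0 by (simp add: mult_left_mono)
  finally show ?thesis .
qed

text \<open>One coordinate carries at least half of the frequency, so one cosine is at most cos y,
  and the other is at most 1. The condition |k| h \<le> 1 keeps both arguments where the cosine is
  decreasing and nonnegative.\<close>

lemma shift_mult_bound:
  assumes h: "0 < h" "norm (freq k) * h \<le> 1" and y: "0 \<le> y" "y \<le> norm (freq k) * h / 2"
  shows "0 \<le> shift_mult h k" "shift_mult h k \<le> cos y"
proof -
  define a b where "a = \<bar>real_of_int (fst k)\<bar> * h" and "b = \<bar>real_of_int (snd k)\<bar> * h"
  have fs: "\<bar>real_of_int (fst k)\<bar> \<le> norm (freq k)" "\<bar>real_of_int (snd k)\<bar> \<le> norm (freq k)"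
    using norm_fst_le[of "of_int (fst k) :: real" "of_int (snd k) :: real"]
      norm_snd_le[of "of_int (snd k) :: real" "of_int (fst k) :: real"] by (simp_all add: freq_def)
  have ab: "0 \<le> a" "0 \<le> b" "a \<le> 1" "b \<le> 1"
  proof -
    have "a \<le> norm (freq k) * h" "b \<le> norm (freq k) * h"
      unfolding a_def b_def using fs h(1) by (intro mult_right_mono; simp)+
    then show "a \<le> 1" "b \<le> 1" using h(2) by simp_all
    show "0 \<le> a" "0 \<le> b" using h(1) by (simp_all add: a_def b_def)
  qed
  have pi: "1 < pi / 2" "1 \<le> pi" using pi_gt3 by simp_all
  have c: "0 \<le> cos a" "0 \<le> cos b" using ab pi by (intro cos_ge_zero; linarith)+
  have eq: "shift_mult h k = cos a * cos b"
  proof -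
    have "cos (t * h) = cos (\<bar>t\<bar> * h)" for t :: real by (simp add: abs_if)
    then show ?thesis unfolding shift_mult_def a_def b_def by metis
  qed
  show "0 \<le> shift_mult h k" unfolding eq using c by simp
  have "norm (freq k) \<le> \<bar>real_of_int (fst k)\<bar> + \<bar>real_of_int (snd k)\<bar>"
    using norm_Pair_le[of "real_of_int (fst k)" "real_of_int (snd k)"] by (simp add: freq_def)
  then have "norm (freq k) * h \<le> a + b"
    unfolding a_def b_def distrib_right[symmetric] using h(1) by (rule mult_right_mono[OF _ less_imp_le])
  then have "y \<le> a \<or> y \<le> b" using y by linarith
  then have "cos a \<le> cos y \<or> cos b \<le> cos y"
    using ab y pi by (auto intro!: cos_monotone_0_pi_le)
  then show "shift_mult h k \<le> cos y"
  proof
    assume "cos a \<le> cos y"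
    then show ?thesis unfolding eq using mult_left_mono[OF cos_le_one[of b] c(1)] by linarith
  next
    assume "cos b \<le> cos y"
    then show ?thesis unfolding eq using mult_right_mono[OF cos_le_one[of a] c(2)] by linarith
  qed
qed

text \<open>
  With Q the average of the four shifts by (\<pm>h, \<pm>h), h of order 2^(-n), and m of order
  2^(n/16): f - Q^m f telescopes into m differences that move onto g, each of order h^(1/8) =
  2^(-n/8), and Q^m f is exponentially small in m because Q has multiplier bounded away from 1
  on the block.
\<close>

lemma lp_pairing_bound:
  assumes d: "dyadic_partition chi phi"
  obtains C where "C > 0" "\<And>n a M g L. (\<And>k. a (- k) = cnj (a k)) \<Longrightarrow> (\<And>x. \<bar>lp_block chi phi n a x\<bar> \<le> M) \<Longrightarrow>
      hoelder_L1 L g \<Longrightarrow> \<bar>\<integral>x. lp_block chi phi n a x * g x \<partial>torus_measure\<bar> \<le> C * 2 powr (- real n / 16) * M * L"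
proof -
  obtain r R where r: "0 < r" and R: "1 \<le> R"
    and sR: "\<And>n k. lp_multiplier chi phi n k \<noteq> 0 \<Longrightarrow> norm (freq k) \<le> R * 2 ^ n"
    and sr: "\<And>n k. n > 0 \<Longrightarrow> lp_multiplier chi phi n k \<noteq> 0 \<Longrightarrow> r * 2 ^ n \<le> norm (freq k)"
    using lp_multiplier_support[OF d] by metis
  \<comment> \<open>On a block with n > 0 the product |k| h will lie between r / R and 1, so half
    the lower bound is admissible in \<open>shift_mult_bound\<close>; the cap at 1 keeps the cosine
    nonnegative.\<close>
  define y where "y = min 1 (r / (2 * R))"
  have y: "0 < y" "y \<le> 1" using r R by (simp_all add: y_def)
  have q: "0 \<le> cos y" "cos y < 1"
  proof -
    have "1 < pi / 2" using pi_gt3 by simp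
    then show "0 \<le> cos y" using y by (intro cos_ge_zero) linarith+
    show "cos y < 1" using cos_monotone_0_pi[of 0 y] y pi_gt3 by simp
  qed
  \<comment> \<open>With p = 2^(n/16), the number of frequencies is of order 4^n = p^32; one more
    power provides the gain 1 / p.\<close>
  obtain C1 where C1: "C1 > 0" "\<And>m. real m ^ 33 * cos y ^ m \<le> C1"
    using polynomial_times_geometric_bounded[OF q] by blast
  define C where "C = 1 + 4 + 25 * R\<^sup>2 * C1"
  have C: "C > 0" using C1(1) R by (simp add: C_def add_pos_pos)
  show thesis
  proof (rule that[OF C])
    fix n a M g L
    assume herm: "\<And>k. a (- k) = cnj (a k)" and M: "\<And>x. \<bar>lp_block chi phi n a x\<bar> \<le> M" and g: "hoelder_L1 L g"
    have M0: "0 \<le> M" using order_trans[OF abs_ge_zero M] .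
    have L0: "0 \<le> L" by (rule hoelder_L1_nonneg[OF g])
    have ig: "integrable torus_measure g" "g \<in> borel_measurable borel" "torus_periodic g" "(\<integral>x. \<bar>g x\<bar> \<partial>torus_measure) \<le> L"
      and gs: "\<And>s. norm s \<le> 2 \<Longrightarrow> (\<integral>x. \<bar>g (x + s) - g x\<bar> \<partial>torus_measure) \<le> L * norm s powr (1 / 8)"
      using g unfolding hoelder_L1_def by blast+
    show "\<bar>\<integral>x. lp_block chi phi n a x * g x \<partial>torus_measure\<bar> \<le> C * 2 powr (- real n / 16) * M * L"
    proof (cases "n = 0")
      case True
      have "\<bar>\<integral>x. lp_block chi phi n a x * g x \<partial>torus_measure\<bar> \<le> M * L"
        by (rule integral_prod_sup_le[OF ig(1) lp_block_measurable[OF d] M ig(4)])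
      also have "\<dots> \<le> C * (M * L)"
        using mult_right_mono[of 1 C "M * L"] M0 L0 C1(1) R by (simp add: C_def)
      finally show ?thesis using True by (simp add: mult.assoc)
    next
      case False
      let ?A = "lp_freqs chi phi n" and ?c = "lp_coeff chi phi n a"
      have H: "hermitian ?A ?c" by (rule hermitian_lp[OF d], rule herm)
      have Mt: "\<And>x. \<bar>trig_sum ?A ?c x\<bar> \<le> M" using M unfolding lp_block_trig_sum .
      have card: "real (card ?A) \<le> 25 * R\<^sup>2 * 4 ^ n"
        by (rule card_lp_freqs[OF R]) (auto simp: lp_freqs_def intro: sR)
      \<comment> \<open>Chosen so that |k| h \<le> 1 for every frequency of the block.\<close>
      define h where "h = 1 / (R * 2 ^ n)"
      have h: "0 < h" "h \<le> 1"
      proof -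
        have "1 \<le> R * 2 ^ n" using mult_mono[OF R one_le_power[of "2::real" n]] R by simp
        then show "0 < h" "h \<le> 1" by (simp_all add: h_def)
      qed
      \<comment> \<open>Since (2 h)^(1/8) is at most 2 / p^2, at most 2 p averages cost 4 / p in
        total, while at least p of them already make the averaged block smaller than any fixed power
        of 1 / p, up to a constant.\<close>
      define p where "p = 2 powr (real n / 16)"
      have p1: "1 \<le> p" unfolding p_def using powr_mono[of 0 "real n / 16" "2::real"] by simp
      define m where "m = nat \<lceil>p\<rceil>"
      have m: "p \<le> real m" "real m \<le> 2 * p" using p1 unfolding m_def by linarith+
      define Qf where "Qf = trig_sum ?A (\<lambda>k. of_real (shift_mult h k ^ m) * ?c k)"
      have first: "\<bar>\<integral>x. (trig_sum ?A ?c x - Qf x) * g x \<partial>torus_measure\<bar> \<le> real m * (M * (L * (2 * h) powr (1 / 8)))"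
        unfolding Qf_def
      proof (rule shift_telescope[OF Mt ig(1-3)])
        fix s :: plane assume s: "norm s \<le> 2 * h"
        have "(\<integral>x. \<bar>g (x + s) - g x\<bar> \<partial>torus_measure) \<le> L * norm s powr (1 / 8)"
          using s h by (intro gs) linarith
        also have "\<dots> \<le> L * (2 * h) powr (1 / 8)"
          using s L0 by (intro mult_left_mono powr_mono2) auto
        finally show "(\<integral>x. \<bar>g (x + s) - g x\<bar> \<partial>torus_measure) \<le> L * (2 * h) powr (1 / 8)" .
      qed (use h in simp)
      have hp: "(2 * h) powr (1 / 8) \<le> 2 * (1 / p\<^sup>2)"
      proof -
        have "2 * h \<le> 2 * 2 powr (- real n)"
          using R by (simp add: h_def powr_minus powr_realpow divide_simps)
        then have "(2 * h) powr (1 / 8) \<le> (2 * 2 powr (- real n)) powr (1 / 8)"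
          using h by (intro powr_mono2) auto
        also have "\<dots> = 2 powr (1 / 8) * 2 powr (- (real n / 8))"
          by (simp add: powr_mult powr_powr)
        also have "\<dots> \<le> 2 * 2 powr (- (real n / 8))"
          using powr_mono[of "1 / 8" 1 "2::real"] by (intro mult_right_mono) auto
        also have "2 powr (- (real n / 8)) = 1 / p\<^sup>2"
          unfolding p_def by (simp add: powr_minus powr_powr inverse_eq_divide flip: powr_realpow)
        finally show ?thesis .
      qed
      have one: "real m * (M * (L * (2 * h) powr (1 / 8))) \<le> 4 * (1 / p) * M * L"
      proof -
        have "real m * (M * (L * (2 * h) powr (1 / 8))) \<le> (2 * p) * (M * (L * (2 * (1 / p\<^sup>2))))"
          using m M0 L0 p1 by (intro mult_mono mult_left_mono hp) auto
        also have "\<dots> = 4 * (1 / p) * M * L" using p1 by (simp add: power2_eq_square field_simps)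
        finally show ?thesis .
      qed
      have Qb: "\<bar>Qf x\<bar> \<le> 25 * R\<^sup>2 * C1 * (1 / p) * M" for x
      proof -
        have "\<bar>Qf x\<bar> \<le> (\<Sum>k\<in>?A. cmod (of_real (shift_mult h k ^ m) * ?c k))"
          unfolding Qf_def by (rule trig_sum_norm_le)
        also have "\<dots> \<le> (\<Sum>k\<in>?A. cos y ^ m * M)"
        proof (rule sum_mono)
          fix k assume k: "k \<in> ?A"
          have n1: "norm (freq k) \<le> R * 2 ^ n" using sR[of n k] k by (simp add: lp_freqs_def)
          have n2: "r * 2 ^ n \<le> norm (freq k)" using sr[of n k] k False by (simp add: lp_freqs_def)
          have "norm (freq k) * h \<le> (R * 2 ^ n) * h" using h n1 by (intro mult_right_mono) auto
          also have "(R * 2 ^ n) * h = 1" using R by (simp add: h_def)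
          finally have u1: "norm (freq k) * h \<le> 1" .
          have "(r * 2 ^ n) * h \<le> norm (freq k) * h" using h n2 by (intro mult_right_mono) auto
          moreover have "(r * 2 ^ n) * h = r / R" using R by (simp add: h_def)
          ultimately have u2: "y \<le> norm (freq k) * h / 2" by (simp add: y_def)
          have sm: "0 \<le> shift_mult h k" "shift_mult h k \<le> cos y"
            using shift_mult_bound[OF h(1) u1 _ u2] y by simp_all
          have "cmod (of_real (shift_mult h k ^ m) * ?c k) = shift_mult h k ^ m * cmod (?c k)"
            unfolding norm_mult norm_of_real using sm by simp
          also have "\<dots> \<le> cos y ^ m * M"
            using sm q M0 by (intro mult_mono power_mono trig_sum_coeff_bound[OF H Mt k]) auto
          finally show "cmod (of_real (shift_mult h k ^ m) * ?c k) \<le> cos y ^ m * M" .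
        qed
        also have "\<dots> = real (card ?A) * (cos y ^ m * M)" by simp
        also have "\<dots> \<le> (25 * R\<^sup>2 * 4 ^ n) * (cos y ^ m * M)"
          using M0 q by (intro mult_right_mono card) auto
        also have "(4::real) ^ n = p ^ 32"
        proof -
          have "(4::real) ^ n = 2 powr (2 * real n)"
            by (simp add: powr_powr[symmetric] powr_realpow)
          also have "\<dots> = p powr 32" by (simp add: p_def powr_powr)
          also have "\<dots> = p ^ 32" using p1 by simp
          finally show ?thesis .
        qed
        also have "(25 * R\<^sup>2 * p ^ 32) * (cos y ^ m * M) \<le> 25 * R\<^sup>2 * (C1 * (1 / p)) * M"
        proof -
          have "p ^ 33 * cos y ^ m \<le> real m ^ 33 * cos y ^ m"
            using m p1 q by (intro mult_right_mono power_mono) auto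
          also have "\<dots> \<le> C1" by (rule C1)
          finally have "p * (p ^ 32 * cos y ^ m) \<le> C1" by (simp add: eval_nat_numeral mult_ac)
          then have "p ^ 32 * cos y ^ m \<le> C1 * (1 / p)" using p1 by (simp add: field_simps)
          then have "25 * R\<^sup>2 * (p ^ 32 * cos y ^ m) * M \<le> 25 * R\<^sup>2 * (C1 * (1 / p)) * M"
            using M0 by (intro mult_right_mono mult_left_mono) auto
          then show ?thesis by (simp add: mult_ac)
        qed
        finally show ?thesis by (simp add: mult_ac)
      qed
      have two: "\<bar>\<integral>x. Qf x * g x \<partial>torus_measure\<bar> \<le> 25 * R\<^sup>2 * C1 * (1 / p) * M * L"
        by (rule integral_prod_sup_le[OF ig(1) _ Qb ig(4)]) (simp add: Qf_def cont_periodic_measurable[OF cont_periodic_trig_sum])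
      have im: "integrable torus_measure (\<lambda>x. f x * g x)" if "cont_periodic f" for f
      proof -
        obtain B where "\<And>x. \<bar>f x\<bar> \<le> B" using cont_periodic_bounded[OF \<open>cont_periodic f\<close>] by blast
        then show ?thesis
          using integrable_mult_bounded[OF ig(1) cont_periodic_measurable[OF that], of B] by (simp add: mult.commute)
      qed
      have "(\<integral>x. lp_block chi phi n a x * g x \<partial>torus_measure) = (\<integral>x. (trig_sum ?A ?c x - Qf x) * g x \<partial>torus_measure) + (\<integral>x. Qf x * g x \<partial>torus_measure)"
        unfolding lp_block_trig_sum using im[OF cont_periodic_trig_sum, of ?A ?c] im[OF cont_periodic_trig_sum] unfolding Qf_def
        by (simp add: left_diff_distrib)
      then have "\<bar>\<integral>x. lp_block chi phi n a x * g x \<partial>torus_measure\<bar> \<le> 4 * (1 / p) * M * L + 25 * R\<^sup>2 * C1 * (1 / p) * M * L"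
        using first one two by linarith
      also have "\<dots> = (4 + 25 * R\<^sup>2 * C1) * (1 / p) * M * L" by (simp add: algebra_simps)
      also have "\<dots> \<le> C * (1 / p) * M * L"
        using M0 L0 p1 unfolding C_def by (intro mult_right_mono) auto
      also have "1 / p = 2 powr (- real n / 16)" by (simp add: p_def powr_minus inverse_eq_divide)
      finally show ?thesis .
    qed
  qed
qed

text \<open>The gain 2^(-n/16) on block n outweighs the growth 2^(2 \<kappa> n) that the Besov norm
  allows. Summability is recorded because brackets are later added and subtracted termwise.\<close>

lemma bracket_bound:
  assumes d: "dyadic_partition chi phi"
  obtains C where "C > 0" "\<And>a B \<kappa> g L. (\<And>k. a (- k) = cnj (a k)) \<Longrightarrow> 0 \<le> B \<Longrightarrow> \<kappa> \<le> 1 / 64 \<Longrightarrow>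
      besov_norm chi phi (- 2 * \<kappa>) a \<le> ennreal B \<Longrightarrow> hoelder_L1 L g \<Longrightarrow>
      summable (\<lambda>n. \<integral>x. lp_block chi phi n a x * g x \<partial>torus_measure) \<and> \<bar>bracket chi phi a g\<bar> \<le> C * B * L"
proof -
  obtain C1 where C1: "C1 > 0" "\<And>n a M g L. (\<And>k. a (- k) = cnj (a k)) \<Longrightarrow> (\<And>x. \<bar>lp_block chi phi n a x\<bar> \<le> M) \<Longrightarrow>
      hoelder_L1 L g \<Longrightarrow> \<bar>\<integral>x. lp_block chi phi n a x * g x \<partial>torus_measure\<bar> \<le> C1 * 2 powr (- real n / 16) * M * L"
    using lp_pairing_bound[OF d] by blast
  show thesis
  proof (rule that[of "C1 * (1 / (1 - decay_ratio))"])
    show "0 < C1 * (1 / (1 - decay_ratio))" using C1(1) decay_ratio_bounds by simp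
    fix a B \<kappa> g L
    assume herm: "\<And>k. a (- k) = cnj (a k)" and B: "0 \<le> B" and \<kappa>: "\<kappa> \<le> 1 / 64"
      and bes: "besov_norm chi phi (- 2 * \<kappa>) a \<le> ennreal B" and g: "hoelder_L1 L g"
    have L0: "0 \<le> L" by (rule hoelder_L1_nonneg[OF g])
    let ?I = "\<lambda>n. \<integral>x. lp_block chi phi n a x * g x \<partial>torus_measure"
    have P: "\<bar>?I n\<bar> \<le> C1 * B * L * decay_ratio ^ n" for n
    proof -
      have "\<bar>lp_block chi phi n a x\<bar> \<le> B * 2 powr (2 * \<kappa> * real n)" for x
        using besov_block_bound[OF bes B, of n x] by simp
      then have "\<bar>?I n\<bar> \<le> C1 * 2 powr (- real n / 16) * (B * 2 powr (2 * \<kappa> * real n)) * L"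
        by (intro C1(2)[OF _ _ g]) (rule herm)
      also have "\<dots> = C1 * B * L * 2 powr (- real n / 16 + 2 * \<kappa> * real n)"
        by (simp only: powr_add mult_ac)
      also have "\<dots> \<le> C1 * B * L * decay_ratio ^ n"
      proof -
        have "2 * \<kappa> * real n \<le> (1 / 32) * real n" using \<kappa> by (intro mult_right_mono) auto
        then have "2 powr (- real n / 16 + 2 * \<kappa> * real n) \<le> decay_ratio ^ n"
          unfolding decay_ratio_power[symmetric] by (intro powr_mono) auto
        then show ?thesis using C1(1) B L0 by (intro mult_left_mono) auto
      qed
      finally show ?thesis .
    qed
    have sumI: "summable (\<lambda>n. \<bar>?I n\<bar>)"
      by (rule summable_comparison_test'[OF sums_summable[OF decay_ratio_sums[of "C1 * B * L"]], of 0]) (use P in auto)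
    have "\<bar>bracket chi phi a g\<bar> \<le> (\<Sum>n. \<bar>?I n\<bar>)"
      unfolding bracket_def by (rule summable_rabs[OF sumI])
    also have "\<dots> \<le> (\<Sum>n. C1 * B * L * decay_ratio ^ n)"
      by (rule suminf_le[OF P sumI sums_summable[OF decay_ratio_sums]])
    also have "\<dots> = C1 * (1 / (1 - decay_ratio)) * B * L"
      using sums_unique[OF decay_ratio_sums[of "C1 * B * L"]] by (simp add: mult_ac)
    finally show "summable ?I \<and> \<bar>bracket chi phi a g\<bar> \<le> C1 * (1 / (1 - decay_ratio)) * B * L"
      using summable_rabs_cancel[OF sumI] by blast
  qed
qed

text \<open>The increment of the product is split into three, with one factor varying at a time.
  Each H1 factor contributes 2, through |s| \<le> 2 |s|^(1/8) for |s| at most 2, and the weight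
  contributes 1, which gives 5.\<close>

lemma hoelder_L1_product:
  assumes v: "v \<in> sobolev_H1" and u: "u \<in> sobolev_H1" and w: "cont_periodic w"
    and P: "\<And>x. \<bar>w x\<bar> \<le> P" "\<And>x s. \<bar>w (x + s) - w x\<bar> \<le> P * norm s powr (1 / 8)"
  shows "hoelder_L1 (5 * P * (H1_norm v * H1_norm u)) (\<lambda>x. v x * u x * w x)"
proof -
  note p = weak_gradient_props[OF v] and q = weak_gradient_props[OF u]
  let ?g = "\<lambda>x. v x * u x * w x" and ?H = "H1_norm v * H1_norm u"
  have P0: "0 \<le> P" using order_trans[OF abs_ge_zero P(1)] .
  have ig: "integrable torus_measure ?g" by (rule integrable_mult3[OF p(2) q(2) w])
  have gm: "?g \<in> borel_measurable borel" using borel_measurable_integrable[OF ig] by (simp add: borel_measurable_torus)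
  have gp: "torus_periodic ?g" using p(6) q(6) w unfolding cont_periodic_def torus_periodic_def by simp
  have cs: "(\<integral>x. \<bar>a x * b x * z x\<bar> \<partial>torus_measure) \<le> B * (L2norm a * L2norm b)"
    if "sqint a" "sqint b" "\<And>x. \<bar>z x\<bar> \<le> B" for a b z B
  proof -
    have B0: "0 \<le> B" using order_trans[OF abs_ge_zero that(3)] .
    have "(\<integral>x. \<bar>a x * b x * z x\<bar> \<partial>torus_measure) \<le> (\<integral>x. B * \<bar>a x * b x\<bar> \<partial>torus_measure)"
    proof (rule integral_mono')
      show "\<bar>a x * b x * z x\<bar> \<le> B * \<bar>a x * b x\<bar>" for x
        using mult_left_mono[OF that(3)[of x], of "\<bar>a x * b x\<bar>"] by (simp add: abs_mult mult_ac)
    qed (use integrable_prod_sqint[OF that(1,2)] B0 in simp_all)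
    also have "\<dots> \<le> B * (L2norm a * L2norm b)"
      using Cauchy_Schwarz_torus[OF that(1,2)] B0 by (simp add: mult_left_mono)
    finally show ?thesis .
  qed
  have LH: "L2norm v * L2norm u \<le> ?H"
    by (intro mult_mono H1_norm_ge v u) simp_all
  have b0: "(\<integral>x. \<bar>?g x\<bar> \<partial>torus_measure) \<le> P * ?H"
    using cs[of v u w P, OF p(2) q(2) P(1)] mult_left_mono[OF LH P0] by linarith
  have "(\<integral>x. \<bar>?g (x + s) - ?g x\<bar> \<partial>torus_measure) \<le> 5 * P * ?H * norm s powr (1 / 8)" if s: "norm s \<le> 2" for s
  proof -
    let ?\<sigma> = "norm s powr (1 / 8)"
    have ns: "norm s \<le> 2 * ?\<sigma>"
    proof -
      have "norm s = norm s powr (7 / 8) * ?\<sigma>"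
        by (simp add: powr_add[symmetric] powr_one_gt_zero_iff)
      also have "norm s powr (7 / 8) \<le> 2 powr (7 / 8)" using s by (intro powr_mono2) auto
      also have "2 powr (7 / 8) \<le> (2::real) powr 1" by (intro powr_mono) auto
      finally show ?thesis by (simp add: mult_right_mono)
    qed
    note tv = sqint_translate[OF p(2) p(6), of s] and tu = sqint_translate[OF q(2) q(6), of s]
    have dv: "sqint (\<lambda>x. v (x + s) - v x)" by (rule sqint_diff[OF tv(1) p(2)])
    have du: "sqint (\<lambda>x. u (x + s) - u x)" by (rule sqint_diff[OF tu(1) q(2)])
    define A1 A2 A3 where "A1 x = (v (x + s) - v x) * u (x + s) * w (x + s)"
      and "A2 x = v x * (u (x + s) - u x) * w (x + s)" and "A3 x = v x * u x * (w (x + s) - w x)" for x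
    have ws: "cont_periodic (\<lambda>x. w (x + s))"
    proof -
      have "torus_periodic (\<lambda>x. w (x + s))" using w by (simp add: cont_periodic_def torus_periodic_translate)
      moreover have "continuous_on UNIV (\<lambda>x. w (x + s))"
        using w unfolding cont_periodic_def by (elim conjE) (rule continuous_on_compose2[of UNIV w], auto intro!: continuous_intros)
      ultimately show ?thesis unfolding cont_periodic_def by simp
    qed
    have i: "integrable torus_measure A1" "integrable torus_measure A2" "integrable torus_measure A3"
      unfolding A1_def A2_def A3_def
      by (rule integrable_mult3[OF dv tu(1) ws] integrable_mult3[OF p(2) du ws] integrable_mult3[OF p(2) q(2) cont_periodic_arith(2)[OF ws w]])+
    have "(\<integral>x. \<bar>?g (x + s) - ?g x\<bar> \<partial>torus_measure) \<le> (\<integral>x. \<bar>A1 x\<bar> + \<bar>A2 x\<bar> + \<bar>A3 x\<bar> \<partial>torus_measure)"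
    proof (rule integral_mono')
      fix x
      have "?g (x + s) - ?g x = A1 x + A2 x + A3 x" by (simp add: A1_def A2_def A3_def algebra_simps)
      then show "\<bar>?g (x + s) - ?g x\<bar> \<le> \<bar>A1 x\<bar> + \<bar>A2 x\<bar> + \<bar>A3 x\<bar>" by linarith
    qed (use i in simp_all)
    also have "\<dots> = (\<integral>x. \<bar>A1 x\<bar> \<partial>torus_measure) + (\<integral>x. \<bar>A2 x\<bar> \<partial>torus_measure) + (\<integral>x. \<bar>A3 x\<bar> \<partial>torus_measure)"
      using i by simp
    also have "(\<integral>x. \<bar>A1 x\<bar> \<partial>torus_measure) \<le> P * ((2 * ?\<sigma>) * ?H)"
    proof -
      have "(\<integral>x. \<bar>A1 x\<bar> \<partial>torus_measure) \<le> P * (L2norm (\<lambda>x. v (x + s) - v x) * L2norm u)"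
        using cs[of _ _ "\<lambda>x. w (x + s)", OF dv tu(1) P(1)] unfolding A1_def tu(2) .
      also have "\<dots> \<le> P * ((2 * ?\<sigma> * H1_norm v) * H1_norm u)"
        using L2norm_translate_diff[OF v, of s] mult_right_mono[OF ns H1_norm_nonneg[of v]] P0
        by (intro mult_left_mono mult_mono H1_norm_ge u) auto
      finally show ?thesis by (simp add: mult_ac)
    qed
    also have "(\<integral>x. \<bar>A2 x\<bar> \<partial>torus_measure) \<le> P * ((2 * ?\<sigma>) * ?H)"
    proof -
      have "(\<integral>x. \<bar>A2 x\<bar> \<partial>torus_measure) \<le> P * (L2norm v * L2norm (\<lambda>x. u (x + s) - u x))"
        using cs[of _ _ "\<lambda>x. w (x + s)", OF p(2) du P(1)] unfolding A2_def .
      also have "\<dots> \<le> P * (H1_norm v * (2 * ?\<sigma> * H1_norm u))"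
        using L2norm_translate_diff[OF u, of s] mult_right_mono[OF ns H1_norm_nonneg[of u]] P0
        by (intro mult_left_mono mult_mono H1_norm_ge v) auto
      finally show ?thesis by (simp add: mult_ac)
    qed
    also have "(\<integral>x. \<bar>A3 x\<bar> \<partial>torus_measure) \<le> (P * ?\<sigma>) * ?H"
    proof -
      have "0 \<le> P * ?\<sigma>" using P0 by simp
      then have "(P * ?\<sigma>) * (L2norm v * L2norm u) \<le> (P * ?\<sigma>) * ?H" by (rule mult_left_mono[OF LH])
      moreover have "(\<integral>x. \<bar>A3 x\<bar> \<partial>torus_measure) \<le> (P * ?\<sigma>) * (L2norm v * L2norm u)"
        using cs[of v u "\<lambda>x. w (x + s) - w x", OF p(2) q(2) P(2)] unfolding A3_def .
      ultimately show ?thesis by linarith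
    qed
    finally show ?thesis by (simp add: algebra_simps)
  qed
  moreover have "(\<integral>x. \<bar>?g x\<bar> \<partial>torus_measure) \<le> 5 * P * ?H"
    using b0 P0 mult_nonneg_nonneg[OF P0 mult_nonneg_nonneg[OF H1_norm_nonneg[of v] H1_norm_nonneg[of u]]] by linarith
  ultimately show ?thesis
    unfolding hoelder_L1_def using ig gm gp by blast
qed

lemma H1_norm_zero_AE:
  assumes "v \<in> sobolev_H1" "H1_norm v = 0"
  shows "AE x in torus_measure. v x = 0" "AE x in torus_measure. weak_gradient v x = 0"
proof -
  note p = weak_gradient_props[OF assms(1)]
  have z: "L2norm v = 0" "L2norm (\<lambda>x. fst (weak_gradient v x)) = 0" "L2norm (\<lambda>x. snd (weak_gradient v x)) = 0"
    using H1_norm_ge[OF assms(1)] assms(2) by (simp_all add: antisym)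
  show "AE x in torus_measure. v x = 0"
    using sqint_eq_0_AE[OF p(2)] z(1) by (simp flip: L2norm_square)
  have "AE x in torus_measure. fst (weak_gradient v x) = 0" "AE x in torus_measure. snd (weak_gradient v x) = 0"
    using sqint_eq_0_AE[OF p(4)] sqint_eq_0_AE[OF p(5)] z by (simp_all flip: L2norm_square)
  then show "AE x in torus_measure. weak_gradient v x = 0"
    by eventually_elim (simp add: prod_eq_iff)
qed

section \<open>Comparison of the two forms\<close>

lemma periodic_fun_of: "torus_periodic (fun_of chi phi a)"
  using torus_periodic_lp_block[of chi phi] unfolding torus_periodic_def fun_of_def by simp

text \<open>Supplies the continuity of the field, which is given only as an infinite sum of
  blocks.\<close>

lemma hoelder_continuous:
  fixes f :: "plane \<Rightarrow> real"
  assumes "\<And>x h. \<bar>f (x + h) - f x\<bar> \<le> K * norm h powr (1 / 8)"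
  shows "continuous_on UNIV f"
proof (rule continuous_at_imp_continuous_on, intro ballI)
  fix x :: plane
  have n: "((\<lambda>y. norm (y - x)) \<longlongrightarrow> 0) (at x)"
    by (rule tendsto_eq_intros refl | simp)+
  have "((\<lambda>y. norm (y - x) powr (1 / 8)) \<longlongrightarrow> 0) (at x)"
    by (rule tendsto_zero_powrI[OF n tendsto_const]) (auto intro!: always_eventually)
  then have "((\<lambda>y. K * norm (y - x) powr (1 / 8)) \<longlongrightarrow> 0) (at x)"
    by (rule tendsto_mult_right_zero)
  then have "((\<lambda>y. f y - f x) \<longlongrightarrow> 0) (at x)"
  proof (rule Lim_null_comparison[rotated])
    show "\<forall>\<^sub>F y in at x. norm (f y - f x) \<le> K * norm (y - x) powr (1 / 8)"
      using assms[of x] by (intro always_eventually allI) (metis add.commute diff_add_cancel real_norm_def)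
  qed
  then show "isCont f x" unfolding isCont_def by (rule LIM_zero_cancel)
qed

section \<open>Exponentials of the fields\<close>

lemma exp_lipschitz: "\<bar>exp a - exp b\<bar> \<le> exp m * \<bar>a - b\<bar>" if "a \<le> m" "b \<le> m" for a b m :: real
proof -
  have *: "\<bar>exp a - exp b\<bar> \<le> exp m * \<bar>a - b\<bar>" if "b \<le> a" "a \<le> m" for a b
  proof -
    have "1 - exp (b - a) \<le> a - b" using exp_ge_add_one_self[of "b - a"] by linarith
    then have "exp a * (1 - exp (b - a)) \<le> exp a * (a - b)" by (intro mult_left_mono) auto
    moreover have "exp a * (1 - exp (b - a)) = exp a - exp b" by (simp add: right_diff_distrib mult_exp_exp)
    moreover have "exp a * (a - b) \<le> exp m * (a - b)" using that by (intro mult_right_mono) auto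
    ultimately show ?thesis using that by simp
  qed
  show ?thesis
    using *[of b a] *[of a b] that by (cases "b \<le> a") (auto simp: abs_minus_commute)
qed

text \<open>The difference of exponentials is factored as e^(2Y) (e^(2(X - Y)) - 1). Both factors
  are bounded and Hoelder, and the second is of order \<delta> in both senses, so the Hoelder bound
  of the difference is linear in \<delta> as well.\<close>

lemma exp_field_bounds:
  assumes X: "\<And>x. \<bar>X x\<bar> \<le> m" "\<And>x h. \<bar>X (x + h) - X x\<bar> \<le> m * norm h powr (1 / 8)"
    and Y: "\<And>x. \<bar>Y x\<bar> \<le> m" "\<And>x h. \<bar>Y (x + h) - Y x\<bar> \<le> m * norm h powr (1 / 8)"
    and D: "\<And>x. \<bar>X x - Y x\<bar> \<le> \<delta>" "\<And>x h. \<bar>(X (x + h) - Y (x + h)) - (X x - Y x)\<bar> \<le> \<delta> * norm h powr (1 / 8)"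
  fixes x h :: plane
  shows "\<bar>exp (2 * Y x)\<bar> \<le> exp (2 * m) * (1 + 2 * m)"
    "\<bar>exp (2 * Y (x + h)) - exp (2 * Y x)\<bar> \<le> exp (2 * m) * (1 + 2 * m) * norm h powr (1 / 8)"
    "\<bar>exp (2 * X x) - exp (2 * Y x)\<bar> \<le> 2 * exp (6 * m) * (1 + 2 * m) * \<delta>"
    "\<bar>(exp (2 * X (x + h)) - exp (2 * Y (x + h))) - (exp (2 * X x) - exp (2 * Y x))\<bar>
      \<le> 2 * exp (6 * m) * (1 + 2 * m) * \<delta> * norm h powr (1 / 8)"
proof -
  have m0: "0 \<le> m" using order_trans[OF abs_ge_zero X(1)] .
  have d0: "0 \<le> \<delta>" using order_trans[OF abs_ge_zero D(1)] .
  let ?\<sigma> = "norm h powr (1 / 8)"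
  define E where "E x = exp (2 * Y x)" for x
  define G where "G x = exp (2 * (X x - Y x)) - 1" for x
  have E1: "\<bar>E x\<bar> \<le> exp (2 * m)" for x using Y(1)[of x] by (simp add: E_def)
  have E2: "\<bar>E (x + h) - E x\<bar> \<le> exp (2 * m) * (2 * m * ?\<sigma>)" for x
  proof -
    have "\<bar>E (x + h) - E x\<bar> \<le> exp (2 * m) * \<bar>2 * Y (x + h) - 2 * Y x\<bar>"
      unfolding E_def using Y(1)[of "x + h"] Y(1)[of x] by (intro exp_lipschitz) linarith+
    also have "\<dots> \<le> exp (2 * m) * (2 * m * ?\<sigma>)"
      using Y(2)[of x h] by (intro mult_left_mono) auto
    finally show ?thesis .
  qed
  \<comment> \<open>Both fields are at most \<open>m\<close> in modulus, so this exponent is at most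
    4 m; with the bound e^(2m) for the other factor it accounts for e^(6m).\<close>
  have D2m: "2 * (X x - Y x) \<le> 4 * m" for x
  proof -
    have "X x \<le> m" "- Y x \<le> m" using X(1)[of x] Y(1)[of x] by (auto simp: abs_le_iff)
    then show ?thesis by simp
  qed
  have G1: "\<bar>G x\<bar> \<le> exp (4 * m) * (2 * \<delta>)" for x
  proof -
    have "\<bar>exp (2 * (X x - Y x)) - exp 0\<bar> \<le> exp (4 * m) * \<bar>2 * (X x - Y x) - 0\<bar>"
      using D2m m0 by (intro exp_lipschitz) auto
    also have "\<dots> \<le> exp (4 * m) * (2 * \<delta>)" using D(1)[of x] by (intro mult_left_mono) auto
    finally show ?thesis by (simp add: G_def)
  qed
  have G2: "\<bar>G (x + h) - G x\<bar> \<le> exp (4 * m) * (2 * \<delta> * ?\<sigma>)" for x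
  proof -
    have "\<bar>G (x + h) - G x\<bar> \<le> exp (4 * m) * \<bar>2 * (X (x + h) - Y (x + h)) - 2 * (X x - Y x)\<bar>"
      using exp_lipschitz[OF D2m D2m, of "x + h" x] by (simp add: G_def)
    also have "\<dots> \<le> exp (4 * m) * (2 * \<delta> * ?\<sigma>)"
      using D(2)[of x h] by (intro mult_left_mono) auto
    finally show ?thesis .
  qed
  have EG: "exp (2 * X x) - exp (2 * Y x) = E x * G x" for x
  proof -
    have "exp (2 * X x) = exp (2 * Y x) * exp (2 * (X x - Y x))" by (simp add: mult_exp_exp)
    then show ?thesis by (simp add: E_def G_def algebra_simps)
  qed
  have e6: "exp (2 * m) * exp (4 * m) = exp (6 * m)" by (simp add: mult_exp_exp)
  show "\<bar>exp (2 * Y x)\<bar> \<le> exp (2 * m) * (1 + 2 * m)"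
  proof -
    have "exp (2 * m) * 1 \<le> exp (2 * m) * (1 + 2 * m)" using m0 by (intro mult_left_mono) auto
    then show ?thesis using E1[of x] unfolding E_def by linarith
  qed
  have "2 * m * ?\<sigma> \<le> (1 + 2 * m) * ?\<sigma>" by (rule mult_right_mono) simp_all
  then have "exp (2 * m) * (2 * m * ?\<sigma>) \<le> exp (2 * m) * ((1 + 2 * m) * ?\<sigma>)"
    by (rule mult_left_mono) simp
  then have "exp (2 * m) * (2 * m * ?\<sigma>) \<le> exp (2 * m) * (1 + 2 * m) * ?\<sigma>"
    by (simp only: mult.assoc)
  then show "\<bar>exp (2 * Y (x + h)) - exp (2 * Y x)\<bar> \<le> exp (2 * m) * (1 + 2 * m) * ?\<sigma>"
    using E2[of x] unfolding E_def by linarith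
  have "\<bar>E x * G x\<bar> \<le> exp (2 * m) * (exp (4 * m) * (2 * \<delta>))"
    unfolding abs_mult by (intro mult_mono E1 G1) auto
  also have "\<dots> = 2 * exp (6 * m) * 1 * \<delta>" unfolding e6[symmetric] by simp
  also have "\<dots> \<le> 2 * exp (6 * m) * (1 + 2 * m) * \<delta>"
    using m0 d0 by (intro mult_right_mono mult_left_mono) auto
  finally show "\<bar>exp (2 * X x) - exp (2 * Y x)\<bar> \<le> 2 * exp (6 * m) * (1 + 2 * m) * \<delta>" unfolding EG .
  have "E (x + h) * G (x + h) - E x * G x = E (x + h) * (G (x + h) - G x) + (E (x + h) - E x) * G x"
    by (simp add: algebra_simps)
  also have "\<bar>\<dots>\<bar> \<le> \<bar>E (x + h)\<bar> * \<bar>G (x + h) - G x\<bar> + \<bar>E (x + h) - E x\<bar> * \<bar>G x\<bar>"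
    unfolding abs_mult[symmetric] by (rule abs_triangle_ineq)
  also have "\<dots> \<le> exp (2 * m) * (exp (4 * m) * (2 * \<delta> * ?\<sigma>)) + (exp (2 * m) * (2 * m * ?\<sigma>)) * (exp (4 * m) * (2 * \<delta>))"
    using m0 by (intro add_mono mult_mono E1 E2 G1 G2) auto
  also have "\<dots> = 2 * exp (6 * m) * (1 + 2 * m) * \<delta> * ?\<sigma>"
    unfolding e6[symmetric] by (simp add: algebra_simps)
  finally show "\<bar>(exp (2 * X (x + h)) - exp (2 * Y (x + h))) - (exp (2 * X x) - exp (2 * Y x))\<bar>
      \<le> 2 * exp (6 * m) * (1 + 2 * m) * \<delta> * ?\<sigma>" unfolding EG .
qed

text \<open>The factors e^(-X) and e^X cancel pointwise, so the conjugated functions are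
  \<open>v1\<close> and \<open>v2\<close> themselves and the chosen weak gradients are literally the
  same.\<close>

lemma anderson_form_conjugate:
  assumes "\<And>x. u1 x = exp (field_X chi phi \<xi> x) * v1 x" "\<And>x. u2 x = exp (field_X chi phi \<xi> x) * v2 x"
  shows "anderson_form chi phi (\<xi>, W) u1 u2
    = (\<integral>x. (weak_gradient v1 x \<bullet> weak_gradient v2 x) * exp (2 * field_X chi phi \<xi> x) \<partial>torus_measure)
      - bracket chi phi W (\<lambda>x. v1 x * v2 x * exp (2 * field_X chi phi \<xi> x))
      + Re (\<xi> 0) * (\<integral>x. v1 x * v2 x * exp (2 * field_X chi phi \<xi> x) \<partial>torus_measure)"
proof -
  have c: "exp (- t) * (exp t * s) = s" for t s :: real
    by (simp add: exp_minus field_simps)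
  show ?thesis by (simp add: anderson_form_def Let_def assms c)
qed

lemma cont_periodic_fourier: "a abs_summable_on UNIV \<Longrightarrow> cont_periodic (\<lambda>x. Re (fourier a x))"
  using continuous_on_fourier[of a UNIV] torus_periodic_fourier[of a] unfolding cont_periodic_def torus_periodic_def
  by (auto intro!: continuous_intros)

text \<open>Combines \<open>conjugated_form\<close> with the reading of the integral against the
  regularised Wick square as a bracket, so that both forms have the same shape. The constant
  \<open>c\<close> may be arbitrary because it enters the potential and the Wick square
  together.\<close>

lemma anderson_form_eps_conjugate:
  assumes d: "dyadic_partition chi phi" and \<xi>: "real_distribution \<xi>" and \<rho>: "mollifier \<rho>" and e: "e > 0"
    and v1: "v1 \<in> sobolev_H1" and v2: "v2 \<in> sobolev_H1"
  defines "X \<equiv> X_eps \<rho> e \<xi>"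
  shows "anderson_form_eps \<rho> e c \<xi> (\<lambda>x. exp (X x) * v1 x) (\<lambda>x. exp (X x) * v2 x)
    = (\<integral>x. (weak_gradient v1 x \<bullet> weak_gradient v2 x) * exp (2 * X x) \<partial>torus_measure)
      - bracket chi phi (dist_of (wick_eps \<rho> e c \<xi>)) (\<lambda>x. v1 x * v2 x * exp (2 * X x))
      + Re (\<xi> 0) * (\<integral>x. v1 x * v2 x * exp (2 * X x) \<partial>torus_measure)"
    and "summable (\<lambda>n. \<integral>x. lp_block chi phi n (dist_of (wick_eps \<rho> e c \<xi>)) x * (v1 x * v2 x * exp (2 * X x)) \<partial>torus_measure)"
    and "cont_periodic X"
proof -
  let ?a = "X_coeff \<rho> e \<xi>"
  note s = coeff_summable[OF \<xi> \<rho> e]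
  note G = GDERIV_X_eps[OF \<xi> \<rho> e]
  show cX: "cont_periodic X" unfolding X_def X_eps_eq[OF \<rho> e] by (rule cont_periodic_fourier[OF s(1)])
  have cE: "cont_periodic (\<lambda>x. exp (2 * X x))" by (intro cont_periodic_exp cont_periodic_arith cont_periodic_const cX)
  have ig: "integrable torus_measure (\<lambda>x. v1 x * v2 x * exp (2 * X x))"
    by (rule integrable_mult3[OF weak_gradient_props(2)[OF v1] weak_gradient_props(2)[OF v2] cE])
  obtain w where w: "w abs_summable_on UNIV" "wick_eps \<rho> e c \<xi> = (\<lambda>x. Re (fourier w x))" "dist_of (wick_eps \<rho> e c \<xi>) = w"
    using wick_eps_fourier[OF \<xi> \<rho> e] by metis
  note br = bracket_fourier[OF d w(1) ig]
  show "summable (\<lambda>n. \<integral>x. lp_block chi phi n (dist_of (wick_eps \<rho> e c \<xi>)) x * (v1 x * v2 x * exp (2 * X x)) \<partial>torus_measure)"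
    unfolding w(3) using br by (rule sums_summable)
  have b: "bracket chi phi (dist_of (wick_eps \<rho> e c \<xi>)) (\<lambda>x. v1 x * v2 x * exp (2 * X x))
      = (\<integral>x. wick_eps \<rho> e c \<xi> x * (v1 x * v2 x * exp (2 * X x)) \<partial>torus_measure)"
    unfolding bracket_def w(3) using sums_unique[OF br] by (simp add: w(2))
  have wick: "wick_eps \<rho> e c \<xi> x = (Re (fourier (dx1 ?a) x))\<^sup>2 + (Re (fourier (dx2 ?a) x))\<^sup>2 - c" for x
    unfolding wick_eps_def gradient_eqI[OF G(1)] by (simp add: norm_prod_def)
  show "anderson_form_eps \<rho> e c \<xi> (\<lambda>x. exp (X x) * v1 x) (\<lambda>x. exp (X x) * v2 x)
    = (\<integral>x. (weak_gradient v1 x \<bullet> weak_gradient v2 x) * exp (2 * X x) \<partial>torus_measure)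
      - bracket chi phi (dist_of (wick_eps \<rho> e c \<xi>)) (\<lambda>x. v1 x * v2 x * exp (2 * X x))
      + Re (\<xi> 0) * (\<integral>x. v1 x * v2 x * exp (2 * X x) \<partial>torus_measure)"
    unfolding anderson_form_eps_def b wick
    by (rule conjugated_form[OF v1 v2 G(1)[folded X_def] G(2,3) cX cont_periodic_fourier[OF s(3)] cont_periodic_fourier[OF s(4)] cont_periodic_fourier[OF s(5)]
          cont_periodic_fourier[OF s(6)] cont_periodic_fourier[OF s(7)] cont_periodic_fourier[OF s(8)] noise_eps_laplacian[OF \<xi> \<rho> e]])
qed

text \<open>In \<open>ennreal\<close> the product of \<infinity> and 0 is 0, so when
  \<open>v1\<close> or \<open>v2\<close> has norm 0 the forms must vanish exactly. They do, because
  that function and its gradient vanish almost everywhere.\<close>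

lemma forms_vanish:
  assumes d: "dyadic_partition chi phi" and \<xi>: "real_distribution \<xi>" and \<rho>: "mollifier \<rho>" and e: "e > 0"
    and v1: "v1 \<in> sobolev_H1" and v2: "v2 \<in> sobolev_H1" and z: "H1_norm v1 = 0 \<or> H1_norm v2 = 0"
  shows "anderson_form chi phi (\<xi>, W) (\<lambda>x. exp (field_X chi phi \<xi> x) * v1 x) (\<lambda>x. exp (field_X chi phi \<xi> x) * v2 x) = 0"
    and "anderson_form_eps \<rho> e c \<xi> (\<lambda>x. exp (X_eps \<rho> e \<xi> x) * v1 x) (\<lambda>x. exp (X_eps \<rho> e \<xi> x) * v2 x) = 0"
proof -
  have AE: "AE x in torus_measure. v1 x * v2 x = 0 \<and> weak_gradient v1 x \<bullet> weak_gradient v2 x = 0"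
    using z
  proof
    assume "H1_norm v1 = 0"
    from H1_norm_zero_AE[OF v1 this] show ?thesis by eventually_elim simp
  next
    assume "H1_norm v2 = 0"
    from H1_norm_zero_AE[OF v2 this] show ?thesis by eventually_elim simp
  qed
  have i: "(\<integral>x. v1 x * v2 x * w x \<partial>torus_measure) = 0" for w
    by (rule integral_eq_zero_AE) (use AE in eventually_elim, simp)
  have j: "(\<integral>x. (weak_gradient v1 x \<bullet> weak_gradient v2 x) * w x \<partial>torus_measure) = 0" for w
    by (rule integral_eq_zero_AE) (use AE in eventually_elim, simp)
  have k: "bracket chi phi a (\<lambda>x. v1 x * v2 x * w x) = 0" for a w
  proof -
    have "(\<integral>x. lp_block chi phi n a x * (v1 x * v2 x * w x) \<partial>torus_measure) = 0" for n
      by (rule integral_eq_zero_AE) (use AE in eventually_elim, simp)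
    then show ?thesis by (simp add: bracket_def)
  qed
  show "anderson_form chi phi (\<xi>, W) (\<lambda>x. exp (field_X chi phi \<xi> x) * v1 x) (\<lambda>x. exp (field_X chi phi \<xi> x) * v2 x) = 0"
    by (subst anderson_form_conjugate[OF refl refl]) (simp add: i j k)
  show "anderson_form_eps \<rho> e c \<xi> (\<lambda>x. exp (X_eps \<rho> e \<xi> x) * v1 x) (\<lambda>x. exp (X_eps \<rho> e \<xi> x) * v2 x) = 0"
    by (subst anderson_form_eps_conjugate(1)[OF d \<xi> \<rho> e v1 v2]) (simp add: i j k)
qed

text \<open>Averaging over translates bounds every block by the same multiple, independent of
  \<open>e\<close>; it makes the bounds of the mollified fields uniform.\<close>

lemma besov_noise_coeff:
  assumes d: "dyadic_partition chi phi" and \<rho>: "mollifier \<rho>" and B: "besov_norm chi phi \<alpha> \<xi> \<le> ennreal B" "0 \<le> B"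
  shows "besov_norm chi phi \<alpha> (noise_coeff \<rho> e \<xi>) \<le> ennreal (B * (\<integral>y. \<bar>\<rho> y\<bar> \<partial>lborel))"
proof (rule besov_norm_leI)
  fix n x
  have "\<bar>lp_block chi phi n (noise_coeff \<rho> e \<xi>) x\<bar> \<le> (B * 2 powr (- \<alpha> * real n)) * (\<integral>y. \<bar>\<rho> y\<bar> \<partial>lborel)"
    by (rule lp_block_mollified[OF d \<rho> besov_block_bound[OF B]])
  then show "\<bar>lp_block chi phi n (noise_coeff \<rho> e \<xi>) x\<bar> \<le> B * (\<integral>y. \<bar>\<rho> y\<bar> \<partial>lborel) * 2 powr (- \<alpha> * real n)"
    by (simp add: mult_ac)
qed

text \<open>The norms of the noises are finite here, and the distances enter through real bounds
  \<open>\<delta>1\<close> and \<open>\<delta>2\<close>, so that the estimate takes place in the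
  reals. \<open>C\<close> is fixed before \<open>e\<close> and \<open>c\<close>.\<close>

lemma comparison_finite:
  assumes d: "dyadic_partition chi phi" and \<rho>: "mollifier \<rho>"
    and \<xi>: "real_distribution \<xi>" and W: "real_distribution W" and \<kappa>: "0 < \<kappa>" "\<kappa> < 1 / 64"
    and B1: "besov_norm chi phi (- 1 - \<kappa>) \<xi> \<le> ennreal B1" "0 \<le> B1"
    and B2: "besov_norm chi phi (- 2 * \<kappa>) W \<le> ennreal B2" "0 \<le> B2"
  obtains C where "C > 0" "\<And>v1 v2 e c \<delta>1 \<delta>2. v1 \<in> sobolev_H1 \<Longrightarrow> v2 \<in> sobolev_H1 \<Longrightarrow> e > 0 \<Longrightarrow>
      0 \<le> \<delta>1 \<Longrightarrow> 0 \<le> \<delta>2 \<Longrightarrow>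
      besov_norm chi phi (- 1 - \<kappa>) (\<xi> - dist_of (noise_eps \<rho> e \<xi>)) \<le> ennreal \<delta>1 \<Longrightarrow>
      besov_norm chi phi (- 2 * \<kappa>) (W - dist_of (wick_eps \<rho> e c \<xi>)) \<le> ennreal \<delta>2 \<Longrightarrow>
      \<bar>anderson_form chi phi (\<xi>, W) (\<lambda>x. exp (field_X chi phi \<xi> x) * v1 x) (\<lambda>x. exp (field_X chi phi \<xi> x) * v2 x)
        - anderson_form_eps \<rho> e c \<xi> (\<lambda>x. exp (X_eps \<rho> e \<xi> x) * v1 x) (\<lambda>x. exp (X_eps \<rho> e \<xi> x) * v2 x)\<bar>
      \<le> C * (\<delta>1 + \<delta>2) * H1_norm v1 * H1_norm v2"
proof -
  obtain CF where CF: "CF > 0"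
    "\<And>a B \<kappa> x h. (\<And>k. a (- k) = cnj (a k)) \<Longrightarrow> 0 \<le> B \<Longrightarrow> \<kappa> \<le> 1 / 32 \<Longrightarrow> besov_norm chi phi (- 1 - \<kappa>) a \<le> ennreal B \<Longrightarrow>
      summable (\<lambda>n. lp_block chi phi n (noise_X a) x) \<and> \<bar>fun_of chi phi (noise_X a) x\<bar> \<le> CF * B \<and>
      \<bar>fun_of chi phi (noise_X a) (x + h) - fun_of chi phi (noise_X a) x\<bar> \<le> CF * B * norm h powr (1 / 8)"
    by (rule field_X_bounds[OF d]) (erule that, simp only:)
  obtain CB where CB: "CB > 0" "\<And>a B \<kappa> g L. (\<And>k. a (- k) = cnj (a k)) \<Longrightarrow> 0 \<le> B \<Longrightarrow> \<kappa> \<le> 1 / 64 \<Longrightarrow>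
      besov_norm chi phi (- 2 * \<kappa>) a \<le> ennreal B \<Longrightarrow> hoelder_L1 L g \<Longrightarrow>
      summable (\<lambda>n. \<integral>x. lp_block chi phi n a x * g x \<partial>torus_measure) \<and> \<bar>bracket chi phi a g\<bar> \<le> CB * B * L"
    by (rule bracket_bound[OF d]) (erule that, simp only:)
  define \<rho>1 where "\<rho>1 = (\<integral>y. \<bar>\<rho> y\<bar> \<partial>lborel)"
  have \<rho>1: "0 \<le> \<rho>1" unfolding \<rho>1_def by (rule Bochner_Integration.integral_nonneg) simp
  \<comment> \<open>A common bound for the field and for all mollified fields, since the mollified
    noise has norm at most \<open>B1 * \<rho>1\<close>.\<close>
  define m where "m = CF * (B1 * (1 + \<rho>1))"
  have m0: "0 \<le> m" using CF(1) B1(2) \<rho>1 by (simp add: m_def)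
  define K where "K = 2 * exp (6 * m) * (1 + 2 * m) * CF"
  define P where "P = exp (2 * m) * (1 + 2 * m)"
  have K0: "0 \<le> K" using m0 CF(1) by (simp add: K_def)
  have P0: "0 \<le> P" using m0 by (simp add: P_def)
  \<comment> \<open>In this order: two gradient components, the bracket with the difference of the
    weights, the mass term, and the bracket with the difference of the Wick squares. The leading 1
    ensures positivity.\<close>
  define C where "C = 1 + (2 * K + CB * B2 * (5 * K) + \<bar>Re (\<xi> 0)\<bar> * K) + CB * (5 * P)"
  have n: "0 \<le> 2 * K + CB * B2 * (5 * K) + \<bar>Re (\<xi> 0)\<bar> * K" "0 \<le> CB * (5 * P)"
    using K0 P0 CB(1) B2(2) by simp_all
  then have C: "C > 0" unfolding C_def by linarith
  let ?X = "field_X chi phi \<xi>"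
  have hX: "\<xi> (- k) = cnj (\<xi> k)" for k by (rule real_distribution_uminus[OF \<xi>])
  have hW: "W (- k) = cnj (W k)" for k by (rule real_distribution_uminus[OF W])
  have \<kappa>': "\<kappa> \<le> 1 / 32" "\<kappa> \<le> 1 / 64" using \<kappa> by simp_all
  show thesis
  proof (rule that[OF C])
    fix v1 v2 e c \<delta>1 \<delta>2
    assume v1: "v1 \<in> sobolev_H1" and v2: "v2 \<in> sobolev_H1" and e: "(e::real) > 0" and \<delta>: "0 \<le> \<delta>1" "0 \<le> \<delta>2"
      and D1: "besov_norm chi phi (- 1 - \<kappa>) (\<xi> - dist_of (noise_eps \<rho> e \<xi>)) \<le> ennreal \<delta>1"
      and D2: "besov_norm chi phi (- 2 * \<kappa>) (W - dist_of (wick_eps \<rho> e c \<xi>)) \<le> ennreal \<delta>2"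
    let ?Y = "X_eps \<rho> e \<xi>" and ?b = "noise_coeff \<rho> e \<xi>" and ?We = "dist_of (wick_eps \<rho> e c \<xi>)"
    let ?H = "H1_norm v1 * H1_norm v2"
    have H0: "0 \<le> ?H" by simp
    note p = weak_gradient_props[OF v1] and q = weak_gradient_props[OF v2]
    note AE = anderson_form_eps_conjugate[OF d \<xi> \<rho> e v1 v2]
    have hb: "?b (- k) = cnj (?b k)" for k by (rule coeff_uminus(2)[OF \<xi>])
    have hd: "(\<xi> - ?b) (- k) = cnj ((\<xi> - ?b) k)" for k using hX hb by simp
    have hwd: "(W - ?We) (- k) = cnj ((W - ?We) k)" for k using hW dist_of_uminus[of "wick_eps \<rho> e c \<xi>"] by simp
    have bb: "besov_norm chi phi (- 1 - \<kappa>) ?b \<le> ennreal (B1 * \<rho>1)"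
      unfolding \<rho>1_def by (rule besov_noise_coeff[OF d \<rho> B1])
    have B\<rho>: "0 \<le> B1 * \<rho>1" using B1(2) \<rho>1 by simp
    note FX = CF(2)[of \<xi> B1 \<kappa>, OF hX B1(2) \<kappa>'(1) B1(1)]
    note FY = CF(2)[of ?b "B1 * \<rho>1" \<kappa>, OF hb B\<rho> \<kappa>'(1) bb]
    have D1': "besov_norm chi phi (- 1 - \<kappa>) (\<xi> - ?b) \<le> ennreal \<delta>1"
      using D1 unfolding dist_of_noise_eps[OF \<xi> \<rho> e] .
    note FD = CF(2)[of "\<xi> - ?b" \<delta>1 \<kappa>, OF hd \<delta>(1) \<kappa>'(1) D1']
    have Xeq: "?X = fun_of chi phi (noise_X \<xi>)" by (simp add: field_X_def)
    have Yeq: "?Y = fun_of chi phi (noise_X ?b)"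
      unfolding noise_X_noise_coeff X_eps_eq(1)[OF \<rho> e] using fun_of_fourier[OF d coeff_summable(1)[OF \<xi> \<rho> e]] by auto
    \<comment> \<open>The field is linear in the noise, so the difference of the fields is
      controlled by the distance of the noises.\<close>
    have XY: "?X x - ?Y x = fun_of chi phi (noise_X (\<xi> - ?b)) x" for x
    proof -
      have "fun_of chi phi (noise_X (\<xi> - ?b)) x = (\<Sum>n. lp_block chi phi n (noise_X \<xi>) x - lp_block chi phi n (noise_X ?b) x)"
        unfolding fun_of_def noise_X_diff lp_block_diff ..
      also have "\<dots> = ?X x - ?Y x"
        unfolding Xeq Yeq fun_of_def by (rule suminf_diff[symmetric]; rule FX[THEN conjunct1] FY[THEN conjunct1])
      finally show ?thesis ..
    qed
    have mono1: "CF * B1 \<le> m" "CF * (B1 * \<rho>1) \<le> m"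
      using CF(1) B1(2) \<rho>1 unfolding m_def by (intro mult_left_mono; simp add: distrib_left)+
    have X1: "\<bar>?X x\<bar> \<le> m" for x using order_trans[OF FX[THEN conjunct2, THEN conjunct1] mono1(1)] unfolding Xeq .
    have X2: "\<bar>?X (x + h) - ?X x\<bar> \<le> m * norm h powr (1 / 8)" for x h
      using order_trans[OF FX[THEN conjunct2, THEN conjunct2] mult_right_mono[OF mono1(1)]] unfolding Xeq by simp
    have Y1: "\<bar>?Y x\<bar> \<le> m" for x using order_trans[OF FY[THEN conjunct2, THEN conjunct1] mono1(2)] unfolding Yeq .
    have Y2: "\<bar>?Y (x + h) - ?Y x\<bar> \<le> m * norm h powr (1 / 8)" for x h
      using order_trans[OF FY[THEN conjunct2, THEN conjunct2] mult_right_mono[OF mono1(2)]] unfolding Yeq by simp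
    have E1: "\<bar>?X x - ?Y x\<bar> \<le> CF * \<delta>1" for x unfolding XY by (rule FD[THEN conjunct2, THEN conjunct1])
    have E2: "\<bar>(?X (x + h) - ?Y (x + h)) - (?X x - ?Y x)\<bar> \<le> CF * \<delta>1 * norm h powr (1 / 8)" for x h
      unfolding XY by (rule FD[THEN conjunct2, THEN conjunct2])
    note EB = exp_field_bounds[OF X1 X2 Y1 Y2 E1 E2]
    define w1 where "w1 x = exp (2 * ?X x) - exp (2 * ?Y x)" for x
    define w2 where "w2 x = exp (2 * ?Y x)" for x
    have w1b: "\<bar>w1 x\<bar> \<le> K * \<delta>1" "\<bar>w1 (x + h) - w1 x\<bar> \<le> K * \<delta>1 * norm h powr (1 / 8)" for x h
      using EB(3)[of x] EB(4)[of x h] by (simp_all add: w1_def K_def mult_ac)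
    have w2b: "\<bar>w2 x\<bar> \<le> P" "\<bar>w2 (x + h) - w2 x\<bar> \<le> P * norm h powr (1 / 8)" for x h
      using EB(1)[of x] EB(2)[of x h] by (simp_all add: w2_def P_def mult_ac)
    have cX: "cont_periodic ?X"
      unfolding cont_periodic_def using hoelder_continuous[OF X2] periodic_fun_of[of chi phi "noise_X \<xi>"] by (simp add: Xeq)
    have cY: "cont_periodic ?Y" by (rule AE(3))
    have cXE: "cont_periodic (\<lambda>x. exp (2 * ?X x))" and cw2: "cont_periodic w2"
      unfolding w2_def by (intro cont_periodic_exp cont_periodic_arith cont_periodic_const cX cY)+
    have cw1: "cont_periodic w1" unfolding w1_def[abs_def] using cont_periodic_arith(2)[OF cXE cw2[unfolded w2_def]] .
    define g1 where "g1 x = v1 x * v2 x * w1 x" for x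
    define g2 where "g2 x = v1 x * v2 x * w2 x" for x
    define g0 where "g0 x = v1 x * v2 x * exp (2 * ?X x)" for x
    have h1: "hoelder_L1 (5 * (K * \<delta>1) * ?H) g1"
      unfolding g1_def by (rule hoelder_L1_product[OF v1 v2 cw1 w1b])
    have h2: "hoelder_L1 (5 * P * ?H) g2"
      unfolding g2_def by (rule hoelder_L1_product[OF v1 v2 cw2 w2b])
    have g012: "g0 x = g1 x + g2 x" for x by (simp add: g0_def g1_def g2_def w1_def w2_def algebra_simps)
    have ig1: "integrable torus_measure g1" and ig2: "integrable torus_measure g2"
      using h1 h2 by (simp_all add: hoelder_L1_def)
    \<comment> \<open>The pair is exchanged in two stages, first the weight with \<open>W\<close>
      fixed and then the distribution: \<langle>W, g0\<rangle> - \<langle>We, g2\<rangle> =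
      \<langle>W, g1\<rangle> + \<langle>W - We, g2\<rangle>.\<close>
    have T2: "\<bar>bracket chi phi W g0 - bracket chi phi ?We g2\<bar> \<le> CB * B2 * (5 * (K * \<delta>1) * ?H) + CB * \<delta>2 * (5 * P * ?H)"
    proof -
      note b1 = CB(2)[of W B2 \<kappa>, OF hW B2(2) \<kappa>'(2) B2(1) h1]
      note b2 = CB(2)[of "W - ?We" \<delta>2 \<kappa>, OF hwd \<delta>(2) \<kappa>'(2) D2 h2]
      note b3 = CB(2)[of W B2 \<kappa>, OF hW B2(2) \<kappa>'(2) B2(1) h2]
      have iB: "integrable torus_measure (\<lambda>x. lp_block chi phi n a x * g x)" if "integrable torus_measure g" for n a g
      proof -
        have "cont_periodic (lp_block chi phi n a)" unfolding lp_block_trig_sum by (rule cont_periodic_trig_sum)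
        then obtain B where B: "\<And>x. \<bar>lp_block chi phi n a x\<bar> \<le> B" using cont_periodic_bounded by blast
        then show ?thesis
          using integrable_mult_bounded[OF that lp_block_measurable[OF d, of n a], of B] by (simp add: mult.commute)
      qed
      have s2: "summable (\<lambda>n. \<integral>x. lp_block chi phi n ?We x * g2 x \<partial>torus_measure)"
        using AE(2) unfolding g2_def w2_def .
      have "bracket chi phi W g0 = bracket chi phi W g1 + bracket chi phi W g2"
      proof -
        have "(\<integral>x. lp_block chi phi n W x * g0 x \<partial>torus_measure)
          = (\<integral>x. lp_block chi phi n W x * g1 x \<partial>torus_measure) + (\<integral>x. lp_block chi phi n W x * g2 x \<partial>torus_measure)" for n
          unfolding g012 distrib_left using iB[OF ig1] iB[OF ig2] by (rule Bochner_Integration.integral_add)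
        then show ?thesis unfolding bracket_def using suminf_add[OF b1[THEN conjunct1] b3[THEN conjunct1]] by simp
      qed
      moreover have "bracket chi phi (W - ?We) g2 = bracket chi phi W g2 - bracket chi phi ?We g2"
      proof -
        have "(\<integral>x. lp_block chi phi n (W - ?We) x * g2 x \<partial>torus_measure)
          = (\<integral>x. lp_block chi phi n W x * g2 x \<partial>torus_measure) - (\<integral>x. lp_block chi phi n ?We x * g2 x \<partial>torus_measure)" for n
          unfolding lp_block_diff left_diff_distrib using iB[OF ig2] iB[OF ig2] by (rule Bochner_Integration.integral_diff)
        then show ?thesis unfolding bracket_def using suminf_diff[OF b3[THEN conjunct1] s2] by simp
      qed
      ultimately have "bracket chi phi W g0 - bracket chi phi ?We g2 = bracket chi phi W g1 + bracket chi phi (W - ?We) g2"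
        by simp
      then show ?thesis using b1[THEN conjunct2] b2[THEN conjunct2] by linarith
    qed
    let ?g = "\<lambda>x. weak_gradient v1 x \<bullet> weak_gradient v2 x"
    have gw: "(\<integral>x. ?g x * w x \<partial>torus_measure)
      = (\<integral>x. fst (weak_gradient v1 x) * fst (weak_gradient v2 x) * w x \<partial>torus_measure)
        + (\<integral>x. snd (weak_gradient v1 x) * snd (weak_gradient v2 x) * w x \<partial>torus_measure)"
      and igw: "integrable torus_measure (\<lambda>x. ?g x * w x)" if "cont_periodic w" for w
    proof -
      have *: "(\<lambda>x. ?g x * w x) = (\<lambda>x. fst (weak_gradient v1 x) * fst (weak_gradient v2 x) * w x
          + snd (weak_gradient v1 x) * snd (weak_gradient v2 x) * w x)"
        by (auto simp: inner_prod_def distrib_right)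
      show "(\<integral>x. ?g x * w x \<partial>torus_measure)
      = (\<integral>x. fst (weak_gradient v1 x) * fst (weak_gradient v2 x) * w x \<partial>torus_measure)
        + (\<integral>x. snd (weak_gradient v1 x) * snd (weak_gradient v2 x) * w x \<partial>torus_measure)"
        "integrable torus_measure (\<lambda>x. ?g x * w x)"
        unfolding * using integrable_mult3[OF p(4) q(4) that] integrable_mult3[OF p(5) q(5) that] by simp_all
    qed
    have K\<delta>: "0 \<le> K * \<delta>1" using K0 \<delta> by simp
    have w1m: "w1 \<in> borel_measurable borel" by (rule cont_periodic_measurable[OF cw1])
    have T1: "\<bar>(\<integral>x. ?g x * exp (2 * ?X x) \<partial>torus_measure) - (\<integral>x. ?g x * w2 x \<partial>torus_measure)\<bar> \<le> 2 * (K * \<delta>1) * ?H"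
    proof -
      have "(\<integral>x. ?g x * exp (2 * ?X x) \<partial>torus_measure) - (\<integral>x. ?g x * w2 x \<partial>torus_measure) = (\<integral>x. ?g x * w1 x \<partial>torus_measure)"
        using igw[OF cXE] igw[OF cw2] by (simp add: w1_def w2_def right_diff_distrib)
      moreover have "\<bar>\<integral>x. fst (weak_gradient v1 x) * fst (weak_gradient v2 x) * w1 x \<partial>torus_measure\<bar> \<le> (K * \<delta>1) * ?H"
        by (rule order_trans[OF abs_integral_prod_le[OF p(4) q(4) w1m w1b(1)]])
          (intro mult_left_mono mult_mono H1_norm_ge v1 v2 K\<delta>, simp_all)
      moreover have "\<bar>\<integral>x. snd (weak_gradient v1 x) * snd (weak_gradient v2 x) * w1 x \<partial>torus_measure\<bar> \<le> (K * \<delta>1) * ?H"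
        by (rule order_trans[OF abs_integral_prod_le[OF p(5) q(5) w1m w1b(1)]])
          (intro mult_left_mono mult_mono H1_norm_ge v1 v2 K\<delta>, simp_all)
      ultimately show ?thesis unfolding gw[OF cw1] by linarith
    qed
    have T3: "\<bar>Re (\<xi> 0) * (\<integral>x. g0 x \<partial>torus_measure) - Re (\<xi> 0) * (\<integral>x. g2 x \<partial>torus_measure)\<bar> \<le> \<bar>Re (\<xi> 0)\<bar> * ((K * \<delta>1) * ?H)"
    proof -
      have "(\<integral>x. g0 x \<partial>torus_measure) - (\<integral>x. g2 x \<partial>torus_measure) = (\<integral>x. g1 x \<partial>torus_measure)"
        unfolding g012 using ig1 ig2 by simp
      moreover have "\<bar>\<integral>x. g1 x \<partial>torus_measure\<bar> \<le> (K * \<delta>1) * ?H"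
        unfolding g1_def by (rule order_trans[OF abs_integral_prod_le[OF p(2) q(2) w1m w1b(1)]])
          (intro mult_left_mono mult_mono H1_norm_ge v1 v2 K\<delta>, simp_all)
      ultimately show ?thesis
        unfolding right_diff_distrib[symmetric] abs_mult by (simp add: mult_left_mono)
    qed
    have F1: "anderson_form chi phi (\<xi>, W) (\<lambda>x. exp (?X x) * v1 x) (\<lambda>x. exp (?X x) * v2 x)
      = (\<integral>x. ?g x * exp (2 * ?X x) \<partial>torus_measure) - bracket chi phi W g0 + Re (\<xi> 0) * (\<integral>x. g0 x \<partial>torus_measure)"
      unfolding g0_def[abs_def] by (rule anderson_form_conjugate[OF refl refl])
    have F2: "anderson_form_eps \<rho> e c \<xi> (\<lambda>x. exp (?Y x) * v1 x) (\<lambda>x. exp (?Y x) * v2 x)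
      = (\<integral>x. ?g x * w2 x \<partial>torus_measure) - bracket chi phi ?We g2 + Re (\<xi> 0) * (\<integral>x. g2 x \<partial>torus_measure)"
      unfolding g2_def[abs_def] w2_def by (rule AE(1))
    have "\<bar>anderson_form chi phi (\<xi>, W) (\<lambda>x. exp (?X x) * v1 x) (\<lambda>x. exp (?X x) * v2 x)
        - anderson_form_eps \<rho> e c \<xi> (\<lambda>x. exp (?Y x) * v1 x) (\<lambda>x. exp (?Y x) * v2 x)\<bar>
      \<le> 2 * (K * \<delta>1) * ?H + (CB * B2 * (5 * (K * \<delta>1) * ?H) + CB * \<delta>2 * (5 * P * ?H)) + \<bar>Re (\<xi> 0)\<bar> * ((K * \<delta>1) * ?H)"
      unfolding F1 F2 using T1 T2 T3 by linarith
    also have "\<dots> = ((2 * K + CB * B2 * (5 * K) + \<bar>Re (\<xi> 0)\<bar> * K) * \<delta>1 + CB * (5 * P) * \<delta>2) * ?H"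
      by (simp add: algebra_simps)
    also have "\<dots> \<le> (C * \<delta>1 + C * \<delta>2) * ?H"
    proof (intro mult_right_mono add_mono H0 \<delta>)
      show "2 * K + CB * B2 * (5 * K) + \<bar>Re (\<xi> 0)\<bar> * K \<le> C" "CB * (5 * P) \<le> C"
        using n unfolding C_def by linarith+
    qed
    finally show "\<bar>anderson_form chi phi (\<xi>, W) (\<lambda>x. exp (?X x) * v1 x) (\<lambda>x. exp (?X x) * v2 x)
        - anderson_form_eps \<rho> e c \<xi> (\<lambda>x. exp (?Y x) * v1 x) (\<lambda>x. exp (?Y x) * v2 x)\<bar>
      \<le> C * (\<delta>1 + \<delta>2) * H1_norm v1 * H1_norm v2"
      by (simp add: algebra_simps)
  qed
qed

lemma comparison_pathwise:
  assumes d: "dyadic_partition chi phi" and \<rho>: "mollifier \<rho>"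
    and \<xi>: "real_distribution \<xi>" and W: "real_distribution W" and \<kappa>: "0 < \<kappa>" "\<kappa> < 1 / 64"
  shows "\<exists>C>0. \<forall>v1\<in>sobolev_H1. \<forall>v2\<in>sobolev_H1. \<forall>e>0. \<forall>c.
      ennreal \<bar>anderson_form chi phi (\<xi>, W) (\<lambda>x. exp (field_X chi phi \<xi> x) * v1 x) (\<lambda>x. exp (field_X chi phi \<xi> x) * v2 x)
        - anderson_form_eps \<rho> e c \<xi> (\<lambda>x. exp (X_eps \<rho> e \<xi> x) * v1 x) (\<lambda>x. exp (X_eps \<rho> e \<xi> x) * v2 x)\<bar>
      \<le> ennreal C * enhanced_norm chi phi \<kappa> ((\<xi>, W) - enhanced_noise_eps \<rho> e c \<xi>) * ennreal (H1_norm v1) * ennreal (H1_norm v2)"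
proof -
  let ?N1 = "\<lambda>a. besov_norm chi phi (- 1 - \<kappa>) a" and ?N2 = "\<lambda>a. besov_norm chi phi (- 2 * \<kappa>) a"
  let ?D = "\<lambda>v1 v2 e c. \<bar>anderson_form chi phi (\<xi>, W) (\<lambda>x. exp (field_X chi phi \<xi> x) * v1 x) (\<lambda>x. exp (field_X chi phi \<xi> x) * v2 x)
        - anderson_form_eps \<rho> e c \<xi> (\<lambda>x. exp (X_eps \<rho> e \<xi> x) * v1 x) (\<lambda>x. exp (X_eps \<rho> e \<xi> x) * v2 x)\<bar>"
  have E: "enhanced_norm chi phi \<kappa> ((\<xi>, W) - enhanced_noise_eps \<rho> e c \<xi>)
    = ?N1 (\<xi> - dist_of (noise_eps \<rho> e \<xi>)) + ?N2 (W - dist_of (wick_eps \<rho> e c \<xi>))" for e c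
    by (simp add: enhanced_norm_def enhanced_noise_eps_def)
  have inf: "ennreal (?D v1 v2 e c) \<le> ennreal C * enhanced_norm chi phi \<kappa> ((\<xi>, W) - enhanced_noise_eps \<rho> e c \<xi>) * ennreal (H1_norm v1) * ennreal (H1_norm v2)"
    if v: "v1 \<in> sobolev_H1" "v2 \<in> sobolev_H1" and e: "e > 0" and C: "C > 0"
      and top: "?N1 (\<xi> - dist_of (noise_eps \<rho> e \<xi>)) = \<top> \<or> ?N2 (W - dist_of (wick_eps \<rho> e c \<xi>)) = \<top>" for v1 v2 e c C
  proof (cases "H1_norm v1 = 0 \<or> H1_norm v2 = 0")
    case True
    show ?thesis
      unfolding forms_vanish(1)[OF d \<xi> \<rho> e v True] forms_vanish(2)[OF d \<xi> \<rho> e v True] by simp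
  next
    case False
    then have "0 < H1_norm v1" "0 < H1_norm v2" by (simp_all add: less_le)
    moreover have "enhanced_norm chi phi \<kappa> ((\<xi>, W) - enhanced_noise_eps \<rho> e c \<xi>) = \<top>"
      unfolding E using top by auto
    ultimately show ?thesis using C by (simp add: ennreal_mult_top ennreal_top_mult)
  qed
  have finFS: "?N1 (dist_of (noise_eps \<rho> e \<xi>)) \<noteq> \<top>" "?N2 (dist_of (wick_eps \<rho> e c \<xi>)) \<noteq> \<top>" if e: "e > 0" for e c
  proof -
    have "?N1 (dist_of (noise_eps \<rho> e \<xi>)) \<le> ennreal (coeff_l1 (noise_coeff \<rho> e \<xi>))"
      unfolding dist_of_noise_eps[OF \<xi> \<rho> e]
      by (rule besov_norm_finite_fourier[OF d coeff_summable(2)[OF \<xi> \<rho> e]]) (use \<kappa> in simp)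
    then show "?N1 (dist_of (noise_eps \<rho> e \<xi>)) \<noteq> \<top>" by (auto simp: top_unique)
    obtain w where "w abs_summable_on UNIV" "dist_of (wick_eps \<rho> e c \<xi>) = w"
      using wick_eps_fourier[OF \<xi> \<rho> e] by metis
    then have "?N2 (dist_of (wick_eps \<rho> e c \<xi>)) \<le> ennreal (coeff_l1 w)"
      using besov_norm_finite_fourier[OF d, of w "- 2 * \<kappa>"] \<kappa> by simp
    then show "?N2 (dist_of (wick_eps \<rho> e c \<xi>)) \<noteq> \<top>" by (auto simp: top_unique)
  qed
  show ?thesis
  \<comment> \<open>If a noise has infinite norm, so has its difference from the regularised one,
    whose norm is finite. The right-hand side is then infinite unless \<open>v1\<close> or
    \<open>v2\<close> has norm 0, and any positive constant works.\<close>
  proof (cases "?N1 \<xi> = \<top> \<or> ?N2 W = \<top>")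
    case True
    have "?N1 (\<xi> - dist_of (noise_eps \<rho> e \<xi>)) = \<top> \<or> ?N2 (W - dist_of (wick_eps \<rho> e c \<xi>)) = \<top>" if e: "e > 0" for e c
      using True
    proof
      assume "?N1 \<xi> = \<top>"
      then have "?N1 (\<xi> - dist_of (noise_eps \<rho> e \<xi>)) + ?N1 (dist_of (noise_eps \<rho> e \<xi>)) = \<top>"
        using besov_norm_triangle[of chi phi "- 1 - \<kappa>" \<xi> "dist_of (noise_eps \<rho> e \<xi>)"] by (simp add: top_unique)
      then show ?thesis using finFS(1)[OF e] by simp
    next
      assume "?N2 W = \<top>"
      then have "?N2 (W - dist_of (wick_eps \<rho> e c \<xi>)) + ?N2 (dist_of (wick_eps \<rho> e c \<xi>)) = \<top>"
        using besov_norm_triangle[of chi phi "- 2 * \<kappa>" W "dist_of (wick_eps \<rho> e c \<xi>)"] by (simp add: top_unique)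
      then show ?thesis using finFS(2)[OF e] by simp
    qed
    then show ?thesis using inf[OF _ _ _ zero_less_one] by (intro exI[of _ 1]) auto
  next
    case False
    then obtain B1 B2 where B: "?N1 \<xi> = ennreal B1" "0 \<le> B1" "?N2 W = ennreal B2" "0 \<le> B2"
      by (metis ennreal_cases)
    obtain C where C: "C > 0" "\<And>v1 v2 e c \<delta>1 \<delta>2. v1 \<in> sobolev_H1 \<Longrightarrow> v2 \<in> sobolev_H1 \<Longrightarrow> e > 0 \<Longrightarrow>
      0 \<le> \<delta>1 \<Longrightarrow> 0 \<le> \<delta>2 \<Longrightarrow> ?N1 (\<xi> - dist_of (noise_eps \<rho> e \<xi>)) \<le> ennreal \<delta>1 \<Longrightarrow>
      ?N2 (W - dist_of (wick_eps \<rho> e c \<xi>)) \<le> ennreal \<delta>2 \<Longrightarrow>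
      ?D v1 v2 e c \<le> C * (\<delta>1 + \<delta>2) * H1_norm v1 * H1_norm v2"
      by (rule comparison_finite[OF d \<rho> \<xi> W \<kappa> eq_refl[OF B(1)] B(2) eq_refl[OF B(3)] B(4)]) (erule that, simp only:)
    have "ennreal (?D v1 v2 e c) \<le> ennreal C * enhanced_norm chi phi \<kappa> ((\<xi>, W) - enhanced_noise_eps \<rho> e c \<xi>) * ennreal (H1_norm v1) * ennreal (H1_norm v2)"
      if v: "v1 \<in> sobolev_H1" "v2 \<in> sobolev_H1" and e: "e > 0" for v1 v2 e c
    proof (cases "?N1 (\<xi> - dist_of (noise_eps \<rho> e \<xi>)) = \<top> \<or> ?N2 (W - dist_of (wick_eps \<rho> e c \<xi>)) = \<top>")
      case True
      then show ?thesis by (rule inf[OF v e C(1)])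
    next
      case False
      then obtain \<delta>1 \<delta>2 where \<delta>: "?N1 (\<xi> - dist_of (noise_eps \<rho> e \<xi>)) = ennreal \<delta>1" "0 \<le> \<delta>1"
          "?N2 (W - dist_of (wick_eps \<rho> e c \<xi>)) = ennreal \<delta>2" "0 \<le> \<delta>2"
        by (metis ennreal_cases)
      have "ennreal (?D v1 v2 e c) \<le> ennreal (C * (\<delta>1 + \<delta>2) * H1_norm v1 * H1_norm v2)"
        by (intro ennreal_leI C(2)[OF v e \<delta>(2,4) eq_refl[OF \<delta>(1)] eq_refl[OF \<delta>(3)]])
      also have "\<dots> = ennreal C * (ennreal \<delta>1 + ennreal \<delta>2) * ennreal (H1_norm v1) * ennreal (H1_norm v2)"
        using C(1) \<delta>(2,4) by (simp add: ennreal_mult ennreal_plus)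
      finally show ?thesis unfolding E \<delta>(1,3) .
    qed
    then show ?thesis using C(1) by blast
  qed
qed

theorem proposition2p4:
  fixes M :: "'w measure"
    and \<xi> W :: "'w \<Rightarrow> torus_distribution"
    and \<rho> chi phi :: "plane \<Rightarrow> real"
  assumes "prob_space M"
    and "white_noise M \<xi>"
    and "mollifier \<rho>"
    and "dyadic_partition chi phi"
    and "wick_square chi phi M \<rho> \<xi> W"
  shows "\<exists>\<kappa>0>0. \<forall>\<kappa>. 0 < \<kappa> \<and> \<kappa> < \<kappa>0 \<longrightarrow>
    (AE \<omega> in M. \<exists>C>0. \<forall>v1\<in>sobolev_H1. \<forall>v2\<in>sobolev_H1. \<forall>\<epsilon>>0.
       let c = c_eps M \<rho> \<xi> \<epsilon>;
           X = field_X chi phi (\<xi> \<omega>);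
           X\<epsilon> = X_eps \<rho> \<epsilon> (\<xi> \<omega>);
           u1 = (\<lambda>x. exp (X x) * v1 x);
           u2 = (\<lambda>x. exp (X x) * v2 x);
           u1\<epsilon> = (\<lambda>x. exp (X\<epsilon> x) * v1 x);
           u2\<epsilon> = (\<lambda>x. exp (X\<epsilon> x) * v2 x);
           \<Xi> = (\<xi> \<omega>, W \<omega>);
           \<Xi>\<epsilon> = enhanced_noise_eps \<rho> \<epsilon> c (\<xi> \<omega>)
       in ennreal \<bar>anderson_form chi phi \<Xi> u1 u2 - anderson_form_eps \<rho> \<epsilon> c (\<xi> \<omega>) u1\<epsilon> u2\<epsilon>\<bar>
          \<le> ennreal C * enhanced_norm chi phi \<kappa> (\<Xi> - \<Xi>\<epsilon>) * ennreal (H1_norm v1) * ennreal (H1_norm v2))"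
\<comment> \<open>The bound 1/64 comes from \<open>bracket_bound\<close>, where 2 \<kappa> must not
  exceed 1/32, so that half of the gain 1/16 is left for summation.\<close>
proof (rule exI[of _ "1 / 64"], rule conjI, simp, intro allI impI, rule AE_I2)
  fix \<kappa> :: real and \<omega>
  assume \<kappa>: "0 < \<kappa> \<and> \<kappa> < 1 / 64" and \<omega>: "\<omega> \<in> space M"
  have \<kappa>': "0 < \<kappa>" "\<kappa> < 1 / 64" using \<kappa> by auto
  have "random_distribution M \<xi>" "random_distribution M W"
    by (rule assms(2)[unfolded white_noise_def, THEN conjunct1] assms(5)[unfolded wick_square_def, THEN conjunct1])+
  then have "real_distribution (\<xi> \<omega>)" "real_distribution (W \<omega>)"
    using \<omega> unfolding random_distribution_def by simp_all
  from comparison_pathwise[OF assms(4,3) this \<kappa>']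
  obtain C where C: "C > 0" "\<forall>v1\<in>sobolev_H1. \<forall>v2\<in>sobolev_H1. \<forall>e>0. \<forall>c.
      ennreal \<bar>anderson_form chi phi (\<xi> \<omega>, W \<omega>) (\<lambda>x. exp (field_X chi phi (\<xi> \<omega>) x) * v1 x) (\<lambda>x. exp (field_X chi phi (\<xi> \<omega>) x) * v2 x)
        - anderson_form_eps \<rho> e c (\<xi> \<omega>) (\<lambda>x. exp (X_eps \<rho> e (\<xi> \<omega>) x) * v1 x) (\<lambda>x. exp (X_eps \<rho> e (\<xi> \<omega>) x) * v2 x)\<bar>
      \<le> ennreal C * enhanced_norm chi phi \<kappa> ((\<xi> \<omega>, W \<omega>) - enhanced_noise_eps \<rho> e c (\<xi> \<omega>)) * ennreal (H1_norm v1) * ennreal (H1_norm v2)"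
    by (elim exE conjE) (rule that)
  show "\<exists>C>0. \<forall>v1\<in>sobolev_H1. \<forall>v2\<in>sobolev_H1. \<forall>\<epsilon>>0.
       let c = c_eps M \<rho> \<xi> \<epsilon>;
           X = field_X chi phi (\<xi> \<omega>);
           X\<epsilon> = X_eps \<rho> \<epsilon> (\<xi> \<omega>);
           u1 = (\<lambda>x. exp (X x) * v1 x);
           u2 = (\<lambda>x. exp (X x) * v2 x);
           u1\<epsilon> = (\<lambda>x. exp (X\<epsilon> x) * v1 x);
           u2\<epsilon> = (\<lambda>x. exp (X\<epsilon> x) * v2 x);
           \<Xi> = (\<xi> \<omega>, W \<omega>);
           \<Xi>\<epsilon> = enhanced_noise_eps \<rho> \<epsilon> c (\<xi> \<omega>)
       in ennreal \<bar>anderson_form chi phi \<Xi> u1 u2 - anderson_form_eps \<rho> \<epsilon> c (\<xi> \<omega>) u1\<epsilon> u2\<epsilon>\<bar>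
          \<le> ennreal C * enhanced_norm chi phi \<kappa> (\<Xi> - \<Xi>\<epsilon>) * ennreal (H1_norm v1) * ennreal (H1_norm v2)"
    unfolding Let_def
  proof (intro exI[of _ C] conjI ballI allI impI)
    fix v1 v2 and \<epsilon> :: real
    assume v: "v1 \<in> sobolev_H1" "v2 \<in> sobolev_H1" "\<epsilon> > 0"
    show "ennreal \<bar>anderson_form chi phi (\<xi> \<omega>, W \<omega>) (\<lambda>x. exp (field_X chi phi (\<xi> \<omega>) x) * v1 x) (\<lambda>x. exp (field_X chi phi (\<xi> \<omega>) x) * v2 x)
        - anderson_form_eps \<rho> \<epsilon> (c_eps M \<rho> \<xi> \<epsilon>) (\<xi> \<omega>) (\<lambda>x. exp (X_eps \<rho> \<epsilon> (\<xi> \<omega>) x) * v1 x) (\<lambda>x. exp (X_eps \<rho> \<epsilon> (\<xi> \<omega>) x) * v2 x)\<bar>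
      \<le> ennreal C * enhanced_norm chi phi \<kappa> ((\<xi> \<omega>, W \<omega>) - enhanced_noise_eps \<rho> \<epsilon> (c_eps M \<rho> \<xi> \<epsilon>) (\<xi> \<omega>)) * ennreal (H1_norm v1) * ennreal (H1_norm v2)"
      by (rule C(2)[rule_format, OF v])
  qed (rule C(1))
qed

end
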